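(* Consider the system of ODEs $$t_1'=\tfrac{1}{6}\big(t_1^2-t_2^2\big),\quad t_2'=\tfrac{1}{3}\big(t_1t_2-t_2^2+54t_3\big),\quad t_3'=\tfrac{2}{3}t_1t_3+\tfrac{1}{3}t_2t_3+9t_4,\quad t_4'=t_1t_4+t_2t_4,$$ in which the polynomial relation $t_3^2-t_2t_4=0$ holds. \begin{enumerate} \item A particular solution of this system is $$t_1=P_3(q):=\tfrac{1}{4}\big(E_2(q)+3E_2(q^3)\big),\quad t_2=Q_3(q):=\tfrac{1}{2}\big(3E_2(q^3)-E_2(q)\big),$$ $$t_3=R_3(q):=\eta^8(q^3)+9\frac{\eta^8(q^3)\eta^3(q^9)}{\eta^3(q)},\quad t_4=S_3(q):=\Big(\frac{\eta^9(q^3)}{\eta^3(q)}\Big)^2,$$ with $Q_3\in\mathscr{M}_2(\Gamma_0(3))$, $R_3\in\mathscr{M}_4(\Gamma_0(3))$, $S_3\in\mathscr{M}_6(\Gamma_0(3))$ and $P_3\in\widetilde{\mathscr{M}}_2(\Gamma_0(3))$. Moreover, if $\Delta_3:=\eta^6(q)\eta^6(q^3)$, then $\Delta_3$ is a cusp form of weight $6$ for $\Gamma_0(3)$, $\Delta_3=Q_3R_3-27S_3$, and $\Delta_3'=P_3\Delta_3$. \item Let $x_1,x_2,x_3,x_4$ be indeterminates, and let $\mathscr{I}$ and $\tilde{\mathscr{I}}$ be the ideals generated by $x_3^2-x_2x_4$ in $\mathbb{C}[x_2,x_3,x_4]$ and in $\mathbb{C}[x_1,x_2,x_3,x_4]$,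 respectively. Then, via $x_1\mapsto P_3$, $x_2\mapsto Q_3$, $x_3\mapsto R_3$, $x_4\mapsto S_3$, $$\mathscr{M}(\Gamma_0(3))\simeq \mathbb{C}[x_2,x_3,x_4]/\mathscr{I},\qquad \widetilde{\mathscr{M}}(\Gamma_0(3))\simeq\mathbb{C}[x_1,x_2,x_3,x_4]/\tilde{\mathscr{I}}.$$ \item The Lie algebra (under the commutator of vector fields) generated by the vector fields on $\mathbb{C}^4$ $$\mathsf{R}_1=\tfrac{1}{6}(t_1^2-t_2^2)\tfrac{\partial}{\partial t_1}+\tfrac{1}{3}(t_1t_2-t_2^2+54t_3)\tfrac{\partial}{\partial t_2}+\big(\tfrac{2}{3}t_1t_3+\tfrac{1}{3}t_2t_3+9t_4\big)\tfrac{\partial}{\partial t_3}+(t_1t_4+t_3^2)\tfrac{\partial}{\partial t_4},$$ $$\mathsf{H}_1=2t_1\tfrac{\partial}{\partial t_1}+2t_2\tfrac{\partial}{\partial t_2}+4t_3\tfrac{\partial}{\partial t_3}+6t_4\tfrac{\partial}{\partial t_4},\qquad \mathsf{F}_1=-6\tfrac{\partial}{\partial t_1}$$ is isomorphic to the Lie algebra $\mathfrak{sl}_2(\mathbb{C})$. \end{enumerate}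
   Context: Throughout, $\tau\in\mathbb{H}=\{\tau\in\mathbb{C}:\operatorname{Im}\tau>0\}$, $q=e^{2\pi i\tau}$, and $f':=q\frac{\partial f}{\partial q}=\frac{1}{2\pi i}\frac{df}{d\tau}$. The Eisenstein series is $E_2(q)=1-24\sum_{k\ge1}\sigma_1(k)q^k$ with $\sigma_1(k)=\sum_{d\mid k}d$. The eta function is $\eta(q)=q^{1/24}\prod_{k\ge1}(1-q^k)$. $\Gamma_0(N)=\{\begin{pmatrix}a&b\\c&d\end{pmatrix}\in\mathrm{SL}_2(\mathbb{Z}): c\equiv0 \pmod N\}$. For a finite-index subgroup $\Gamma\subset\mathrm{SL}_2(\mathbb{Z})$, $\mathscr{M}_k(\Gamma)$ denotes the space of (holomorphic) modular forms of weight $k$ on $\Gamma$ (holomorphic on $\mathbb{H}$ and at all cusps, satisfying $(c\tau+d)^{-k}f(\gamma\tau)=f(\tau)$ for $\gamma\in\Gamma$); a cusp form additionally vanishes at all cusps. $\widetilde{\mathscr{M}}_k(\Gamma)$ denotes the space of quasi-modular forms of weight $k$: holomorphic functions $f$ of moderate growth such that for all $\gamma=\begin{pmatrix}a&b\\c&d\end{pmatrix}\in\Gamma$, $(c\tau+d)^{-k}f(\gamma\tau)=\sum_{j=0}^p f_j(\tau)\big(\frac{c}{c\tau+d}\big)^j$ with $f_j$ holomorphic of moderate growth and $f_0=f$. $\mathscr{M}(\Gamma)=\bigoplus_{k\ge0}\mathscr{M}_k(\Gamma)$ and $\widetilde{\mathscr{M}}(\Gamma)=\bigoplus_{k\ge0}\widetilde{\mathscr{M}}_k(\Gamma)$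 are the graded algebras of modular and quasi-modular forms. *)

theory Defs
  imports
    "HOL-Complex_Analysis.Complex_Analysis"
    "HOL-Library.Poly_Mapping"
    "HOL-Algebra.QuotRing"
begin

section \<open>Functions on the upper half-plane\<close>

text \<open>
  A function on the upper half-plane is represented by the function on all of \<open>\<complex>\<close> that extends it
  by zero. This makes the representation unique, so that equality of forms is equality of
  functions; all spaces of forms below contain only functions normalised in this way.
\<close>

definition upper_half_plane :: "complex set" ("\<H>") where
  "\<H> = {\<tau>. Im \<tau> > 0}"

definition on_uhp :: "(complex \<Rightarrow> complex) \<Rightarrow> complex \<Rightarrow> complex" where
  "on_uhp f = (\<lambda>\<tau>. if \<tau> \<in> \<H> then f \<tau> else 0)"

definition nome :: "complex \<Rightarrow> complex" where
  "nome \<tau> = exp (2 * of_real pi * \<i> * \<tau>)"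

text \<open>The derivation \<open>f' = q df/dq = (2 \<pi> i)\<^sup>-\<^sup>1 df/d\<tau>\<close>.\<close>

definition qderiv :: "(complex \<Rightarrow> complex) \<Rightarrow> complex \<Rightarrow> complex" where
  "qderiv f \<tau> = deriv f \<tau> / (2 * of_real pi * \<i>)"


section \<open>Modular and quasi-modular forms\<close>

definition SL2Z :: "(int^2^2) set" where
  "SL2Z = {\<gamma>. det \<gamma> = 1}"

definition Gamma0 :: "nat \<Rightarrow> (int^2^2) set" where
  "Gamma0 N = {\<gamma> \<in> SL2Z. int N dvd \<gamma> $ 2 $ 1}"

definition aut_factor :: "int^2^2 \<Rightarrow> complex \<Rightarrow> complex" where
  "aut_factor \<gamma> \<tau> = of_int (\<gamma> $ 2 $ 1) * \<tau> + of_int (\<gamma> $ 2 $ 2)"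

definition moebius_act :: "int^2^2 \<Rightarrow> complex \<Rightarrow> complex" where
  "moebius_act \<gamma> \<tau> = (of_int (\<gamma> $ 1 $ 1) * \<tau> + of_int (\<gamma> $ 1 $ 2)) / aut_factor \<gamma> \<tau>"

definition slash :: "nat \<Rightarrow> int^2^2 \<Rightarrow> (complex \<Rightarrow> complex) \<Rightarrow> complex \<Rightarrow> complex" where
  "slash k \<gamma> f \<tau> = f (moebius_act \<gamma> \<tau>) / aut_factor \<gamma> \<tau> ^ k"

text \<open>
  \<open>f\<close> is holomorphic at \<open>i\<infinity>\<close> if for some width \<open>h\<close> it is a holomorphic function of
  \<open>q\<^sub>h = exp (2 \<pi> i \<tau> / h)\<close>, including at \<open>q\<^sub>h = 0\<close>; it vanishes at \<open>i\<infinity>\<close> if moreover that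
  function vanishes at \<open>q\<^sub>h = 0\<close>. The other cusps are moved to \<open>i\<infinity>\<close> by the slash action of
  \<open>SL2Z\<close>.
\<close>

definition cusp_expansion :: "(complex \<Rightarrow> complex) \<Rightarrow> nat \<Rightarrow> (complex \<Rightarrow> complex) \<Rightarrow> bool" where
  "cusp_expansion f h g \<longleftrightarrow>
     h > 0 \<and> g holomorphic_on ball 0 1 \<and> (\<forall>\<tau>\<in>\<H>. f \<tau> = g (nome (\<tau> / of_nat h)))"

definition holomorphic_at_ioo :: "(complex \<Rightarrow> complex) \<Rightarrow> bool" where
  "holomorphic_at_ioo f \<longleftrightarrow> (\<exists>h g. cusp_expansion f h g)"

definition vanishes_at_ioo :: "(complex \<Rightarrow> complex) \<Rightarrow> bool" where
  "vanishes_at_ioo f \<longleftrightarrow> (\<exists>h g. cusp_expansion f h g \<and> g 0 = 0)"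

text \<open>In the following, \<open>\<Gamma>\<close> is meant to be a finite-index subgroup of \<open>SL2Z\<close>.\<close>

definition modular_forms :: "nat \<Rightarrow> (int^2^2) set \<Rightarrow> (complex \<Rightarrow> complex) set" where
  "modular_forms k \<Gamma> = {f.
     f holomorphic_on \<H> \<and> (\<forall>\<tau>. \<tau> \<notin> \<H> \<longrightarrow> f \<tau> = 0) \<and>
     (\<forall>\<gamma>\<in>\<Gamma>. \<forall>\<tau>\<in>\<H>. slash k \<gamma> f \<tau> = f \<tau>) \<and>
     (\<forall>\<gamma>\<in>SL2Z. holomorphic_at_ioo (slash k \<gamma> f))}"

definition cusp_forms :: "nat \<Rightarrow> (int^2^2) set \<Rightarrow> (complex \<Rightarrow> complex) set" where
  "cusp_forms k \<Gamma> =
     {f \<in> modular_forms k \<Gamma>. \<forall>\<gamma>\<in>SL2Z. vanishes_at_ioo (slash k \<gamma> f)}"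

text \<open>
  Moderate growth is polynomial growth towards the boundary, measured by the usual function
  \<open>(1 + \<bar>\<tau>\<bar>\<^sup>2) / Im \<tau>\<close>.
\<close>

definition moderate_growth :: "(complex \<Rightarrow> complex) \<Rightarrow> bool" where
  "moderate_growth f \<longleftrightarrow>
     (\<exists>(C::real) (N::nat). \<forall>\<tau>\<in>\<H>. norm (f \<tau>) \<le> C * ((1 + (norm \<tau>)\<^sup>2) / Im \<tau>) ^ N)"

definition quasimodular_forms :: "nat \<Rightarrow> (int^2^2) set \<Rightarrow> (complex \<Rightarrow> complex) set" where
  "quasimodular_forms k \<Gamma> = {f.
     f holomorphic_on \<H> \<and> moderate_growth f \<and> (\<forall>\<tau>. \<tau> \<notin> \<H> \<longrightarrow> f \<tau> = 0) \<and>
     (\<exists>(p::nat) (F :: nat \<Rightarrow> complex \<Rightarrow> complex).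
        F 0 = f \<and>
        (\<forall>j\<le>p. F j holomorphic_on \<H> \<and> moderate_growth (F j)) \<and>
        (\<forall>\<gamma>\<in>\<Gamma>. \<forall>\<tau>\<in>\<H>. slash k \<gamma> f \<tau> =
           (\<Sum>j\<le>p. F j \<tau> * (of_int (\<gamma> $ 2 $ 1) / aut_factor \<gamma> \<tau>) ^ j)))}"


section \<open>Graded algebras of forms\<close>

text \<open>
  The direct sum \<open>\<Oplus>\<^sub>k M k\<close> of spaces of functions on the upper half-plane, with elements the
  finitely supported families \<open>F\<close> with \<open>F k \<in> M k\<close> and the graded multiplication. The complex
  scalars are embedded as the constant functions in degree \<open>0\<close>.
\<close>

definition in_degree :: "nat \<Rightarrow> (complex \<Rightarrow> complex) \<Rightarrow> nat \<Rightarrow> complex \<Rightarrow> complex" where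
  "in_degree k f = (\<lambda>j. if j = k then f else (\<lambda>_. 0))"

definition scalar_form :: "complex \<Rightarrow> nat \<Rightarrow> complex \<Rightarrow> complex" where
  "scalar_form c = in_degree 0 (on_uhp (\<lambda>_. c))"

definition graded_algebra ::
    "(nat \<Rightarrow> (complex \<Rightarrow> complex) set) \<Rightarrow> (nat \<Rightarrow> complex \<Rightarrow> complex) ring" where
  "graded_algebra M =
     \<lparr> carrier = {F. (\<forall>k. F k \<in> M k) \<and> finite {k. F k \<noteq> (\<lambda>_. 0)}},
       mult = (\<lambda>F G k \<tau>. \<Sum>i\<le>k. F i \<tau> * G (k - i) \<tau>),
       one = scalar_form 1,
       zero = (\<lambda>k \<tau>. 0),
       add = (\<lambda>F G k \<tau>. F k \<tau> + G k \<tau>) \<rparr>"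

definition modular_algebra :: "(int^2^2) set \<Rightarrow> (nat \<Rightarrow> complex \<Rightarrow> complex) ring" where
  "modular_algebra \<Gamma> = graded_algebra (\<lambda>k. modular_forms k \<Gamma>)"

definition quasimodular_algebra :: "(int^2^2) set \<Rightarrow> (nat \<Rightarrow> complex \<Rightarrow> complex) ring" where
  "quasimodular_algebra \<Gamma> = graded_algebra (\<lambda>k. quasimodular_forms k \<Gamma>)"


section \<open>Polynomial rings\<close>

text \<open>
  Polynomials over \<open>\<complex>\<close> in indeterminates \<open>x\<^sub>i\<close> (\<open>i :: nat\<close>): a monomial is a finitely supported
  exponent function, a polynomial a finitely supported coefficient function on monomials.
\<close>

type_synonym cpoly = "(nat \<Rightarrow>\<^sub>0 nat) \<Rightarrow>\<^sub>0 complex"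

definition Const :: "complex \<Rightarrow> cpoly" where
  "Const c = Poly_Mapping.single 0 c"

definition X :: "nat \<Rightarrow> cpoly" where
  "X i = Poly_Mapping.single (Poly_Mapping.single i 1) 1"

definition poly_ring :: "nat set \<Rightarrow> cpoly ring" where
  "poly_ring I =
     \<lparr> carrier = {p. \<forall>m \<in> Poly_Mapping.keys p. Poly_Mapping.keys m \<subseteq> I},
       mult = (*), one = 1, zero = 0, add = (+) \<rparr>"


section \<open>Holomorphic vector fields on \<open>\<complex>\<^sup>4\<close>\<close>

text \<open>The vector field \<open>\<Sum>\<^sub>i V\<^sub>i \<partial>/\<partial>t\<^sub>i\<close> is represented by the map \<open>t \<mapsto> (V\<^sub>1 t, \<dots>, V\<^sub>4 t)\<close>.\<close>

type_synonym vfield = "complex^4 \<Rightarrow> complex^4"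

definition partial_deriv :: "4 \<Rightarrow> (complex^4 \<Rightarrow> complex) \<Rightarrow> complex^4 \<Rightarrow> complex" where
  "partial_deriv i f t = deriv (\<lambda>w. f (\<chi> k. if k = i then w else t $ k)) (t $ i)"

definition vf_bracket :: "vfield \<Rightarrow> vfield \<Rightarrow> vfield" where
  "vf_bracket V W = (\<lambda>t. \<chi> j. \<Sum>i\<in>UNIV.
     V t $ i * partial_deriv i (\<lambda>s. W s $ j) t - W t $ i * partial_deriv i (\<lambda>s. V s $ j) t)"

inductive_set lie_generated :: "vfield set \<Rightarrow> vfield set" for G :: "vfield set" where
  gen: "V \<in> G \<Longrightarrow> V \<in> lie_generated G"
| zero: "(\<lambda>t. 0) \<in> lie_generated G"
| add: "V \<in> lie_generated G \<Longrightarrow> W \<in> lie_generated G \<Longrightarrow> (\<lambda>t. V t + W t) \<in> lie_generated G"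
| scale: "V \<in> lie_generated G \<Longrightarrow> (\<lambda>t. c *s V t) \<in> lie_generated G"
| bracket: "V \<in> lie_generated G \<Longrightarrow> W \<in> lie_generated G \<Longrightarrow> vf_bracket V W \<in> lie_generated G"

definition sl2 :: "(complex^2^2) set" where
  "sl2 = {A. trace A = 0}"

definition lie_isomorphic_sl2 :: "vfield set \<Rightarrow> bool" where
  "lie_isomorphic_sl2 L \<longleftrightarrow> (\<exists>\<phi> :: vfield \<Rightarrow> complex^2^2.
     bij_betw \<phi> L sl2 \<and>
     (\<forall>V\<in>L. \<forall>W\<in>L. \<phi> (\<lambda>t. V t + W t) = \<phi> V + \<phi> W) \<and>
     (\<forall>c. \<forall>V\<in>L. \<phi> (\<lambda>t. c *s V t) = (\<chi> i. c *s (\<phi> V $ i))) \<and>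
     (\<forall>V\<in>L. \<forall>W\<in>L. \<phi> (vf_bracket V W) = \<phi> V ** \<phi> W - \<phi> W ** \<phi> V))"


section \<open>The Ramanujan-type system for \<open>\<Gamma>\<^sub>0(3)\<close>\<close>

definition sigma1 :: "nat \<Rightarrow> nat" where
  "sigma1 k = (\<Sum>d | d dvd k. d)"

definition E2 :: "complex \<Rightarrow> complex" where
  "E2 q = 1 - 24 * suminf (\<lambda>k. of_nat (sigma1 (Suc k)) * q ^ Suc k)"

text \<open>
  Since \<open>q\<^sup>1\<^sup>/\<^sup>2\<^sup>4\<close> means \<open>exp (2 \<pi> i \<tau> / 24)\<close>, the eta function is a function of \<open>\<tau>\<close> rather than
  of \<open>q\<close>; what is written \<open>\<eta>(q\<^sup>m)\<close> is \<open>eta (m * \<tau>)\<close>.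
\<close>

definition eta :: "complex \<Rightarrow> complex" where
  "eta \<tau> = nome (\<tau> / 24) * prodinf (\<lambda>k. 1 - nome \<tau> ^ Suc k)"

definition P3 :: "complex \<Rightarrow> complex" where
  "P3 = on_uhp (\<lambda>\<tau>. (E2 (nome \<tau>) + 3 * E2 (nome \<tau> ^ 3)) / 4)"

definition Q3 :: "complex \<Rightarrow> complex" where
  "Q3 = on_uhp (\<lambda>\<tau>. (3 * E2 (nome \<tau> ^ 3) - E2 (nome \<tau>)) / 2)"

definition R3 :: "complex \<Rightarrow> complex" where
  "R3 = on_uhp (\<lambda>\<tau>. eta (3*\<tau>) ^ 8 + 9 * (eta (3*\<tau>) ^ 8 * eta (9*\<tau>) ^ 3 / eta \<tau> ^ 3))"

definition S3 :: "complex \<Rightarrow> complex" where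
  "S3 = on_uhp (\<lambda>\<tau>. (eta (3*\<tau>) ^ 9 / eta \<tau> ^ 3)\<^sup>2)"

definition Delta3 :: "complex \<Rightarrow> complex" where
  "Delta3 = on_uhp (\<lambda>\<tau>. eta \<tau> ^ 6 * eta (3*\<tau>) ^ 6)"

definition ramanujan_system_solution ::
    "(complex \<Rightarrow> complex) \<Rightarrow> (complex \<Rightarrow> complex) \<Rightarrow> (complex \<Rightarrow> complex) \<Rightarrow> (complex \<Rightarrow> complex) \<Rightarrow> bool"
where
  "ramanujan_system_solution t1 t2 t3 t4 \<longleftrightarrow>
     t1 holomorphic_on \<H> \<and> t2 holomorphic_on \<H> \<and> t3 holomorphic_on \<H> \<and> t4 holomorphic_on \<H> \<and>
     (\<forall>\<tau>\<in>\<H>.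
        qderiv t1 \<tau> = 1/6 * ((t1 \<tau>)\<^sup>2 - (t2 \<tau>)\<^sup>2) \<and>
        qderiv t2 \<tau> = 1/3 * (t1 \<tau> * t2 \<tau> - (t2 \<tau>)\<^sup>2 + 54 * t3 \<tau>) \<and>
        qderiv t3 \<tau> = 2/3 * t1 \<tau> * t3 \<tau> + 1/3 * t2 \<tau> * t3 \<tau> + 9 * t4 \<tau> \<and>
        qderiv t4 \<tau> = t1 \<tau> * t4 \<tau> + t2 \<tau> * t4 \<tau> \<and>
        (t3 \<tau>)\<^sup>2 - t2 \<tau> * t4 \<tau> = 0)"

definition R1 :: vfield where
  "R1 t = vector
     [1/6 * ((t$1)\<^sup>2 - (t$2)\<^sup>2),
      1/3 * (t$1 * t$2 - (t$2)\<^sup>2 + 54 * t$3),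
      2/3 * t$1 * t$3 + 1/3 * t$2 * t$3 + 9 * t$4,
      t$1 * t$4 + (t$3)\<^sup>2]"

definition H1 :: vfield where
  "H1 t = vector [2 * t$1, 2 * t$2, 4 * t$3, 6 * t$4]"

definition F1 :: vfield where
  "F1 t = vector [-6, 0, 0, 0]"

definition ideal_I :: "cpoly set" where
  "ideal_I = Idl\<^bsub>poly_ring {2,3,4}\<^esub> {(X 3)\<^sup>2 - X 2 * X 4}"

definition ideal_I_tilde :: "cpoly set" where
  "ideal_I_tilde = Idl\<^bsub>poly_ring {1,2,3,4}\<^esub> {(X 3)\<^sup>2 - X 2 * X 4}"

end

theory Submission
  imports Defs
begin

text \<open>
  A form on \<open>\<Gamma>\<^sub>0(3)\<close> is a pair of power series in \<open>q\<close>, its expansions at the two cusps, which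
  are exchanged by \<open>\<tau> \<mapsto> - 1 / (3 \<tau>)\<close>. The inversion law of \<open>E\<^sub>2\<close> comes from the logarithmic
  derivative of a theta function and yields that of \<open>\<eta>\<close>; the Borwein function
  \<open>a = (\<eta>(q)^3 + 9 \<eta>(q^9)^3) / \<eta>(q^3)\<close> is such a form of weight 1 because of Jacobi's series for
  \<open>\<eta>^3\<close>. The quotient \<open>c = \<eta>(q^3)^9 / \<eta>(q)^3\<close> of weight 3 vanishes exactly at the cusp
  \<open>\<infinity>\<close>, so subtracting a multiple of \<open>a^k\<close> and dividing by \<open>c\<close> lowers the weight, and since forms of
  weight 0 are constant and there are none of negative weight, all forms are polynomials in \<open>a\<close>
  and \<open>c\<close>. With \<open>Q\<^sub>3 = a^2\<close>, \<open>R\<^sub>3 = a c\<close>, \<open>S\<^sub>3 = c^2\<close> this gives the ring of modular forms, and every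
  identity between forms reduces to a few coefficients; the differential system is obtained from Serre
  derivatives. For quasi-modular forms, the last coefficient of the transformation law of a form is
  modular, so that the length of the law decreases after subtraction of a multiple of a power of
  \<open>P\<^sub>3\<close>. The vector fields \<open>R\<^sub>1\<close>, \<open>H\<^sub>1\<close>, \<open>F\<^sub>1\<close> form a standard basis of \<open>sl\<^sub>2\<close>.
\<close>

section \<open>The inversion law of the Eisenstein series\<close>

text \<open>The forms a and c have odd weight while \<Gamma>_0(3) contains -1, so they are not
  modular forms in the sense of \<open>modular_forms\<close>; they carry a character. Pairs of
  expansions avoid it: the Fricke equation makes sense in every integer weight, negative ones
  included, and evenness enters only on the way back to \<Gamma>_0(3). Regularity at both cusps is
  built into a pair, and division by c preserves it because the dual of c has no zeros. The obstacle
  is to have a form of weight 1. The inversion law of eta yields the dual expansion of a as a series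
  in q^(1/3); that only integral powers of q occur is a congruence modulo 3 for triangular numbers,
  the exponents in Jacobi's series. Quasi-modular forms are restricted by growth alone. Periodicity
  together with growth polynomial in Im \<tau> makes q = 0 a removable singularity, which leads back
  to pairs. Conversely, the growth of R_3 and S_3 is not estimated: the differential equations
  express them by P_3, Q_3 and derivatives.\<close>

lemma holomorphic_on_suminf:
  fixes f :: "nat \<Rightarrow> complex \<Rightarrow> complex"
  assumes S: "open S" and hol: "\<And>n. f n holomorphic_on S"
    and bnd: "\<And>x. x \<in> S \<Longrightarrow> \<exists>T B. open T \<and> x \<in> T \<and> T \<subseteq> S \<and> summable B \<and>
               (\<forall>n. \<forall>y\<in>T. norm (f n y) \<le> B n)"
  shows "(\<lambda>x. suminf (\<lambda>n. f n x)) holomorphic_on S"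
proof (rule holomorphic_uniform_sequence[OF S, where f = "\<lambda>N x. \<Sum>n<N. f n x"])
  show "(\<lambda>x. \<Sum>n<N. f n x) holomorphic_on S" for N
    using hol by (intro holomorphic_intros) auto
  fix x assume "x \<in> S"
  \<comment> \<open>The majorant may depend on the point: the first term of \<open>theta_sum\<close>
    has its poles on the rim of the annulus.\<close>
  then obtain T B where T: "open T" "x \<in> T" "T \<subseteq> S" "summable B"
      and B: "\<And>n y. y \<in> T \<Longrightarrow> norm (f n y) \<le> B n"
    using bnd by meson
  then obtain d where d: "d > 0" "cball x d \<subseteq> T"
    using open_contains_cball by metis
  have "uniform_limit (cball x d) (\<lambda>N x. \<Sum>n<N. f n x) (\<lambda>x. suminf (\<lambda>n. f n x)) sequentially"
    by (rule Weierstrass_m_test[where M = B]) (use B d T in auto)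
  then show "\<exists>d>0. cball x d \<subseteq> S \<and>
      uniform_limit (cball x d) (\<lambda>N x. \<Sum>n<N. f n x) (\<lambda>x. suminf (\<lambda>n. f n x)) sequentially"
    using d T by blast
qed

text \<open>All three sums rearrange the absolutely convergent double series of n q^(n m) over n, m
  \<ge> 1: collecting equal products n m gives divisor sums, summing first over m gives geometric
  series, summing first over n gives derivatives of geometric series.\<close>

lemma lambert_has_sum:
  fixes q :: complex
  assumes q: "norm q < 1"
  shows "(\<lambda>k. of_nat (sigma1 (Suc k)) * q ^ Suc k) sums
           suminf (\<lambda>n. of_nat (Suc n) * q ^ Suc n / (1 - q ^ Suc n))" (is ?A)
    and "(\<lambda>n. of_nat (Suc n) * q ^ Suc n / (1 - q ^ Suc n)) sums
           suminf (\<lambda>n. of_nat (Suc n) * q ^ Suc n / (1 - q ^ Suc n))" (is ?B)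
    and "(\<lambda>n. q ^ Suc n / (1 - q ^ Suc n)\<^sup>2) sums
           suminf (\<lambda>n. of_nat (Suc n) * q ^ Suc n / (1 - q ^ Suc n))" (is ?C)
proof -
  define f :: "nat \<times> nat \<Rightarrow> complex"
    where "f = (\<lambda>(n,m). of_nat (Suc n) * q ^ (Suc n * Suc m))"
  define r where "r = norm q"
  have r: "0 \<le> r" "r < 1" using q by (auto simp: r_def)
  have geo: "((\<lambda>m. r ^ m) has_sum (1 / (1 - r))) UNIV"
    by (rule norm_summable_imp_has_sum) (use r geometric_sums[of r] in auto)
  have geo2: "((\<lambda>n. real (Suc n) * r ^ n) has_sum (1 / (1 - r)\<^sup>2)) UNIV"
    using geometric_deriv_sums[of r] r
    by (intro norm_summable_imp_has_sum) (auto simp: sums_iff simp del: of_nat_Suc)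
  \<comment> \<open>Majorant: the exponent (n + 1)(m + 1) is at least n + m, and the resulting
    double series is a product of two single ones.\<close>
  have "(\<lambda>(n,m). real (Suc n) * r ^ n * r ^ m) summable_on (UNIV \<times> UNIV)"
  proof (rule summable_on_SigmaI)
    show "((\<lambda>m. case (n, m) of (n, m) \<Rightarrow> real (Suc n) * r ^ n * r ^ m) has_sum
            real (Suc n) * r ^ n * (1 / (1 - r))) UNIV" for n
      using has_sum_cmult_right[OF geo, of "real (Suc n) * r ^ n"] by simp
    show "(\<lambda>n. real (Suc n) * r ^ n * (1 / (1 - r))) summable_on UNIV"
      using has_sum_imp_summable[OF has_sum_cmult_left[OF geo2, of "1 / (1 - r)"]] by simp
  qed (use r in auto)
  then have "(\<lambda>x. norm (f x)) summable_on (UNIV \<times> UNIV)"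
  proof (rule summable_on_comparison_test)
    fix x :: "nat \<times> nat"
    obtain n m where x: "x = (n, m)" by (cases x)
    have "r ^ (Suc n * Suc m) \<le> r ^ (n + m)"
      by (rule power_decreasing) (use r in auto)
    then show "norm (f x) \<le> (case x of (n, m) \<Rightarrow> real (Suc n) * r ^ n * r ^ m)"
      by (simp add: x f_def norm_mult norm_power r_def power_add mult_left_mono mult.assoc
          del: of_nat_Suc power_Suc mult_Suc mult_Suc_right)
  qed auto
  then have sf: "f summable_on (UNIV \<times> UNIV)"
    by (rule abs_summable_summable)
  then obtain s where s: "(f has_sum s) (UNIV \<times> UNIV)"
    by (auto simp: summable_on_def)
  have qn: "norm (q ^ Suc n) < 1" for n
    using q by (simp add: norm_power power_less_one_iff del: power_Suc)
  have qne: "q ^ Suc n \<noteq> 1" for n using qn[of n] by force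
  have rows: "((\<lambda>m. f (n, m)) has_sum (of_nat (Suc n) * q ^ Suc n / (1 - q ^ Suc n))) UNIV" for n
  proof -
    have "((\<lambda>m. (q ^ Suc n) ^ m) has_sum (1 / (1 - q ^ Suc n))) UNIV"
    proof (rule norm_summable_imp_has_sum)
      have "(\<lambda>m. norm ((q ^ Suc n) ^ m)) = (\<lambda>m. norm (q ^ Suc n) ^ m)"
        by (rule ext, rule norm_power)
      then show "summable (\<lambda>m. norm ((q ^ Suc n) ^ m))"
        using summable_geometric[of "norm (q ^ Suc n)"] qn[of n] by simp
      show "(\<lambda>m. (q ^ Suc n) ^ m) sums (1 / (1 - q ^ Suc n))"
        by (rule geometric_sums) (rule qn)
    qed
    from has_sum_cmult_right[OF this, of "of_nat (Suc n) * q ^ Suc n"]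
    show ?thesis
      by (simp add: f_def power_mult[symmetric] power_add mult.assoc del: of_nat_Suc power_Suc mult_Suc)
         (simp add: power_add mult.assoc)
  qed
  have cols: "((\<lambda>n. f (n, m)) has_sum (q ^ Suc m / (1 - q ^ Suc m)\<^sup>2)) UNIV" for m
  proof -
    let ?x = "q ^ Suc m"
    have "(\<lambda>n. norm (of_nat (Suc n) * ?x ^ n)) = (\<lambda>n. of_nat (Suc n) * norm ?x ^ n)"
      by (auto simp: norm_mult norm_power simp del: of_nat_Suc power_Suc)
    then have "summable (\<lambda>n. norm (of_nat (Suc n) * ?x ^ n))"
      using geometric_deriv_sums[of "norm ?x"] qn[of m] by (auto simp: sums_iff simp del: power_Suc)
    moreover have "(\<lambda>n. of_nat (Suc n) * ?x ^ n) sums (1 / (1 - ?x)\<^sup>2)"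
      by (rule geometric_deriv_sums) (rule qn)
    ultimately have "((\<lambda>n. of_nat (Suc n) * ?x ^ n) has_sum (1 / (1 - ?x)\<^sup>2)) UNIV"
      by (rule norm_summable_imp_has_sum)
    from has_sum_cmult_left[OF this, of "q ^ Suc m"] show ?thesis
      by (simp add: f_def mult.assoc power_mult[symmetric] del: of_nat_Suc power_Suc)
         (simp add: power_add mult.commute mult.left_commute algebra_simps)
  qed
  have B: "((\<lambda>n. of_nat (Suc n) * q ^ Suc n / (1 - q ^ Suc n)) has_sum s) UNIV"
    by (rule has_sum_SigmaD[OF s]) (use rows in auto)
  have "((\<lambda>(m,n). f (n,m)) has_sum s) (UNIV \<times> UNIV)"
    using s by (subst has_sum_swap) auto
  then have C: "((\<lambda>n. q ^ Suc n / (1 - q ^ Suc n)\<^sup>2) has_sum s) UNIV"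
    by (rule has_sum_SigmaD) (use cols in auto)
  \<comment> \<open>A pair (n, m) corresponds to (k, d) with d = n + 1 a divisor of k + 1 = (n +
    1)(m + 1); all indices are shifted by 1.\<close>
  have "((\<lambda>(k,d). of_nat d * q ^ Suc k) has_sum s) (SIGMA k:UNIV. {d. d dvd Suc k}) \<longleftrightarrow>
        (f has_sum s) (UNIV \<times> UNIV)"
  proof (rule has_sum_reindex_bij_witness[of _ "\<lambda>(n,m). (Suc n * Suc m - 1, Suc n)"
          "\<lambda>(k,d). (d - 1, Suc k div d - 1)"])
    fix x assume "x \<in> (SIGMA k:UNIV. {d. d dvd Suc k})"
    then obtain k d e where x: "x = (k, d)" and de: "Suc k = d * e"
      by (auto simp: dvd_def)
    then have "d > 0" "e > 0" by (metis gr0I mult_is_0 nat.simps(3))+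
    then obtain d' e' where "d = Suc d'" "e = Suc e'" by (metis gr0_implies_Suc)
    then have *: "Suc k = Suc d' * Suc e'" "d = Suc d'" "Suc k div d = Suc e'"
      using de by (simp_all only: nonzero_mult_div_cancel_left)
    show "(case case x of (k, d) \<Rightarrow> (d - 1, Suc k div d - 1) of (n, m) \<Rightarrow> (Suc n * Suc m - 1, Suc n)) = x"
      using * by (simp only: x prod.case diff_Suc_1) (metis diff_Suc_1)
    show "f (case x of (k, d) \<Rightarrow> (d - 1, Suc k div d - 1)) = (case x of (k, d) \<Rightarrow> of_nat d * q ^ Suc k)"
      using * by (simp only: x prod.case diff_Suc_1 f_def)
  next
    fix y :: "nat \<times> nat" assume "y \<in> UNIV \<times> UNIV"
    obtain n m where y: "y = (n, m)" by (cases y)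
    have *: "Suc (Suc n * Suc m - 1) = Suc n * Suc m" by simp
    have **: "Suc n * Suc m div Suc n = Suc m" by (rule nonzero_mult_div_cancel_left) simp
    show "(case case y of (n, m) \<Rightarrow> (Suc n * Suc m - 1, Suc n) of (k, d) \<Rightarrow> (d - 1, Suc k div d - 1)) = y"
      by (simp only: y prod.case * ** diff_Suc_1)
    show "(case y of (n, m) \<Rightarrow> (Suc n * Suc m - 1, Suc n)) \<in> (SIGMA k:UNIV. {d. d dvd Suc k})"
      by (simp only: y prod.case mem_Sigma_iff * mem_Collect_eq dvd_triv_left) simp
  qed auto
  then have "((\<lambda>(k,d). of_nat d * q ^ Suc k) has_sum s) (SIGMA k:UNIV. {d. d dvd Suc k})"
    using s by blast
  then have A: "((\<lambda>k. of_nat (sigma1 (Suc k)) * q ^ Suc k) has_sum s) UNIV"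
  proof (rule has_sum_SigmaD)
    fix k :: nat
    have "finite {d. d dvd Suc k}" by simp
    from has_sum_finite[OF this, of "\<lambda>d. of_nat d * q ^ Suc k"]
    show "((\<lambda>d. case (k, d) of (k, d) \<Rightarrow> of_nat d * q ^ Suc k) has_sum
            of_nat (sigma1 (Suc k)) * q ^ Suc k) {d. d dvd Suc k}"
      by (simp add: sigma1_def sum_distrib_right of_nat_sum)
  qed
  have "s = suminf (\<lambda>n. of_nat (Suc n) * q ^ Suc n / (1 - q ^ Suc n))"
    using has_sum_imp_sums[OF B] by (simp add: sums_iff)
  then show ?A ?B ?C
    using has_sum_imp_sums[OF A] has_sum_imp_sums[OF B] has_sum_imp_sums[OF C] by auto
qed

section \<open>The nome on the upper half-plane\<close>

lemma norm_nome: "norm (nome \<tau>) = exp (- (2 * pi * Im \<tau>))"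
  by (simp add: nome_def norm_exp_eq_Re)

lemma nome_nonzero [simp]: "nome \<tau> \<noteq> 0"
  by (simp add: nome_def)

lemma nome_add: "nome (a + b) = nome a * nome b"
  by (simp add: nome_def ring_distribs exp_add)

lemma nome_minus: "nome (- a) = inverse (nome a)"
  by (simp add: nome_def exp_minus)

lemma nome_of_int [simp]: "nome (of_int n) = 1"
  using exp_integer_2pi[of "of_int n"] by (simp add: nome_def mult_ac)

lemma nome_1 [simp]: "nome 1 = 1"
  using nome_of_int[of 1] by simp

lemma nome_0 [simp]: "nome 0 = 1"
  by (simp add: nome_def)

lemma nome_mult_nat: "nome (of_nat n * \<tau>) = nome \<tau> ^ n"
  by (induction n) (auto simp: nome_add ring_distribs)

lemma nome_eq_1_iff: "nome z = 1 \<longleftrightarrow> (\<exists>n::int. z = of_int n)"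
proof -
  have "nome z = 1 \<longleftrightarrow> (\<exists>n::int. Im (2 * of_real pi * \<i> * z) = of_int (2 * n) * pi \<and>
          Re (2 * of_real pi * \<i> * z) = 0)"
    unfolding nome_def exp_eq_1 by auto
  also have "\<dots> \<longleftrightarrow> (\<exists>n::int. z = of_int n)"
    by (auto simp: complex_eq_iff)
  finally show ?thesis .
qed

lemma nome_holomorphic [holomorphic_intros]:
  "f holomorphic_on S \<Longrightarrow> (\<lambda>z. nome (f z)) holomorphic_on S"
  unfolding nome_def by (intro holomorphic_intros) auto

lemma nome_has_field_derivative:
  "(nome has_field_derivative 2 * of_real pi * \<i> * nome z) (at z within S)"
  unfolding nome_def by (auto intro!: derivative_eq_intros)

lemma open_uhp: "open \<H>"
  unfolding upper_half_plane_def by (simp add: open_halfspace_Im_gt)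

lemma norm_nome_less_1: "\<tau> \<in> \<H> \<Longrightarrow> norm (nome \<tau>) < 1"
  by (auto simp: norm_nome upper_half_plane_def)

lemma uhp_neg_inverse: "\<tau> \<in> \<H> \<Longrightarrow> - 1 / \<tau> \<in> \<H>"
  by (auto simp: upper_half_plane_def Im_divide power2_eq_square add_pos_nonneg sum_power2_gt_zero_iff
      intro!: divide_pos_pos) (smt (verit) not_sum_squares_lt_zero zero_less_mult_iff)+

lemma E2_eq_lambert:
  assumes "norm q < 1"
  shows "E2 q = 1 - 24 * suminf (\<lambda>n. q ^ Suc n / (1 - q ^ Suc n)\<^sup>2)"
  using lambert_has_sum[OF assms] unfolding E2_def by (simp only: sums_iff)

section \<open>The logarithmic derivative of a theta function in the elliptic variable\<close>

definition theta_sum :: "complex \<Rightarrow> complex \<Rightarrow> complex" where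
  "theta_sum q x = suminf (\<lambda>n. q ^ Suc n / ((x - q ^ Suc n) * (1 - x * q ^ Suc n)))"

text \<open>With x = \<open>nome z\<close> and q = \<open>nome \<tau>\<close> this is d/dz of the
  logarithm of (x^(1/2) - x^(-1/2)) times the product over n \<ge> 1 of (1 - x q^n)(1 - q^n / x).
  Each pair of factors contributes one term of \<open>theta_sum\<close>, which makes the symmetry
  under x \<mapsto> 1/x visible.\<close>

definition theta_log_deriv :: "complex \<Rightarrow> complex \<Rightarrow> complex" where
  "theta_log_deriv \<tau> z = 2 * of_real pi * \<i> *
     ((nome z + 1) / (2 * (nome z - 1)) + (1 - (nome z)\<^sup>2) * theta_sum (nome \<tau>) (nome z))"

text \<open>Bounds independent of n are what turns the terms of \<open>theta_sum\<close> into
  geometric majorants on the annulus.\<close>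

lemma annulus_bounds:
  fixes q x :: complex
  assumes "norm q < r" "r < norm x" "norm x < 1 / r" "r \<le> 1"
  shows "r - norm q \<le> norm (x - q ^ Suc n)" "1 - norm q / r \<le> norm (1 - x * q ^ Suc n)"
proof -
  have r: "r > 0" using assms(1) by (smt (verit) norm_ge_zero)
  have *: "norm (q ^ Suc n) \<le> norm q"
    using power_decreasing[of 1 "Suc n" "norm q"] assms by (simp add: norm_power norm_mult)
  have "norm (x - q ^ Suc n) \<ge> norm x - norm (q ^ Suc n)"
    by (rule norm_triangle_ineq2)
  then show "r - norm q \<le> norm (x - q ^ Suc n)" using * assms by linarith
  have "norm (x * q ^ Suc n) \<le> 1 / r * norm q"
    unfolding norm_mult by (rule mult_mono) (use * assms r in auto)
  moreover have "norm (1 - x * q ^ Suc n) \<ge> norm (1::complex) - norm (x * q ^ Suc n)"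
    by (rule norm_triangle_ineq2)
  ultimately show "1 - norm q / r \<le> norm (1 - x * q ^ Suc n)" by simp
qed

lemma annulus_radius:
  assumes "norm (q::complex) < norm x" "norm x * norm q < 1"  "norm q < 1"
  obtains r where "norm q < r" "r < norm x" "norm x < 1 / r" "r \<le> 1"
proof -
  have x: "norm x > 0" using assms(1) by (smt (verit) norm_ge_zero)
  have "norm q < min (min (norm x) (1 / norm x)) 1"
    using assms x by (auto simp: field_simps)
  then obtain r where r: "norm q < r" "r < min (min (norm x) (1 / norm x)) 1"
    using dense by blast
  moreover have "r > 0" using r by (smt (verit) norm_ge_zero)
  ultimately show ?thesis
    using that[of r] x by (auto simp: field_simps)
qed

lemma theta_sum_holomorphic:
  assumes q: "norm q < 1"
  shows "theta_sum q holomorphic_on {x. norm q < norm x \<and> norm x * norm q < 1}"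
proof -
  have op: "open {x::complex. norm q < norm x \<and> norm x * norm q < 1}"
    by (intro open_Collect_conj open_Collect_less continuous_intros)
  show ?thesis
    unfolding theta_sum_def
  proof (rule holomorphic_on_suminf[OF op])
    fix n
    show "(\<lambda>x. q ^ Suc n / ((x - q ^ Suc n) * (1 - x * q ^ Suc n))) holomorphic_on
            {x. norm q < norm x \<and> norm x * norm q < 1}"
    proof (intro holomorphic_intros)
      fix x :: complex assume "x \<in> {x. norm q < norm x \<and> norm x * norm q < 1}"
      then have "norm q < norm x" "norm x * norm q < 1" by auto
      then obtain r where r: "norm q < r" "r < norm x" "norm x < 1 / r" "r \<le> 1"
        using q by (rule annulus_radius)
      have "norm q / r < 1" using r by (smt (verit) divide_less_eq_1 norm_ge_zero)
      then show "(x - q ^ Suc n) * (1 - x * q ^ Suc n) \<noteq> 0"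
        using annulus_bounds[OF r, of n] r(1) by (metis diff_gt_0_iff_gt leD mult_eq_0_iff norm_zero)
    qed
  next
    fix x :: complex assume "x \<in> {x. norm q < norm x \<and> norm x * norm q < 1}"
    then have x: "norm q < norm x" "norm x * norm q < 1" by auto
    then obtain r where r: "norm q < r" "r < norm x" "norm x < 1 / r" "r \<le> 1"
      using q by (rule annulus_radius)
    have r0: "r > 0" using r(1) by (smt (verit) norm_ge_zero)
    have q1: "norm q / r < 1" using r r0 by simp
    define T where "T = {y::complex. r < norm y \<and> norm y < 1 / r}"
    define B where "B = (\<lambda>n. norm q ^ Suc n * (1 / ((r - norm q) * (1 - norm q / r))))"
    have "open T" unfolding T_def
      by (intro open_Collect_conj open_Collect_less continuous_intros)
    moreover have "x \<in> T" using r by (simp add: T_def)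
    moreover have "T \<subseteq> {x. norm q < norm x \<and> norm x * norm q < 1}"
    proof
      fix y assume "y \<in> T"
      then have y: "r < norm y" "norm y < 1 / r" by (auto simp: T_def)
      have "norm y * norm q \<le> 1 / r * norm q"
        by (rule mult_right_mono) (use y in auto)
      then show "y \<in> {x. norm q < norm x \<and> norm x * norm q < 1}"
        using y r q1 by auto
    qed
    moreover have "summable B"
      unfolding B_def using q by (intro summable_mult2) (simp add: summable_geometric summable_mult)
    moreover have "norm (q ^ Suc n / ((y - q ^ Suc n) * (1 - y * q ^ Suc n))) \<le> B n" if "y \<in> T" for n y
    proof -
      from that have y: "r < norm y" "norm y < 1 / r" by (auto simp: T_def)
      have "(r - norm q) * (1 - norm q / r) \<le> norm (y - q ^ Suc n) * norm (1 - y * q ^ Suc n)"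
        by (rule mult_mono) (use annulus_bounds[OF r(1) y r(4), of n] q1 r in auto)
      moreover have "0 < (r - norm q) * (1 - norm q / r)"
        using q1 r by simp
      ultimately show ?thesis
        unfolding B_def norm_divide norm_mult norm_power
        by (simp add: frac_le)
    qed
    ultimately show "\<exists>T B. open T \<and> x \<in> T \<and> T \<subseteq> {x. norm q < norm x \<and> norm x * norm q < 1} \<and>
        summable B \<and> (\<forall>n. \<forall>y\<in>T. norm (q ^ Suc n / ((y - q ^ Suc n) * (1 - y * q ^ Suc n))) \<le> B n)"
      by blast
  qed
qed

text \<open>Inverting x exchanges the two factors of each denominator and costs a factor 1/x in
  each.\<close>

lemma theta_sum_inverse:
  assumes x: "x \<noteq> 0" and "summable (\<lambda>n. q ^ Suc n / ((x - q ^ Suc n) * (1 - x * q ^ Suc n)))"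
  shows "theta_sum q (inverse x) = x\<^sup>2 * theta_sum q x"
proof -
  have "q ^ Suc n / ((inverse x - q ^ Suc n) * (1 - inverse x * q ^ Suc n)) =
        x\<^sup>2 * (q ^ Suc n / ((x - q ^ Suc n) * (1 - x * q ^ Suc n)))" for n
  proof -
    have "inverse x - q ^ Suc n = (1 - x * q ^ Suc n) / x" "1 - inverse x * q ^ Suc n = (x - q ^ Suc n) / x"
      using x by (simp_all add: field_simps)
    then show ?thesis using x by (simp add: power2_eq_square mult_ac)
  qed
  then show ?thesis
    unfolding theta_sum_def using assms by (simp only: suminf_mult)
qed

text \<open>The last equation is a partial fraction decomposition: it separates the zeros x = q^n of
  theta from the zeros x = q^(-n). Replacing x by x q shifts the index in each family, which the
  combined series hides.\<close>

lemma theta_summands: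
  assumes x: "norm q < norm x" "norm x * norm q < 1" "norm q < 1"
  shows "summable (\<lambda>n. q ^ Suc n / (x - q ^ Suc n))"
    and "summable (\<lambda>n. x * q ^ Suc n / (1 - x * q ^ Suc n))"
    and "summable (\<lambda>n. q ^ Suc n / ((x - q ^ Suc n) * (1 - x * q ^ Suc n)))"
    and "(1 - x\<^sup>2) * theta_sum q x = suminf (\<lambda>n. q ^ Suc n / (x - q ^ Suc n)) -
           suminf (\<lambda>n. x * q ^ Suc n / (1 - x * q ^ Suc n))"
proof -
  obtain r where r: "norm q < r" "r < norm x" "norm x < 1 / r" "r \<le> 1"
    using x by (rule annulus_radius)
  have r0: "r > 0" using r(1) by (smt (verit) norm_ge_zero)
  have q1: "norm q / r < 1" using r r0 by simp
  have geo: "summable (\<lambda>n. norm q ^ Suc n * c)" for c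
    using x(3) by (intro summable_mult2) (simp add: summable_geometric summable_mult)
  note b = annulus_bounds[OF r]
  have nz: "x - q ^ Suc n \<noteq> 0" "1 - x * q ^ Suc n \<noteq> 0" for n
    using b[of n] q1 r(1) by (auto simp del: power_Suc)
  show s1: "summable (\<lambda>n. q ^ Suc n / (x - q ^ Suc n))"
  proof (rule summable_comparison_test'[OF geo[of "1 / (r - norm q)"]])
    fix n show "norm (q ^ Suc n / (x - q ^ Suc n)) \<le> norm q ^ Suc n * (1 / (r - norm q))"
      unfolding norm_divide norm_power using b(1)[of n] r(1) by (simp add: frac_le del: power_Suc)
  qed
  show s2: "summable (\<lambda>n. x * q ^ Suc n / (1 - x * q ^ Suc n))"
  proof (rule summable_comparison_test'[OF geo[of "norm x * (1 / (1 - norm q / r))"]])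
    fix n
    have "norm (x * q ^ Suc n / (1 - x * q ^ Suc n)) \<le> norm x * norm q ^ Suc n / (1 - norm q / r)"
      unfolding norm_divide norm_mult norm_power using b(2)[of n] q1 by (intro frac_le) auto
    then show "norm (x * q ^ Suc n / (1 - x * q ^ Suc n)) \<le> norm q ^ Suc n * (norm x * (1 / (1 - norm q / r)))"
      by (simp add: mult_ac)
  qed
  show s3: "summable (\<lambda>n. q ^ Suc n / ((x - q ^ Suc n) * (1 - x * q ^ Suc n)))"
  proof (rule summable_comparison_test'[OF geo[of "1 / ((r - norm q) * (1 - norm q / r))"]])
    fix n
    have "(r - norm q) * (1 - norm q / r) \<le> norm (x - q ^ Suc n) * norm (1 - x * q ^ Suc n)"
      by (rule mult_mono) (use b[of n] q1 r in auto)
    moreover have "0 < (r - norm q) * (1 - norm q / r)"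
      using q1 r by simp
    ultimately show "norm (q ^ Suc n / ((x - q ^ Suc n) * (1 - x * q ^ Suc n))) \<le>
        norm q ^ Suc n * (1 / ((r - norm q) * (1 - norm q / r)))"
      unfolding norm_divide norm_mult norm_power by (simp add: frac_le del: power_Suc)
  qed
  have "(1 - x\<^sup>2) * (q ^ Suc n / ((x - q ^ Suc n) * (1 - x * q ^ Suc n))) =
          q ^ Suc n / (x - q ^ Suc n) - x * q ^ Suc n / (1 - x * q ^ Suc n)" for n
  proof -
    define y where "y = q ^ Suc n"
    show ?thesis using nz[of n] unfolding y_def[symmetric]
      by (simp add: divide_simps) (simp add: power2_eq_square algebra_simps)
  qed
  then show "(1 - x\<^sup>2) * theta_sum q x = suminf (\<lambda>n. q ^ Suc n / (x - q ^ Suc n)) -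
           suminf (\<lambda>n. x * q ^ Suc n / (1 - x * q ^ Suc n))"
    unfolding theta_sum_def by (simp only: suminf_mult[OF s3, symmetric] suminf_diff[OF s1 s2])
qed

lemma norm_nome_strip:
  assumes "\<bar>Im z\<bar> < Im \<tau>"
  shows "norm (nome \<tau>) < norm (nome z)" "norm (nome z) * norm (nome \<tau>) < 1" "norm (nome \<tau>) < 1"
proof -
  have "Im z < Im \<tau>" "0 < Im z + Im \<tau>" using assms by auto
  then show "norm (nome \<tau>) < norm (nome z)" "norm (nome z) * norm (nome \<tau>) < 1" "norm (nome \<tau>) < 1"
    using assms by (auto simp: norm_nome mult_exp_exp distrib_left[symmetric] simp del: distrib_left)
       (smt (verit, best) pi_gt_zero mult_pos_pos distrib_left)+
qed

lemma theta_log_deriv_odd: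
  assumes "\<bar>Im z\<bar> < Im \<tau>"
  shows "theta_log_deriv \<tau> (- z) = - theta_log_deriv \<tau> z"
proof -
  note b = norm_nome_strip[OF assms]
  define x where "x = nome z"
  have x0: "x \<noteq> 0" by (simp add: x_def)
  have *: "theta_sum (nome \<tau>) (inverse x) = x\<^sup>2 * theta_sum (nome \<tau>) x"
    using theta_sum_inverse[OF x0, of "nome \<tau>"] theta_summands(3)[of "nome \<tau>" x] b by (auto simp: x_def)
  have "(inverse x + 1) / (2 * (inverse x - 1)) = - ((x + 1) / (2 * (x - 1)))"
    using x0 by (cases "x = 1") (auto simp: divide_simps, auto simp: algebra_simps)
  moreover have "(1 - (inverse x)\<^sup>2) * (x\<^sup>2 * theta_sum (nome \<tau>) x) = - ((1 - x\<^sup>2) * theta_sum (nome \<tau>) x)"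
    using x0 by (simp add: field_simps)
  ultimately show ?thesis
    unfolding theta_log_deriv_def nome_minus x_def[symmetric] * by (simp add: algebra_simps)
qed

lemma theta_log_deriv_period: "theta_log_deriv \<tau> (z + 1) = theta_log_deriv \<tau> z"
  by (simp add: theta_log_deriv_def nome_add)

text \<open>Passing from x to x q shifts the index in both sums of \<open>theta_summands\<close>:
  \<open>A\<close> gains 1/(x - 1) and \<open>B\<close> loses x q/(1 - x q). Together with the
  change of (x + 1)/(2(x - 1)) this adds up to -1. The two strip conditions put x and x q into the
  annulus of convergence.\<close>

lemma theta_log_deriv_quasi_period:
  assumes z: "\<bar>Im z\<bar> < Im \<tau>" and z': "\<bar>Im (z + \<tau>)\<bar> < Im \<tau>"
  shows "theta_log_deriv \<tau> (z + \<tau>) = theta_log_deriv \<tau> z - 2 * of_real pi * \<i>"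
proof -
  define x q where "x = nome z" and "q = nome \<tau>"
  have x0: "x \<noteq> 0" "q \<noteq> 0" by (auto simp: x_def q_def)
  note b = norm_nome_strip[OF z, folded x_def q_def]
  note b' = norm_nome_strip[OF z', unfolded nome_add, folded x_def q_def]
  have Im: "Im z < 0" using z z' by auto
  have "norm x > 1" unfolding x_def norm_nome using Im by (simp add: mult_pos_neg)
  then have x1: "x \<noteq> 1" by auto
  have "norm (x * q) < 1" using b by (simp add: norm_mult)
  then have xq1: "x * q \<noteq> 1" by auto
  define A where "A = (\<lambda>x. suminf (\<lambda>n. q ^ Suc n / (x - q ^ Suc n)))"
  define B where "B = (\<lambda>x. suminf (\<lambda>n. x * q ^ Suc n / (1 - x * q ^ Suc n)))"
  have 1: "(1 - x\<^sup>2) * theta_sum q x = A x - B x"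
    unfolding A_def B_def by (rule theta_summands(4)[OF b])
  have 2: "(1 - (x * q)\<^sup>2) * theta_sum q (x * q) = A (x * q) - B (x * q)"
    unfolding A_def B_def by (rule theta_summands(4)[OF b'])
  have "A (x * q) = suminf (\<lambda>n. q ^ n / (x - q ^ n))"
    unfolding A_def
  proof (intro arg_cong[where f = suminf] ext)
    fix n
    have "q ^ Suc n / (x * q - q ^ Suc n) = (q * q ^ n) / (q * (x - q ^ n))"
      by (simp add: algebra_simps)
    then show "q ^ Suc n / (x * q - q ^ Suc n) = q ^ n / (x - q ^ n)"
      using x0 by simp
  qed
  also have "\<dots> = 1 / (x - 1) + A x"
  proof -
    have "summable (\<lambda>n. q ^ n / (x - q ^ n))"
      using theta_summands(1)[OF b] summable_Suc_iff[of "\<lambda>n. q ^ n / (x - q ^ n)"] by simp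
    from suminf_split_head[OF this] show ?thesis unfolding A_def by simp
  qed
  finally have 3: "A (x * q) = 1 / (x - 1) + A x" .
  have 4: "B x = x * q / (1 - x * q) + B (x * q)"
    using suminf_split_head[OF theta_summands(2)[OF b]] unfolding B_def by (simp add: mult_ac)
  have "(x * q + 1) / (2 * (x * q - 1)) - (x + 1) / (2 * (x - 1)) + 1 / (x - 1) + x * q / (1 - x * q) = -1"
  proof -
    define y where "y = x * q"
    have "y - 1 \<noteq> 0" "x - 1 \<noteq> 0" "1 - y \<noteq> 0" using x1 xq1 by (auto simp: y_def)
    then have "(y + 1) / (2 * (y - 1)) = 1 / 2 + 1 / (y - 1)" "(x + 1) / (2 * (x - 1)) = 1 / 2 + 1 / (x - 1)"
      "y / (1 - y) = - 1 - 1 / (y - 1)"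
      by (auto simp: field_simps)
    then show ?thesis unfolding y_def by simp
  qed
  then have "(x * q + 1) / (2 * (x * q - 1)) + (1 - (x * q)\<^sup>2) * theta_sum q (x * q) =
        (x + 1) / (2 * (x - 1)) + (1 - x\<^sup>2) * theta_sum q x - 1" (is "?l = ?r - 1")
    unfolding 1 2 3 4 by (simp add: algebra_simps)
  then have "2 * of_real pi * \<i> * ?l = 2 * of_real pi * \<i> * ?r - 2 * of_real pi * \<i>"
    by (simp only: right_diff_distrib mult_1_right)
  then show ?thesis
    unfolding theta_log_deriv_def nome_add x_def[symmetric] q_def[symmetric] .
qed

lemma theta_log_deriv_holomorphic:
  "theta_log_deriv \<tau> holomorphic_on {z. \<bar>Im z\<bar> < Im \<tau> \<and> nome z \<noteq> 1}"
proof (cases "Im \<tau> > 0")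
  case True
  have "theta_sum (nome \<tau>) \<circ> nome holomorphic_on {z. \<bar>Im z\<bar> < Im \<tau> \<and> nome z \<noteq> 1}"
  proof (rule holomorphic_on_compose_gen[OF _ theta_sum_holomorphic])
    show "nome holomorphic_on {z. \<bar>Im z\<bar> < Im \<tau> \<and> nome z \<noteq> 1}"
      by (intro nome_holomorphic[OF holomorphic_on_ident])
  qed (use True norm_nome_strip in \<open>auto simp: norm_nome\<close>)
  then show ?thesis
    unfolding theta_log_deriv_def[abs_def] o_def
    by (intro holomorphic_intros nome_holomorphic) auto
next
  case False
  then have "{z. \<bar>Im z\<bar> < Im \<tau> \<and> nome z \<noteq> 1} = {}" by auto
  then show ?thesis by (simp only: holomorphic_on_empty)
qed

text \<open>The function is half of coth(u/2), with expansion 1/u + u/12 - ..., where 1/12 = B_2/2.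
  The cubic Taylor polynomial of exp with remainder \<open>R\<close> suffices, as numerator and
  denominator of the whole quotient both vanish to order 3.\<close>

lemma coth_limit:
  "((\<lambda>u::complex. ((exp u + 1) / (2 * (exp u - 1)) - 1 / u) / u) \<longlongrightarrow> 1 / 12) (at 0)"
proof -
  define R where "R = (\<lambda>u::complex. (exp u - (\<Sum>k\<le>3. u ^ k / fact k)) / u ^ 3)"
  have exp_R: "exp u = 1 + u + u\<^sup>2 / 2 + u ^ 3 / 6 + R u * u ^ 3" if "u \<noteq> 0" for u
    using that by (simp add: R_def eval_nat_numeral)
  have R0: "(R \<longlongrightarrow> 0) (at 0)"
  proof (rule Lim_null_comparison)
    show "eventually (\<lambda>u. norm (R u) \<le> exp (norm u) * norm u) (at 0)"
    proof (rule eventually_at_filter[THEN iffD2], rule always_eventually, intro allI impI)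
      fix u :: complex assume u: "u \<noteq> 0"
      have "norm (exp u - (\<Sum>k\<le>3. u ^ k / fact k)) \<le> exp (norm u) * norm u ^ Suc 3 / fact 3"
        by (rule Taylor_exp_field)
      also have "\<dots> \<le> exp (norm u) * norm u ^ Suc 3"
        by (simp add: divide_le_eq fact_numeral mult_left_mono)
      finally show "norm (R u) \<le> exp (norm u) * norm u"
        unfolding R_def norm_divide norm_power using u by (simp add: divide_le_eq mult_ac eval_nat_numeral)
    qed
    show "((\<lambda>u::complex. exp (norm u) * norm u) \<longlongrightarrow> 0) (at 0)"
      by (auto intro!: tendsto_eq_intros)
  qed
  have "((\<lambda>u. (1 / 6 + u / 6 + R u * (u - 2)) / (2 * (1 + u / 2 + u\<^sup>2 / 6 + R u * u\<^sup>2))) \<longlongrightarrow>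
          (1 / 6 + 0 / 6 + 0 * (0 - 2)) / (2 * (1 + 0 / 2 + 0\<^sup>2 / 6 + 0 * 0\<^sup>2))) (at (0::complex))"
    by (intro tendsto_intros R0) auto
  then have lim: "((\<lambda>u. (1 / 6 + u / 6 + R u * (u - 2)) / (2 * (1 + u / 2 + u\<^sup>2 / 6 + R u * u\<^sup>2))) \<longlongrightarrow> 1 / 12) (at (0::complex))"
    by simp
  have "eventually (\<lambda>u::complex. exp u \<noteq> 1) (at 0)"
  proof -
    have "eventually (\<lambda>u::complex. u \<in> ball 0 1 - {0}) (at 0)"
      by (rule eventually_at_in_open) auto
    then show ?thesis
    proof eventually_elim
      case (elim u)
      show "exp u \<noteq> 1"
      proof
        assume "exp u = 1"
        then obtain n :: int where n: "Re u = 0" "Im u = of_int (2 * n) * pi" unfolding exp_eq_1 by auto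
        then have "\<bar>Im u\<bar> < 1" using elim abs_Im_le_cmod[of u] by auto
        then have "\<bar>of_int n * (2 * pi)\<bar> < 1" using n by (simp add: mult_ac)
        then have "real_of_int \<bar>n\<bar> * (2 * pi) < 1" by (simp add: abs_mult)
        moreover have "1 * 1 \<le> real_of_int \<bar>n\<bar> * (2 * pi)" if "n \<noteq> 0"
          by (rule mult_mono) (use that pi_gt3 in auto)
        ultimately have "n = 0" by linarith
        then show False using n elim by (simp add: complex_eq_iff)
      qed
    qed
  qed
  moreover have "eventually (\<lambda>u::complex. u \<noteq> 0) (at 0)"
    by (simp add: eventually_at_filter)
  ultimately have "eventually (\<lambda>u. (1 / 6 + u / 6 + R u * (u - 2)) / (2 * (1 + u / 2 + u\<^sup>2 / 6 + R u * u\<^sup>2)) =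
      ((exp u + 1) / (2 * (exp u - 1)) - 1 / u) / u) (at 0)"
  proof eventually_elim
    case (elim u)
    have e1: "exp u - 1 = u * (1 + u / 2 + u\<^sup>2 / 6 + R u * u\<^sup>2)"
      using exp_R[OF elim(2)] by (simp add: power2_eq_square power3_eq_cube algebra_simps)
    then have nz: "1 + u / 2 + u\<^sup>2 / 6 + R u * u\<^sup>2 \<noteq> 0" using elim by auto
    have e2: "u * (exp u + 1) - 2 * (exp u - 1) = u ^ 3 * (1 / 6 + u / 6 + R u * (u - 2))"
      unfolding exp_R[OF elim(2)] by (simp add: power2_eq_square power3_eq_cube field_simps)
    have "((exp u + 1) / (2 * (exp u - 1)) - 1 / u) / u = (u * (exp u + 1) - 2 * (exp u - 1)) / (2 * u\<^sup>2 * (exp u - 1))"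
      using elim by (simp add: divide_simps power2_eq_square)
    also have "\<dots> = (u ^ 3 * (1 / 6 + u / 6 + R u * (u - 2))) / (u ^ 3 * (2 * (1 + u / 2 + u\<^sup>2 / 6 + R u * u\<^sup>2)))"
      unfolding e2 unfolding e1 by (simp add: power2_eq_square power3_eq_cube mult_ac)
    finally show ?case using elim by simp
  qed
  from tendsto_cong[OF this] lim show ?thesis by simp
qed

text \<open>E_2 is the linear Laurent coefficient at the pole. With c = 2 pi i the rational part
  contributes c^2/12; as 1 - x^2 has derivative -2c at z = 0, the series contributes -2c^2 times its
  value at x = 1, the Lambert series with squared denominators.\<close>

lemma theta_log_deriv_at_0:
  assumes "\<tau> \<in> \<H>"
  shows "((\<lambda>z. (theta_log_deriv \<tau> z - 1 / z) / z) \<longlongrightarrow> - (of_real pi ^ 2 / 3) * E2 (nome \<tau>)) (at 0)"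
proof -
  let ?c = "2 * of_real pi * \<i> :: complex"
  define q where "q = nome \<tau>"
  have q: "norm q < 1" using norm_nome_less_1[OF assms] by (simp add: q_def)
  have lin: "filterlim (\<lambda>z. ?c * z) (at 0) (at 0)"
    by (auto simp: filterlim_at intro!: tendsto_eq_intros eventually_at_filter[THEN iffD2])
  from filterlim_compose[OF coth_limit this]
  have L1: "((\<lambda>z. ((nome z + 1) / (2 * (nome z - 1)) - 1 / (?c * z)) / (?c * z)) \<longlongrightarrow> 1 / 12) (at 0)"
    by (simp add: nome_def)
  have "isCont (theta_sum q) (nome 0)"
  proof -
    have "continuous_on {x. norm q < norm x \<and> norm x * norm q < 1} (theta_sum q)"
      by (intro holomorphic_on_imp_continuous_on theta_sum_holomorphic q)
    moreover have "open {x::complex. norm q < norm x \<and> norm x * norm q < 1}"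
      by (intro open_Collect_conj open_Collect_less continuous_intros)
    ultimately show ?thesis using q by (simp add: continuous_on_eq_continuous_at)
  qed
  moreover have "isCont nome 0"
    using nome_has_field_derivative DERIV_isCont by blast
  ultimately have "isCont (\<lambda>z. theta_sum q (nome z)) 0"
    by (rule isCont_o2[rotated])
  then have L2: "((\<lambda>z. theta_sum q (nome z)) \<longlongrightarrow> theta_sum q 1) (at 0)"
    by (simp add: isCont_def)
  have "((\<lambda>z. 1 - (nome z)\<^sup>2) has_field_derivative - (2 * ?c)) (at 0)"
    by (auto intro!: derivative_eq_intros nome_has_field_derivative)
  then have L3: "((\<lambda>z. (1 - (nome z)\<^sup>2) / z) \<longlongrightarrow> - (2 * ?c)) (at 0)"
    by (simp add: has_field_derivative_iff)
  have "((\<lambda>z. ?c\<^sup>2 * (((nome z + 1) / (2 * (nome z - 1)) - 1 / (?c * z)) / (?c * z)) +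
           ?c * ((1 - (nome z)\<^sup>2) / z * theta_sum q (nome z))) \<longlongrightarrow> ?c\<^sup>2 * (1 / 12) + ?c * (- (2 * ?c) * theta_sum q 1)) (at 0)"
    by (intro tendsto_intros L1 L2 L3)
  also have "?c\<^sup>2 * (1 / 12) + ?c * (- (2 * ?c) * theta_sum q 1) = - (of_real pi ^ 2 / 3) * (1 - 24 * theta_sum q 1)"
    by (simp add: power2_eq_square algebra_simps)
  also have "1 - 24 * theta_sum q 1 = E2 q"
    unfolding E2_eq_lambert[OF q] theta_sum_def by (simp add: power2_eq_square)
  finally have L: "((\<lambda>z. ?c\<^sup>2 * (((nome z + 1) / (2 * (nome z - 1)) - 1 / (?c * z)) / (?c * z)) +
           ?c * ((1 - (nome z)\<^sup>2) / z * theta_sum q (nome z))) \<longlongrightarrow> - (of_real pi ^ 2 / 3) * E2 q) (at 0)" .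
  have "eventually (\<lambda>z. ?c\<^sup>2 * (((nome z + 1) / (2 * (nome z - 1)) - 1 / (?c * z)) / (?c * z)) +
           ?c * ((1 - (nome z)\<^sup>2) / z * theta_sum q (nome z)) = (theta_log_deriv \<tau> z - 1 / z) / z) (at 0)"
    unfolding eventually_at_filter
  proof (rule always_eventually, intro allI impI)
    fix z :: complex assume z: "z \<noteq> 0"
    have c: "?c \<noteq> 0" by simp
    have "c\<^sup>2 * ((K - 1 / (c * z)) / (c * z)) + c * (m / z * t) = (c * (K + m * t) - 1 / z) / z"
      if "c \<noteq> 0" for c K m t :: complex
      using z that by (simp add: field_simps power2_eq_square)
    from this[OF c] show "?c\<^sup>2 * (((nome z + 1) / (2 * (nome z - 1)) - 1 / (?c * z)) / (?c * z)) +
           ?c * ((1 - (nome z)\<^sup>2) / z * theta_sum q (nome z)) = (theta_log_deriv \<tau> z - 1 / z) / z"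
      unfolding theta_log_deriv_def q_def by blast
  qed
  from tendsto_cong[OF this] L show ?thesis by (simp add: q_def)
qed

text \<open>The open parallelogram of all a + b \<tau> with real |a|, |b| < 1, written as the
  intersection of the strips where the two theta functions are given by their series. Its only
  lattice point is 0.\<close>

definition period_domain :: "complex \<Rightarrow> complex set" where
  "period_domain \<tau> = {z. \<bar>Im z\<bar> < Im \<tau> \<and> \<bar>Im (z / \<tau>)\<bar> < Im (- 1 / \<tau>)}"

lemma Im_neg_inverse_pos: "\<tau> \<in> \<H> \<Longrightarrow> Im (- 1 / \<tau>) > 0"
  using uhp_neg_inverse by (auto simp: upper_half_plane_def)

lemma uhp_nonzero: "\<tau> \<in> \<H> \<Longrightarrow> \<tau> \<noteq> 0"
  by (auto simp: upper_half_plane_def)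

lemma period_domain_open: "open (period_domain \<tau>)"
  unfolding period_domain_def divide_inverse
  by (intro open_Collect_conj open_Collect_less continuous_intros)

lemma period_domain_convex: "convex (period_domain \<tau>)"
proof (rule convexI)
  fix x y :: complex and u v :: real
  assume *: "x \<in> period_domain \<tau>" "y \<in> period_domain \<tau>" "0 \<le> u" "0 \<le> v" "u + v = 1"
  have conv: "\<bar>u * a + v * b\<bar> < M" if "\<bar>a\<bar> < M" "\<bar>b\<bar> < M" for a b M :: real
  proof -
    have "convex {-M<..<M}" by (rule convex_real_interval)
    then have "u *\<^sub>R a + v *\<^sub>R b \<in> {-M<..<M}" by (rule convexD) (use that * in auto)
    then show ?thesis by auto
  qed
  have "(u *\<^sub>R x + v *\<^sub>R y) / \<tau> = u *\<^sub>R (x / \<tau>) + v *\<^sub>R (y / \<tau>)"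
    by (simp add: scaleR_conv_of_real add_divide_distrib)
  then have "Im ((u *\<^sub>R x + v *\<^sub>R y) / \<tau>) = u * Im (x / \<tau>) + v * Im (y / \<tau>)"
    by (simp only: plus_complex.simps scaleR_complex.simps)
  then show "u *\<^sub>R x + v *\<^sub>R y \<in> period_domain \<tau>"
    using * conv by (auto simp: period_domain_def)
qed

lemma period_domain_uminus: "z \<in> period_domain \<tau> \<Longrightarrow> - z \<in> period_domain \<tau>"
  by (simp add: period_domain_def)

lemma period_domain_nome:
  assumes "\<tau> \<in> \<H>" "z \<in> period_domain \<tau>" "z \<noteq> 0"
  shows "nome z \<noteq> 1" "nome (z / \<tau>) \<noteq> 1"
proof -
  note i0 = Im_neg_inverse_pos[OF assms(1)] and t0 = uhp_nonzero[OF assms(1)]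
  have small: "n = 0" if "\<bar>of_int n * a\<bar> < a" for n :: int and a :: real
  proof (rule ccontr)
    assume "n \<noteq> 0"
    then have "1 \<le> real_of_int \<bar>n\<bar>" by auto
    moreover have "a > 0" using that by linarith
    ultimately have "1 * a \<le> real_of_int \<bar>n\<bar> * a" by (intro mult_right_mono) auto
    then show False using that \<open>a > 0\<close> by (simp add: abs_mult)
  qed
  show "nome z \<noteq> 1"
  proof
    assume "nome z = 1"
    then obtain n :: int where n: "z = of_int n" by (auto simp: nome_eq_1_iff)
    have "Im (z / \<tau>) = - (of_int n * Im (- 1 / \<tau>))"
      unfolding n by (simp add: Im_divide)
    then have "n = 0" using assms(2) small[of n "Im (- 1 / \<tau>)"] by (simp add: period_domain_def)
    then show False using n assms by simp
  qed
  show "nome (z / \<tau>) \<noteq> 1"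
  proof
    assume "nome (z / \<tau>) = 1"
    then obtain n :: int where "z / \<tau> = of_int n" by (auto simp: nome_eq_1_iff)
    then have n: "z = of_int n * \<tau>" using t0 by (simp add: field_simps)
    have "n = 0" using assms(2) small[of n "Im \<tau>"] by (simp add: period_domain_def n)
    then show False using n assms by simp
  qed
qed

text \<open>The part |a|, |b| \<le> 1/2 of the same parallelogram: a closed fundamental cell centred
  at the pole.\<close>

definition period_cell :: "complex \<Rightarrow> complex set" where
  "period_cell \<tau> = {z. \<bar>Im z\<bar> \<le> Im \<tau> / 2 \<and> \<bar>Im (z / \<tau>)\<bar> \<le> Im (- 1 / \<tau>) / 2}"

lemma period_cell_compact:
  assumes "\<tau> \<in> \<H>"
  shows "compact (period_cell \<tau>)"
proof -
  have cl: "closed (period_cell \<tau>)"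
    unfolding period_cell_def divide_inverse
    by (intro closed_Collect_conj closed_Collect_le continuous_intros)
  define u where "u = 1 / \<tau>"
  have u: "Im u < 0" using Im_neg_inverse_pos[OF assms] by (simp add: u_def)
  have "norm z \<le> (Im (- 1 / \<tau>) / 2 + Im \<tau> / 2 * \<bar>Re u\<bar>) / \<bar>Im u\<bar> + Im \<tau> / 2" if "z \<in> period_cell \<tau>" for z
  proof -
    have z: "\<bar>Im z\<bar> \<le> Im \<tau> / 2" "\<bar>Im (z / \<tau>)\<bar> \<le> Im (- 1 / \<tau>) / 2"
      using that by (auto simp: period_cell_def)
    have "z / \<tau> = z * u" by (simp add: u_def)
    \<comment> \<open>Im z and Im (z / \<tau>) determine Re z because Im u is not 0.\<close>
    then have "Re z * Im u = Im (z / \<tau>) - Im z * Re u" by simp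
    then have "\<bar>Re z\<bar> * \<bar>Im u\<bar> = \<bar>Im (z / \<tau>) - Im z * Re u\<bar>" by (metis abs_mult)
    also have "\<dots> \<le> \<bar>Im (z / \<tau>)\<bar> + \<bar>Im z\<bar> * \<bar>Re u\<bar>" by (metis abs_mult abs_triangle_ineq4)
    also have "\<dots> \<le> Im (- 1 / \<tau>) / 2 + Im \<tau> / 2 * \<bar>Re u\<bar>"
      by (intro add_mono z mult_right_mono) auto
    finally have "\<bar>Re z\<bar> \<le> (Im (- 1 / \<tau>) / 2 + Im \<tau> / 2 * \<bar>Re u\<bar>) / \<bar>Im u\<bar>"
      using u by (subst pos_le_divide_eq) auto
    then show ?thesis using z cmod_le[of z] by linarith
  qed
  then have "bounded (period_cell \<tau>)" unfolding bounded_iff by blast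
  with cl show ?thesis by (simp add: compact_eq_bounded_closed)
qed

lemma period_cell_subset: "\<tau> \<in> \<H> \<Longrightarrow> period_cell \<tau> \<subseteq> period_domain \<tau>"
  using Im_neg_inverse_pos[of \<tau>]
  by (auto simp: period_cell_def period_domain_def upper_half_plane_def)

text \<open>
  The two logarithmic derivatives have the same simple poles and, after the linear correction, the
  same periods; so their difference is an elliptic function without poles.
\<close>

lemma theta_log_deriv_inversion:
  assumes t: "\<tau> \<in> \<H>" and z: "z \<in> period_domain \<tau>" "z \<noteq> 0"
  shows "theta_log_deriv \<tau> z - theta_log_deriv (- 1 / \<tau>) (z / \<tau>) / \<tau> + 2 * of_real pi * \<i> * z / \<tau> = 0"
proof -
  let ?P = "period_domain \<tau>"
  define D where "D = (\<lambda>z. theta_log_deriv \<tau> z - theta_log_deriv (- 1 / \<tau>) (z / \<tau>) / \<tau> + 2 * of_real pi * \<i> * z / \<tau>)"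
  have t0: "\<tau> \<noteq> 0" using t by (rule uhp_nonzero)
  have i0: "Im (- 1 / \<tau>) > 0" using t by (rule Im_neg_inverse_pos)
  have P0: "0 \<in> ?P" using t i0 by (auto simp: period_domain_def upper_half_plane_def)
  have hol: "D holomorphic_on ?P - {0}"
  proof -
    have 1: "theta_log_deriv \<tau> holomorphic_on ?P - {0}"
      by (rule holomorphic_on_subset[OF theta_log_deriv_holomorphic])
         (use period_domain_nome[OF t] in \<open>auto simp: period_domain_def\<close>)
    have "theta_log_deriv (- 1 / \<tau>) \<circ> (\<lambda>z. z / \<tau>) holomorphic_on ?P - {0}"
    proof (rule holomorphic_on_compose_gen[OF _ theta_log_deriv_holomorphic])
      show "(\<lambda>z. z / \<tau>) holomorphic_on ?P - {0}" using t0 by (intro holomorphic_intros)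
    qed (use period_domain_nome[OF t] in \<open>auto simp: period_domain_def\<close>)
    with 1 show ?thesis unfolding D_def o_def using t0 by (intro holomorphic_intros) auto
  qed
  have odd: "D (- w) = - D w" if "w \<in> ?P" for w
  proof -
    have "\<bar>Im w\<bar> < Im \<tau>" "\<bar>Im (w / \<tau>)\<bar> < Im (- 1 / \<tau>)" using that by (auto simp: period_domain_def)
    then show ?thesis
      using theta_log_deriv_odd[of w \<tau>] theta_log_deriv_odd[of "w / \<tau>" "- 1 / \<tau>"]
      by (simp add: D_def)
  qed
  \<comment> \<open>For the second function, translating z by 1 is translating z / \<tau> by minus
    its quasi-period -1/\<tau>; the linear term compensates the jump.\<close>
  have per1: "D (w + 1) = D w" if "w \<in> ?P" "w + 1 \<in> ?P" for w
  proof -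
    have e: "(w + 1) / \<tau> - 1 / \<tau> = w / \<tau>" by (simp add: add_divide_distrib)
    have "theta_log_deriv (- 1 / \<tau>) ((w + 1) / \<tau> + (- 1 / \<tau>)) =
            theta_log_deriv (- 1 / \<tau>) ((w + 1) / \<tau>) - 2 * of_real pi * \<i>"
      by (rule theta_log_deriv_quasi_period) (use that e in \<open>auto simp: period_domain_def\<close>)
    then have "theta_log_deriv (- 1 / \<tau>) ((w + 1) / \<tau>) = theta_log_deriv (- 1 / \<tau>) (w / \<tau>) + 2 * of_real pi * \<i>"
      using e by simp
    then show ?thesis
      unfolding D_def theta_log_deriv_period by (simp add: add_divide_distrib ring_distribs)
  qed
  have pert: "D (w + \<tau>) = D w" if "w \<in> ?P" "w + \<tau> \<in> ?P" for w
  proof -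
    have e: "(w + \<tau>) / \<tau> = w / \<tau> + 1" using t0 by (simp add: add_divide_distrib)
    have "theta_log_deriv \<tau> (w + \<tau>) = theta_log_deriv \<tau> w - 2 * of_real pi * \<i>"
      by (rule theta_log_deriv_quasi_period) (use that in \<open>auto simp: period_domain_def\<close>)
    then show ?thesis
      unfolding D_def e theta_log_deriv_period using t0 by (simp add: add_divide_distrib ring_distribs)
  qed
  \<comment> \<open>Both functions contribute the principal part 1/z, the second one as (1 / (z /
    \<tau>)) / \<tau>, so the pole of \<open>D\<close> at 0 is removable.\<close>
  have lim: "((\<lambda>z. (z - 0) * D z) \<longlongrightarrow> 0) (at 0)"
  proof -
    let ?A = "\<lambda>z. (theta_log_deriv \<tau> z - 1 / z) / z"
    let ?B = "\<lambda>z. (theta_log_deriv (- 1 / \<tau>) z - 1 / z) / z"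
    have f: "filterlim (\<lambda>z. z / \<tau>) (at 0) (at 0)"
      using t0 by (auto simp: filterlim_at intro!: tendsto_eq_intros eventually_at_filter[THEN iffD2])
    note A = theta_log_deriv_at_0[OF t]
    note B = filterlim_compose[OF theta_log_deriv_at_0[OF uhp_neg_inverse[OF t]] f]
    have "((\<lambda>z. z\<^sup>2 * ?A z - (z / \<tau>)\<^sup>2 * ?B (z / \<tau>) + 2 * of_real pi * \<i> * z\<^sup>2 / \<tau>) \<longlongrightarrow>
       0\<^sup>2 * (- (of_real pi ^ 2 / 3) * E2 (nome \<tau>)) - (0 / \<tau>)\<^sup>2 * (- (of_real pi ^ 2 / 3) * E2 (nome (- 1 / \<tau>)))
         + 2 * of_real pi * \<i> * 0\<^sup>2 / \<tau>) (at 0)"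
      by (intro tendsto_intros A B) (use t0 in auto)
    moreover have "eventually (\<lambda>z. z\<^sup>2 * ?A z - (z / \<tau>)\<^sup>2 * ?B (z / \<tau>) + 2 * of_real pi * \<i> * z\<^sup>2 / \<tau> = (z - 0) * D z) (at 0)"
      unfolding eventually_at_filter
    proof (rule always_eventually, intro allI impI)
      fix z :: complex assume z: "z \<noteq> 0"
      have divide_nonzero: "z / \<tau> \<noteq> 0" using z t0 by simp
      have sq: "w\<^sup>2 * ((k - 1 / w) / w) = w * k - 1" if "w \<noteq> 0" for w k :: complex
        using that by (simp add: field_simps power2_eq_square)
      show "z\<^sup>2 * ?A z - (z / \<tau>)\<^sup>2 * ?B (z / \<tau>) + 2 * of_real pi * \<i> * z\<^sup>2 / \<tau> = (z - 0) * D z"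
        unfolding sq[OF z] sq[OF divide_nonzero] by (simp add: D_def power2_eq_square algebra_simps)
    qed
    ultimately show ?thesis by (simp add: tendsto_cong)
  qed
  obtain g where g: "g holomorphic_on ?P" and gD: "\<And>w. w \<in> ?P - {0} \<Longrightarrow> g w = D w"
    using holomorphic_on_extend_lim[OF hol, THEN iffD2, OF _ lim] P0 period_domain_open
    by (auto simp: interior_open)
  have contg: "continuous_on ?P g" using g by (rule holomorphic_on_imp_continuous_on)
  have "continuous_on (period_cell \<tau>) (\<lambda>w. norm (g w))"
    by (intro continuous_intros continuous_on_subset[OF contg] period_cell_subset t)
  moreover have "period_cell \<tau> \<noteq> {}"
    using P0 by (auto simp: period_cell_def period_domain_def intro!: exI[of _ 0])
  ultimately obtain p where p: "p \<in> period_cell \<tau>" and pmax: "\<And>w. w \<in> period_cell \<tau> \<Longrightarrow> norm (g w) \<le> norm (g p)"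
    using continuous_attains_sup[OF period_cell_compact[OF t]] by blast
  \<comment> \<open>The translates must avoid 0, where \<open>D\<close> and its extension
    \<open>g\<close> need not agree; the conditions on the nomes guarantee this.\<close>
  have step1: "\<exists>w'. w' \<in> ?P \<and> \<bar>Im w'\<bar> \<le> Im \<tau> / 2 \<and> w' \<noteq> 0 \<and> D w' = D w" if w: "w \<in> ?P" "w \<noteq> 0" "nome w \<noteq> 1 \<and> nome (w / \<tau>) \<noteq> 1" for w
  proof -
    have shift: "Im ((w + \<tau>) / \<tau>) = Im (w / \<tau>)" "Im ((w - \<tau>) / \<tau>) = Im (w / \<tau>)"
      using t0 by (simp_all add: add_divide_distrib diff_divide_distrib)
    consider "\<bar>Im w\<bar> \<le> Im \<tau> / 2" | "Im w > Im \<tau> / 2" | "Im w < - (Im \<tau> / 2)" by linarith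
    then show ?thesis
    proof cases
      case 1 then show ?thesis using w by blast
    next
      case 2
      have "w - \<tau> \<in> ?P" using w(1) 2 shift by (auto simp: period_domain_def)
      moreover from this have "D (w - \<tau>) = D w" using pert[of "w - \<tau>"] w by simp
      moreover have "w - \<tau> \<noteq> 0" using w t0 by auto
      moreover have "\<bar>Im (w - \<tau>)\<bar> \<le> Im \<tau> / 2" using w(1) 2 by (auto simp: period_domain_def)
      ultimately show ?thesis by blast
    next
      case 3
      have "w + \<tau> \<in> ?P" using w(1) 3 shift by (auto simp: period_domain_def)
      moreover from this have "D (w + \<tau>) = D w" using pert[of "w"] w by simp
      moreover have "w + \<tau> \<noteq> 0"
      proof
        assume "w + \<tau> = 0"
        then have "w = - \<tau>" by (simp add: eq_neg_iff_add_eq_0)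
        then have "w / \<tau> = - 1" using t0 by simp
        then show False using w by (simp add: nome_minus)
      qed
      moreover have "\<bar>Im (w + \<tau>)\<bar> \<le> Im \<tau> / 2" using w(1) 3 by (auto simp: period_domain_def)
      ultimately show ?thesis by blast
    qed
  qed
  have step2: "\<exists>w'. w' \<in> period_cell \<tau> \<and> w' \<noteq> 0 \<and> D w' = D w" if w: "w \<in> ?P" "w \<noteq> 0" "\<bar>Im w\<bar> \<le> Im \<tau> / 2" for w
  proof -
    note nw = period_domain_nome[OF t w(1,2)]
    have shift: "Im ((w + 1) / \<tau>) = Im (w / \<tau>) - Im (- 1 / \<tau>)" "Im ((w - 1) / \<tau>) = Im (w / \<tau>) + Im (- 1 / \<tau>)"
      by (simp_all add: add_divide_distrib diff_divide_distrib)
    have "w + 1 \<noteq> 0" using nw nome_of_int[of "-1"] by (auto simp: eq_neg_iff_add_eq_0[symmetric])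
    have "w - 1 \<noteq> 0" using nw by auto
    consider "\<bar>Im (w / \<tau>)\<bar> \<le> Im (- 1 / \<tau>) / 2" | "Im (w / \<tau>) > Im (- 1 / \<tau>) / 2" | "Im (w / \<tau>) < - (Im (- 1 / \<tau>) / 2)" by linarith
    then show ?thesis
    proof cases
      case 1 then show ?thesis using w by (auto simp: period_cell_def)
    next
      case 2
      have "w + 1 \<in> ?P" using w(1) 2 shift by (auto simp: period_domain_def)
      moreover from this have "D (w + 1) = D w" using per1[of w] w by simp
      moreover have "w + 1 \<in> period_cell \<tau>" using w 2 shift by (auto simp: period_cell_def period_domain_def)
      ultimately show ?thesis using \<open>w + 1 \<noteq> 0\<close> by blast
    next
      case 3
      have "w - 1 \<in> ?P" using w(1) 3 shift by (auto simp: period_domain_def)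
      moreover from this have "D (w - 1) = D w" using per1[of "w - 1"] w by simp
      moreover have "w - 1 \<in> period_cell \<tau>" using w 3 shift by (auto simp: period_cell_def period_domain_def)
      ultimately show ?thesis using \<open>w - 1 \<noteq> 0\<close> by blast
    qed
  qed
  \<comment> \<open>By periodicity all values of \<open>g\<close> occur on the compact cell, which
    lies inside the open domain, so |g| has an interior maximum.\<close>
  have gmax: "norm (g w) \<le> norm (g p)" if w: "w \<in> ?P" for w
  proof (cases "w = 0")
    case True
    then have "w \<in> period_cell \<tau>" using t i0 by (auto simp: period_cell_def upper_half_plane_def)
    then show ?thesis by (rule pmax)
  next
    case False
    obtain w' where "w' \<in> ?P" "\<bar>Im w'\<bar> \<le> Im \<tau> / 2" "w' \<noteq> 0" "D w' = D w"
      using step1[OF w False] period_domain_nome[OF t w False] by blast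
    then obtain w'' where w'': "w'' \<in> period_cell \<tau>" "w'' \<noteq> 0" "D w'' = D w"
      using step2 by metis
    then have "g w'' = g w" using gD[of w] gD[of w''] w False period_cell_subset[OF t] by auto
    then show ?thesis using pmax[OF w''(1)] by simp
  qed
  have "g constant_on ?P"
    by (rule maximum_modulus_principle[OF g period_domain_open convex_connected[OF period_domain_convex]
          period_domain_open order_refl, of p])
       (use p period_cell_subset[OF t] gmax in auto)
  then obtain c where c: "\<And>w. w \<in> ?P \<Longrightarrow> g w = c" unfolding constant_on_def by blast
  \<comment> \<open>The constant is the value of an odd function at z and at -z, hence 0.\<close>
  have "D (- z) = c" "D z = c"
    using c gD z period_domain_uminus[OF z(1)] by (metis Diff_iff singletonD neg_equal_0_iff_equal)+
  then have "c = - c" using odd[OF z(1)] by simp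
  then have "c = 0" by simp
  then show ?thesis using \<open>D z = c\<close> by (simp add: D_def)
qed

text \<open>Comparison of the linear coefficients at z = 0 in
  \<open>theta_log_deriv_inversion\<close>; the correction 2 pi i z / \<tau> becomes the non-modular
  term.\<close>

lemma E2_inversion:
  assumes t: "\<tau> \<in> \<H>"
  shows "E2 (nome (- 1 / \<tau>)) = \<tau>\<^sup>2 * E2 (nome \<tau>) + 6 * \<tau> / (of_real pi * \<i>)"
proof -
  let ?A = "\<lambda>z. (theta_log_deriv \<tau> z - 1 / z) / z"
  let ?B = "\<lambda>z. (theta_log_deriv (- 1 / \<tau>) z - 1 / z) / z"
  let ?a = "- (of_real pi ^ 2 / 3) * E2 (nome \<tau>)"
  let ?b = "- (of_real pi ^ 2 / 3) * E2 (nome (- 1 / \<tau>))"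
  have t0: "\<tau> \<noteq> 0" using t by (rule uhp_nonzero)
  have f: "filterlim (\<lambda>z. z / \<tau>) (at 0) (at 0)"
    using t0 by (auto simp: filterlim_at intro!: tendsto_eq_intros eventually_at_filter[THEN iffD2])
  note A = theta_log_deriv_at_0[OF t]
  note B = filterlim_compose[OF theta_log_deriv_at_0[OF uhp_neg_inverse[OF t]] f]
  have "((\<lambda>z. ?A z - ?B (z / \<tau>) / \<tau>\<^sup>2 + 2 * of_real pi * \<i> / \<tau>) \<longlongrightarrow> ?a - ?b / \<tau>\<^sup>2 + 2 * of_real pi * \<i> / \<tau>) (at 0)"
    by (intro tendsto_intros A B) (use t0 in auto)
  moreover have "eventually (\<lambda>z. ?A z - ?B (z / \<tau>) / \<tau>\<^sup>2 + 2 * of_real pi * \<i> / \<tau> = 0) (at 0)"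
  proof -
    have "0 \<in> period_domain \<tau>"
      using t Im_neg_inverse_pos[OF t] by (auto simp: period_domain_def upper_half_plane_def)
    then have "eventually (\<lambda>z. z \<in> period_domain \<tau> - {0}) (at 0)"
      by (intro eventually_at_in_open period_domain_open)
    then show ?thesis
    proof eventually_elim
      case (elim z)
      then have z: "z \<noteq> 0" by simp
      have e: "(k - 1 / z) / z - ((l - 1 / (z / \<tau>)) / (z / \<tau>)) / \<tau>\<^sup>2 + c / \<tau> = (k - l / \<tau> + c * z / \<tau>) / z" for k l c :: complex
        using z t0 by (simp add: field_simps power2_eq_square)
      show ?case
        unfolding e using theta_log_deriv_inversion[OF t _ z] elim by simp
    qed
  qed
  ultimately have "((\<lambda>z. 0) \<longlongrightarrow> ?a - ?b / \<tau>\<^sup>2 + 2 * of_real pi * \<i> / \<tau>) (at (0::complex))"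
    by (rule Lim_transform_eventually)
  then have e0: "?a - ?b / \<tau>\<^sup>2 + 2 * of_real pi * \<i> / \<tau> = 0"
    using tendsto_unique[OF _ _ tendsto_const] by (metis trivial_limit_at)
  define p e e' where "p = (of_real pi :: complex)" and "e = E2 (nome \<tau>)" and "e' = E2 (nome (- 1 / \<tau>))"
  have p0: "p \<noteq> 0" by (simp add: p_def)
  have "- (p\<^sup>2 / 3) * e - (- (p\<^sup>2 / 3) * e') / \<tau>\<^sup>2 + 2 * p * \<i> / \<tau> = 0"
    using e0 by (simp add: p_def e_def e'_def)
  then have "p * (p * e') = p * (p * \<tau>\<^sup>2 * e - 6 * \<i> * \<tau>)"
    using t0 by (simp add: field_simps power2_eq_square)
  then have "p * e' = p * \<tau>\<^sup>2 * e - 6 * \<i> * \<tau>" using p0 by simp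
  then have "e' = \<tau>\<^sup>2 * e - 6 * \<i> * \<tau> / p" using p0 by (simp add: field_simps)
  also have "\<dots> = \<tau>\<^sup>2 * e + 6 * \<tau> / (p * \<i>)" using p0 by (simp add: field_simps)
  finally show ?thesis by (simp add: p_def e_def e'_def)
qed

section \<open>The eta function\<close>

definition euler_prod :: "complex \<Rightarrow> complex" where
  "euler_prod q = prodinf (\<lambda>k. 1 - q ^ Suc k)"

lemma one_minus_power_nonzero: "norm (q::complex) < 1 \<Longrightarrow> 1 - q ^ Suc k \<noteq> 0"
proof
  assume q: "norm q < 1" and "1 - q ^ Suc k = 0"
  then have "q ^ Suc k = 1" by simp
  then have "norm q ^ Suc k = 1" by (metis norm_one norm_power)
  moreover have "norm q ^ Suc k < 1" using q by (simp add: power_less_one_iff del: power_Suc)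
  ultimately show False by simp
qed

lemma euler_prod_convergent:
  assumes q: "norm (q::complex) < 1"
  shows "convergent_prod (\<lambda>k. 1 - q ^ Suc k)"
proof -
  have "summable (\<lambda>k. norm q ^ Suc k)" using q by (simp add: summable_geometric summable_mult)
  then have "summable (\<lambda>k. norm (1 - q ^ Suc k - 1))" by (simp add: norm_power norm_mult)
  then show ?thesis
    by (intro abs_convergent_prod_imp_convergent_prod summable_imp_abs_convergent_prod)
qed

lemma euler_prod_LIMSEQ:
  assumes q: "norm (q::complex) < 1"
  shows "(\<lambda>n. \<Prod>k<n. 1 - q ^ Suc k) \<longlonglongrightarrow> euler_prod q"
proof -
  have "(\<lambda>n. \<Prod>k\<le>n. 1 - q ^ Suc k) \<longlonglongrightarrow> euler_prod q"
    unfolding euler_prod_def by (intro convergent_prod_LIMSEQ euler_prod_convergent q)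
  then show ?thesis
    by (subst (asm) lessThan_Suc_atMost[symmetric]) (rule LIMSEQ_imp_Suc)
qed

lemma euler_prod_nonzero: "norm q < 1 \<Longrightarrow> euler_prod q \<noteq> 0"
  unfolding euler_prod_def by (intro prodinf_nonzero euler_prod_convergent one_minus_power_nonzero)

lemma euler_prod_0 [simp]: "euler_prod 0 = 1"
  by (simp add: euler_prod_def)

lemma euler_prod_uniform_limit:
  assumes r: "r < 1"
  shows "uniform_limit (cball 0 r) (\<lambda>n q::complex. \<Prod>k<n. 1 - q ^ Suc k) euler_prod sequentially"
proof (cases "r \<ge> 0")
  case True
  have "uniformly_convergent_on (cball 0 r) (\<lambda>N q::complex. \<Sum>n<N. norm (1 - q ^ Suc n - 1))"
  proof (rule Weierstrass_m_test')
    show "summable (\<lambda>n. r ^ Suc n)" using r True by (simp add: summable_geometric summable_mult)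
    show "norm (norm (1 - q ^ Suc n - 1)) \<le> r ^ Suc n" if "q \<in> cball 0 r" for n and q :: complex
      using that power_mono[of "norm q" r "Suc n"] by (simp add: norm_power norm_mult)
  qed
  then have "uniformly_convergent_on (cball 0 r) (\<lambda>N q::complex. \<Prod>n<N. 1 - q ^ Suc n)"
    by (intro Infinite_Products.uniformly_convergent_on_prod') (auto intro!: continuous_intros)
  then obtain l where l: "uniform_limit (cball 0 r) (\<lambda>N q::complex. \<Prod>n<N. 1 - q ^ Suc n) l sequentially"
    by (auto simp: uniformly_convergent_on_def)
  have "l q = euler_prod q" if "q \<in> cball 0 r" for q
    using LIMSEQ_unique[OF tendsto_uniform_limitI[OF l that] euler_prod_LIMSEQ] that r by auto
  then have "uniform_limit (cball 0 r) (\<lambda>n q::complex. \<Prod>k<n. 1 - q ^ Suc k) l sequentially \<longleftrightarrow> ?thesis"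
    by (intro uniform_limit_cong') auto
  then show ?thesis using l by simp
qed auto

lemma euler_prod_holomorphic: "euler_prod holomorphic_on ball 0 1"
proof (rule holomorphic_uniform_sequence[where f = "\<lambda>n q. \<Prod>k<n. 1 - q ^ Suc k"])
  show "(\<lambda>q. \<Prod>k<n. 1 - q ^ Suc k) holomorphic_on ball 0 1" for n
    by (intro holomorphic_intros)
  fix x :: complex assume x: "x \<in> ball 0 1"
  define d where "d = (1 - norm x) / 2"
  have d: "0 < d" "norm x + d < 1" using x by (auto simp: d_def field_simps)
  have sub: "cball x d \<subseteq> cball 0 (norm x + d)"
    by (auto simp: dist_norm) (metis add.commute add_left_mono dual_order.trans norm_minus_commute norm_triangle_sub)
  have "uniform_limit (cball x d) (\<lambda>n q::complex. \<Prod>k<n. 1 - q ^ Suc k) euler_prod sequentially"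
    by (rule uniform_limit_on_subset[OF euler_prod_uniform_limit[OF d(2)] sub])
  moreover have "cball x d \<subseteq> ball 0 1" using sub d by fastforce
  ultimately show "\<exists>d>0. cball x d \<subseteq> ball 0 1 \<and>
      uniform_limit (cball x d) (\<lambda>n q. \<Prod>k<n. 1 - q ^ Suc k) euler_prod sequentially"
    using d by blast
qed auto

lemma euler_prod_holomorphic' [holomorphic_intros]:
  assumes "f holomorphic_on S" "\<And>z. z \<in> S \<Longrightarrow> norm (f z) < 1"
  shows "(\<lambda>z. euler_prod (f z)) holomorphic_on S"
  using holomorphic_on_compose_gen[OF assms(1) euler_prod_holomorphic] assms(2) by (auto simp: o_def image_subset_iff)

text \<open>Termwise logarithmic differentiation produces the Lambert series with numerators n q^n,
  which is E_2 up to normalisation.\<close>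

lemma euler_prod_deriv:
  assumes q: "norm q < 1"
  shows "q * deriv euler_prod q = (E2 q - 1) / 24 * euler_prod q"
proof -
  define r where "r = (1 + norm q) / 2"
  have r: "norm q < r" "r < 1" using q by (auto simp: r_def)
  have nz: "euler_prod q \<noteq> 0" using q by (rule euler_prod_nonzero)
  have "(\<lambda>k. deriv (\<lambda>q. 1 - q ^ Suc k) q / (1 - q ^ Suc k)) sums (deriv euler_prod q / euler_prod q)"
    by (rule logderiv_prodinf_complex_uniform_limit[OF uniform_limit_on_subset[OF euler_prod_uniform_limit[OF r(2)] ball_subset_cball]])
       (use r nz in \<open>auto intro!: holomorphic_intros\<close>)
  from sums_mult[OF this, of q]
  have 1: "(\<lambda>k. q * (deriv (\<lambda>q. 1 - q ^ Suc k) q / (1 - q ^ Suc k))) sums (q * (deriv euler_prod q / euler_prod q))" .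
  have "deriv (\<lambda>q. 1 - q ^ Suc k) q = - (of_nat (Suc k) * q ^ k)" for k
    by (rule DERIV_imp_deriv) (auto intro!: derivative_eq_intros simp del: power_Suc of_nat_Suc)
  then have "(\<lambda>k. q * (deriv (\<lambda>q. 1 - q ^ Suc k) q / (1 - q ^ Suc k))) =
      (\<lambda>k. - (of_nat (Suc k) * q ^ Suc k / (1 - q ^ Suc k)))"
    by (simp add: mult_ac)
  with 1 have 2: "(\<lambda>k. - (of_nat (Suc k) * q ^ Suc k / (1 - q ^ Suc k))) sums (q * (deriv euler_prod q / euler_prod q))"
    by simp
  have "E2 q = 1 - 24 * suminf (\<lambda>n. of_nat (Suc n) * q ^ Suc n / (1 - q ^ Suc n))"
    using lambert_has_sum(1)[OF q] unfolding E2_def by (simp only: sums_iff)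
  also have "suminf (\<lambda>n. of_nat (Suc n) * q ^ Suc n / (1 - q ^ Suc n)) = - (q * (deriv euler_prod q / euler_prod q))"
    using sums_unique2[OF sums_minus[OF lambert_has_sum(2)[OF q]] 2] by (metis minus_minus)
  finally show ?thesis using nz by (simp add: field_simps)
qed

text \<open>Holomorphy is inherited from the product through
  \<open>euler_prod_deriv\<close>.\<close>

lemma E2_holomorphic: "E2 holomorphic_on ball 0 1"
proof (rule holomorphic_transform)
  show "(\<lambda>q. 1 + 24 * (q * deriv euler_prod q / euler_prod q)) holomorphic_on ball 0 1"
    by (intro holomorphic_intros euler_prod_holomorphic) (auto simp: euler_prod_nonzero)
  show "1 + 24 * (q * deriv euler_prod q / euler_prod q) = E2 q" if "q \<in> ball 0 1" for q
    using that euler_prod_deriv[of q] euler_prod_nonzero[of q] by (auto simp: field_simps)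
qed

lemma E2_holomorphic' [holomorphic_intros]:
  assumes "f holomorphic_on S" "\<And>z. z \<in> S \<Longrightarrow> norm (f z) < 1"
  shows "(\<lambda>z. E2 (f z)) holomorphic_on S"
  using holomorphic_on_compose_gen[OF assms(1) E2_holomorphic] assms(2) by (auto simp: o_def image_subset_iff)

lemma E2_0 [simp]: "E2 0 = 1"
  by (simp add: E2_def)

lemma eta_eq: "eta \<tau> = nome (\<tau> / 24) * euler_prod (nome \<tau>)"
  by (simp add: eta_def euler_prod_def)

lemma eta_nonzero: "\<tau> \<in> \<H> \<Longrightarrow> eta \<tau> \<noteq> 0"
  by (simp add: eta_eq euler_prod_nonzero norm_nome_less_1)

text \<open>The factor q^(1/24) of eta supplies the constant term of E_2 that is subtracted in
  \<open>euler_prod_deriv\<close>.\<close>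

lemma eta_has_field_derivative:
  assumes t: "\<tau> \<in> \<H>"
  shows "(eta has_field_derivative 2 * of_real pi * \<i> / 24 * E2 (nome \<tau>) * eta \<tau>) (at \<tau> within S)"
proof -
  define q where "q = nome \<tau>"
  have q: "norm q < 1" using norm_nome_less_1[OF t] by (simp add: q_def)
  have "(euler_prod has_field_derivative deriv euler_prod q) (at q)"
    using holomorphic_derivI[OF euler_prod_holomorphic open_ball] q by auto
  then have 1: "((\<lambda>\<tau>. euler_prod (nome \<tau>)) has_field_derivative
      deriv euler_prod q * (2 * of_real pi * \<i> * q)) (at \<tau> within S)"
    unfolding q_def by (rule DERIV_chain2) (rule nome_has_field_derivative)
  have 2: "((\<lambda>\<tau>. nome (\<tau> / 24)) has_field_derivative (2 * of_real pi * \<i> * nome (\<tau> / 24)) * (1 / 24)) (at \<tau> within S)"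
    by (rule DERIV_chain2[where f = nome, OF nome_has_field_derivative]) (auto intro!: derivative_eq_intros)
  have "(2 * of_real pi * \<i> * nome (\<tau> / 24)) * (1 / 24) * euler_prod q +
      deriv euler_prod q * (2 * of_real pi * \<i> * q) * nome (\<tau> / 24) =
      2 * of_real pi * \<i> * nome (\<tau> / 24) * (euler_prod q / 24 + q * deriv euler_prod q)"
    by (simp add: algebra_simps)
  also have "\<dots> = 2 * of_real pi * \<i> / 24 * E2 q * (nome (\<tau> / 24) * euler_prod q)"
    unfolding euler_prod_deriv[OF q] by (simp add: field_simps)
  finally have 3: "(2 * of_real pi * \<i> * nome (\<tau> / 24)) * (1 / 24) * euler_prod q +
      deriv euler_prod q * (2 * of_real pi * \<i> * q) * nome (\<tau> / 24) =
      2 * of_real pi * \<i> / 24 * E2 q * (nome (\<tau> / 24) * euler_prod q)" .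
  have "((\<lambda>\<tau>. nome (\<tau> / 24) * euler_prod (nome \<tau>)) has_field_derivative
      2 * of_real pi * \<i> / 24 * E2 q * (nome (\<tau> / 24) * euler_prod q)) (at \<tau> within S)"
    using DERIV_mult[OF 2 1] unfolding q_def[symmetric] 3 .
  then show ?thesis by (simp add: eta_eq[abs_def] q_def)
qed

lemma csqrt_of_real_mult:
  assumes "r > 0"
  shows "csqrt (of_real r * z) = of_real (sqrt r) * csqrt z"
proof (rule csqrt_unique)
  show "(of_real (sqrt r) * csqrt z)\<^sup>2 = of_real r * z"
    using assms by (simp add: power_mult_distrib flip: of_real_power)
  show "0 < Re (of_real (sqrt r) * csqrt z) \<or> Re (of_real (sqrt r) * csqrt z) = 0 \<and> 0 \<le> Im (of_real (sqrt r) * csqrt z)"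
    using csqrt_principal[of z] assms by (auto simp del: csqrt.simps)
qed

text \<open>The quotient of both sides has derivative 0: the non-modular term of
  \<open>E2_inversion\<close> is exactly the logarithmic derivative of the square root. The constant
  is found at \<tau> = i, which the inversion fixes.\<close>

lemma eta_inversion:
  assumes t: "\<tau> \<in> \<H>"
  shows "eta (- 1 / \<tau>) = csqrt (- \<i> * \<tau>) * eta \<tau>"
proof -
  define f where "f = (\<lambda>\<tau>. eta (- 1 / \<tau>) / (csqrt (- \<i> * \<tau>) * eta \<tau>))"
  have "\<exists>c. \<forall>x\<in>\<H>. f x = c"
  proof (rule has_field_derivative_zero_constant)
    show "convex \<H>" unfolding upper_half_plane_def by (rule convex_halfspace_Im_gt)
    fix x assume x: "x \<in> \<H>"
    have x0: "x \<noteq> 0" using x by (rule uhp_nonzero)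
    define s where "s = csqrt (- \<i> * x)"
    have s0: "s \<noteq> 0" using x0 by (simp add: s_def)
    have s2: "s * s = - \<i> * x" unfolding s_def by (metis power2_csqrt power2_eq_square)
    have 1: "((\<lambda>x. eta (- 1 / x)) has_field_derivative
        (2 * of_real pi * \<i> / 24 * E2 (nome (- 1 / x)) * eta (- 1 / x)) * (1 / x\<^sup>2)) (at x within \<H>)"
      by (rule DERIV_chain2[where f = eta and g = "\<lambda>x. - 1 / x" and x = x, OF eta_has_field_derivative[OF uhp_neg_inverse[OF x]]])
         (use x0 in \<open>auto intro!: derivative_eq_intros simp: power2_eq_square\<close>)
    \<comment> \<open>Multiplication by -i carries the upper half-plane to the right one, away from
      the branch cut.\<close>
    have "- \<i> * x \<notin> \<real>\<^sub>\<le>\<^sub>0" using x by (auto simp: complex_nonpos_Reals_iff upper_half_plane_def)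
    then have 2: "((\<lambda>x. csqrt (- \<i> * x)) has_field_derivative (- \<i> / (2 * s))) (at x within \<H>)"
      unfolding s_def by (auto intro!: derivative_eq_intros)
    have "- \<i> / (2 * s) = s / (2 * x)" using s0 x0 s2 by (simp add: field_simps)
    with 2 have 2: "((\<lambda>x. csqrt (- \<i> * x)) has_field_derivative s / (2 * x)) (at x within \<H>)" by simp
    note 3 = eta_has_field_derivative[OF x, of \<H>]
    note nz = eta_nonzero[OF x]
    define e e' E p where "e = eta x" and "e' = eta (- 1 / x)" and "E = E2 (nome x)" and "p = (of_real pi :: complex)"
    have p0: "p \<noteq> 0" by (simp add: p_def)
    have "(f has_field_derivative
       ((2 * p * \<i> / 24 * (x\<^sup>2 * E + 6 * x / (p * \<i>)) * e') * (1 / x\<^sup>2) * (s * e) -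
         e' * (s / (2 * x) * e + (2 * p * \<i> / 24 * E * e) * s)) / ((s * e) * (s * e))) (at x within \<H>)"
      using DERIV_divide[OF 1 DERIV_mult[OF 2 3]] nz s0
      unfolding E2_inversion[OF x] f_def e_def e'_def E_def p_def s_def by (simp add: mult.commute)
    moreover have "(2 * p * \<i> / 24 * (x\<^sup>2 * E + 6 * x / (p * \<i>)) * e') * (1 / x\<^sup>2) * (s * e) -
         e' * (s / (2 * x) * e + (2 * p * \<i> / 24 * E * e) * s) = 0"
    proof -
      have "2 * p * \<i> / 24 * (x\<^sup>2 * E + 6 * x / (p * \<i>)) * (1 / x\<^sup>2) = 2 * p * \<i> / 24 * E + 1 / (2 * x)"
        using x0 p0 by (simp add: field_simps power2_eq_square)
      moreover have "a * e' * b * (s * e) = (a * b) * e' * (s * e)" for a b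
        by (simp only: mult_ac)
      ultimately have "(2 * p * \<i> / 24 * (x\<^sup>2 * E + 6 * x / (p * \<i>)) * e') * (1 / x\<^sup>2) * (s * e) =
          (2 * p * \<i> / 24 * E + 1 / (2 * x)) * e' * (s * e)"
        by (simp only:)
      then show ?thesis by (simp add: algebra_simps)
    qed
    ultimately show "(f has_field_derivative 0) (at x within \<H>)" by simp
  qed
  then obtain c where c: "\<And>x. x \<in> \<H> \<Longrightarrow> f x = c" by blast
  have i: "\<i> \<in> \<H>" by (simp add: upper_half_plane_def)
  have "f \<i> = 1" using eta_nonzero[OF i] by (simp add: f_def)
  then have "f \<tau> = 1" using c i t by metis
  then show ?thesis
    using eta_nonzero[OF t] uhp_nonzero[OF t] by (simp add: f_def field_simps)
qed

section \<open>Jacobi's identity\<close>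

text \<open>Gaussian binomial coefficients, defined by the q-Pascal rule so that no division occurs;
  \<open>qbinomial_qfact\<close> recovers the quotient of q-factorials.\<close>

primrec qbinomial :: "complex \<Rightarrow> nat \<Rightarrow> nat \<Rightarrow> complex" where
  "qbinomial q 0 j = (if j = 0 then 1 else 0)"
| "qbinomial q (Suc m) j = (case j of 0 \<Rightarrow> 1 | Suc i \<Rightarrow> qbinomial q m (Suc i) + q ^ (m - i) * qbinomial q m i)"

abbreviation qfact :: "complex \<Rightarrow> nat \<Rightarrow> complex" where
  "qfact q n \<equiv> (\<Prod>k<n. 1 - q ^ Suc k)"

lemma qbinomial_0 [simp]: "qbinomial q m 0 = 1"
  by (cases m) auto

lemma qbinomial_eq_0: "m < j \<Longrightarrow> qbinomial q m j = 0"
  by (induction m arbitrary: j) (auto split: nat.split)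

text \<open>In the q-Pascal rule the two summands become multiples of \<open>qfact q m\<close> by 1
  - q^(m-i) and q^(m-i) (1 - q^(i+1)), which add up to 1 - q^(m+1).\<close>

lemma qbinomial_qfact: "j \<le> m \<Longrightarrow> qbinomial q m j * (qfact q j * qfact q (m - j)) = qfact q m"
proof (induction m arbitrary: j)
  case (Suc m)
  show ?case
  proof (cases j)
    case (Suc i)
    then have i: "i \<le> m" using Suc.prems by simp
    note IH = Suc.IH
    have 1: "qbinomial q m (Suc i) * (qfact q (Suc i) * qfact q (m - i)) = (1 - q ^ (m - i)) * qfact q m"
    proof (cases "i < m")
      case True
      then have "m - i = Suc (m - Suc i)" by simp
      then have "qfact q (m - i) = qfact q (m - Suc i) * (1 - q ^ (m - i))" by simp
      then have "qbinomial q m (Suc i) * (qfact q (Suc i) * qfact q (m - i)) =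
          (qbinomial q m (Suc i) * (qfact q (Suc i) * qfact q (m - Suc i))) * (1 - q ^ (m - i))"
        by (simp only: mult.assoc)
      also have "qbinomial q m (Suc i) * (qfact q (Suc i) * qfact q (m - Suc i)) = qfact q m"
        using True by (intro IH) simp
      finally show ?thesis by (simp only: mult.commute)
    next
      case False
      then show ?thesis using i by (simp add: qbinomial_eq_0)
    qed
    have 2: "qbinomial q m i * (qfact q (Suc i) * qfact q (m - i)) = (1 - q ^ Suc i) * qfact q m"
      unfolding IH[OF i, symmetric] by (simp add: mult_ac)
    have "q ^ (m - i) * q ^ Suc i = q ^ Suc m" using i by (simp flip: power_add)
    then have "(1 - q ^ (m - i)) + q ^ (m - i) * (1 - q ^ Suc i) = 1 - q ^ Suc m"
      by (simp only: right_diff_distrib mult_1_right) simp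
    moreover have "qbinomial q (Suc m) j * (qfact q j * qfact q (Suc m - j)) =
       qbinomial q m (Suc i) * (qfact q (Suc i) * qfact q (m - i)) +
       q ^ (m - i) * (qbinomial q m i * (qfact q (Suc i) * qfact q (m - i)))"
      using Suc by (simp add: algebra_simps del: prod.lessThan_Suc)
    ultimately show ?thesis
      unfolding 1 2 by (simp only: mult.assoc[symmetric] distrib_right[symmetric] prod.lessThan_Suc) (simp only: mult.commute)
  qed simp
qed simp

text \<open>The new factor 1 + x q^m is absorbed by the q-Pascal rule, because (i + 1 choose 2) + (m
  - i) = m + (i choose 2).\<close>

lemma qbinomial_theorem:
  "(\<Prod>k<m. 1 + x * q ^ k) = (\<Sum>j\<le>m. q ^ (j choose 2) * qbinomial q m j * x ^ j)"
proof (induction m)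
  case (Suc m)
  have ch: "Suc i choose 2 = (i choose 2) + i" for i by (simp add: numeral_2_eq_2)
  let ?c = "\<lambda>m j. q ^ (j choose 2) * qbinomial q m j * x ^ j"
  have "(\<Sum>j\<le>Suc m. ?c (Suc m) j) = 1 + (\<Sum>i\<le>m. ?c (Suc m) (Suc i))"
    by (subst sum.atMost_Suc_shift) (simp add: numeral_2_eq_2)
  also have "(\<Sum>i\<le>m. ?c (Suc m) (Suc i)) = (\<Sum>i\<le>m. ?c m (Suc i)) + (\<Sum>i\<le>m. x * q ^ m * ?c m i)"
    unfolding sum.distrib[symmetric]
  proof (rule sum.cong)
    fix i assume "i \<in> {..m}"
    then have e: "q ^ (Suc i choose 2) * q ^ (m - i) = q ^ m * q ^ (i choose 2)"
      by (simp add: ch add.commute flip: power_add)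
    have "?c (Suc m) (Suc i) = ?c m (Suc i) + (q ^ (Suc i choose 2) * q ^ (m - i)) * (qbinomial q m i * x ^ Suc i)"
      by (simp add: algebra_simps)
    then show "?c (Suc m) (Suc i) = ?c m (Suc i) + x * q ^ m * ?c m i"
      unfolding e by (simp add: mult_ac)
  qed simp
  also have "1 + ((\<Sum>i\<le>m. ?c m (Suc i)) + (\<Sum>i\<le>m. x * q ^ m * ?c m i)) =
      (\<Sum>j\<le>Suc m. ?c m j) + x * q ^ m * (\<Sum>i\<le>m. ?c m i)"
    by (subst sum.atMost_Suc_shift) (simp add: sum_distrib_left numeral_2_eq_2)
  also have "(\<Sum>j\<le>Suc m. ?c m j) = (\<Sum>j\<le>m. ?c m j)"
    by (simp add: qbinomial_eq_0)
  finally show ?case using Suc.IH by (simp add: algebra_simps)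
qed (simp add: numeral_2_eq_2)

text \<open>
  Differentiating the q-binomial theorem for an odd exponent at the middle root, and folding the
  sum about its middle, gives a finite form of Jacobi's identity.
\<close>

lemma choose_2_middle:
  "(Suc n choose 2) + (n + 1 + i choose 2) = n * (n + 1 + i) + (Suc i choose 2)"
  "i \<le> n \<Longrightarrow> (Suc n choose 2) + (n - i choose 2) = n * (n - i) + (Suc i choose 2)"
proof -
  have c: "2 * int (k choose 2) = int k * (int k - 1)" for k
    by (induction k) (auto simp: numeral_2_eq_2 algebra_simps)
  have "2 * int ((Suc n choose 2) + (n + 1 + i choose 2)) = 2 * int (n * (n + 1 + i) + (Suc i choose 2))"
    unfolding of_nat_add distrib_left c by (simp add: algebra_simps)
  then show "(Suc n choose 2) + (n + 1 + i choose 2) = n * (n + 1 + i) + (Suc i choose 2)"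
    by (simp only: mult_cancel_left of_nat_eq_iff numeral_neq_zero simp_thms)
  assume "i \<le> n"
  then have "2 * int ((Suc n choose 2) + (n - i choose 2)) = 2 * int (n * (n - i) + (Suc i choose 2))"
    unfolding of_nat_add distrib_left c by (simp add: of_nat_diff algebra_simps)
  then show "(Suc n choose 2) + (n - i choose 2) = n * (n - i) + (Suc i choose 2)"
    by (simp only: mult_cancel_left of_nat_eq_iff numeral_neq_zero simp_thms)
qed

lemma finite_jacobi_identity:
  assumes q0: "q \<noteq> 0" and q: "norm q < 1"
  shows "(qfact q n)\<^sup>2 = (\<Sum>i\<le>n. (-1) ^ i * of_nat (2 * i + 1) * q ^ (Suc i choose 2) * qbinomial q (2 * n + 1) (n - i))"
proof -
  define w where "w = q ^ n"
  have w0: "w \<noteq> 0" using q0 by (simp add: w_def)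
  \<comment> \<open>The zero of the middle factor k = n among the 2n + 1 factors.\<close>
  define x0 where "x0 = - 1 / w"
  let ?m = "2 * n + 1"
  let ?b = "qbinomial q ?m"
  let ?f = "\<lambda>x. \<Prod>k<?m. 1 + x * q ^ k"
  define g where "g = (\<lambda>x. \<Prod>k\<in>{..<?m} - {n}. 1 + x * q ^ k)"
  have fg: "?f = (\<lambda>x. (1 + x * w) * g x)"
    unfolding g_def w_def by (subst prod.remove[of _ n]) auto
  have g': "(g has_field_derivative deriv g x0) (at x0)"
  proof -
    have "g holomorphic_on UNIV" unfolding g_def by (intro holomorphic_intros)
    then show ?thesis using holomorphic_derivI by blast
  qed
  \<comment> \<open>At the zero of the middle factor the product rule leaves only the derivative of
    that factor times the other factors.\<close>
  have 1: "(?f has_field_derivative w * g x0) (at x0)"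
  proof -
    have "((\<lambda>x. 1 + x * w) has_field_derivative w) (at x0)" by (auto intro!: derivative_eq_intros)
    from DERIV_mult[OF this g'] show ?thesis unfolding fg using w0 by (simp add: x0_def)
  qed
  have "((\<lambda>x. \<Sum>j\<le>?m. q ^ (j choose 2) * ?b j * x ^ j) has_field_derivative
      (\<Sum>j\<le>?m. q ^ (j choose 2) * ?b j * (of_nat j * x0 ^ (j - 1)))) (at x0)"
    by (auto intro!: derivative_eq_intros sum.cong simp del: sum.atMost_Suc qbinomial.simps)
  then have "w * g x0 = (\<Sum>j\<le>?m. q ^ (j choose 2) * ?b j * (of_nat j * x0 ^ (j - 1)))"
    using DERIV_unique[OF 1] unfolding qbinomial_theorem by blast
  then have "x0 * (w * g x0) = (\<Sum>j\<le>?m. q ^ (j choose 2) * ?b j * (of_nat j * x0 ^ j))"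
    by (simp add: sum_distrib_left mult_ac power_eq_if[of x0] del: sum.atMost_Suc)
      (intro sum.cong, auto simp: power_eq_if)
  moreover have "x0 * (w * g x0) = - g x0"
    using w0 by (simp add: x0_def)
  ultimately have 2: "g x0 = - (\<Sum>j\<le>?m. q ^ (j choose 2) * ?b j * (of_nat j * x0 ^ j))"
    by (metis minus_minus)
  \<comment> \<open>The factors above the middle are 1 - q^(i+1); those below have negative powers
    of q, which q^(1 + ... + n) clears at the price of n signs.\<close>
  have 3: "q ^ (Suc n choose 2) * g x0 = (- 1) ^ n * (qfact q n)\<^sup>2"
  proof -
    have S: "{..<?m} - {n} = {..<n} \<union> (\<lambda>i. n + 1 + i) ` {..<n}"
    proof -
      have "k \<in> (\<lambda>i. n + 1 + i) ` {..<n}" if "n < k" "k < ?m" for k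
        using that by (intro image_eqI[of _ _ "k - n - 1"]) auto
      then have "(\<lambda>i. n + 1 + i) ` {..<n} = {n<..<?m}" by auto
      moreover have "{..<?m} - {n} = {..<n} \<union> {n<..<?m}" by auto
      ultimately show ?thesis by simp
    qed
    have "g x0 = (\<Prod>k<n. 1 + x0 * q ^ k) * (\<Prod>i<n. 1 + x0 * q ^ (n + 1 + i))"
      unfolding g_def S by (subst prod.union_disjoint) (auto simp: prod.reindex inj_on_def)
    moreover have "1 + x0 * q ^ (n + 1 + i) = 1 - q ^ Suc i" for i
      using w0 by (simp add: x0_def power_add w_def[symmetric])
    moreover have "q ^ (Suc n choose 2) * (\<Prod>k<n. 1 + x0 * q ^ k) = (-1) ^ n * qfact q n"
    proof -
      have "(Suc n choose 2) = (\<Sum>k<n. Suc k)"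
        by (induction n) (auto simp: numeral_2_eq_2)
      then have "q ^ (Suc n choose 2) = (\<Prod>k<n. q ^ Suc k)" by (simp only: power_sum)
      moreover have "(\<Prod>k<n. 1 + x0 * q ^ k) = (\<Prod>k<n. 1 + x0 * q ^ (n - Suc k))"
        by (rule prod.nat_diff_reindex[symmetric])
      moreover have "(\<Prod>k<n. q ^ Suc k) * (\<Prod>k<n. 1 + x0 * q ^ (n - Suc k)) = (\<Prod>k<n. - (1 - q ^ Suc k))"
        unfolding prod.distrib[symmetric]
      proof (rule prod.cong)
        fix k assume "k \<in> {..<n}"
        then have "w = q ^ Suc k * q ^ (n - Suc k)" unfolding w_def by (simp flip: power_add power_Suc)
        then have "q ^ Suc k * (x0 * q ^ (n - Suc k)) = -1"
          using w0 by (simp add: x0_def field_simps)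
        then show "q ^ Suc k * (1 + x0 * q ^ (n - Suc k)) = - (1 - q ^ Suc k)"
          by (simp only: distrib_left) simp
      qed simp
      ultimately have "q ^ (Suc n choose 2) * (\<Prod>k<n. 1 + x0 * q ^ k) = (\<Prod>k<n. - (1 - q ^ Suc k))"
        by (simp only:)
      then show ?thesis by (simp only: prod_uminus card_lessThan)
    qed
    ultimately show ?thesis by (simp add: power2_eq_square mult.assoc[symmetric])
  qed
  define t where "t = (\<lambda>j. q ^ (j choose 2) * ?b j * (of_nat j * x0 ^ j))"
  \<comment> \<open>Folding: j = n - i and j = n + 1 + i carry the same Gaussian coefficient and the
    same power of q, with opposite signs, so their weights n - i and n + 1 + i combine to 2i +
    1.\<close>
  have S: "{..?m} = (\<lambda>i. n - i) ` {..n} \<union> (\<lambda>i. n + 1 + i) ` {..n}"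
  proof -
    have "k \<in> (\<lambda>i. n + 1 + i) ` {..n}" if "\<not> k \<le> n" "k \<le> ?m" for k
      using that by (intro image_eqI[of _ _ "k - n - 1"]) auto
    then have "(\<lambda>i. n + 1 + i) ` {..n} = {n<..?m}" by auto
    moreover have "k \<in> (\<lambda>i. n - i) ` {..n}" if "k \<le> n" for k
      using that by (intro image_eqI[of _ _ "n - k"]) auto
    then have "(\<lambda>i. n - i) ` {..n} = {..n}" by auto
    moreover have "{..?m} = {..n} \<union> {n<..?m}" by auto
    ultimately show ?thesis by simp
  qed
  have sym: "?b (n + 1 + i) = ?b (n - i)" if "i \<le> n" for i
  proof -
    have a: "?b (n + 1 + i) * (qfact q (n + 1 + i) * qfact q (n - i)) = qfact q ?m"
      using qbinomial_qfact[of "n + 1 + i" ?m q] that by (simp del: prod.lessThan_Suc)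
    have "?m - (n - i) = n + 1 + i" using that by simp
    then have b: "?b (n - i) * (qfact q (n + 1 + i) * qfact q (n - i)) = qfact q ?m"
      using qbinomial_qfact[of "n - i" ?m q] that by (simp del: prod.lessThan_Suc add: mult_ac)
    have "qfact q k \<noteq> 0" for k using one_minus_power_nonzero[OF q] by (simp del: power_Suc)
    then show ?thesis using a b by (metis mult_cancel_right mult_eq_0_iff)
  qed
  have x0j: "q ^ (Suc n choose 2) * (q ^ (j choose 2) * x0 ^ j) = (-1) ^ j * q ^ (Suc i choose 2)"
    if "(Suc n choose 2) + (j choose 2) = n * j + (Suc i choose 2)" for i j
  proof -
    have "q ^ (Suc n choose 2) * q ^ (j choose 2) = w ^ j * q ^ (Suc i choose 2)"
      unfolding w_def power_mult[symmetric] power_add[symmetric] that ..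
    moreover have "w ^ j * x0 ^ j = (-1) ^ j"
      unfolding power_mult_distrib[symmetric] using w0 by (simp add: x0_def)
    ultimately show ?thesis by (metis (no_types, lifting) mult.assoc mult.commute)
  qed
  have "q ^ (Suc n choose 2) * (\<Sum>j\<le>?m. t j) = (\<Sum>i\<le>n. q ^ (Suc n choose 2) * t (n - i) + q ^ (Suc n choose 2) * t (n + 1 + i))"
  proof -
    have "sum f ((\<lambda>i. n - i) ` {..n}) = (\<Sum>i\<le>n. f (n - i))"
      "sum f ((\<lambda>i. n + 1 + i) ` {..n}) = (\<Sum>i\<le>n. f (n + 1 + i))" for f :: "nat \<Rightarrow> complex"
      by (subst sum.reindex; auto simp: inj_on_def)+
    moreover have "sum t {..?m} = sum t ((\<lambda>i. n - i) ` {..n}) + sum t ((\<lambda>i. n + 1 + i) ` {..n})"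
      unfolding S by (rule sum.union_disjoint) auto
    ultimately show ?thesis by (simp only: sum.distrib sum_distrib_left distrib_left)
  qed
  also have "\<dots> = (\<Sum>i\<le>n. - ((-1) ^ n * ((-1) ^ i * of_nat (2 * i + 1) * q ^ (Suc i choose 2) * ?b (n - i))))"
  proof (rule sum.cong)
    fix i assume "i \<in> {..n}"
    then have i: "i \<le> n" by simp
    have "q ^ (Suc n choose 2) * t (n - i) = (q ^ (Suc n choose 2) * (q ^ (n - i choose 2) * x0 ^ (n - i))) * ?b (n - i) * of_nat (n - i)"
      by (simp add: t_def mult_ac)
    also have "\<dots> = (-1) ^ (n - i) * q ^ (Suc i choose 2) * ?b (n - i) * of_nat (n - i)"
      by (subst x0j[OF choose_2_middle(2)[OF i]]) simp
    also have "(-1::complex) ^ (n - i) = (-1) ^ n * (-1) ^ i"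
      using i by (metis minus_one_power_iff even_diff_nat even_add mult_minus1 mult_minus1_right mult_1 minus_minus leD)
    finally have A: "q ^ (Suc n choose 2) * t (n - i) = (-1) ^ n * (-1) ^ i * q ^ (Suc i choose 2) * ?b (n - i) * (of_nat n - of_nat i)"
      using i by (simp add: of_nat_diff)
    have "q ^ (Suc n choose 2) * t (n + 1 + i) = (q ^ (Suc n choose 2) * (q ^ (n + 1 + i choose 2) * x0 ^ (n + 1 + i))) * ?b (n + 1 + i) * of_nat (n + 1 + i)"
      by (simp add: t_def mult_ac)
    also have "\<dots> = (-1) ^ (n + 1 + i) * q ^ (Suc i choose 2) * ?b (n - i) * of_nat (n + 1 + i)"
      by (subst x0j[OF choose_2_middle(1)]) (simp only: sym[OF i])
    finally have B: "q ^ (Suc n choose 2) * t (n + 1 + i) = - ((-1) ^ n * (-1) ^ i) * q ^ (Suc i choose 2) * ?b (n - i) * (of_nat n + 1 + of_nat i)"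
      by (simp add: power_add)
    show "q ^ (Suc n choose 2) * t (n - i) + q ^ (Suc n choose 2) * t (n + 1 + i) =
        - ((-1) ^ n * ((-1) ^ i * of_nat (2 * i + 1) * q ^ (Suc i choose 2) * ?b (n - i)))"
      unfolding A B by (simp add: algebra_simps)
  qed simp
  also have "\<dots> = - ((-1) ^ n * (\<Sum>i\<le>n. (-1) ^ i * of_nat (2 * i + 1) * q ^ (Suc i choose 2) * ?b (n - i)))"
    by (simp only: sum_negf sum_distrib_left)
  finally have F: "q ^ (Suc n choose 2) * (\<Sum>j\<le>?m. t j) =
      - ((-1) ^ n * (\<Sum>i\<le>n. (-1) ^ i * of_nat (2 * i + 1) * q ^ (Suc i choose 2) * ?b (n - i)))" .
  have "(-1) ^ n * (qfact q n)\<^sup>2 = - (q ^ (Suc n choose 2) * (\<Sum>j\<le>?m. t j))"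
    unfolding 3[symmetric] 2 t_def by (rule mult_minus_right)
  also have "\<dots> = (-1) ^ n * (\<Sum>i\<le>n. (-1) ^ i * of_nat (2 * i + 1) * q ^ (Suc i choose 2) * ?b (n - i))"
    unfolding F by (rule minus_minus)
  finally show ?thesis by (simp only: mult_cancel_left power_eq_0_iff neg_equal_0_iff_equal one_neq_zero simp_thms)
qed

text \<open>As n grows, every Gaussian coefficient in \<open>finite_jacobi_identity\<close> tends to
  1 / \<open>euler_prod q\<close>, so the limit is the square of the product times this factor on
  the other side. Tannery's theorem permits the termwise limit; q = 0 is separate because the finite
  identity inverts q.\<close>

lemma jacobi_identity:
  assumes q: "norm q < 1"
  shows "(\<lambda>i. (-1) ^ i * of_nat (2 * i + 1) * q ^ (Suc i choose 2)) sums (euler_prod q ^ 3)"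
proof (cases "q = 0")
  case True
  have "(\<lambda>i. (-1) ^ i * of_nat (2 * i + 1) * q ^ (Suc i choose 2)) = (\<lambda>i. if i = 0 then 1 else 0)"
    using True by (auto simp: numeral_2_eq_2 power_0_left)
  then show ?thesis using True sums_single[of 0 "\<lambda>_. 1::complex"] by simp
next
  case q0: False
  let ?c = "\<lambda>i. (-1) ^ i * of_nat (2 * i + 1) * q ^ (Suc i choose 2)"
  let ?P = "euler_prod q"
  have P0: "?P \<noteq> 0" using q by (rule euler_prod_nonzero)
  note lim = euler_prod_LIMSEQ[OF q]
  have nz: "qfact q k \<noteq> 0" for k using one_minus_power_nonzero[OF q] by (simp del: power_Suc)
  obtain K where K: "\<And>k. norm (qfact q k) \<le> K"
    using convergent_imp_Bseq[OF convergentI[OF lim]] by (auto simp: Bseq_def)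
  have "(\<lambda>n. inverse (qfact q n)) \<longlonglongrightarrow> inverse ?P" by (intro tendsto_inverse lim P0)
  from convergent_imp_Bseq[OF convergentI[OF this]]
  obtain L where L: "\<And>k. norm (inverse (qfact q k)) \<le> L"
    unfolding Bseq_def by blast
  have L0: "L \<ge> 0" using order_trans[OF norm_ge_zero L] .
  have qb: "qbinomial q (2 * n + 1) (n - i) = qfact q (2 * n + 1) * inverse (qfact q (n - i)) * inverse (qfact q (n + 1 + i))"
    if "i \<le> n" for n i
  proof -
    have "2 * n + 1 - (n - i) = n + 1 + i" using that by simp
    then show ?thesis
      using qbinomial_qfact[of "n - i" "2 * n + 1" q] nz[of "n - i"] nz[of "n + 1 + i"] that
      by (simp add: field_simps del: prod.lessThan_Suc)
  qed
  \<comment> \<open>Terms beyond n are set to 0, so that the finite sums become series over a common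
    index set.\<close>
  define a where "a = (\<lambda>i n. if i \<le> n then ?c i * qbinomial q (2 * n + 1) (n - i) else 0)"
  \<comment> \<open>\<open>K\<close> bounds the finite products and \<open>L\<close> their inverses;
    the triangular exponent is at least i, so |q|^i majorises the power of q.\<close>
  define M where "M = (\<lambda>i. real (2 * i + 1) * norm q ^ i * (K * L * L))"
  have "(\<lambda>n. suminf (\<lambda>i. a i n)) \<longlonglongrightarrow> suminf (\<lambda>i. ?c i * inverse ?P)"
    and sm: "summable (\<lambda>i. norm (?c i * inverse ?P))"
  proof -
    have "eventually (\<lambda>n. summable (\<lambda>k. norm (a k n))) sequentially \<and>
           summable (\<lambda>i. norm (?c i * inverse ?P)) \<and> (\<lambda>n. suminf (\<lambda>i. a i n)) \<longlonglongrightarrow> suminf (\<lambda>i. ?c i * inverse ?P)"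
    proof (rule tannerys_theorem)
      fix i
      have "(\<lambda>n. ?c i * (qfact q (2 * n + 1) * inverse (qfact q (n - i)) * inverse (qfact q (n + 1 + i)))) \<longlonglongrightarrow>
          ?c i * (?P * inverse ?P * inverse ?P)"
      proof (intro tendsto_intros P0)
        show "(\<lambda>n. qfact q (2 * n + 1)) \<longlonglongrightarrow> ?P"
          by (rule filterlim_compose[OF lim]) (rule filterlim_subseq, simp add: strict_mono_def)
        show "(\<lambda>n. qfact q (n - i)) \<longlonglongrightarrow> ?P"
          by (rule filterlim_compose[OF lim]) (rule filterlim_minus_const_nat_at_top)
        show "(\<lambda>n. qfact q (n + 1 + i)) \<longlonglongrightarrow> ?P"
          by (rule filterlim_compose[OF lim]) (rule filterlim_subseq, simp add: strict_mono_def)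
      qed
      moreover have "eventually (\<lambda>n. ?c i * (qfact q (2 * n + 1) * inverse (qfact q (n - i)) * inverse (qfact q (n + 1 + i))) = a i n) sequentially"
        using eventually_ge_at_top[of i] by eventually_elim (simp only: a_def qb if_True)
      ultimately have "(\<lambda>n. a i n) \<longlonglongrightarrow> ?c i * (?P * inverse ?P * inverse ?P)"
        by (rule Lim_transform_eventually)
      then show "(\<lambda>n. a i n) \<longlonglongrightarrow> ?c i * inverse ?P"
        by (simp only: right_inverse[OF P0] mult_1_left)
    next
      have "norm (a i n) \<le> M i" for i n
      proof (cases "i \<le> n")
        case True
        have c1: "norm (?c i) \<le> real (2 * i + 1) * norm q ^ i"
        proof -
          have "norm q ^ (Suc i choose 2) \<le> norm q ^ i"
            by (rule power_decreasing) (use q in \<open>auto simp: numeral_2_eq_2\<close>)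
          then show ?thesis
            by (simp only: norm_mult norm_power norm_minus_cancel norm_one power_one mult_1 norm_of_nat) (simp add: mult_left_mono)
        qed
        have "norm (qbinomial q (2 * n + 1) (n - i)) \<le> K * L * L"
          unfolding qb[OF True] norm_mult
          by (intro mult_mono K L mult_nonneg_nonneg norm_ge_zero order_trans[OF norm_ge_zero K] L0)
        then show ?thesis
          unfolding a_def M_def using True c1 by (simp only: if_True norm_mult[of "?c i"]) (intro mult_mono, auto)
      next
        case False
        have "K \<ge> 0" using order_trans[OF norm_ge_zero K] .
        then show ?thesis using False L0 by (simp add: a_def M_def)
      qed
      then show "eventually (\<lambda>(i, n). norm (a i n) \<le> M i) (sequentially \<times>\<^sub>F sequentially)"
        by (intro always_eventually) auto
      have "summable (\<lambda>i. 2 * (of_nat (Suc i) * norm q ^ i) + - (norm q ^ i))"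
        using geometric_deriv_sums[of "norm q"] q
        by (intro summable_add summable_mult summable_minus) (auto simp: sums_iff summable_geometric simp del: of_nat_Suc)
      moreover have "2 * (of_nat (Suc i) * norm q ^ i) + - (norm q ^ i) = real (2 * i + 1) * norm q ^ i" for i
        by (simp add: algebra_simps)
      ultimately show "summable M" unfolding M_def by (intro summable_mult2) simp
    qed simp
    then show "(\<lambda>n. suminf (\<lambda>i. a i n)) \<longlonglongrightarrow> suminf (\<lambda>i. ?c i * inverse ?P)"
      "summable (\<lambda>i. norm (?c i * inverse ?P))" by auto
  qed
  moreover have "suminf (\<lambda>i. a i n) = (qfact q n)\<^sup>2" for n
  proof -
    have "suminf (\<lambda>i. a i n) = (\<Sum>i\<le>n. a i n)"
      by (rule suminf_finite) (auto simp: a_def)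
    then show ?thesis unfolding finite_jacobi_identity[OF q0 q] by (simp add: a_def)
  qed
  moreover have "(\<lambda>n. (qfact q n)\<^sup>2) \<longlonglongrightarrow> ?P\<^sup>2" by (intro tendsto_power lim)
  ultimately have "suminf (\<lambda>i. ?c i * inverse ?P) = ?P\<^sup>2"
    using LIMSEQ_unique by fastforce
  then have "(\<lambda>i. ?c i * inverse ?P) sums (?P\<^sup>2)"
    using summable_norm_cancel[OF sm] by (simp only: sums_iff)
  from sums_mult2[OF this, of ?P] show ?thesis
    using P0 by (simp add: mult.assoc power2_eq_square power3_eq_cube)
qed

text \<open>
  The terms of Jacobi's series for \<open>euler_prod z ^ 3\<close> with index \<open>i \<equiv> 1 (mod 3)\<close> sum up to
  \<open>- 3 z euler_prod (z ^ 9) ^ 3\<close>, and the exponents of all other terms are multiples of 3.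
\<close>

lemma euler_prod_cube_dissection:
  assumes z: "norm z < 1" and w: "w ^ 3 = 1"
  shows "euler_prod (w * z) ^ 3 + 3 * (w * z) * euler_prod ((w * z) ^ 9) ^ 3 =
         euler_prod z ^ 3 + 3 * z * euler_prod (z ^ 9) ^ 3"
proof -
  let ?T = "\<lambda>i. Suc i choose 2"
  define d where "d = (\<lambda>i. if i mod 3 = 1 then 0 else (-1) ^ i * of_nat (2 * i + 1) :: complex)"
  have T: "?T (3 * m + 1) = 9 * ?T m + 1" for m
  proof -
    have c: "2 * int (k choose 2) = int k * (int k - 1)" for k
      by (induction k) (auto simp: numeral_2_eq_2 algebra_simps)
    have "2 * int (?T (3 * m + 1)) = 2 * int (9 * ?T m + 1)"
      unfolding of_nat_add of_nat_mult distrib_left c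
      using c[of "Suc m"] c[of "Suc (3 * m + 1)"] by (simp add: algebra_simps)
    then show ?thesis by (simp only: mult_cancel_left of_nat_eq_iff numeral_neq_zero simp_thms)
  qed
  have key: "(\<lambda>i. d i * z ^ ?T i) sums (euler_prod z ^ 3 + 3 * z * euler_prod (z ^ 9) ^ 3)" if z: "norm z < 1" for z
  proof -
    let ?f = "\<lambda>i. if i mod 3 = 1 then (- ((-1) ^ i * of_nat (2 * i + 1) * z ^ ?T i)) else 0"
    have "norm (z ^ 9) < 1" using z by (simp add: norm_power power_less_one_iff)
    from sums_mult[OF jacobi_identity[OF this], of "3 * z"]
    have "(\<lambda>m. 3 * z * ((-1) ^ m * of_nat (2 * m + 1) * (z ^ 9) ^ ?T m)) sums (3 * z * euler_prod (z ^ 9) ^ 3)" .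
    \<comment> \<open>For i = 3m + 1 the factor 2i + 1 is 3(2m + 1), the sign is -(-1)^m and the
      exponent is 9 T(m) + 1, with T(m) the m-th triangular number: this is why 3 z
      \<open>euler_prod (z ^ 9) ^ 3\<close> cancels exactly these terms.\<close>
    moreover have "3 * z * ((-1) ^ m * of_nat (2 * m + 1) * (z ^ 9) ^ ?T m) = ?f (3 * m + 1)" for m
    proof -
      have "z ^ ?T (3 * m + 1) = (z ^ 9) ^ ?T m * z" unfolding T by (simp add: power_add power_mult)
      moreover have "(-1::complex) ^ (3 * m + 1) = - ((-1) ^ m)" by (simp add: power_add power_mult)
      moreover have "(3 * m + 1) mod 3 = 1" by presburger
      ultimately show ?thesis by (simp add: algebra_simps)
    qed
    ultimately have "(\<lambda>m. ?f (3 * m + 1)) sums (3 * z * euler_prod (z ^ 9) ^ 3)" by simp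
    then have 1: "?f sums (3 * z * euler_prod (z ^ 9) ^ 3)"
    proof (subst (asm) sums_mono_reindex)
      show "strict_mono (\<lambda>m::nat. 3 * m + 1)" by (simp add: strict_mono_def)
      fix n :: nat assume "n \<notin> range (\<lambda>m. 3 * m + 1)"
      moreover have "n = 3 * (n div 3) + 1" if "n mod 3 = 1" using that by presburger
      ultimately have "n mod 3 \<noteq> 1" by blast
      then show "?f n = 0" by simp
    qed
    have "(\<lambda>i. (-1) ^ i * of_nat (2 * i + 1) * z ^ ?T i + ?f i) = (\<lambda>i. d i * z ^ ?T i)"
      by (auto simp: d_def)
    with sums_add[OF jacobi_identity[OF z] 1] show ?thesis by simp
  qed
  \<comment> \<open>For i congruent to 0 or 2 modulo 3, one of i and i + 1 is divisible by 3, hence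
    so is the triangular number.\<close>
  have "w ^ ?T i = 1" if "i mod 3 \<noteq> 1" for i
  proof -
    have "3 dvd ?T i"
    proof -
      have c: "2 * (Suc k choose 2) = Suc k * k" for k
        by (induction k) (auto simp: numeral_2_eq_2 algebra_simps)
      have "i mod 3 = 0 \<or> i mod 3 = 2" using that by linarith
      then have "3 dvd Suc i * i" by (metis dvd_mult dvd_mult2 mod_0_imp_dvd mod_Suc numeral_3_eq_3 numeral_2_eq_2)
      then have "3 dvd 2 * ?T i" unfolding c .
      then show ?thesis using coprime_dvd_mult_right_iff[of 3 "2::nat" "?T i"] by simp
    qed
    then obtain k where "?T i = 3 * k" by (auto simp: dvd_def)
    then show ?thesis using w by (simp add: power_mult)
  qed
  then have eq: "d i * (w * z) ^ ?T i = d i * z ^ ?T i" for i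
    by (auto simp: d_def power_mult_distrib)
  have wz: "norm (w * z) < 1"
  proof -
    have "norm w ^ 3 = 1" using w by (metis norm_one norm_power)
    then have "norm w = 1" using power_eq_iff_eq_base[of 3 "norm w" 1] by simp
    then show ?thesis using z by (simp add: norm_mult)
  qed
  show ?thesis by (rule sums_unique2[OF key[OF wz, unfolded eq] key[OF z]])
qed

section \<open>Periodic functions as functions of the nome\<close>

lemma nome_surj:
  assumes "q \<in> ball 0 1" "q \<noteq> 0"
  obtains \<tau> where "\<tau> \<in> \<H>" "nome \<tau> = q"
proof -
  define t where "t = Ln q / (2 * of_real pi * \<i>)"
  have n: "nome t = q" using assms by (simp add: nome_def t_def)
  have "exp (- (2 * pi * Im t)) < 1" using assms norm_nome[of t] unfolding n by simp
  then have "t \<in> \<H>" by (simp add: upper_half_plane_def zero_less_mult_iff)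
  then show ?thesis using n that by blast
qed

lemma nome_in_ball: "\<tau> \<in> \<H> \<Longrightarrow> nome \<tau> \<in> ball 0 1"
  using norm_nome_less_1 by simp

lemma nome_eq_iff: "nome a = nome b \<longleftrightarrow> (\<exists>n::int. a = b + of_int n)"
proof -
  have "nome a = nome b * nome (a - b)" using nome_add[of b "a - b"] by simp
  then have "nome a = nome b \<longleftrightarrow> nome (a - b) = 1" by simp
  then show ?thesis unfolding nome_eq_1_iff by (auto simp: algebra_simps)
qed

text \<open>Every point of the punctured disc is a nome, and the identity theorem adds q =
  0.\<close>

lemma nome_expansion_unique:
  assumes "F holomorphic_on ball 0 1" "G holomorphic_on ball 0 1"
    and "\<And>\<tau>. \<tau> \<in> \<H> \<Longrightarrow> F (nome \<tau>) = G (nome \<tau>)" and "q \<in> ball 0 1"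
  shows "F q = G q"
proof (rule analytic_continuation_open[of "ball 0 1 - {0}" "ball 0 1" F G])
  have "(1/2 :: complex) \<in> ball 0 1 - {0}" by simp
  then show "ball 0 1 - {0::complex} \<noteq> {}" by blast
  show "F z = G z" if "z \<in> ball 0 1 - {0}" for z
  proof -
    from that have "z \<in> ball 0 1" "z \<noteq> 0" by auto
    then obtain \<tau> where "\<tau> \<in> \<H>" "nome \<tau> = z" by (rule nome_surj)
    then show ?thesis using assms(3) by auto
  qed
qed (use assms in auto)

lemma periodic_int:
  assumes "\<And>\<tau>. \<tau> \<in> \<H> \<Longrightarrow> f (\<tau> + 1) = f \<tau>" "\<tau> \<in> \<H>"
  shows "f (\<tau> + of_int n) = f \<tau>"
proof -
  have nat: "f (\<tau> + of_nat m) = f \<tau>" if "\<tau> \<in> \<H>" for m \<tau>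
  proof (induction m)
    case (Suc m)
    have "\<tau> + of_nat m \<in> \<H>" using that by (simp add: upper_half_plane_def)
    from assms(1)[OF this] show ?case using Suc by (simp add: algebra_simps)
  qed simp
  show ?thesis
  proof (cases "n \<ge> 0")
    case True
    then show ?thesis using nat[OF assms(2), of "nat n"] by simp
  next
    case False
    have "\<tau> + of_int n \<in> \<H>" using assms by (simp add: upper_half_plane_def)
    from nat[OF this, of "nat (- n)"] False show ?thesis by simp
  qed
qed

text \<open>Riemann's theorem on removable singularities: a polynomial bound in Im \<tau> is a bound
  by a power of log |q|, so q F(q) tends to 0. A bound on one vertical strip is enough because F is
  evaluated with the principal logarithm.\<close>

lemma periodic_imp_nome_expansion:
  assumes hol: "f holomorphic_on \<H>" and per: "\<And>\<tau>. \<tau> \<in> \<H> \<Longrightarrow> f (\<tau> + 1) = f \<tau>"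
    and bnd: "\<And>\<tau>. Im \<tau> \<ge> 1 \<Longrightarrow> \<bar>Re \<tau>\<bar> \<le> 1 \<Longrightarrow> norm (f \<tau>) \<le> C * Im \<tau> ^ N"
  shows "\<exists>F. F holomorphic_on ball 0 1 \<and> (\<forall>\<tau>\<in>\<H>. f \<tau> = F (nome \<tau>))"
proof -
  let ?c = "2 * of_real pi * \<i> :: complex"
  define F where "F = (\<lambda>q. f (Ln q / ?c))"
  have Ff: "F q = f \<tau>" if "\<tau> \<in> \<H>" "nome \<tau> = q" for q \<tau>
  proof -
    have "nome (Ln q / ?c) = nome \<tau>" using that nome_nonzero[of \<tau>] by (simp add: nome_def)
    then obtain n :: int where n: "Ln q / ?c = \<tau> + of_int n" unfolding nome_eq_iff by blast
    show ?thesis unfolding F_def n by (rule periodic_int[where f = f, OF per that(1)])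
  qed
  have holF: "F holomorphic_on ball 0 1 - {0}"
    unfolding holomorphic_on_def
  proof
    fix q0 :: complex assume q0: "q0 \<in> ball 0 1 - {0}"
    \<comment> \<open>A branch of the logarithm holomorphic near \<open>q0\<close> even if
      \<open>q0\<close> lies on the cut: division by \<open>q0\<close> moves it to 1.\<close>
    define U where "U = {q \<in> ball 0 1. q / q0 \<in> - \<real>\<^sub>\<le>\<^sub>0}"
    define L where "L = (\<lambda>q. (Ln (q / q0) + Ln q0) / ?c)"
    have "continuous_on (ball 0 1) (\<lambda>q. q / q0)" using q0 by (intro continuous_intros) auto
    moreover have "U = ball 0 1 \<inter> (\<lambda>q. q / q0) -` (- \<real>\<^sub>\<le>\<^sub>0)" by (auto simp: U_def)
    ultimately have opU: "open U"
      by (simp add: continuous_on_open_vimage open_Compl Int_commute)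
    have qU: "q0 \<in> U" using q0 by (auto simp: U_def)
    have Un: "nome (L q) = q" "L q \<in> \<H>" if "q \<in> U" for q
    proof -
      have q: "q \<noteq> 0" using that by (auto simp: U_def)
      show n: "nome (L q) = q" using q q0 by (simp add: nome_def L_def exp_add)
      have "exp (- (2 * pi * Im (L q))) < 1" using that norm_nome[of "L q"] unfolding n by (simp add: U_def)
      then show "L q \<in> \<H>" by (simp add: upper_half_plane_def zero_less_mult_iff)
    qed
    have "L holomorphic_on U" unfolding L_def using q0 by (intro holomorphic_intros) (auto simp: U_def)
    then have "f \<circ> L holomorphic_on U"
      by (rule holomorphic_on_compose_gen[OF _ hol]) (use Un in auto)
    then have "F holomorphic_on U"
      by (rule holomorphic_transform) (simp add: Ff[OF Un(2) Un(1)])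
    then show "F field_differentiable at q0 within ball 0 1 - {0}"
      using opU qU holomorphic_on_imp_differentiable_at field_differentiable_at_within by blast
  qed
  have "((\<lambda>q. (q - 0) * F q) \<longlongrightarrow> 0) (at 0)"
  proof (rule Lim_null_comparison)
    define Y where "Y = (\<lambda>q::complex. - ln (norm q) / (2 * pi))"
    have Y: "filterlim Y at_top (at 0)"
    proof -
      have "filterlim (\<lambda>q::complex. norm q) (at_right 0) (at 0)"
        by (auto simp: filterlim_at intro!: tendsto_eq_intros eventually_at_filter[THEN iffD2])
      then have "filterlim (\<lambda>q::complex. ln (norm q)) at_bot (at 0)"
        by (rule filterlim_compose[OF ln_at_0])
      then have "filterlim (\<lambda>q::complex. - ln (norm q)) at_top (at 0)"
        by (simp add: filterlim_uminus_at_top)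
      then have "filterlim (\<lambda>q::complex. (1 / (2 * pi)) * (- ln (norm q))) at_top (at 0)"
        by (intro filterlim_tendsto_pos_mult_at_top[OF tendsto_const]) auto
      then show ?thesis by (simp add: Y_def)
    qed
    have "((\<lambda>q. Y q ^ N / exp (Y q)) \<longlongrightarrow> 0) (at 0)"
      by (rule filterlim_compose[OF tendsto_power_div_exp_0 Y])
    from tendsto_mult[OF tendsto_const[of "\<bar>C\<bar>"] this]
    show "((\<lambda>q. \<bar>C\<bar> * (Y q ^ N / exp (Y q))) \<longlongrightarrow> 0) (at 0)" by simp
    have "eventually (\<lambda>q. Y q \<ge> 1) (at 0)" using Y by (simp add: filterlim_at_top)
    moreover have "eventually (\<lambda>q::complex. q \<noteq> 0) (at 0)" by (simp add: eventually_at_filter)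
    ultimately show "eventually (\<lambda>q. norm ((q - 0) * F q) \<le> \<bar>C\<bar> * (Y q ^ N / exp (Y q))) (at 0)"
    proof eventually_elim
      case (elim q)
      define t where "t = Ln q / ?c"
      have ReIm: "Im t = Y q" "Re t = Im (Ln q) / (2 * pi)"
        using elim by (simp_all add: t_def Y_def Re_divide Im_divide power2_eq_square)
      have "\<bar>Im (Ln q)\<bar> \<le> pi" using elim mpi_less_Im_Ln[of q] Im_Ln_le_pi[of q] by linarith
      then have "\<bar>Re t\<bar> \<le> 1" unfolding ReIm using pi_gt_zero by (simp add: abs_divide divide_le_eq)
      then have "norm (f t) \<le> C * Y q ^ N" using bnd[of t] ReIm elim by simp
      also have "\<dots> \<le> \<bar>C\<bar> * Y q ^ N" using elim by (intro mult_right_mono) auto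
      finally have 1: "norm (F q) \<le> \<bar>C\<bar> * Y q ^ N" by (simp add: F_def t_def)
      have "2 * pi * Y q = - ln (norm q)" by (simp add: Y_def)
      then have "norm q = exp (- (2 * pi * Y q))" using elim by simp
      also have "\<dots> \<le> exp (- Y q)"
      proof -
        have "1 * Y q \<le> 2 * pi * Y q" by (rule mult_right_mono) (use elim pi_gt3 in auto)
        then show ?thesis by simp
      qed
      finally have "norm q * norm (F q) \<le> exp (- Y q) * (\<bar>C\<bar> * Y q ^ N)"
        by (intro mult_mono 1) (use elim in auto)
      then show ?case by (simp add: norm_mult exp_minus divide_inverse mult_ac)
    qed
  qed
  then obtain G where G: "G holomorphic_on ball 0 1" "\<And>q. q \<in> ball 0 1 - {0} \<Longrightarrow> G q = F q"
    using holomorphic_on_extend_lim[OF holF] by (auto simp: interior_open)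
  have "f \<tau> = G (nome \<tau>)" if "\<tau> \<in> \<H>" for \<tau>
    using G(2)[of "nome \<tau>"] nome_in_ball[OF that] Ff[OF that refl] by simp
  then show ?thesis using G(1) by blast
qed

section \<open>Pairs of expansions exchanged by the Fricke involution\<close>

text \<open>
  \<open>fricke_pair k F G\<close> encodes a form of weight \<open>k\<close> by its expansions at both cusps: the involution
  \<open>\<tau> \<mapsto> - 1 / (3 \<tau>)\<close> conjugates \<open>\<tau> \<mapsto> \<tau> + 1\<close> to \<open>\<tau> \<mapsto> \<tau> / (1 - 3 \<tau>)\<close>, and these two
  maps together with \<open>- 1\<close> generate \<open>\<Gamma>\<^sub>0(3)\<close>.
\<close>

definition fricke_pair :: "int \<Rightarrow> (complex \<Rightarrow> complex) \<Rightarrow> (complex \<Rightarrow> complex) \<Rightarrow> bool" where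
  "fricke_pair k F G \<longleftrightarrow> F holomorphic_on ball 0 1 \<and> G holomorphic_on ball 0 1 \<and>
     (\<forall>\<tau>\<in>\<H>. F (nome (- 1 / (3 * \<tau>))) = \<tau> powi k * G (nome \<tau>))"

lemma fricke_uhp: "\<tau> \<in> \<H> \<Longrightarrow> - 1 / (3 * \<tau>) \<in> \<H>"
  using uhp_neg_inverse[of "3 * \<tau>"] by (simp add: upper_half_plane_def)

lemma fricke_pairD:
  assumes "fricke_pair k F G"
  shows "F holomorphic_on ball 0 1" "G holomorphic_on ball 0 1"
    "\<tau> \<in> \<H> \<Longrightarrow> F (nome (- 1 / (3 * \<tau>))) = \<tau> powi k * G (nome \<tau>)"
  using assms by (auto simp: fricke_pair_def)

lemma fricke_pair_cong:
  assumes "fricke_pair k F G" "\<And>q. q \<in> ball 0 1 \<Longrightarrow> F q = F' q" "\<And>q. q \<in> ball 0 1 \<Longrightarrow> G q = G' q"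
  shows "fricke_pair k F' G'"
  using assms nome_in_ball fricke_uhp unfolding fricke_pair_def
  by (metis holomorphic_cong)

lemma fricke_pair_mult:
  assumes "fricke_pair k F G" "fricke_pair l F' G'"
  shows "fricke_pair (k + l) (\<lambda>q. F q * F' q) (\<lambda>q. G q * G' q)"
  using assms uhp_nonzero unfolding fricke_pair_def
  by (auto intro!: holomorphic_intros simp: power_int_add)

lemma fricke_pair_const: "fricke_pair 0 (\<lambda>_. c) (\<lambda>_. c)"
  by (auto simp: fricke_pair_def)

lemma fricke_pair_scale:
  assumes "fricke_pair k F G"
  shows "fricke_pair k (\<lambda>q. c * F q) (\<lambda>q. c * G q)"
  using fricke_pair_mult[OF fricke_pair_const[of c] assms] by simp

lemma fricke_pair_add:
  assumes "fricke_pair k F G" "fricke_pair k F' G'"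
  shows "fricke_pair k (\<lambda>q. F q + F' q) (\<lambda>q. G q + G' q)"
  using assms unfolding fricke_pair_def by (auto intro!: holomorphic_intros simp: ring_distribs)

lemma fricke_pair_diff:
  assumes "fricke_pair k F G" "fricke_pair k F' G'"
  shows "fricke_pair k (\<lambda>q. F q - F' q) (\<lambda>q. G q - G' q)"
  using assms unfolding fricke_pair_def by (auto intro!: holomorphic_intros simp: ring_distribs)

lemma fricke_pair_power:
  assumes "fricke_pair k F G"
  shows "fricke_pair (int n * k) (\<lambda>q. F q ^ n) (\<lambda>q. G q ^ n)"
proof (induction n)
  case (Suc n)
  from fricke_pair_mult[OF assms Suc] show ?case by (simp add: algebra_simps)
qed (use fricke_pair_const[of 1] in simp)

lemma fricke_pair_sum:
  assumes "finite A" "\<And>i. i \<in> A \<Longrightarrow> fricke_pair k (F i) (G i)"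
  shows "fricke_pair k (\<lambda>q. \<Sum>i\<in>A. F i q) (\<lambda>q. \<Sum>i\<in>A. G i q)"
  using assms unfolding fricke_pair_def by (auto intro!: holomorphic_intros simp: sum_distrib_left)

text \<open>Applying the involution twice gives \<tau> back; with \<sigma> = -1/(3 \<tau>) one has
  -3 \<tau> \<sigma> = 1, which produces the factor (-3)^k.\<close>

lemma fricke_pair_swap:
  assumes "fricke_pair k F G"
  shows "fricke_pair k G (\<lambda>q. (- 3) powi k * F q)"
  unfolding fricke_pair_def
proof (intro conjI ballI)
  note D = fricke_pairD[OF assms]
  show "G holomorphic_on ball 0 1" "(\<lambda>q. (- 3) powi k * F q) holomorphic_on ball 0 1"
    using D by (auto intro!: holomorphic_intros)
  fix \<tau> assume t: "\<tau> \<in> \<H>"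
  have t0: "\<tau> \<noteq> 0" using t by (rule uhp_nonzero)
  define \<sigma> where "\<sigma> = - 1 / (3 * \<tau>)"
  have "- 1 / (3 * \<sigma>) = \<tau>" using t0 by (simp add: \<sigma>_def)
  then have "F (nome \<tau>) = \<sigma> powi k * G (nome \<sigma>)"
    using D(3)[of \<sigma>] fricke_uhp[OF t] by (simp add: \<sigma>_def)
  moreover have "(\<tau> * (- 3)) powi k * \<sigma> powi k = 1"
    unfolding power_int_mult_distrib[symmetric] using t0 by (simp add: \<sigma>_def)
  ultimately have "(\<tau> * (- 3)) powi k * F (nome \<tau>) = G (nome \<sigma>)"
    by (simp only: mult.assoc[symmetric] mult_1_left)
  then show "G (nome (- 1 / (3 * \<tau>))) = \<tau> powi k * ((- 3) powi k * F (nome \<tau>))"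
    unfolding \<sigma>_def[symmetric] power_int_mult_distrib by (simp only: mult.assoc)
qed

text \<open>This transports an identity of expansions at one cusp to the other, where further
  coefficients can be read off.\<close>

lemma fricke_pair_unique:
  assumes "fricke_pair k F G" "fricke_pair k F' G'" "\<And>q. q \<in> ball 0 1 \<Longrightarrow> F q = F' q" "q \<in> ball 0 1"
  shows "G q = G' q"
proof (rule nome_expansion_unique[OF fricke_pairD(2)[OF assms(1)] fricke_pairD(2)[OF assms(2)] _ assms(4)])
  fix \<tau> assume t: "\<tau> \<in> \<H>"
  have "\<tau> powi k * G (nome \<tau>) = \<tau> powi k * G' (nome \<tau>)"
    using fricke_pairD(3)[OF assms(1) t] fricke_pairD(3)[OF assms(2) t] assms(3) nome_in_ball[OF fricke_uhp[OF t]] by auto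
  then show "G (nome \<tau>) = G' (nome \<tau>)" using uhp_nonzero[OF t] by simp
qed

text \<open>If f does not vanish at a point, then g vanishes on a neighbourhood of it and hence
  everywhere by the identity theorem.\<close>

lemma holomorphic_mult_eq_0:
  assumes "f holomorphic_on S" "g holomorphic_on S" "open S" "connected S" "\<And>z. z \<in> S \<Longrightarrow> f z * g z = 0"
  shows "(\<forall>z\<in>S. f z = 0) \<or> (\<forall>z\<in>S. g z = 0)"
proof (rule ccontr)
  assume "\<not> ?thesis"
  then obtain b c where b: "b \<in> S" "f b \<noteq> 0" and c: "c \<in> S" "g c \<noteq> 0" by blast
  have "open (S \<inter> f -` (- {0}))"
    using assms(1,3) by (intro continuous_open_preimage holomorphic_on_imp_continuous_on) auto
  then have "g c = 0"
    by (intro analytic_continuation_open[of "S \<inter> f -` (- {0})" S g "\<lambda>_. 0" c]) (use assms b c in auto)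
  then show False using c by simp
qed

text \<open>When Im \<tau> < 1/2, translating to |Re \<sigma>| \<le> 1/2 gives |\<sigma>|^2 \<le>
  1/2, and the inversion at least doubles the imaginary part. The bound 1/2, weaker than that of the
  usual fundamental domain, provides this definite gain.\<close>

lemma uhp_reduction:
  assumes T: "\<And>\<tau>. \<tau> \<in> \<H> \<Longrightarrow> N (\<tau> + 1) = N \<tau>" and S: "\<And>\<tau>. \<tau> \<in> \<H> \<Longrightarrow> N (- 1 / \<tau>) = N \<tau>"
    and t: "\<tau> \<in> \<H>"
  shows "\<exists>\<tau>'. Im \<tau>' \<ge> 1 / 2 \<and> N \<tau>' = N \<tau>"
proof -
  \<comment> \<open>Here n bounds the number of doublings still needed.\<close>
  have "\<exists>\<tau>'. Im \<tau>' \<ge> 1 / 2 \<and> N \<tau>' = N \<tau>" if "\<tau> \<in> \<H>" "Im \<tau> * 2 ^ n \<ge> 1 / 2" for n \<tau>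
    using that
  proof (induction n arbitrary: \<tau>)
    case (Suc n)
    show ?case
    proof (cases "Im \<tau> \<ge> 1 / 2")
      case False
      define \<sigma> where "\<sigma> = \<tau> + of_int (- round (Re \<tau>))"
      have s: "\<sigma> \<in> \<H>" "Im \<sigma> = Im \<tau>" using Suc.prems by (auto simp: \<sigma>_def upper_half_plane_def)
      have Ns: "N \<sigma> = N \<tau>" unfolding \<sigma>_def by (rule periodic_int[where f = N, OF T Suc.prems(1)])
      have "\<bar>Re \<sigma>\<bar> \<le> 1 / 2" using of_int_round_abs_le[of "Re \<tau>"] by (simp add: \<sigma>_def abs_minus_commute)
      then have "(Re \<sigma>)\<^sup>2 \<le> (1 / 2)\<^sup>2" by (simp add: abs_le_square_iff[symmetric])
      moreover have "(Im \<sigma>)\<^sup>2 \<le> (1 / 2)\<^sup>2"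
        using False s by (intro power_mono) (auto simp: upper_half_plane_def)
      ultimately have le: "(Re \<sigma>)\<^sup>2 + (Im \<sigma>)\<^sup>2 \<le> 1 / 2" by (simp add: power2_eq_square)
      have pos: "(Re \<sigma>)\<^sup>2 + (Im \<sigma>)\<^sup>2 > 0"
        using s by (auto simp: upper_half_plane_def intro!: add_nonneg_pos)
      have "Im \<sigma> * ((Re \<sigma>)\<^sup>2 + (Im \<sigma>)\<^sup>2) \<le> Im \<sigma> * (1 / 2)"
        using s by (intro mult_left_mono le) (auto simp: upper_half_plane_def)
      then have "Im \<sigma> * 2 \<le> Im \<sigma> / ((Re \<sigma>)\<^sup>2 + (Im \<sigma>)\<^sup>2)"
        using pos by (simp add: pos_le_divide_eq)
      then have "Im \<sigma> * 2 \<le> Im (- 1 / \<sigma>)" by (simp add: Im_divide)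
      then have "Im \<tau> * 2 * 2 ^ n \<le> Im (- 1 / \<sigma>) * 2 ^ n" using s by (intro mult_right_mono) auto
      then have "1 / 2 \<le> Im (- 1 / \<sigma>) * 2 ^ n" using Suc.prems(2) by (simp add: mult_ac)
      from Suc.IH[OF uhp_neg_inverse[OF s(1)] this] show ?thesis using S[OF s(1)] Ns by simp
    qed blast
  qed auto
  moreover obtain n where "1 / (2 * Im \<tau>) < 2 ^ n" using real_arch_pow[of 2 "1 / (2 * Im \<tau>)"] by auto
  then have "Im \<tau> * 2 ^ n \<ge> 1 / 2" using t by (simp add: upper_half_plane_def field_simps)
  ultimately show ?thesis using t by blast
qed

text \<open>
  The four factors are the conjugates of the form under \<open>SL\<^sub>2(\<int>)\<close>; their product is invariant,
  hence determined on \<open>Im \<tau> \<ge> 1 / 2\<close>, where it attains its maximum.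
\<close>

lemma fricke_pair_0_constant:
  assumes FG: "fricke_pair 0 F G"
  shows "\<exists>c. \<forall>q\<in>ball 0 1. F q = c \<and> G q = c"
proof -
  note D = fricke_pairD[OF FG]
  define c where "c = F 0"
  define w where "w = nome (1 / 3)"
  have w3: "w ^ 3 = 1" using nome_mult_nat[of 3 "1 / 3"] by (simp add: w_def)
  then have "norm w ^ 3 = 1" by (metis norm_one norm_power)
  then have w1: "norm w = 1" using power_eq_iff_eq_base[of 3 "norm w" 1] by simp
  \<comment> \<open>In terms of z = q^(1/3), the identity coset of \<Gamma>_0(3) contributes F(z^3)
    and the three other cosets contribute G at z, w z and w^2 z. Subtracting c = F(0) makes the
    product vanish at z = 0.\<close>
  define n where "n = (\<lambda>z. (F (z ^ 3) - c) * ((G z - c) * ((G (w * z) - c) * (G (w\<^sup>2 * z) - c))))"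
  define N where "N = (\<lambda>\<tau>. n (nome (\<tau> / 3)))"
  have comp: "(\<lambda>z. H (g z)) holomorphic_on ball 0 1"
    if "H holomorphic_on ball 0 1" "g holomorphic_on ball 0 1" "\<And>z. norm z < 1 \<Longrightarrow> norm (g z) < 1" for H g :: "complex \<Rightarrow> complex"
    using holomorphic_on_compose_gen[OF that(2,1)] that(3) by (auto simp: o_def image_subset_iff)
  have hF: "(\<lambda>z. F (z ^ 3) - c) holomorphic_on ball 0 1"
    by (intro holomorphic_intros comp[OF D(1)]) (auto simp: norm_power power_less_one_iff)
  have hG: "(\<lambda>z. G (u * z) - c) holomorphic_on ball 0 1" if "norm u = 1" for u
    by (intro holomorphic_intros comp[OF D(2)]) (use that in \<open>auto simp: norm_mult\<close>)
  have hG0: "(\<lambda>z. G z - c) holomorphic_on ball 0 1" using D by (intro holomorphic_intros)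
  have w2: "norm (w\<^sup>2) = 1" using w1 by (simp add: norm_power)
  have holn: "n holomorphic_on ball 0 1"
    unfolding n_def by (intro holomorphic_on_mult hF hG0 hG w1 w2)
  have F_W: "F (nome (- 1 / x)) = G (nome (x / 3))" if "x \<in> \<H>" for x
    using D(3)[of "x / 3"] that by (simp add: upper_half_plane_def)
  have G_W: "G (nome x) = F (nome (- 1 / (3 * x)))" if "x \<in> \<H>" for x
    using D(3)[OF that] by simp
  \<comment> \<open>Translation multiplies z by w and permutes the three factors with G
    cyclically.\<close>
  have NT: "N (\<tau> + 1) = N \<tau>" if "\<tau> \<in> \<H>" for \<tau>
  proof -
    have "nome ((\<tau> + 1) / 3) = w * nome (\<tau> / 3)" by (simp add: add_divide_distrib nome_add w_def)
    moreover have "w * (w * (w * z)) = z" for z using w3 by (simp add: power3_eq_cube flip: mult.assoc)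
    moreover have "(w * z) ^ 3 = z ^ 3" for z using w3 by (simp add: power_mult_distrib)
    ultimately show ?thesis by (simp only: N_def n_def power2_eq_square mult.assoc) (simp only: mult_ac)
  qed
  \<comment> \<open>The inversion exchanges F(z^3) with G(z), and G(w z) with G(w^2 z).\<close>
  have NS: "N (- 1 / \<tau>) = N \<tau>" if t: "\<tau> \<in> \<H>" for \<tau>
  proof -
    have t0: "\<tau> \<noteq> 0" using t by (rule uhp_nonzero)
    have tp: "\<tau> - 1 \<in> \<H>" "\<tau> + 1 \<in> \<H>" using t by (auto simp: upper_half_plane_def)
    note tp0 = tp[THEN uhp_nonzero]
    define z where "z = nome (\<tau> / 3)"
    define y where "y = nome (- 1 / (3 * \<tau>))"
    have z3: "z ^ 3 = nome \<tau>" "y ^ 3 = nome (- 1 / \<tau>)"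
      using nome_mult_nat[of 3 "\<tau> / 3"] nome_mult_nat[of 3 "- 1 / (3 * \<tau>)"] by (simp_all add: z_def y_def)
    have e1: "F (y ^ 3) = G z" unfolding z3 z_def by (rule F_W[OF t])
    have e2: "G y = F (z ^ 3)" unfolding z3 y_def using G_W[OF fricke_uhp[OF t]] t0 by simp
    have wz: "w * z = nome ((\<tau> + 1) / 3)" "w\<^sup>2 * z = nome ((\<tau> - 1) / 3)"
    proof -
      show "w * z = nome ((\<tau> + 1) / 3)" by (simp add: add_divide_distrib nome_add w_def z_def mult.commute)
      have "w\<^sup>2 = nome (- (1 / 3))"
        using w3 nome_nonzero[of "1 / 3"] by (simp add: nome_minus w_def[symmetric] field_simps power2_eq_square power3_eq_cube)
      then show "w\<^sup>2 * z = nome ((\<tau> - 1) / 3)"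
        using nome_add[of "\<tau> / 3" "- (1 / 3)"] by (simp add: diff_divide_distrib z_def mult.commute)
    qed
    have e3: "G (w * y) = G (w\<^sup>2 * z)"
    proof -
      define x where "x = (\<tau> - 1) / (3 * \<tau>)"
      have x: "x = - 1 / (3 * \<tau>) + 1 / 3" using t0 by (simp add: x_def field_simps)
      have xH: "x \<in> \<H>" using fricke_uhp[OF t] unfolding x by (simp add: upper_half_plane_def)
      have "w * y = nome x" unfolding x nome_add by (simp add: w_def y_def)
      moreover have "- 1 / (3 * x) = - 1 / (\<tau> - 1) + of_int (- 1)"
        using t0 tp0 by (simp add: x_def field_simps)
      then have "nome (- 1 / (3 * x)) = nome (- 1 / (\<tau> - 1))" by (simp only: nome_add nome_of_int mult_1_right)
      ultimately show ?thesis unfolding wz using G_W[OF xH] F_W[OF tp(1)] by simp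
    qed
    have e4: "G (w\<^sup>2 * y) = G (w * z)"
    proof -
      define x where "x = - (\<tau> + 1) / (3 * \<tau>)"
      have x: "x = - 1 / (3 * \<tau>) + - (1 / 3)" using t0 by (simp add: x_def field_simps)
      have xH: "x \<in> \<H>" using fricke_uhp[OF t] unfolding x by (simp add: upper_half_plane_def)
      have "w\<^sup>2 = nome (- (1 / 3))"
        using w3 nome_nonzero[of "1 / 3"] by (simp add: nome_minus w_def[symmetric] field_simps power2_eq_square power3_eq_cube)
      then have "w\<^sup>2 * y = nome x" unfolding x nome_add by (simp add: y_def)
      moreover have "3 * x = - ((\<tau> + 1) / \<tau>)" using t0 by (simp add: x_def field_simps)
      then have "- 1 / (3 * x) = \<tau> / (\<tau> + 1)" by simp
      then have "- 1 / (3 * x) = - 1 / (\<tau> + 1) + of_int 1"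
        using tp0 by (simp add: field_simps)
      then have "nome (- 1 / (3 * x)) = nome (- 1 / (\<tau> + 1))" by (simp only: nome_add nome_of_int mult_1_right)
      ultimately show ?thesis unfolding wz using G_W[OF xH] F_W[OF tp(2)] by simp
    qed
    have ny: "nome (- 1 / \<tau> / 3) = y" by (simp add: y_def mult.commute)
    show ?thesis unfolding N_def n_def z_def[symmetric] ny e1 e2 e3 e4 by (simp only: mult_ac)
  qed
  \<comment> \<open>This is |z| for Im \<tau> = 1/2, so the reduced points lie in a compact
    disc.\<close>
  define r where "r = exp (- (pi / 3))"
  have r: "0 < r" "r < 1" using pi_gt_zero by (auto simp: r_def)
  have "continuous_on (cball 0 r) (\<lambda>z. norm (n z))"
    using r by (intro continuous_intros continuous_on_subset[OF holomorphic_on_imp_continuous_on[OF holn]]) auto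
  then obtain p where p: "p \<in> cball 0 r" "\<And>z. z \<in> cball 0 r \<Longrightarrow> norm (n z) \<le> norm (n p)"
    using continuous_attains_sup[of "cball 0 r" "\<lambda>z. norm (n z)"] r by auto
  have max: "norm (n z) \<le> norm (n p)" if z: "z \<in> ball 0 1" for z
  proof (cases "z = 0")
    case False
    obtain t where t: "t \<in> \<H>" "nome t = z" using nome_surj[OF z False] by blast
    then have "3 * t \<in> \<H>" by (simp add: upper_half_plane_def)
    from uhp_reduction[where N = N, OF NT NS this]
    obtain t' where t': "Im t' \<ge> 1 / 2" "N t' = N (3 * t)" by blast
    have "norm (nome (t' / 3)) \<le> r" unfolding norm_nome r_def using t' by simp
    then have "norm (n (nome (t' / 3))) \<le> norm (n p)" by (intro p) auto
    then show ?thesis using t' t by (simp add: N_def)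
  qed (use p r in auto)
  have "n constant_on ball 0 1"
    by (rule maximum_modulus_principle[OF holn, of "ball 0 1" p]) (use p r max in auto)
  moreover have "n 0 = 0" by (simp add: n_def c_def)
  ultimately have n0: "n z = 0" if "z \<in> ball 0 1" for z
    using that unfolding constant_on_def by (metis centre_in_ball zero_less_one)
  \<comment> \<open>The product is constant with value 0 at the origin, so one of its factors
    vanishes identically.\<close>
  have cases: "(\<forall>z\<in>ball 0 1. F (z ^ 3) - c = 0) \<or> (\<forall>z\<in>ball 0 1. G z - c = 0) \<or>
      (\<forall>z\<in>ball 0 1. G (w * z) - c = 0) \<or> (\<forall>z\<in>ball 0 1. G (w\<^sup>2 * z) - c = 0)"
  proof -
    note h = holomorphic_mult_eq_0[of _ "ball 0 1", OF _ _ open_ball connected_ball]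
    have "(\<forall>z\<in>ball 0 1. F (z ^ 3) - c = 0) \<or> (\<forall>z\<in>ball 0 1. (G z - c) * ((G (w * z) - c) * (G (w\<^sup>2 * z) - c)) = 0)"
      by (rule h) (use n0 in \<open>auto simp: n_def intro!: holomorphic_on_mult hF hG0 hG w1 w2\<close>)
    moreover have "(\<forall>z\<in>ball 0 1. G z - c = 0) \<or> (\<forall>z\<in>ball 0 1. (G (w * z) - c) * (G (w\<^sup>2 * z) - c) = 0)"
      if "\<forall>z\<in>ball 0 1. (G z - c) * ((G (w * z) - c) * (G (w\<^sup>2 * z) - c)) = 0"
      by (rule h) (use that in \<open>auto intro!: holomorphic_on_mult hF hG0 hG w1 w2\<close>)
    moreover have "(\<forall>z\<in>ball 0 1. G (w * z) - c = 0) \<or> (\<forall>z\<in>ball 0 1. G (w\<^sup>2 * z) - c = 0)"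
      if "\<forall>z\<in>ball 0 1. (G (w * z) - c) * (G (w\<^sup>2 * z) - c) = 0"
      by (rule h) (use that in \<open>auto intro!: holomorphic_on_mult hF hG0 hG w1 w2\<close>)
    ultimately show ?thesis by blast
  qed
  have rot: "\<forall>q\<in>ball 0 1. G q = c" if "norm u = 1" "\<forall>z\<in>ball 0 1. G (u * z) - c = 0" for u
  proof
    fix q :: complex assume "q \<in> ball 0 1"
    then have "q / u \<in> ball 0 1" using that by (simp add: norm_divide)
    moreover have "u * (q / u) = q" using that by auto
    ultimately show "G q = c" using that(2) by (metis eq_iff_diff_eq_0)
  qed
  \<comment> \<open>A rotation of the disc does not matter for a constant, so F or G is constant; in
    weight 0 the involution then passes the value to the other one.\<close>
  have "(\<forall>\<tau>\<in>\<H>. F (nome \<tau>) = c) \<or> (\<forall>\<tau>\<in>\<H>. G (nome \<tau>) = c)"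
    using cases
  proof (elim disjE)
    assume *: "\<forall>z\<in>ball 0 1. F (z ^ 3) - c = 0"
    have "F (nome \<tau>) = c" if "\<tau> \<in> \<H>" for \<tau>
    proof -
      have "\<tau> / 3 \<in> \<H>" using that by (simp add: upper_half_plane_def)
      then show ?thesis using * nome_in_ball[of "\<tau> / 3"] nome_mult_nat[of 3 "\<tau> / 3"] by simp
    qed
    then show ?thesis by blast
  next
    assume "\<forall>z\<in>ball 0 1. G z - c = 0"
    then show ?thesis using nome_in_ball by auto
  next
    assume "\<forall>z\<in>ball 0 1. G (w * z) - c = 0"
    from rot[OF w1 this] show ?thesis using nome_in_ball by auto
  next
    assume "\<forall>z\<in>ball 0 1. G (w\<^sup>2 * z) - c = 0"
    from rot[OF w2 this] show ?thesis using nome_in_ball by auto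
  qed
  then have FGc: "F (nome \<tau>) = c" "G (nome \<tau>) = c" if "\<tau> \<in> \<H>" for \<tau>
  proof -
    have "- 1 / (3 * (- 1 / (3 * \<tau>))) = \<tau>" using uhp_nonzero[OF that] by simp
    then have *: "F (nome \<tau>) = G (nome (- 1 / (3 * \<tau>)))" "G (nome \<tau>) = F (nome (- 1 / (3 * \<tau>)))"
      using G_W[OF fricke_uhp[OF that]] G_W[OF that] by simp_all
    show "F (nome \<tau>) = c" "G (nome \<tau>) = c"
      using \<open>(\<forall>\<tau>\<in>\<H>. F (nome \<tau>) = c) \<or> (\<forall>\<tau>\<in>\<H>. G (nome \<tau>) = c)\<close> * that fricke_uhp[OF that] by auto
  qed
  have "F q = c \<and> G q = c" if "q \<in> ball 0 1" for q
    using nome_expansion_unique[OF D(1) holomorphic_on_const[of c] FGc(1) that]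
      nome_expansion_unique[OF D(2) holomorphic_on_const[of c] FGc(2) that] by simp
  then show ?thesis by blast
qed

section \<open>Generating pairs\<close>

definition pexp :: "complex \<Rightarrow> complex" where
  "pexp q = (E2 q + 3 * E2 (q ^ 3)) / 4"

definition qexp :: "complex \<Rightarrow> complex" where
  "qexp q = (3 * E2 (q ^ 3) - E2 q) / 2"

text \<open>
  In terms of the Borwein cubic theta functions, \<open>aexp\<close>, \<open>bexp\<close>, \<open>cexp\<close> are the expansions of
  \<open>a\<close>, \<open>b^3\<close> and \<open>c^3 / 27\<close>.
\<close>

definition aexp :: "complex \<Rightarrow> complex" where
  "aexp q = (euler_prod q ^ 3 + 9 * q * euler_prod (q ^ 9) ^ 3) / euler_prod (q ^ 3)"

definition bexp :: "complex \<Rightarrow> complex" where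
  "bexp q = euler_prod q ^ 9 / euler_prod (q ^ 3) ^ 3"

definition cexp :: "complex \<Rightarrow> complex" where
  "cexp q = q * (euler_prod (q ^ 3) ^ 9 / euler_prod q ^ 3)"

lemma norm_power_less_1: "norm (q::complex) < 1 \<Longrightarrow> 0 < n \<Longrightarrow> norm (q ^ n) < 1"
  by (simp add: norm_power power_less_one_iff)

lemma exps_0 [simp]: "pexp 0 = 1" "qexp 0 = 1" "aexp 0 = 1" "bexp 0 = 1" "cexp 0 = 0"
  by (simp_all add: pexp_def qexp_def aexp_def bexp_def cexp_def)

lemma exps_holomorphic:
  "pexp holomorphic_on ball 0 1" "qexp holomorphic_on ball 0 1" "aexp holomorphic_on ball 0 1"
  "bexp holomorphic_on ball 0 1" "cexp holomorphic_on ball 0 1"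
  unfolding pexp_def qexp_def aexp_def bexp_def cexp_def
  by (auto intro!: holomorphic_intros simp: norm_power_less_1 euler_prod_nonzero)

lemma bexp_nonzero: "norm q < 1 \<Longrightarrow> bexp q \<noteq> 0"
  by (simp add: bexp_def euler_prod_nonzero norm_power_less_1)

lemma cexp_nonzero: "norm q < 1 \<Longrightarrow> q \<noteq> 0 \<Longrightarrow> cexp q \<noteq> 0"
  by (simp add: cexp_def euler_prod_nonzero norm_power_less_1)

lemma nome_multiple: "nome (3 * \<tau>) = nome \<tau> ^ 3" "nome (9 * \<tau>) = nome \<tau> ^ 9"
  using nome_mult_nat[of 3 \<tau>] nome_mult_nat[of 9 \<tau>] by simp_all

lemma eta_power: "eta \<tau> ^ n = nome (of_nat n * \<tau> / 24) * euler_prod (nome \<tau>) ^ n"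
  using nome_mult_nat[of n "\<tau> / 24"] by (simp add: eta_eq power_mult_distrib)

lemma nome_prod_eq: "a = b + c \<Longrightarrow> nome a = nome b * nome c"
  by (simp add: nome_add)

text \<open>With u = q^(1/8), the fractional prefactors of eta(\<tau>)^3, eta(3 \<tau>) and eta(9
  \<tau>)^3 are u, u and u q. All fractional powers cancel, and the q that remains is the explicit
  factor in \<open>aexp_def\<close> and \<open>cexp_def\<close>.\<close>

lemma eta_quotients:
  assumes t: "\<tau> \<in> \<H>"
  shows "aexp (nome \<tau>) = (eta \<tau> ^ 3 + 9 * eta (9 * \<tau>) ^ 3) / eta (3 * \<tau>)"
    and "bexp (nome \<tau>) = eta \<tau> ^ 9 / eta (3 * \<tau>) ^ 3"
    and "cexp (nome \<tau>) = eta (3 * \<tau>) ^ 9 / eta \<tau> ^ 3"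
proof -
  define u where "u = nome (\<tau> / 8)"
  have u0: "u \<noteq> 0" by (simp add: u_def)
  have e1: "eta \<tau> ^ 3 = u * euler_prod (nome \<tau>) ^ 3" by (simp add: eta_power u_def)
  have "nome (9 * \<tau> / 8) = u * nome \<tau>" unfolding u_def by (rule nome_prod_eq) simp
  then have e9: "eta (9 * \<tau>) ^ 3 = u * nome \<tau> * euler_prod (nome \<tau> ^ 9) ^ 3"
    by (simp add: eta_power nome_multiple)
  have e3: "eta (3 * \<tau>) = u * euler_prod (nome \<tau> ^ 3)"
    using eta_power[of "3 * \<tau>" 1] by (simp add: nome_multiple u_def)
  have "eta \<tau> ^ 3 + 9 * eta (9 * \<tau>) ^ 3 = u * (euler_prod (nome \<tau>) ^ 3 + 9 * nome \<tau> * euler_prod (nome \<tau> ^ 9) ^ 3)"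
    unfolding e1 e9 by (simp add: algebra_simps)
  then show "aexp (nome \<tau>) = (eta \<tau> ^ 3 + 9 * eta (9 * \<tau>) ^ 3) / eta (3 * \<tau>)"
    unfolding e3 aexp_def using u0 by simp
  have e1': "eta \<tau> ^ 9 = u ^ 3 * euler_prod (nome \<tau>) ^ 9"
  proof -
    have "eta \<tau> ^ 9 = (eta \<tau> ^ 3) ^ 3" by (simp flip: power_mult)
    then show ?thesis unfolding e1 by (simp add: power_mult_distrib flip: power_mult)
  qed
  show "bexp (nome \<tau>) = eta \<tau> ^ 9 / eta (3 * \<tau>) ^ 3"
    unfolding e1' e3 bexp_def using u0 by (simp add: power_mult_distrib)
  have "u ^ 9 = u * nome \<tau>"
    using nome_mult_nat[of 9 "\<tau> / 8"] nome_add[of "\<tau> / 8" \<tau>] by (simp add: u_def)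
  then show "cexp (nome \<tau>) = eta (3 * \<tau>) ^ 9 / eta \<tau> ^ 3"
    unfolding e1 e3 cexp_def using u0 by (simp add: power_mult_distrib)
qed

text \<open>The involution interchanges E_2(q) and E_2(q^3) up to scaling. The linear terms 18
  \<tau>/(pi i) and 6 \<tau>/(pi i) cancel in \<open>qexp\<close> and add up in
  \<open>pexp\<close>.\<close>

lemma E2_fricke:
  assumes t: "\<tau> \<in> \<H>"
  shows "E2 (nome (- 1 / (3 * \<tau>))) = 9 * \<tau>\<^sup>2 * E2 (nome \<tau> ^ 3) + 18 * \<tau> / (of_real pi * \<i>)"
    and "E2 (nome (- 1 / (3 * \<tau>)) ^ 3) = \<tau>\<^sup>2 * E2 (nome \<tau>) + 6 * \<tau> / (of_real pi * \<i>)"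
proof -
  have t3: "3 * \<tau> \<in> \<H>" using t by (simp add: upper_half_plane_def)
  show "E2 (nome (- 1 / (3 * \<tau>))) = 9 * \<tau>\<^sup>2 * E2 (nome \<tau> ^ 3) + 18 * \<tau> / (of_real pi * \<i>)"
    using E2_inversion[OF t3] by (simp add: nome_multiple power_mult_distrib)
  have "nome (- 1 / (3 * \<tau>)) ^ 3 = nome (- 1 / \<tau>)"
    using nome_mult_nat[of 3 "- 1 / (3 * \<tau>)"] by simp
  then show "E2 (nome (- 1 / (3 * \<tau>)) ^ 3) = \<tau>\<^sup>2 * E2 (nome \<tau>) + 6 * \<tau> / (of_real pi * \<i>)"
    using E2_inversion[OF t] by simp
qed

lemma qexp_pair: "fricke_pair 2 qexp (\<lambda>q. - 3 * qexp q)"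
  unfolding fricke_pair_def
proof (intro conjI ballI)
  fix \<tau> assume t: "\<tau> \<in> \<H>"
  show "qexp (nome (- 1 / (3 * \<tau>))) = \<tau> powi 2 * (- 3 * qexp (nome \<tau>))"
    unfolding qexp_def E2_fricke[OF t] by (simp add: field_simps power2_eq_square)
qed (intro holomorphic_intros exps_holomorphic)+

lemma pexp_fricke:
  assumes "\<tau> \<in> \<H>"
  shows "pexp (nome (- 1 / (3 * \<tau>))) = 3 * \<tau>\<^sup>2 * pexp (nome \<tau>) + 9 * \<tau> / (of_real pi * \<i>)"
  unfolding pexp_def E2_fricke[OF assms] by (simp add: field_simps power2_eq_square)

text \<open>One square root s serves all three laws, so that the quotients needed later contain only
  even powers of s, that is, powers of -i \<tau>.\<close>

lemma eta_fricke:
  assumes t: "\<tau> \<in> \<H>"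
  defines "s \<equiv> csqrt (- \<i> * \<tau>)"
  shows "eta (- 1 / (3 * \<tau>)) = of_real (sqrt 3) * s * eta (3 * \<tau>)"
    and "eta (3 * (- 1 / (3 * \<tau>))) = s * eta \<tau>"
    and "eta (9 * (- 1 / (3 * \<tau>))) = s / of_real (sqrt 3) * eta (\<tau> / 3)"
proof -
  have t3: "3 * \<tau> \<in> \<H>" "\<tau> / 3 \<in> \<H>" using t by (auto simp: upper_half_plane_def)
  have "csqrt (- \<i> * (3 * \<tau>)) = of_real (sqrt 3) * s"
    using csqrt_of_real_mult[of 3 "- \<i> * \<tau>"] by (simp add: s_def mult_ac)
  then show "eta (- 1 / (3 * \<tau>)) = of_real (sqrt 3) * s * eta (3 * \<tau>)"
    using eta_inversion[OF t3(1)] by simp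
  show "eta (3 * (- 1 / (3 * \<tau>))) = s * eta \<tau>"
    using eta_inversion[OF t] by (simp add: s_def)
  have "csqrt (- \<i> * (\<tau> / 3)) = of_real (sqrt (1 / 3)) * s"
    using csqrt_of_real_mult[of "1 / 3" "- \<i> * \<tau>"] by (simp add: s_def mult_ac)
  then have "csqrt (- \<i> * (\<tau> / 3)) = s / of_real (sqrt 3)"
    by (simp add: real_sqrt_divide)
  moreover have "9 * (- 1 / (3 * \<tau>)) = - 1 / (\<tau> / 3)" by simp
  ultimately show "eta (9 * (- 1 / (3 * \<tau>))) = s / of_real (sqrt 3) * eta (\<tau> / 3)"
    using eta_inversion[OF t3(2)] by simp
qed

lemma sqrt3_powers:
  "of_real (sqrt 3) ^ 2 = (3 :: complex)" "of_real (sqrt 3) ^ 3 = (3 * of_real (sqrt 3) :: complex)"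
  "of_real (sqrt 3) \<noteq> (0 :: complex)"
proof -
  show *: "of_real (sqrt 3) ^ 2 = (3 :: complex)" by (simp flip: of_real_power)
  then show "of_real (sqrt 3) ^ 3 = (3 * of_real (sqrt 3) :: complex)"
    by (simp only: power3_eq_cube power2_eq_square)
qed simp

text \<open>The powers of s leave s^6 = (-i \<tau>)^3 = i \<tau>^3, and sqrt 3 enters cubed; this is
  the constant i / (3 sqrt 3).\<close>

lemma cexp_pair: "fricke_pair 3 cexp (\<lambda>q. \<i> / (3 * of_real (sqrt 3)) * bexp q)"
  unfolding fricke_pair_def
proof (intro conjI ballI)
  fix \<tau> assume t: "\<tau> \<in> \<H>"
  define s where "s = csqrt (- \<i> * \<tau>)"
  have s2: "s\<^sup>2 = - \<i> * \<tau>" by (simp add: s_def)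
  have s0: "s \<noteq> 0" using uhp_nonzero[OF t] by (simp add: s_def)
  have "s ^ 9 / s ^ 3 = (s\<^sup>2) ^ 3" using s0 by (simp add: field_simps flip: power_add power_mult)
  also have "\<dots> = \<i> * \<tau> ^ 3" unfolding s2 by (simp add: power3_eq_cube algebra_simps)
  finally have s6: "s ^ 9 / s ^ 3 = \<i> * \<tau> ^ 3" .
  have "cexp (nome (- 1 / (3 * \<tau>))) = (s * eta \<tau>) ^ 9 / (of_real (sqrt 3) * s * eta (3 * \<tau>)) ^ 3"
    unfolding eta_quotients[OF fricke_uhp[OF t]] eta_fricke[OF t] s_def ..
  also have "\<dots> = (s ^ 9 / s ^ 3) / (of_real (sqrt 3)) ^ 3 * (eta \<tau> ^ 9 / eta (3 * \<tau>) ^ 3)"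
    by (simp add: power_mult_distrib)
  finally show "cexp (nome (- 1 / (3 * \<tau>))) = \<tau> powi 3 * (\<i> / (3 * of_real (sqrt 3)) * bexp (nome \<tau>))"
    unfolding s6 sqrt3_powers eta_quotients[OF t, symmetric] by simp
qed (intro holomorphic_intros exps_holomorphic)+

text \<open>The swapped pair of c, rescaled; its dual carries the factor (-3)^3 = -27 of
  \<open>fricke_pair_swap\<close>.\<close>

lemma bexp_pair: "fricke_pair 3 bexp (\<lambda>q. 81 * of_real (sqrt 3) * \<i> * cexp q)"
proof -
  have "fricke_pair 3 bexp (\<lambda>q. (3 * of_real (sqrt 3) / \<i>) * (-27 * cexp q))"
    by (rule fricke_pair_cong[OF fricke_pair_scale[OF fricke_pair_swap[OF cexp_pair], of "3 * of_real (sqrt 3) / \<i>"]])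
       auto
  then show ?thesis by (rule fricke_pair_cong) (auto simp: field_simps)
qed

text \<open>On the disc \<open>cexp\<close> has only a simple zero at 0, and its dual, a multiple of
  \<open>bexp\<close>, has none. So F(0) = 0 makes the quotient regular at the first cusp, and at
  the second it is regular anyway.\<close>

lemma fricke_pair_divide_cexp:
  assumes FG: "fricke_pair k F G" and F0: "F 0 = 0"
  shows "\<exists>F' G'. fricke_pair (k - 3) F' G' \<and> (\<forall>q\<in>ball 0 1. F q = F' q * cexp q)"
proof -
  note D = fricke_pairD[OF FG]
  define \<kappa> where "\<kappa> = \<i> / (3 * of_real (sqrt 3))"
  have k0: "\<kappa> \<noteq> 0" by (simp add: \<kappa>_def)
  define F1 where "F1 = (\<lambda>z. if z = 0 then deriv F 0 else (F z - F 0) / (z - 0))"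
  have F1: "F1 holomorphic_on ball 0 1"
    unfolding F1_def by (rule pole_lemma[OF D(1)]) (simp add: interior_open)
  have FF1: "F z = z * F1 z" for z using F0 by (simp add: F1_def)
  define U where "U = (\<lambda>q. euler_prod (q ^ 3) ^ 9 / euler_prod q ^ 3)"
  have U: "U holomorphic_on ball 0 1"
    unfolding U_def by (auto intro!: holomorphic_intros simp: norm_power_less_1 euler_prod_nonzero)
  have U0: "U q \<noteq> 0" if "q \<in> ball 0 1" for q using that by (simp add: U_def norm_power_less_1 euler_prod_nonzero)
  have CU: "cexp q = q * U q" for q by (simp add: cexp_def U_def)
  have eq: "F q = F1 q / U q * cexp q" if "q \<in> ball 0 1" for q using U0[OF that] by (simp add: CU FF1)
  have "fricke_pair (k - 3) (\<lambda>q. F1 q / U q) (\<lambda>q. G q / (\<kappa> * bexp q))"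
    unfolding fricke_pair_def
  proof (intro conjI ballI)
    show "(\<lambda>q. F1 q / U q) holomorphic_on ball 0 1" using F1 U U0 by (intro holomorphic_intros)
    show "(\<lambda>q. G q / (\<kappa> * bexp q)) holomorphic_on ball 0 1"
      using D(2) exps_holomorphic k0 by (intro holomorphic_intros) (auto simp: bexp_nonzero)
    fix \<tau> assume t: "\<tau> \<in> \<H>"
    define \<sigma> where "\<sigma> = - 1 / (3 * \<tau>)"
    have s: "\<sigma> \<in> \<H>" unfolding \<sigma>_def by (rule fricke_uhp[OF t])
    have t0: "\<tau> \<noteq> 0" using t by (rule uhp_nonzero)
    have C: "cexp (nome \<sigma>) = \<tau> powi 3 * (\<kappa> * bexp (nome \<tau>))"
      using fricke_pairD(3)[OF cexp_pair t] by (simp add: \<sigma>_def \<kappa>_def)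
    have C0: "cexp (nome \<sigma>) \<noteq> 0" using s by (intro cexp_nonzero norm_nome_less_1) auto
    have "F1 (nome \<sigma>) / U (nome \<sigma>) = F (nome \<sigma>) / cexp (nome \<sigma>)"
      using eq[OF nome_in_ball[OF s]] C0 by simp
    also have "\<dots> = \<tau> powi k * G (nome \<tau>) / (\<tau> powi 3 * (\<kappa> * bexp (nome \<tau>)))"
      unfolding C using D(3)[OF t] by (simp add: \<sigma>_def)
    also have "\<dots> = \<tau> powi (k - 3) * (G (nome \<tau>) / (\<kappa> * bexp (nome \<tau>)))"
      using t0 by (simp add: power_int_diff)
    finally show "F1 (nome (- 1 / (3 * \<tau>))) / U (nome (- 1 / (3 * \<tau>))) = \<tau> powi (k - 3) * (G (nome \<tau>) / (\<kappa> * bexp (nome \<tau>)))"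
      by (simp add: \<sigma>_def)
  qed
  then show ?thesis using eq by blast
qed

text \<open>The product F^3 c^(-k) has weight 0, so it is constant, and the positive power of c
  makes it vanish at q = 0.\<close>

lemma fricke_pair_negative:
  assumes FG: "fricke_pair k F G" and k: "k < 0" and q: "q \<in> ball 0 1"
  shows "F q = 0"
proof -
  note D = fricke_pairD[OF FG]
  define m where "m = nat (- k)"
  have m: "m > 0" "int m = - k" using k by (auto simp: m_def)
  have "fricke_pair (int 3 * k + int m * 3) (\<lambda>q. F q ^ 3 * cexp q ^ m)
      (\<lambda>q. G q ^ 3 * (\<i> / (3 * of_real (sqrt 3)) * bexp q) ^ m)"
    by (intro fricke_pair_mult fricke_pair_power FG cexp_pair)
  then have "fricke_pair 0 (\<lambda>q. F q ^ 3 * cexp q ^ m) (\<lambda>q. G q ^ 3 * (\<i> / (3 * of_real (sqrt 3)) * bexp q) ^ m)"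
    using m by simp
  from fricke_pair_0_constant[OF this] obtain c where "\<forall>q\<in>ball 0 1. F q ^ 3 * cexp q ^ m = c"
    by auto
  then have c: "F q ^ 3 * cexp q ^ m = c" if "q \<in> ball 0 1" for q using that by blast
  have "c = 0" using c[of 0] m by (simp add: zero_power)
  have "F (nome \<tau>) = 0" if "\<tau> \<in> \<H>" for \<tau>
  proof -
    have "cexp (nome \<tau>) \<noteq> 0" using that by (intro cexp_nonzero norm_nome_less_1) auto
    then show ?thesis using c[OF nome_in_ball[OF that]] \<open>c = 0\<close> by simp
  qed
  from nome_expansion_unique[OF D(1) holomorphic_on_const this q] show ?thesis .
qed

text \<open>
  The expansion of \<open>a\<close> at the other cusp as it comes out of the inversion law of \<open>\<eta>\<close>, with
  \<open>q^(1/3)\<close> as parameter; it depends on the cube of this parameter only.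
\<close>

definition aexp_dual :: "complex \<Rightarrow> complex" where
  "aexp_dual z = (euler_prod z ^ 3 + 3 * z * euler_prod (z ^ 9) ^ 3) / euler_prod (z ^ 3)"

text \<open>With r = sqrt 3, the involution turns eta(\<tau>)^3 into 3 r s^3 eta(3 \<tau>)^3 and 9
  eta(9 \<tau>)^3 into r s^3 eta(\<tau>/3)^3. The two terms change places, which explains the
  coefficients 1 and 3 in \<open>aexp_dual\<close>.\<close>

lemma aexp_fricke:
  assumes t: "\<tau> \<in> \<H>"
  shows "aexp (nome (- 1 / (3 * \<tau>))) = \<tau> * (- \<i> * of_real (sqrt 3) * aexp_dual (nome (\<tau> / 3)))"
proof -
  define s where "s = csqrt (- \<i> * \<tau>)"
  have s2: "s * s = - \<i> * \<tau>" unfolding s_def by (metis power2_csqrt power2_eq_square)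
  have s0: "s \<noteq> 0" using uhp_nonzero[OF t] by (simp add: s_def)
  define r where "r = (of_real (sqrt 3) :: complex)"
  have r: "r\<^sup>2 = 3" "r \<noteq> 0" using sqrt3_powers by (simp_all add: r_def)
  define z where "z = nome (\<tau> / 3)"
  have z3: "z ^ 3 = nome \<tau>" "z ^ 9 = nome (3 * \<tau>)"
    using nome_mult_nat[of 3 "\<tau> / 3"] nome_mult_nat[of 9 "\<tau> / 3"] by (simp_all add: z_def)
  define u where "u = nome (\<tau> / 24)"
  have u0: "u \<noteq> 0" by (simp add: u_def)
  have e1: "eta \<tau> = u * euler_prod (z ^ 3)" by (simp add: eta_eq u_def z3)
  have e2: "eta (\<tau> / 3) ^ 3 = u * euler_prod z ^ 3" by (simp add: eta_power u_def z_def)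
  have "nome (9 * \<tau> / 24) = u * z" unfolding u_def z_def by (rule nome_prod_eq) simp
  then have e3: "eta (3 * \<tau>) ^ 3 = u * z * euler_prod (z ^ 9) ^ 3" by (simp add: eta_power z3)
  have "aexp (nome (- 1 / (3 * \<tau>))) = ((r * s * eta (3 * \<tau>)) ^ 3 + 9 * (s / r * eta (\<tau> / 3)) ^ 3) / (s * eta \<tau>)"
    unfolding eta_quotients[OF fricke_uhp[OF t]] eta_fricke[OF t] s_def r_def ..
  also have "\<dots> = (r ^ 3 * s ^ 3 * eta (3 * \<tau>) ^ 3 + 9 * (s ^ 3 / r ^ 3 * eta (\<tau> / 3) ^ 3)) / (s * eta \<tau>)"
    by (simp add: power_mult_distrib power_divide)
  also have "r ^ 3 = 3 * r" using r by (simp add: power3_eq_cube power2_eq_square)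
  also have "9 * (s ^ 3 / (3 * r) * eta (\<tau> / 3) ^ 3) = r * s ^ 3 * eta (\<tau> / 3) ^ 3"
    using r by (simp add: field_simps power2_eq_square)
  also have "3 * r * s ^ 3 * eta (3 * \<tau>) ^ 3 + r * s ^ 3 * eta (\<tau> / 3) ^ 3 =
      r * s ^ 3 * u * (euler_prod z ^ 3 + 3 * z * euler_prod (z ^ 9) ^ 3)"
    unfolding e2 e3 by (simp add: algebra_simps)
  also have "s ^ 3 = (s * s) * s" by (simp add: power3_eq_cube)
  finally have "aexp (nome (- 1 / (3 * \<tau>))) = r * ((s * s) * s) * u * (euler_prod z ^ 3 + 3 * z * euler_prod (z ^ 9) ^ 3) / (s * eta \<tau>)" .
  moreover have "r * (- \<i> * \<tau> * s) * u * x / (s * (u * e)) = \<tau> * (- \<i> * r * (x / e))" for x e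
    using s0 u0 by (simp add: mult_ac)
  ultimately show ?thesis
    unfolding s2 e1 aexp_dual_def z_def[symmetric] r_def[symmetric] by (simp only:)
qed

text \<open>By \<open>euler_prod_cube_dissection\<close>, \<open>aexp_dual\<close> is unchanged when
  z is multiplied by a cube root of unity, so it is a function \<open>A\<close> of q = z^3 and makes
  a pair with \<open>aexp\<close>. That \<open>A\<close> is \<open>aexp\<close> itself is then
  forced by the absence of forms of negative weight.\<close>

lemma aexp_pair: "fricke_pair 1 aexp (\<lambda>q. - \<i> * of_real (sqrt 3) * aexp q)"
proof -
  define f where "f = (\<lambda>\<tau>. aexp_dual (nome (\<tau> / 3)))"
  define w where "w = nome (1 / 3)"
  have w3: "w ^ 3 = 1" using nome_mult_nat[of 3 "1 / 3"] by (simp add: w_def)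
  have hol: "aexp_dual holomorphic_on ball 0 1"
    unfolding aexp_dual_def by (auto intro!: holomorphic_intros simp: norm_power_less_1 euler_prod_nonzero)
  have h3: "\<tau> / 3 \<in> \<H>" if "\<tau> \<in> \<H>" for \<tau> using that by (simp add: upper_half_plane_def)
  have holf: "f holomorphic_on \<H>"
  proof -
    have "aexp_dual \<circ> (\<lambda>\<tau>. nome (\<tau> / 3)) holomorphic_on \<H>"
      by (rule holomorphic_on_compose_gen[OF _ hol])
         (use h3 nome_in_ball in \<open>auto intro!: holomorphic_intros\<close>)
    then show ?thesis by (simp add: f_def o_def)
  qed
  have per: "f (\<tau> + 1) = f \<tau>" if t: "\<tau> \<in> \<H>" for \<tau>
  proof -
    have "nome ((\<tau> + 1) / 3) = w * nome (\<tau> / 3)" by (simp add: add_divide_distrib nome_add w_def)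
    moreover have "(w * nome (\<tau> / 3)) ^ 3 = nome (\<tau> / 3) ^ 3" using w3 by (simp add: power_mult_distrib)
    ultimately show ?thesis
      using euler_prod_cube_dissection[OF norm_nome_less_1[OF h3[OF t]] w3] by (simp add: f_def aexp_dual_def)
  qed
  define r where "r = exp (- (2 * pi / 3))"
  have r: "0 < r" "r < 1" using pi_gt_zero by (auto simp: r_def)
  have "continuous_on (cball 0 r) aexp_dual"
    using r by (intro holomorphic_on_imp_continuous_on holomorphic_on_subset[OF hol]) auto
  then have "bounded (aexp_dual ` cball 0 r)" by (intro compact_imp_bounded compact_continuous_image) auto
  then obtain M where "\<forall>x\<in>aexp_dual ` cball 0 r. norm x \<le> M" unfolding bounded_iff by blast
  then have M: "\<And>z. z \<in> cball 0 r \<Longrightarrow> norm (aexp_dual z) \<le> M" by blast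
  have bnd: "norm (f \<tau>) \<le> M * Im \<tau> ^ 0" if "Im \<tau> \<ge> 1" for \<tau>
    using M[of "nome (\<tau> / 3)"] that by (simp add: f_def norm_nome r_def)
  obtain A where A: "A holomorphic_on ball 0 1" "\<And>\<tau>. \<tau> \<in> \<H> \<Longrightarrow> f \<tau> = A (nome \<tau>)"
    using periodic_imp_nome_expansion[OF holf per bnd] by blast
  \<comment> \<open>\<open>A\<close> is known only through nomes; its value at 0 comes from A(z^3) =
    \<open>aexp_dual z\<close> on the whole disc.\<close>
  have A0: "A 0 = 1"
  proof -
    have "A (z ^ 3) = aexp_dual z" if "z \<in> ball 0 1" for z
    proof (rule nome_expansion_unique[OF _ hol _ that])
      show "(\<lambda>z. A (z ^ 3)) holomorphic_on ball 0 1"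
      proof -
        have "A \<circ> (\<lambda>z. z ^ 3) holomorphic_on ball 0 1"
          by (rule holomorphic_on_compose_gen[OF _ A(1)])
             (auto simp: norm_power_less_1 intro!: holomorphic_intros)
        then show ?thesis by (simp add: o_def)
      qed
      fix \<tau> assume t: "\<tau> \<in> \<H>"
      then have "3 * \<tau> \<in> \<H>" by (simp add: upper_half_plane_def)
      from A(2)[OF this] show "A (nome \<tau> ^ 3) = aexp_dual (nome \<tau>)" by (simp add: f_def nome_multiple)
    qed
    from this[of 0] show ?thesis by (simp add: aexp_dual_def)
  qed
  let ?c = "- \<i> * of_real (sqrt 3) :: complex"
  have c2: "?c * ?c = - 3" using sqrt3_powers(1) by (simp add: power2_eq_square mult_ac)
  have pair: "fricke_pair 1 aexp (\<lambda>q. ?c * A q)"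
    unfolding fricke_pair_def
    using exps_holomorphic A aexp_fricke by (auto intro!: holomorphic_intros simp: f_def)
  \<comment> \<open>The swapped pair minus a multiple of the pair: its first expansion vanishes at
    0, so it is c times a form of weight 1 - 3 = -2, which is 0.\<close>
  have "fricke_pair 1 (\<lambda>q. ?c * A q - ?c * aexp q) (\<lambda>q. (- 3) powi 1 * aexp q - ?c * (?c * A q))"
    by (intro fricke_pair_diff fricke_pair_scale fricke_pair_swap pair)
  from fricke_pair_divide_cexp[OF this] obtain F' G' where FG': "fricke_pair (1 - 3) F' G'"
      and eq: "\<forall>q\<in>ball 0 1. ?c * A q - ?c * aexp q = F' q * cexp q"
    using A0 by auto
  have "F' q = 0" if "q \<in> ball 0 1" for q using fricke_pair_negative[OF FG' _ that] by simp
  then have "?c * A q = ?c * aexp q" if "q \<in> ball 0 1" for q using eq that by simp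
  then show ?thesis using fricke_pair_cong[OF pair] by auto
qed

theorem fricke_pair_structure:
  assumes "fricke_pair (int k) F G"
  shows "\<exists>\<alpha>. \<forall>q\<in>ball 0 1. F q = (\<Sum>j\<le>k div 3. \<alpha> j * (aexp q ^ (k - 3 * j) * cexp q ^ j))"
  using assms
proof (induction k arbitrary: F G rule: less_induct)
  case (less k)
  have "fricke_pair (int k) (\<lambda>q. F q - F 0 * aexp q ^ k) (\<lambda>q. G q - F 0 * (- \<i> * of_real (sqrt 3) * aexp q) ^ k)"
    using fricke_pair_diff[OF less.prems fricke_pair_scale[OF fricke_pair_power[OF aexp_pair, of k, unfolded mult_1_right], of "F 0"]] .
  from fricke_pair_divide_cexp[OF this] obtain F' G' where FG': "fricke_pair (int k - 3) F' G'"
      and eq: "\<And>q. q \<in> ball 0 1 \<Longrightarrow> F q - F 0 * aexp q ^ k = F' q * cexp q"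
    by auto
  show ?case
  proof (cases "k < 3")
    \<comment> \<open>Here the quotient by c has negative weight.\<close>
    case True
    then have "F q = F 0 * aexp q ^ k" if "q \<in> ball 0 1" for q
      using eq[OF that] fricke_pair_negative[OF FG' _ that] by simp
    moreover have k0: "k div 3 = 0" using True by simp
    have "(\<Sum>j\<le>k div 3. F 0 * (aexp q ^ (k - 3 * j) * cexp q ^ j)) = F 0 * aexp q ^ k" for q
      unfolding k0 by simp
    ultimately show ?thesis by (intro exI[of _ "\<lambda>_. F 0"]) (simp only:, blast)
  next
    case False
    then have k3': "int k - 3 = int (k - 3)" by simp
    from FG' have "fricke_pair (int (k - 3)) F' G'" unfolding k3' .
    from less.IH[OF _ this] False obtain \<beta> where b: "\<And>q. q \<in> ball 0 1 \<Longrightarrow>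
        F' q = (\<Sum>j\<le>(k - 3) div 3. \<beta> j * (aexp q ^ (k - 3 - 3 * j) * cexp q ^ j))"
      by (auto simp: not_less)
    \<comment> \<open>Index 0 holds the coefficient of the subtracted a^k; multiplying by c shifts
      the others by one.\<close>
    define \<alpha> where "\<alpha> = (\<lambda>j. case j of 0 \<Rightarrow> F 0 | Suc i \<Rightarrow> \<beta> i)"
    have k3: "k div 3 = Suc ((k - 3) div 3)" using False le_div_geq[of 3 k] by simp
    have "F q = (\<Sum>j\<le>k div 3. \<alpha> j * (aexp q ^ (k - 3 * j) * cexp q ^ j))" if q: "q \<in> ball 0 1" for q
    proof -
      have "(\<Sum>j\<le>k div 3. \<alpha> j * (aexp q ^ (k - 3 * j) * cexp q ^ j)) =
          F 0 * aexp q ^ k + (\<Sum>i\<le>(k - 3) div 3. \<beta> i * (aexp q ^ (k - 3 * Suc i) * cexp q ^ Suc i))"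
        unfolding k3 by (subst sum.atMost_Suc_shift) (simp add: \<alpha>_def)
      also have "(\<Sum>i\<le>(k - 3) div 3. \<beta> i * (aexp q ^ (k - 3 * Suc i) * cexp q ^ Suc i)) = F' q * cexp q"
        unfolding b[OF q] sum_distrib_right by (rule sum.cong) (auto simp: mult_ac)
      finally show ?thesis using eq[OF q] by (simp add: algebra_simps)
    qed
    then show ?thesis by blast
  qed
qed

section \<open>Serre derivatives\<close>

lemma fricke_expansion_has_field_derivative:
  assumes "F holomorphic_on ball 0 1" "\<tau> \<in> \<H>"
  shows "((\<lambda>\<tau>. F (nome \<tau>)) has_field_derivative 2 * of_real pi * \<i> * (nome \<tau> * deriv F (nome \<tau>))) (at \<tau>)"
proof -
  have "(F has_field_derivative deriv F (nome \<tau>)) (at (nome \<tau>))"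
    using holomorphic_derivI[OF assms(1) open_ball nome_in_ball[OF assms(2)]] .
  from DERIV_chain2[OF this nome_has_field_derivative, of UNIV] show ?thesis by (simp add: mult_ac)
qed

lemma fricke_image_has_field_derivative:
  assumes "F holomorphic_on ball 0 1" "\<tau> \<in> \<H>"
  shows "((\<lambda>\<tau>. F (nome (- 1 / (3 * \<tau>)))) has_field_derivative
     2 * of_real pi * \<i> * (nome (- 1 / (3 * \<tau>)) * deriv F (nome (- 1 / (3 * \<tau>)))) / (3 * \<tau>\<^sup>2)) (at \<tau>)"
proof -
  have "((\<lambda>\<tau>. - 1 / (3 * \<tau>)) has_field_derivative 1 / (3 * \<tau>\<^sup>2)) (at \<tau>)"
    using uhp_nonzero[OF assms(2)] by (auto intro!: derivative_eq_intros simp: field_simps power2_eq_square)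
  from DERIV_chain2[OF fricke_expansion_has_field_derivative[OF assms(1) fricke_uhp[OF assms(2)]] this]
  show ?thesis by simp
qed

lemma DERIV_unique_uhp:
  assumes "(f has_field_derivative a) (at \<tau>)" "(g has_field_derivative b) (at \<tau>)"
    "\<tau> \<in> \<H>" "\<And>x. x \<in> \<H> \<Longrightarrow> f x = g x"
  shows "a = b"
proof -
  have "(f has_field_derivative b) (at \<tau>)"
    by (rule has_field_derivative_transform_within_open[OF assms(2) open_uhp assms(3)]) (use assms(4) in auto)
  then show ?thesis using assms(1) DERIV_unique by blast
qed

text \<open>Differentiating the Fricke equation produces an extra term with k \<tau>^(k-1), which
  the linear term 9 \<tau>/(pi i) of \<open>pexp_fricke\<close> cancels after multiplication by k.
  The factor 3 of the dual is the inverse of the 1/3 in the derivative 1/(3 \<tau>^2) of the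
  involution.\<close>

lemma fricke_pair_serre:
  assumes FG: "fricke_pair k F G"
  shows "fricke_pair (k + 2) (\<lambda>q. 6 * (q * deriv F q) - of_int k * pexp q * F q)
           (\<lambda>q. 3 * (6 * (q * deriv G q) - of_int k * pexp q * G q))"
  unfolding fricke_pair_def
proof (intro conjI ballI)
  note D = fricke_pairD[OF FG]
  show "(\<lambda>q. 6 * (q * deriv F q) - of_int k * pexp q * F q) holomorphic_on ball 0 1"
    "(\<lambda>q. 3 * (6 * (q * deriv G q) - of_int k * pexp q * G q)) holomorphic_on ball 0 1"
    by (intro holomorphic_intros D exps_holomorphic holomorphic_deriv open_ball)+
  fix \<tau> assume t: "\<tau> \<in> \<H>"
  have t0: "\<tau> \<noteq> 0" using t by (rule uhp_nonzero)
  let ?c = "2 * of_real pi * \<i> :: complex"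
  define X where "X = nome (- 1 / (3 * \<tau>)) * deriv F (nome (- 1 / (3 * \<tau>)))"
  define Y where "Y = nome \<tau> * deriv G (nome \<tau>)"
  define g where "g = G (nome \<tau>)"
  define f where "f = F (nome (- 1 / (3 * \<tau>)))"
  define T where "T = \<tau> powi k"
  have f: "f = T * g" unfolding f_def T_def g_def by (rule D(3)[OF t])
  have Tk: "\<tau> powi (k - 1) = T / \<tau>" "\<tau> powi (k + 2) = T * \<tau>\<^sup>2"
    using t0 by (simp_all add: T_def power_int_diff power_int_add)
  have d1: "((\<lambda>\<tau>. \<tau> powi k) has_field_derivative of_int k * (T / \<tau>)) (at \<tau>)"
    using t0 unfolding Tk(1)[symmetric] by (auto intro!: derivative_eq_intros)
  have d2: "((\<lambda>\<tau>. G (nome \<tau>)) has_field_derivative ?c * Y) (at \<tau>)"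
    unfolding Y_def by (rule fricke_expansion_has_field_derivative[OF D(2) t])
  have dG: "((\<lambda>\<tau>. \<tau> powi k * G (nome \<tau>)) has_field_derivative
      of_int k * (T / \<tau>) * g + ?c * Y * T) (at \<tau>)"
    using DERIV_mult[OF d1 d2] unfolding g_def T_def .
  have dF: "((\<lambda>\<tau>. F (nome (- 1 / (3 * \<tau>)))) has_field_derivative ?c * X / (3 * \<tau>\<^sup>2)) (at \<tau>)"
    unfolding X_def by (rule fricke_image_has_field_derivative[OF D(1) t])
  have e: "?c * X / (3 * \<tau>\<^sup>2) = of_int k * (T / \<tau>) * g + ?c * Y * T"
    by (rule DERIV_unique_uhp[OF dF dG t]) (rule D(3))
  define p where "p = (of_real pi * \<i> :: complex)"
  have p0: "p \<noteq> 0" by (simp add: p_def)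
  have "2 * p * X = 2 * p * (3 * \<tau>\<^sup>2 * T * Y + 3 * of_int k * \<tau> * T * g / (2 * p))"
    using e t0 p0 unfolding p_def[symmetric] mult.assoc by (simp add: field_simps power2_eq_square)
  then have X: "X = 3 * \<tau>\<^sup>2 * T * Y + 3 * of_int k * \<tau> * T * g / (2 * p)" using p0 by simp
  have P: "pexp (nome (- 1 / (3 * \<tau>))) = 3 * \<tau>\<^sup>2 * pexp (nome \<tau>) + 9 * \<tau> / p"
    using pexp_fricke[OF t] by (simp add: p_def)
  have "6 * X - of_int k * pexp (nome (- 1 / (3 * \<tau>))) * f =
      T * \<tau>\<^sup>2 * (3 * (6 * Y - of_int k * pexp (nome \<tau>) * g))"
    unfolding X P f using p0 by (simp add: field_simps)
  then show "6 * (nome (- 1 / (3 * \<tau>)) * deriv F (nome (- 1 / (3 * \<tau>)))) -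
        of_int k * pexp (nome (- 1 / (3 * \<tau>))) * F (nome (- 1 / (3 * \<tau>))) =
      \<tau> powi (k + 2) * (3 * (6 * (nome \<tau> * deriv G (nome \<tau>)) - of_int k * pexp (nome \<tau>) * G (nome \<tau>)))"
    unfolding X_def[symmetric] Y_def[symmetric] f_def[symmetric] g_def[symmetric] Tk .
qed

text \<open>P_3 serves as its own correction term: because of its linear anomaly the square appears
  with coefficient 1, not with the 2 that a form of weight 2 would require in
  \<open>fricke_pair_serre\<close>.\<close>

lemma pexp_serre:
  "fricke_pair 4 (\<lambda>q. 6 * (q * deriv pexp q) - (pexp q)\<^sup>2) (\<lambda>q. 9 * (6 * (q * deriv pexp q) - (pexp q)\<^sup>2))"
  unfolding fricke_pair_def
proof (intro conjI ballI)
  show "(\<lambda>q. 6 * (q * deriv pexp q) - (pexp q)\<^sup>2) holomorphic_on ball 0 1"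
    "(\<lambda>q. 9 * (6 * (q * deriv pexp q) - (pexp q)\<^sup>2)) holomorphic_on ball 0 1"
    by (intro holomorphic_intros exps_holomorphic holomorphic_deriv open_ball)+
  fix \<tau> assume t: "\<tau> \<in> \<H>"
  have t0: "\<tau> \<noteq> 0" using t by (rule uhp_nonzero)
  define p where "p = (of_real pi * \<i> :: complex)"
  have p0: "p \<noteq> 0" by (simp add: p_def)
  let ?c = "2 * of_real pi * \<i> :: complex"
  define X where "X = nome (- 1 / (3 * \<tau>)) * deriv pexp (nome (- 1 / (3 * \<tau>)))"
  define Y where "Y = nome \<tau> * deriv pexp (nome \<tau>)"
  define g where "g = pexp (nome \<tau>)"
  have d1: "((\<lambda>\<tau>. 3 * \<tau>\<^sup>2) has_field_derivative 6 * \<tau>) (at \<tau>)"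
    by (auto intro!: derivative_eq_intros)
  have d2: "((\<lambda>\<tau>. pexp (nome \<tau>)) has_field_derivative ?c * Y) (at \<tau>)"
    unfolding Y_def by (rule fricke_expansion_has_field_derivative[OF exps_holomorphic(1) t])
  have d3: "((\<lambda>\<tau>. 9 * \<tau> / p) has_field_derivative 9 / p) (at \<tau>)"
    using p0 by (auto intro!: derivative_eq_intros)
  have dG: "((\<lambda>\<tau>. 3 * \<tau>\<^sup>2 * pexp (nome \<tau>) + 9 * \<tau> / p) has_field_derivative
      6 * \<tau> * g + ?c * Y * (3 * \<tau>\<^sup>2) + 9 / p) (at \<tau>)"
    using DERIV_add[OF DERIV_mult[OF d1 d2] d3] unfolding g_def .
  have dF: "((\<lambda>\<tau>. pexp (nome (- 1 / (3 * \<tau>)))) has_field_derivative ?c * X / (3 * \<tau>\<^sup>2)) (at \<tau>)"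
    unfolding X_def by (rule fricke_image_has_field_derivative[OF exps_holomorphic(1) t])
  have e: "?c * X / (3 * \<tau>\<^sup>2) = 6 * \<tau> * g + ?c * Y * (3 * \<tau>\<^sup>2) + 9 / p"
    by (rule DERIV_unique_uhp[OF dF dG t]) (simp only: pexp_fricke p_def)
  have X: "X = 9 * \<tau> ^ 4 * Y + 9 * \<tau> ^ 3 * g / p + 27 * \<tau>\<^sup>2 / (2 * p\<^sup>2)"
    using e t0 p0 unfolding p_def[symmetric] mult.assoc by (simp add: field_simps power2_eq_square power3_eq_cube power4_eq_xxxx)
  have P: "pexp (nome (- 1 / (3 * \<tau>))) = 3 * \<tau>\<^sup>2 * g + 9 * \<tau> / p"
    using pexp_fricke[OF t] by (simp add: p_def g_def)
  have "6 * X - (pexp (nome (- 1 / (3 * \<tau>))))\<^sup>2 = \<tau> ^ 4 * (9 * (6 * Y - g\<^sup>2))"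
    unfolding X P using p0 by (simp add: field_simps power2_eq_square power3_eq_cube power4_eq_xxxx)
  then show "6 * (nome (- 1 / (3 * \<tau>)) * deriv pexp (nome (- 1 / (3 * \<tau>)))) - (pexp (nome (- 1 / (3 * \<tau>))))\<^sup>2 =
      \<tau> powi 4 * (9 * (6 * (nome \<tau> * deriv pexp (nome \<tau>)) - (pexp (nome \<tau>))\<^sup>2))"
    unfolding X_def[symmetric] Y_def[symmetric] g_def[symmetric] by simp
qed

abbreviation dual_a :: complex where "dual_a \<equiv> - \<i> * of_real (sqrt 3)"
abbreviation dual_c :: complex where "dual_c \<equiv> \<i> / (3 * of_real (sqrt 3))"

lemma dual_constants: "dual_a\<^sup>2 = - 3" "dual_a ^ 3 = 3 * of_real (sqrt 3) * \<i>" "dual_a ^ 4 = 9" "dual_a * dual_c = 1 / 3"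
proof -
  show 2: "dual_a\<^sup>2 = - 3" using sqrt3_powers(1) by (simp add: power_mult_distrib)
  then show "dual_a ^ 3 = 3 * of_real (sqrt 3) * \<i>" by (simp add: power3_eq_cube power2_eq_square)
  have "dual_a ^ 4 = (dual_a\<^sup>2)\<^sup>2" by (simp flip: power_mult)
  then show "dual_a ^ 4 = 9" unfolding 2 by simp
  show "dual_a * dual_c = 1 / 3" using sqrt3_powers(3) by (simp add: field_simps)
qed

lemma fricke_pair_weight_2:
  assumes "fricke_pair 2 F G" "q \<in> ball 0 1"
  shows "F q = F 0 * (aexp q)\<^sup>2"
proof -
  obtain \<alpha> where a: "\<forall>q\<in>ball 0 1. F q = \<alpha> * (aexp q)\<^sup>2"
    using fricke_pair_structure[of 2 F G] assms(1) by auto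
  then have "F 0 = \<alpha>" by simp
  then show ?thesis using a assms(2) by simp
qed

text \<open>In weights 3 and 4 the second coefficient is read off from the values at the other cusp.\<close>

lemma fricke_pair_weight_3:
  assumes FG: "fricke_pair 3 F G" and q: "q \<in> ball 0 1"
  shows "F q = F 0 * aexp q ^ 3 + (G 0 - F 0 * dual_a ^ 3) / dual_c * cexp q"
proof -
  obtain \<alpha> where "\<forall>q\<in>ball 0 1. F q = (\<Sum>j\<le>1. \<alpha> j * (aexp q ^ (3 - 3 * j) * cexp q ^ j))"
    using fricke_pair_structure[of 3 F G] FG by auto
  then have a: "F q = \<alpha> 0 * aexp q ^ 3 + \<alpha> 1 * cexp q" if "q \<in> ball 0 1" for q using that by simp
  have F0: "F 0 = \<alpha> 0" using a[of 0] by simp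
  have a3: "fricke_pair 3 (\<lambda>q. aexp q ^ 3) (\<lambda>q. (dual_a * aexp q) ^ 3)"
    using fricke_pair_power[OF aexp_pair, of 3] by simp
  \<comment> \<open>At the other cusp neither a^3 nor c vanishes, so the dual constant term
    determines the coefficient of c.\<close>
  have "G 0 = \<alpha> 0 * (dual_a * aexp 0) ^ 3 + \<alpha> 1 * (dual_c * bexp 0)"
    by (rule fricke_pair_unique[OF FG fricke_pair_add[OF fricke_pair_scale[OF a3] fricke_pair_scale[OF cexp_pair]] a]) auto
  then have "\<alpha> 1 = (G 0 - F 0 * dual_a ^ 3) / dual_c"
    using F0 sqrt3_powers(3) by (simp add: field_simps)
  then show ?thesis using a[OF q] F0 by simp
qed

lemma fricke_pair_weight_4:
  assumes FG: "fricke_pair 4 F G" and q: "q \<in> ball 0 1"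
  shows "F q = F 0 * aexp q ^ 4 + 3 * (G 0 - 9 * F 0) * (aexp q * cexp q)"
proof -
  obtain \<alpha> where "\<forall>q\<in>ball 0 1. F q = (\<Sum>j\<le>1. \<alpha> j * (aexp q ^ (4 - 3 * j) * cexp q ^ j))"
    using fricke_pair_structure[of 4 F G] FG by auto
  then have a: "F q = \<alpha> 0 * aexp q ^ 4 + \<alpha> 1 * (aexp q * cexp q)" if "q \<in> ball 0 1" for q using that by simp
  have F0: "F 0 = \<alpha> 0" using a[of 0] by simp
  have a4: "fricke_pair 4 (\<lambda>q. aexp q ^ 4) (\<lambda>q. (dual_a * aexp q) ^ 4)"
    using fricke_pair_power[OF aexp_pair, of 4] by simp
  have ac: "fricke_pair 4 (\<lambda>q. aexp q * cexp q) (\<lambda>q. (dual_a * aexp q) * (dual_c * bexp q))"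
    using fricke_pair_mult[OF aexp_pair cexp_pair] by simp
  have "G 0 = \<alpha> 0 * (dual_a * aexp 0) ^ 4 + \<alpha> 1 * ((dual_a * aexp 0) * (dual_c * bexp 0))"
    by (rule fricke_pair_unique[OF FG fricke_pair_add[OF fricke_pair_scale[OF a4] fricke_pair_scale[OF ac]] a]) auto
  also have "(dual_a * aexp 0) ^ 4 = 9" using dual_constants(3) by simp
  also have "(dual_a * aexp 0) * (dual_c * bexp 0) = 1 / 3" using dual_constants(4) by simp
  finally have "\<alpha> 1 = 3 * (G 0 - 9 * F 0)" using F0 by simp
  then show ?thesis using a[OF q] F0 by simp
qed

text \<open>In weight 2 the only monomial is a^2, and both sides are 1 at q = 0.\<close>

lemma qexp_eq_aexp: "q \<in> ball 0 1 \<Longrightarrow> qexp q = (aexp q)\<^sup>2"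
  using fricke_pair_weight_2[OF qexp_pair] by simp

text \<open>The cubic identity a^3 = b^3 + c^3 of the Borweins. The coefficient -27 results from the
  constant terms 1 and 0 at the two cusps.\<close>

lemma bexp_eq:
  assumes "q \<in> ball 0 1"
  shows "bexp q = aexp q ^ 3 - 27 * cexp q"
proof -
  have c: "(0 - 1 * dual_a ^ 3) / dual_c = - 27"
    unfolding dual_constants using sqrt3_powers(1,3) by (simp add: field_simps power2_eq_square)
  show ?thesis using fricke_pair_weight_3[OF bexp_pair assms] unfolding exps_0 mult_zero_right c by simp
qed

text \<open>The Serre derivative of a has weight 3, hence is a combination of a^3 and c, fixed by
  its values -1 and -3 \<open>dual_a\<close> at the two cusps.\<close>

lemma aexp_deriv:
  assumes "q \<in> ball 0 1"
  shows "6 * (q * deriv aexp q) = pexp q * aexp q - aexp q ^ 3 + 54 * cexp q"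
proof -
  have p: "fricke_pair 3 (\<lambda>q. 6 * (q * deriv aexp q) - pexp q * aexp q)
     (\<lambda>q. 3 * (6 * (q * deriv (\<lambda>q. dual_a * aexp q) q) - pexp q * (dual_a * aexp q)))"
    using fricke_pair_serre[OF aexp_pair] by simp
  have c: "(3 * (- dual_a) - (- 1) * dual_a ^ 3) / dual_c = 54"
    unfolding dual_constants using sqrt3_powers(1,3) by (simp add: field_simps power2_eq_square)
  have "6 * (q * deriv aexp q) - pexp q * aexp q = - 1 * aexp q ^ 3 + (3 * (- dual_a) - (- 1) * dual_a ^ 3) / dual_c * cexp q"
    using fricke_pair_weight_3[OF p assms] by simp
  then show ?thesis unfolding c by (simp add: algebra_simps)
qed

text \<open>The constant terms in \<open>pexp_serre\<close> are -1 and -9, for which the coefficient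
  of a c in weight 4 is 0; only -a^4, the square of Q_3 with a minus sign, is left.\<close>

lemma pexp_deriv:
  assumes "q \<in> ball 0 1"
  shows "6 * (q * deriv pexp q) = (pexp q)\<^sup>2 - (qexp q)\<^sup>2"
  using fricke_pair_weight_4[OF pexp_serre assms] unfolding qexp_eq_aexp[OF assms]
  by (simp add: algebra_simps flip: power_mult)

text \<open>Logarithmic differentiation of the product gives (9 E_2(q^3) - E_2(q)) / 8, which is
  half of P_3 + Q_3; the factor q of \<open>cexp\<close> cancels the constants.\<close>

lemma cexp_deriv:
  assumes q: "q \<in> ball 0 1"
  shows "2 * (q * deriv cexp q) = cexp q * (pexp q + qexp q)"
proof -
  have n: "norm q < 1" "norm (q ^ 3) < 1" using q by (auto simp: norm_power_less_1)
  define u v u' v' where "u = euler_prod q" and "v = euler_prod (q ^ 3)"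
    and "u' = deriv euler_prod q" and "v' = deriv euler_prod (q ^ 3)"
  have nz: "u \<noteq> 0" "v \<noteq> 0" using n by (auto simp: u_def v_def euler_prod_nonzero)
  have 1: "(euler_prod has_field_derivative u') (at q)"
    unfolding u'_def using holomorphic_derivI[OF euler_prod_holomorphic open_ball q] .
  have "(euler_prod has_field_derivative v') (at (q ^ 3))"
    unfolding v'_def using holomorphic_derivI[OF euler_prod_holomorphic open_ball] n by simp
  moreover have "((\<lambda>q. q ^ 3) has_field_derivative 3 * q\<^sup>2) (at q)" by (auto intro!: derivative_eq_intros)
  ultimately have 2: "((\<lambda>q. euler_prod (q ^ 3)) has_field_derivative v' * (3 * q\<^sup>2)) (at q)"
    by (rule DERIV_chain2)
  have u: "q * u' = (E2 q - 1) / 24 * u" unfolding u_def u'_def by (rule euler_prod_deriv[OF n(1)])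
  have v: "q ^ 3 * v' = (E2 (q ^ 3) - 1) / 24 * v" unfolding v_def v'_def by (rule euler_prod_deriv[OF n(2)])
  have "((\<lambda>q. q * (euler_prod (q ^ 3) ^ 9 / euler_prod q ^ 3)) has_field_derivative
      1 * (v ^ 9 / u ^ 3) + (of_nat 9 * (v' * (3 * q\<^sup>2) * v ^ (9 - Suc 0)) * u ^ 3 -
        v ^ 9 * (of_nat 3 * (u' * u ^ (3 - Suc 0)))) / (u ^ 3 * u ^ 3) * q) (at q)"
    unfolding u_def v_def
    by (rule DERIV_mult[OF DERIV_ident DERIV_divide[OF DERIV_power[OF 2] DERIV_power[OF 1]]])
       (use nz in \<open>simp add: u_def\<close>)
  then have "deriv cexp q = 1 * (v ^ 9 / u ^ 3) + (of_nat 9 * (v' * (3 * q\<^sup>2) * v ^ (9 - Suc 0)) * u ^ 3 -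
        v ^ 9 * (of_nat 3 * (u' * u ^ (3 - Suc 0)))) / (u ^ 3 * u ^ 3) * q"
    unfolding cexp_def[abs_def] by (rule DERIV_imp_deriv)
  also have "\<dots> = v ^ 9 / u ^ 3 * (1 + 27 * (q ^ 3 * v') / v - 3 * (q * u') / u)"
    using nz by (simp add: field_simps eval_nat_numeral)
  also have "\<dots> = v ^ 9 / u ^ 3 * ((pexp q + qexp q) / 2)"
    unfolding u v using nz by (simp add: pexp_def qexp_def field_simps)
  finally show ?thesis by (simp add: cexp_def u_def v_def)
qed

section \<open>Modular forms as pairs\<close>

lemma SL2Z_iff: "\<gamma> \<in> SL2Z \<longleftrightarrow> \<gamma> $ 1 $ 1 * \<gamma> $ 2 $ 2 - \<gamma> $ 1 $ 2 * \<gamma> $ 2 $ 1 = 1"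
  by (simp add: SL2Z_def det_2)

lemma Gamma0_iff: "\<gamma> \<in> Gamma0 3 \<longleftrightarrow>
    \<gamma> $ 1 $ 1 * \<gamma> $ 2 $ 2 - \<gamma> $ 1 $ 2 * \<gamma> $ 2 $ 1 = 1 \<and> 3 dvd \<gamma> $ 2 $ 1"
  by (simp add: Gamma0_def SL2Z_iff)

lemma exists_int_matrix:
  fixes a b c d :: int
  obtains \<gamma> :: "int^2^2" where "\<gamma> $ 1 $ 1 = a" "\<gamma> $ 1 $ 2 = b" "\<gamma> $ 2 $ 1 = c" "\<gamma> $ 2 $ 2 = d"
proof
  let ?m = "vector [vector [a, b], vector [c, d]] :: int^2^2"
  show "?m $ 1 $ 1 = a" "?m $ 1 $ 2 = b" "?m $ 2 $ 1 = c" "?m $ 2 $ 2 = d" by simp_all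
qed

lemma denominator_nonzero:
  fixes a b c d :: int
  assumes "a * d - b * c = 1" "\<tau> \<in> \<H>"
  shows "of_int c * \<tau> + of_int d \<noteq> 0"
proof
  assume *: "of_int c * \<tau> + of_int d = 0"
  then have "Im (of_int c * \<tau> + of_int d) = 0" by simp
  then have "c = 0" using assms(2) by (simp add: upper_half_plane_def)
  with * have "d = 0" by simp
  with \<open>c = 0\<close> assms(1) show False by simp
qed

lemma moebius_in_uhp:
  fixes a b c d :: int
  assumes det: "a * d - b * c = 1" and t: "\<tau> \<in> \<H>"
  shows "(of_int a * \<tau> + of_int b) / (of_int c * \<tau> + of_int d) \<in> \<H>"
proof -
  let ?D = "of_int c * \<tau> + of_int d"
  have D0: "?D \<noteq> 0" by (rule denominator_nonzero[OF det t])
  have D: "(Re ?D)\<^sup>2 + (Im ?D)\<^sup>2 > 0"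
    using D0 complex_neq_0 by blast
  have "Im ((of_int a * \<tau> + of_int b) / ?D) =
      ((of_int a * Im \<tau>) * (of_int c * Re \<tau> + of_int d) - (of_int a * Re \<tau> + of_int b) * (of_int c * Im \<tau>)) / ((Re ?D)\<^sup>2 + (Im ?D)\<^sup>2)"
    by (simp add: Im_divide)
  also have "(of_int a * Im \<tau>) * (of_int c * Re \<tau> + of_int d) - (of_int a * Re \<tau> + of_int b) * (of_int c * Im \<tau>) =
      real_of_int (a * d - b * c) * Im \<tau>" by (simp add: algebra_simps)
  finally show ?thesis using D t det by (simp add: upper_half_plane_def)
qed

lemma nearest_multiple: "y \<noteq> 0 \<Longrightarrow> \<exists>n. 2 * \<bar>x + n * y\<bar> \<le> \<bar>y :: int\<bar>"
proof -
  assume y: "y \<noteq> 0"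
  have e: "x + (- (x div y)) * y = x mod y" "x + (- (x div y) - 1) * y = x mod y - y"
    by (simp_all add: minus_div_mult_eq_mod[symmetric] algebra_simps)
  define r where "r = x mod y"
  have "0 < y \<Longrightarrow> 0 \<le> r \<and> r < y" "y < 0 \<Longrightarrow> y < r \<and> r \<le> 0" by (auto simp: r_def)
  then have "2 * \<bar>r\<bar> \<le> \<bar>y\<bar> \<or> 2 * \<bar>r - y\<bar> \<le> \<bar>y\<bar>" using y by arith
  then have "2 * \<bar>x mod y\<bar> \<le> \<bar>y\<bar> \<or> 2 * \<bar>x mod y - y\<bar> \<le> \<bar>y\<bar>" unfolding r_def .
  then show ?thesis using e by metis
qed

text \<open>
  Reduction of the bottom row \<open>(c, d)\<close> by right multiplication with powers of
  \<open>(1, 1; 0, 1)\<close> and \<open>(1, 0; 3, 1)\<close>: after \<open>2 \<bar>d\<bar> \<le> \<bar>c\<bar>\<close>, the second step gives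
  \<open>2 \<bar>c\<bar> \<le> 3 \<bar>d\<bar>\<close>, so \<open>\<bar>c\<bar>\<close> shrinks by a factor 3/4.
\<close>

lemma Gamma0_3_induct:
  fixes a b c d :: int
  assumes "3 dvd c" "a * d - b * c = 1"
    and base: "\<And>a b d. a * d = 1 \<Longrightarrow> P a b 0 d"
    and T: "\<And>a b c d n. 3 dvd c \<Longrightarrow> a * d - b * c = 1 \<Longrightarrow> P a (b + n * a) c (d + n * c) \<Longrightarrow> P a b c d"
    and V: "\<And>a b c d m. 3 dvd c \<Longrightarrow> a * d - b * c = 1 \<Longrightarrow> P (a + 3 * m * b) b (c + 3 * m * d) d \<Longrightarrow> P a b c d"
  shows "P a b c d"
  using assms(1,2)
proof (induction "nat \<bar>c\<bar>" arbitrary: a b c d rule: less_induct)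
  case less
  show ?case
  proof (cases "c = 0")
    case True
    then show ?thesis using less.prems base by simp
  next
    case False
    obtain n where n: "2 * \<bar>d + n * c\<bar> \<le> \<bar>c\<bar>" using nearest_multiple[OF False] by blast
    define b' d' where "b' = b + n * a" and "d' = d + n * c"
    have det': "a * d' - b' * c = 1" using less.prems(2) by (simp add: b'_def d'_def algebra_simps)
    \<comment> \<open>Otherwise the determinant makes c a unit, although 3 divides it.\<close>
    have d0: "d' \<noteq> 0"
    proof
      assume "d' = 0"
      then have "c * (- b') = 1" using det' by (simp add: mult.commute)
      then have "c dvd 1" by (metis dvd_triv_left)
      with less.prems(1) have "(3::int) dvd 1" using dvd_trans by blast
      then show False by simp
    qed
    obtain m where m: "2 * \<bar>c + m * (3 * d')\<bar> \<le> \<bar>3 * d'\<bar>" using nearest_multiple[of "3 * d'" c] d0 by auto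
    define a' c' where "a' = a + 3 * m * b'" and "c' = c + 3 * m * d'"
    have c': "2 * \<bar>c'\<bar> \<le> 3 * \<bar>d'\<bar>" using m by (simp add: c'_def mult_ac abs_mult)
    have "2 * \<bar>d'\<bar> \<le> \<bar>c\<bar>" using n by (simp add: d'_def)
    then have "nat \<bar>c'\<bar> < nat \<bar>c\<bar>" using c' False by linarith
    moreover have "3 dvd c'" using less.prems(1) by (simp add: c'_def mult.assoc)
    moreover have "a' * d' - b' * c' = 1" using det' by (simp add: a'_def c'_def algebra_simps)
    ultimately have "P a' b' c' d'" by (rule less.hyps)
    then have "P a b' c d'" unfolding a'_def c'_def by (rule V[OF less.prems(1) det'])
    then show ?thesis unfolding b'_def d'_def by (rule T[OF less.prems])
  qed
qed

text \<open>The shear is the conjugate of the translation by -m under the involution, and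
  translation invariance of the dual expansion is automatic.\<close>

lemma fricke_pair_shear:
  assumes FG: "fricke_pair k F G" and t: "\<tau> \<in> \<H>"
  shows "F (nome (\<tau> / (1 + 3 * of_int m * \<tau>))) = (1 + 3 * of_int m * \<tau>) powi k * F (nome \<tau>)"
proof -
  have t0: "\<tau> \<noteq> 0" using t by (rule uhp_nonzero)
  have D0: "1 + 3 * of_int m * \<tau> \<noteq> 0"
    using denominator_nonzero[of 1 1 0 "3 * m" \<tau>] t by (simp add: add.commute)
  define x where "x = - 1 / (3 * \<tau>)"
  define y where "y = x + of_int (- m)"
  have xH: "x \<in> \<H>" unfolding x_def by (rule fricke_uhp[OF t])
  then have yH: "y \<in> \<H>" by (simp add: y_def upper_half_plane_def)
  have yx: "y = (1 + 3 * of_int m * \<tau>) * x" using t0 by (simp add: x_def y_def field_simps)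
  have 1: "- 1 / (3 * x) = \<tau>" using t0 by (simp add: x_def)
  have x0: "x \<noteq> 0" using xH by (rule uhp_nonzero)
  have 2: "- 1 / (3 * y) = \<tau> / (1 + 3 * of_int m * \<tau>)"
  proof -
    have "- 1 / (3 * y) = (- 1 / (3 * x)) / (1 + 3 * of_int m * \<tau>)" unfolding yx by simp
    then show ?thesis unfolding 1 .
  qed
  have "F (nome (\<tau> / (1 + 3 * of_int m * \<tau>))) = y powi k * G (nome y)"
    using fricke_pairD(3)[OF FG yH] unfolding 2 .
  also have "nome y = nome x" unfolding y_def nome_add nome_of_int by simp
  also have "y powi k = (1 + 3 * of_int m * \<tau>) powi k * x powi k" unfolding yx by (rule power_int_mult_distrib)
  also have "(1 + 3 * of_int m * \<tau>) powi k * x powi k * G (nome x) = (1 + 3 * of_int m * \<tau>) powi k * F (nome \<tau>)"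
    using fricke_pairD(3)[OF FG xH] unfolding 1 by simp
  finally show ?thesis .
qed

text \<open>Evenness of k is used in the base case, where a = d = -1 gives the factor (-1)^k; the
  other two cases transport the law along a translation and a shear.\<close>

lemma fricke_pair_transform:
  fixes a b c d :: int
  assumes FG: "fricke_pair (int k) F G" and k: "even k" and c: "3 dvd c" and det: "a * d - b * c = 1"
    and t: "\<tau> \<in> \<H>"
  shows "F (nome ((of_int a * \<tau> + of_int b) / (of_int c * \<tau> + of_int d))) = (of_int c * \<tau> + of_int d) ^ k * F (nome \<tau>)"
proof -
  let ?P = "\<lambda>a b c d. \<forall>\<tau>\<in>\<H>. F (nome ((of_int a * \<tau> + of_int b) / (of_int c * \<tau> + of_int d))) =
      (of_int c * \<tau> + of_int d) ^ k * F (nome \<tau>)"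
  have "?P a b c d"
  proof (rule Gamma0_3_induct[OF c det])
    fix a b d :: int assume "a * d = 1"
    then have "a = 1 \<and> d = 1 \<or> a = - 1 \<and> d = - 1" by (auto simp: zmult_eq_1_iff)
    moreover have "nome (\<tau> - of_int b) = nome \<tau>" for \<tau> using nome_add[of \<tau> "of_int (- b)"] nome_of_int[of "- b"] by simp
    ultimately show "?P a b 0 d"
      using k by (auto simp: nome_add)
  next
    fix a b c d n :: int
    assume det: "a * d - b * c = 1" and P: "?P a (b + n * a) c (d + n * c)"
    show "?P a b c d"
    proof
      fix \<tau> assume t: "\<tau> \<in> \<H>"
      then have "\<tau> + of_int (- n) \<in> \<H>" by (simp add: upper_half_plane_def)
      from P[rule_format, OF this]
      show "F (nome ((of_int a * \<tau> + of_int b) / (of_int c * \<tau> + of_int d))) = (of_int c * \<tau> + of_int d) ^ k * F (nome \<tau>)"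
        unfolding nome_add[of \<tau>] nome_of_int by (simp add: algebra_simps)
    qed
  next
    fix a b c d m :: int
    assume det: "a * d - b * c = 1" and P: "?P (a + 3 * m * b) b (c + 3 * m * d) d"
    show "?P a b c d"
    proof
      fix \<tau> assume t: "\<tau> \<in> \<H>"
      \<comment> \<open>\<tau> / D is the image of \<tau> under the inverse shear; at this point the
        assumed law has numerator and denominator of the wanted one, both divided by D.\<close>
      define D where "D = 1 + 3 * of_int (- m) * \<tau>"
      have D0: "D \<noteq> 0" using denominator_nonzero[of 1 1 0 "3 * (- m)" \<tau>] t by (simp add: D_def add.commute)
      have s: "\<tau> / D \<in> \<H>" using moebius_in_uhp[of 1 1 0 "- 3 * m" \<tau>] t by (simp add: D_def add.commute)
      have num: "of_int (a + 3 * m * b) * (\<tau> / D) + of_int b = (of_int a * \<tau> + of_int b) / D"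
        and den: "of_int (c + 3 * m * d) * (\<tau> / D) + of_int d = (of_int c * \<tau> + of_int d) / D"
        using D0 by (simp_all add: field_simps) (simp_all add: D_def algebra_simps)
      have "F (nome ((of_int a * \<tau> + of_int b) / (of_int c * \<tau> + of_int d))) =
          ((of_int c * \<tau> + of_int d) / D) ^ k * F (nome (\<tau> / D))"
        using P[rule_format, OF s] D0 unfolding num den by simp
      also have "F (nome (\<tau> / D)) = D ^ k * F (nome \<tau>)"
        using fricke_pair_shear[OF FG t, of "- m"] unfolding D_def[symmetric] by simp
      finally show "F (nome ((of_int a * \<tau> + of_int b) / (of_int c * \<tau> + of_int d))) = (of_int c * \<tau> + of_int d) ^ k * F (nome \<tau>)"
        using D0 by (simp add: power_divide)
    qed
  qed
  then show ?thesis using t by blast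
qed

section \<open>Modular and cusp forms from pairs\<close>

definition form_of :: "(complex \<Rightarrow> complex) \<Rightarrow> complex \<Rightarrow> complex" where
  "form_of F = on_uhp (\<lambda>\<tau>. F (nome \<tau>))"

lemma form_of_apply: "\<tau> \<in> \<H> \<Longrightarrow> form_of F \<tau> = F (nome \<tau>)"
  by (simp add: form_of_def on_uhp_def)

lemma form_of_outside: "\<tau> \<notin> \<H> \<Longrightarrow> form_of F \<tau> = 0"
  by (simp add: form_of_def on_uhp_def)

lemma form_of_holomorphic:
  assumes "F holomorphic_on ball 0 1"
  shows "form_of F holomorphic_on \<H>"
proof -
  have "F \<circ> nome holomorphic_on \<H>"
    by (rule holomorphic_on_compose_gen[OF nome_holomorphic[OF holomorphic_on_ident] assms])
       (use nome_in_ball in auto)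
  then show ?thesis by (rule holomorphic_transform) (simp add: form_of_apply)
qed

lemma form_of_qderiv:
  assumes "F holomorphic_on ball 0 1" "\<tau> \<in> \<H>"
  shows "qderiv (form_of F) \<tau> = nome \<tau> * deriv F (nome \<tau>)"
proof -
  have "(form_of F has_field_derivative 2 * of_real pi * \<i> * (nome \<tau> * deriv F (nome \<tau>))) (at \<tau>)"
    by (rule has_field_derivative_transform_within_open[OF fricke_expansion_has_field_derivative[OF assms] open_uhp assms(2)])
       (simp add: form_of_apply)
  then have "deriv (form_of F) \<tau> = 2 * of_real pi * \<i> * (nome \<tau> * deriv F (nome \<tau>))"
    by (rule DERIV_imp_deriv)
  then show ?thesis by (simp add: qderiv_def)
qed

lemma form_of_slash_Gamma0:
  assumes FG: "fricke_pair (int k) F G" and k: "even k" and g: "\<gamma> \<in> Gamma0 3" and t: "\<tau> \<in> \<H>"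
  shows "slash k \<gamma> (form_of F) \<tau> = form_of F \<tau>"
proof -
  have det: "\<gamma> $ 1 $ 1 * \<gamma> $ 2 $ 2 - \<gamma> $ 1 $ 2 * \<gamma> $ 2 $ 1 = 1" and c: "3 dvd \<gamma> $ 2 $ 1"
    using g by (auto simp: Gamma0_iff)
  show ?thesis
    unfolding slash_def moebius_act_def aut_factor_def form_of_apply[OF t] form_of_apply[OF moebius_in_uhp[OF det t]]
      fricke_pair_transform[OF FG k c det t]
    using denominator_nonzero[OF det t] by simp
qed

text \<open>Outside \<Gamma>_0(3) the entry c is prime to 3, so \<gamma> factors as an element of
  \<Gamma>_0(3), the inversion and a translation by j. The inversion turns F into G at \<tau> / 3,
  divided by 3^k, and the translation contributes the cube root of unity u.\<close>

lemma form_of_slash_other: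
  assumes FG: "fricke_pair (int k) F G" and k: "even k" and g: "\<gamma> \<in> SL2Z" "\<gamma> \<notin> Gamma0 3"
  shows "\<exists>u. norm u = 1 \<and> (\<forall>\<tau>\<in>\<H>. slash k \<gamma> (form_of F) \<tau> = G (u * nome (\<tau> / 3)) / 3 ^ k)"
proof -
  define a b c d where "a = \<gamma> $ 1 $ 1" and "b = \<gamma> $ 1 $ 2" and "c = \<gamma> $ 2 $ 1" and "d = \<gamma> $ 2 $ 2"
  have det: "a * d - b * c = 1" using g by (simp add: SL2Z_iff a_def b_def c_def d_def)
  have "\<not> 3 dvd c" using g by (auto simp: SL2Z_iff Gamma0_iff c_def)
  then have "\<exists>j. 3 dvd c * j - d"
  proof -
    have "c mod 3 = 1 \<or> c mod 3 = 2" using \<open>\<not> 3 dvd c\<close> by presburger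
    \<comment> \<open>The witness is j = c d, as c^2 is congruent to 1 modulo 3.\<close>
    then have "3 dvd c * (c * d) - d"
    proof
      assume "c mod 3 = 1"
      then obtain e where "c = 3 * e + 1" by (metis mult_div_mod_eq)
      then show ?thesis by (intro dvdI[of _ _ "(3 * e * e + 2 * e) * d"]) (simp add: algebra_simps)
    next
      assume "c mod 3 = 2"
      then obtain e where "c = 3 * e + 2" by (metis mult_div_mod_eq)
      then show ?thesis by (intro dvdI[of _ _ "(3 * e * e + 4 * e + 1) * d"]) (simp add: algebra_simps)
    qed
    then show ?thesis by blast
  qed
  then obtain j where j: "3 dvd c * j - d" by blast
  have det': "(a * j - b) * c - a * (c * j - d) = 1" using det by (simp add: algebra_simps)
  have "slash k \<gamma> (form_of F) \<tau> = G (nome (of_int j / 3) * nome (\<tau> / 3)) / 3 ^ k" if t: "\<tau> \<in> \<H>" for \<tau>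
  proof -
    define x where "x = \<tau> + of_int j"
    have x: "x \<in> \<H>" using t by (simp add: x_def upper_half_plane_def)
    have x0: "x \<noteq> 0" using x by (rule uhp_nonzero)
    have x3: "x / 3 \<in> \<H>" using x by (simp add: upper_half_plane_def)
    let ?D = "of_int c * \<tau> + of_int d"
    have D0: "?D \<noteq> 0" by (rule denominator_nonzero[OF det t])
    have num: "of_int (a * j - b) * (- 1 / x) + of_int a = (of_int a * \<tau> + of_int b) / x"
      and den: "of_int (c * j - d) * (- 1 / x) + of_int c = ?D / x"
      using x0 by (simp_all add: field_simps) (simp_all add: x_def algebra_simps)
    have "F (nome ((of_int a * \<tau> + of_int b) / ?D)) = (?D / x) ^ k * F (nome (- 1 / x))"
      using fricke_pair_transform[OF FG k j det' uhp_neg_inverse[OF x]] x0 unfolding num den by simp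
    also have "F (nome (- 1 / x)) = (x / 3) ^ k * G (nome (x / 3))"
      using fricke_pairD(3)[OF FG x3] by simp
    also have "nome (x / 3) = nome (of_int j / 3) * nome (\<tau> / 3)"
      by (simp add: x_def add_divide_distrib nome_add)
    finally have "F (nome ((of_int a * \<tau> + of_int b) / ?D)) = (?D / x) ^ k * ((x / 3) ^ k * G (nome (of_int j / 3) * nome (\<tau> / 3)))" .
    then show ?thesis
      unfolding slash_def moebius_act_def aut_factor_def a_def[symmetric] b_def[symmetric] c_def[symmetric] d_def[symmetric]
        form_of_apply[OF moebius_in_uhp[OF det t]]
      using x0 D0 by (simp add: power_divide)
  qed
  moreover have "norm (nome (of_int j / 3)) = 1" by (simp add: norm_nome)
  ultimately show ?thesis by blast
qed

lemma cusp_expansion_other: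
  assumes "G holomorphic_on ball 0 1" "norm u = 1" "\<forall>\<tau>\<in>\<H>. f \<tau> = G (u * nome (\<tau> / 3)) / 3 ^ k"
  shows "cusp_expansion f 3 (\<lambda>z. G (u * z) / 3 ^ k)"
  unfolding cusp_expansion_def
proof (intro conjI)
  have "G \<circ> (\<lambda>z. u * z) holomorphic_on ball 0 1"
    by (rule holomorphic_on_compose_gen[OF _ assms(1)]) (use assms(2) in \<open>auto simp: norm_mult intro!: holomorphic_intros\<close>)
  then show "(\<lambda>z. G (u * z) / 3 ^ k) holomorphic_on ball 0 1" by (auto simp: o_def intro!: holomorphic_intros)
qed (use assms in auto)

lemma cusp_expansion_identity:
  assumes "F holomorphic_on ball 0 1" "\<And>\<tau>. \<tau> \<in> \<H> \<Longrightarrow> f \<tau> = form_of F \<tau>"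
  shows "cusp_expansion f 1 F"
  using assms by (simp add: cusp_expansion_def form_of_apply)

lemma fricke_pair_imp_modular:
  assumes FG: "fricke_pair (int k) F G" and k: "even k"
  shows "form_of F \<in> modular_forms k (Gamma0 3)"
proof -
  note D = fricke_pairD[OF FG]
  have "holomorphic_at_ioo (slash k \<gamma> (form_of F))" if g: "\<gamma> \<in> SL2Z" for \<gamma>
  proof (cases "\<gamma> \<in> Gamma0 3")
    case True
    then show ?thesis
      unfolding holomorphic_at_ioo_def using cusp_expansion_identity[OF D(1) form_of_slash_Gamma0[OF FG k True]] by blast
  next
    case False
    then show ?thesis
      unfolding holomorphic_at_ioo_def using form_of_slash_other[OF FG k g False] cusp_expansion_other[OF D(2)] by blast
  qed
  then show ?thesis
    using form_of_holomorphic[OF D(1)] form_of_slash_Gamma0[OF FG k]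
    by (auto simp: modular_forms_def form_of_outside)
qed

lemma fricke_pair_imp_cusp_form:
  assumes FG: "fricke_pair (int k) F G" and k: "even k" and 0: "F 0 = 0" "G 0 = 0"
  shows "form_of F \<in> cusp_forms k (Gamma0 3)"
proof -
  note D = fricke_pairD[OF FG]
  have "vanishes_at_ioo (slash k \<gamma> (form_of F))" if g: "\<gamma> \<in> SL2Z" for \<gamma>
  proof (cases "\<gamma> \<in> Gamma0 3")
    case True
    then show ?thesis
      unfolding vanishes_at_ioo_def using cusp_expansion_identity[OF D(1) form_of_slash_Gamma0[OF FG k True]] 0 by blast
  next
    case False
    then obtain u where "norm u = 1" "\<forall>\<tau>\<in>\<H>. slash k \<gamma> (form_of F) \<tau> = G (u * nome (\<tau> / 3)) / 3 ^ k"
      using form_of_slash_other[OF FG k g] by blast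
    from cusp_expansion_other[OF D(2) this] show ?thesis
      unfolding vanishes_at_ioo_def using 0
      by (intro exI[of _ 3] exI[of _ "\<lambda>z. G (u * z) / 3 ^ k"] conjI) simp_all
  qed
  then show ?thesis using fricke_pair_imp_modular[OF FG k] by (simp add: cusp_forms_def)
qed

text \<open>The second expansion is that of the Fricke transform \<open>g\<close> of f;
  \<open>V\<close> is precisely the periodicity of \<open>g\<close>, since the involution conjugates
  translation to \<tau> \<mapsto> \<tau> / (1 - 3 \<tau>). Polynomial bounds and integer weights
  cover both modular forms and the last coefficients of quasi-modular forms.\<close>

lemma fricke_pair_of_invariant:
  assumes hol: "f holomorphic_on \<H>" and T: "\<And>\<tau>. \<tau> \<in> \<H> \<Longrightarrow> f (\<tau> + 1) = f \<tau>"
    and V: "\<And>\<tau>. \<tau> \<in> \<H> \<Longrightarrow> f (\<tau> / (1 - 3 * \<tau>)) = (1 - 3 * \<tau>) powi k * f \<tau>"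
    and bnd1: "\<And>\<tau>. Im \<tau> \<ge> 1 \<Longrightarrow> \<bar>Re \<tau>\<bar> \<le> 1 \<Longrightarrow> norm (f \<tau>) \<le> C * Im \<tau> ^ N"
    and bnd2: "\<And>\<tau>. Im \<tau> \<ge> 1 \<Longrightarrow> \<bar>Re \<tau>\<bar> \<le> 1 \<Longrightarrow> norm (\<tau> powi (- k) * f (- 1 / (3 * \<tau>))) \<le> C' * Im \<tau> ^ N'"
  shows "\<exists>F G. fricke_pair k F G \<and> (\<forall>\<tau>\<in>\<H>. f \<tau> = F (nome \<tau>))"
proof -
  define g where "g = (\<lambda>\<tau>. \<tau> powi (- k) * f (- 1 / (3 * \<tau>)))"
  obtain F where F: "F holomorphic_on ball 0 1" "\<And>\<tau>. \<tau> \<in> \<H> \<Longrightarrow> f \<tau> = F (nome \<tau>)"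
    using periodic_imp_nome_expansion[OF hol T bnd1] by blast
  have "f \<circ> (\<lambda>\<tau>. - 1 / (3 * \<tau>)) holomorphic_on \<H>"
    by (rule holomorphic_on_compose_gen[OF _ hol])
       (use fricke_uhp uhp_nonzero in \<open>auto intro!: holomorphic_intros\<close>)
  then have holg: "g holomorphic_on \<H>"
    unfolding g_def using uhp_nonzero by (auto intro!: holomorphic_intros simp: o_def)
  have Tg: "g (\<tau> + 1) = g \<tau>" if t: "\<tau> \<in> \<H>" for \<tau>
  proof -
    have t0: "\<tau> \<noteq> 0" using t by (rule uhp_nonzero)
    have t1: "\<tau> + 1 \<noteq> 0" using t by (intro uhp_nonzero) (simp add: upper_half_plane_def)
    define x where "x = - 1 / (3 * \<tau>)"
    have e: "1 - 3 * x = (\<tau> + 1) / \<tau>" using t0 by (simp add: x_def field_simps)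
    have "x / (1 - 3 * x) = - 1 / (3 * (\<tau> + 1))" unfolding e using t0 t1 by (simp add: x_def)
    then have "f (- 1 / (3 * (\<tau> + 1))) = ((\<tau> + 1) / \<tau>) powi k * f x"
      using V[OF fricke_uhp[OF t], folded x_def] unfolding e by simp
    moreover have "(\<tau> + 1) powi (- k) * ((\<tau> + 1) / \<tau>) powi k = \<tau> powi (- k)"
      using t0 t1 by (simp add: power_int_divide_distrib power_int_minus field_simps)
    ultimately show ?thesis unfolding g_def x_def[symmetric] by (simp only: mult.assoc[symmetric])
  qed
  obtain G where G: "G holomorphic_on ball 0 1" "\<And>\<tau>. \<tau> \<in> \<H> \<Longrightarrow> g \<tau> = G (nome \<tau>)"
    using periodic_imp_nome_expansion[OF holg Tg, of C' N'] bnd2 unfolding g_def by blast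
  have "F (nome (- 1 / (3 * \<tau>))) = \<tau> powi k * G (nome \<tau>)" if t: "\<tau> \<in> \<H>" for \<tau>
  proof -
    have "\<tau> powi k * \<tau> powi (- k) = 1" using uhp_nonzero[OF t] by (simp add: power_int_minus)
    then show ?thesis
      using F(2)[OF fricke_uhp[OF t]] unfolding G(2)[OF t, symmetric] g_def by (simp add: mult.assoc[symmetric])
  qed
  then show ?thesis using F G unfolding fricke_pair_def by blast
qed

lemma slash_entries:
  "slash k \<gamma> f \<tau> = f ((of_int (\<gamma> $ 1 $ 1) * \<tau> + of_int (\<gamma> $ 1 $ 2)) / (of_int (\<gamma> $ 2 $ 1) * \<tau> + of_int (\<gamma> $ 2 $ 2)))
     / (of_int (\<gamma> $ 2 $ 1) * \<tau> + of_int (\<gamma> $ 2 $ 2)) ^ k"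
  by (simp add: slash_def moebius_act_def aut_factor_def)

lemma cusp_expansion_bounded:
  assumes "cusp_expansion f h g"
  shows "\<exists>M. \<forall>\<tau>. Im \<tau> \<ge> 1 \<longrightarrow> norm (f \<tau>) \<le> M"
proof -
  have h: "h > 0" and g: "g holomorphic_on ball 0 1" and fg: "\<And>\<tau>. \<tau> \<in> \<H> \<Longrightarrow> f \<tau> = g (nome (\<tau> / of_nat h))"
    using assms by (auto simp: cusp_expansion_def)
  define r where "r = exp (- (2 * pi / real h))"
  have r: "0 < r" "r < 1" using pi_gt_zero h by (auto simp: r_def)
  have "continuous_on (cball 0 r) g"
    using r by (intro holomorphic_on_imp_continuous_on holomorphic_on_subset[OF g]) auto
  then have "bounded (g ` cball 0 r)" by (intro compact_imp_bounded compact_continuous_image) auto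
  then obtain M where M: "\<forall>x\<in>g ` cball 0 r. norm x \<le> M" unfolding bounded_iff by blast
  have "norm (f \<tau>) \<le> M" if "Im \<tau> \<ge> 1" for \<tau>
  proof -
    have "Im (\<tau> / of_nat h) = Im \<tau> / real h" by (metis Im_divide_of_real of_real_of_nat_eq)
    then have "norm (nome (\<tau> / of_nat h)) \<le> r"
      using that h by (simp add: norm_nome r_def divide_right_mono mult_left_mono)
    moreover have "\<tau> \<in> \<H>" using that by (simp add: upper_half_plane_def)
    ultimately show ?thesis using M fg by auto
  qed
  then show ?thesis by blast
qed

text \<open>The matrix -1 acts in weight k by (-1)^k.\<close>

lemma modular_form_odd:
  assumes f: "f \<in> modular_forms k (Gamma0 3)" and k: "odd k"
  shows "f = (\<lambda>_. 0)"
proof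
  fix \<tau>
  show "f \<tau> = 0"
  proof (cases "\<tau> \<in> \<H>")
    case True
    obtain \<gamma> :: "int^2^2" where g: "\<gamma> $ 1 $ 1 = - 1" "\<gamma> $ 1 $ 2 = 0" "\<gamma> $ 2 $ 1 = 0" "\<gamma> $ 2 $ 2 = - 1"
      by (rule exists_int_matrix)
    then have "slash k \<gamma> f \<tau> = f \<tau>" using f True by (auto simp: modular_forms_def Gamma0_iff)
    then show ?thesis using k by (simp add: slash_entries g)
  qed (use f in \<open>auto simp: modular_forms_def\<close>)
qed

lemma slash_invariant_generators:
  assumes f: "\<And>\<gamma> \<tau>. \<gamma> \<in> Gamma0 3 \<Longrightarrow> \<tau> \<in> \<H> \<Longrightarrow>
      f (moebius_act \<gamma> \<tau>) = aut_factor \<gamma> \<tau> powi k * f \<tau>" and t: "\<tau> \<in> \<H>"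
  shows "f (\<tau> + 1) = f \<tau>" "f (\<tau> / (1 - 3 * \<tau>)) = (1 - 3 * \<tau>) powi k * f \<tau>"
proof -
  obtain \<gamma> :: "int^2^2" where g: "\<gamma> $ 1 $ 1 = 1" "\<gamma> $ 1 $ 2 = 1" "\<gamma> $ 2 $ 1 = 0" "\<gamma> $ 2 $ 2 = 1"
    by (rule exists_int_matrix)
  show "f (\<tau> + 1) = f \<tau>"
    using f[of \<gamma> \<tau>] t by (simp add: Gamma0_iff g moebius_act_def aut_factor_def)
  obtain \<gamma> :: "int^2^2" where g: "\<gamma> $ 1 $ 1 = 1" "\<gamma> $ 1 $ 2 = 0" "\<gamma> $ 2 $ 1 = - 3" "\<gamma> $ 2 $ 2 = 1"
    by (rule exists_int_matrix)
  show "f (\<tau> / (1 - 3 * \<tau>)) = (1 - 3 * \<tau>) powi k * f \<tau>"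
    using f[of \<gamma> \<tau>] t by (simp add: Gamma0_iff g moebius_act_def aut_factor_def)
qed

lemma modular_imp_fricke_pair:
  assumes f: "f \<in> modular_forms k (Gamma0 3)"
  shows "\<exists>F G. fricke_pair (int k) F G \<and> f = form_of F"
proof -
  have hol: "f holomorphic_on \<H>" and out: "\<And>\<tau>. \<tau> \<notin> \<H> \<Longrightarrow> f \<tau> = 0"
    and inv: "\<And>\<gamma> \<tau>. \<gamma> \<in> Gamma0 3 \<Longrightarrow> \<tau> \<in> \<H> \<Longrightarrow> slash k \<gamma> f \<tau> = f \<tau>"
    and cusp: "\<And>\<gamma>. \<gamma> \<in> SL2Z \<Longrightarrow> holomorphic_at_ioo (slash k \<gamma> f)"
    using f by (auto simp: modular_forms_def)
  have inv': "f (moebius_act \<gamma> \<tau>) = aut_factor \<gamma> \<tau> powi (int k) * f \<tau>" if "\<gamma> \<in> Gamma0 3" "\<tau> \<in> \<H>" for \<gamma> \<tau>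
    using inv[OF that] denominator_nonzero[of "\<gamma> $ 1 $ 1" "\<gamma> $ 2 $ 2" "\<gamma> $ 1 $ 2" "\<gamma> $ 2 $ 1" \<tau>] that
    by (auto simp: slash_def aut_factor_def Gamma0_iff field_simps)
  note gen = slash_invariant_generators[of f "int k", OF inv']
  obtain \<gamma> :: "int^2^2" where g: "\<gamma> $ 1 $ 1 = 1" "\<gamma> $ 1 $ 2 = 0" "\<gamma> $ 2 $ 1 = 0" "\<gamma> $ 2 $ 2 = 1"
    by (rule exists_int_matrix)
  have "holomorphic_at_ioo (slash k \<gamma> f)" by (rule cusp) (simp add: SL2Z_iff g)
  then obtain M where "\<forall>\<tau>. Im \<tau> \<ge> 1 \<longrightarrow> norm (slash k \<gamma> f \<tau>) \<le> M"
    unfolding holomorphic_at_ioo_def using cusp_expansion_bounded by blast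
  then have M: "norm (f \<tau>) \<le> M * Im \<tau> ^ 0" if "Im \<tau> \<ge> 1" for \<tau>
    using that by (simp add: slash_entries g)
  \<comment> \<open>The inversion evaluated at 3 \<tau> is the Fricke involution at \<tau>; the
    change of argument costs the factor 3^k.\<close>
  obtain \<gamma> :: "int^2^2" where g: "\<gamma> $ 1 $ 1 = 0" "\<gamma> $ 1 $ 2 = - 1" "\<gamma> $ 2 $ 1 = 1" "\<gamma> $ 2 $ 2 = 0"
    by (rule exists_int_matrix)
  have "holomorphic_at_ioo (slash k \<gamma> f)" by (rule cusp) (simp add: SL2Z_iff g)
  then obtain M' where M': "\<forall>\<tau>. Im \<tau> \<ge> 1 \<longrightarrow> norm (slash k \<gamma> f \<tau>) \<le> M'"
    unfolding holomorphic_at_ioo_def using cusp_expansion_bounded by blast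
  have "norm (\<tau> powi (- int k) * f (- 1 / (3 * \<tau>))) \<le> (3 ^ k * M') * Im \<tau> ^ 0" if "Im \<tau> \<ge> 1" for \<tau>
  proof -
    have "norm (slash k \<gamma> f (3 * \<tau>)) \<le> M'" using M' that by simp
    then have "3 ^ k * norm (slash k \<gamma> f (3 * \<tau>)) \<le> 3 ^ k * M'" by simp
    moreover have "3 ^ k * norm (slash k \<gamma> f (3 * \<tau>)) = norm (\<tau> powi (- int k) * f (- 1 / (3 * \<tau>)))"
      by (simp add: slash_entries g norm_divide norm_mult norm_power power_int_minus norm_inverse power_mult_distrib field_simps)
    ultimately show ?thesis by simp
  qed
  from fricke_pair_of_invariant[OF hol gen(1) gen(2) M this]
  obtain F G where FG: "fricke_pair (int k) F G" "\<forall>\<tau>\<in>\<H>. f \<tau> = F (nome \<tau>)" by blast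
  then have "f = form_of F" using out by (intro ext) (metis form_of_apply form_of_outside)
  then show ?thesis using FG by blast
qed

section \<open>Moderate growth\<close>

definition height :: "complex \<Rightarrow> real" where
  "height \<tau> = (1 + (norm \<tau>)\<^sup>2) / Im \<tau>"

lemma moderate_growth_iff:
  "moderate_growth f \<longleftrightarrow> (\<exists>C N. \<forall>\<tau>\<in>\<H>. norm (f \<tau>) \<le> C * height \<tau> ^ N)"
  by (simp add: moderate_growth_def height_def)

lemma height_bounds:
  assumes "\<tau> \<in> \<H>"
  shows "1 \<le> height \<tau>" "1 / Im \<tau> \<le> height \<tau>"
proof -
  have y: "Im \<tau> > 0" using assms by (simp add: upper_half_plane_def)
  have "Im \<tau> \<le> norm \<tau>" using abs_Im_le_cmod[of \<tau>] y by simp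
  moreover have "2 * norm \<tau> \<le> 1 + (norm \<tau>)\<^sup>2"
    using zero_le_power2[of "norm \<tau> - 1"] by (simp add: power2_eq_square algebra_simps)
  ultimately have "Im \<tau> \<le> 1 + (norm \<tau>)\<^sup>2" using norm_ge_zero[of \<tau>] by linarith
  then show "1 \<le> height \<tau>" using y by (simp add: height_def)
  show "1 / Im \<tau> \<le> height \<tau>" unfolding height_def using y by (intro divide_right_mono) auto
qed

lemma moderate_growthI:
  assumes "\<And>\<tau>. \<tau> \<in> \<H> \<Longrightarrow> norm (f \<tau>) \<le> C * height \<tau> ^ N"
  shows "moderate_growth f"
  using assms by (auto simp: moderate_growth_iff)

lemma moderate_growthE:
  assumes "moderate_growth f"
  obtains C N where "C \<ge> 0" "\<And>\<tau>. \<tau> \<in> \<H> \<Longrightarrow> norm (f \<tau>) \<le> C * height \<tau> ^ N"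
proof -
  obtain C N where CN: "\<And>\<tau>. \<tau> \<in> \<H> \<Longrightarrow> norm (f \<tau>) \<le> C * height \<tau> ^ N"
    using assms by (auto simp: moderate_growth_iff)
  have "norm (f \<tau>) \<le> \<bar>C\<bar> * height \<tau> ^ N" if "\<tau> \<in> \<H>" for \<tau>
  proof -
    have "C * height \<tau> ^ N \<le> \<bar>C\<bar> * height \<tau> ^ N"
      using height_bounds(1)[OF that] by (intro mult_right_mono) auto
    then show ?thesis using CN[OF that] by linarith
  qed
  then show ?thesis using that[of "\<bar>C\<bar>" N] by simp
qed

lemma moderate_growth_cong:
  "(\<And>\<tau>. \<tau> \<in> \<H> \<Longrightarrow> f \<tau> = g \<tau>) \<Longrightarrow> moderate_growth f \<longleftrightarrow> moderate_growth g"
  by (simp add: moderate_growth_def)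

lemma moderate_growth_const: "moderate_growth (\<lambda>_. c)"
  by (rule moderate_growthI[of _ "norm c" 0]) simp

lemma moderate_growth_add:
  assumes "moderate_growth f" "moderate_growth g"
  shows "moderate_growth (\<lambda>\<tau>. f \<tau> + g \<tau>)"
proof -
  obtain C N where f: "C \<ge> 0" "\<And>\<tau>. \<tau> \<in> \<H> \<Longrightarrow> norm (f \<tau>) \<le> C * height \<tau> ^ N"
    using moderate_growthE[OF assms(1)] by blast
  obtain D M where g: "D \<ge> 0" "\<And>\<tau>. \<tau> \<in> \<H> \<Longrightarrow> norm (g \<tau>) \<le> D * height \<tau> ^ M"
    using moderate_growthE[OF assms(2)] by blast
  show ?thesis
  proof (rule moderate_growthI[of _ "C + D" "max N M"])
    fix \<tau> assume t: "\<tau> \<in> \<H>"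
    have "C * height \<tau> ^ N \<le> C * height \<tau> ^ max N M" "D * height \<tau> ^ M \<le> D * height \<tau> ^ max N M"
      using f g height_bounds(1)[OF t] by (auto intro!: mult_left_mono power_increasing)
    then show "norm (f \<tau> + g \<tau>) \<le> (C + D) * height \<tau> ^ max N M"
      using f(2)[OF t] g(2)[OF t] norm_triangle_ineq[of "f \<tau>" "g \<tau>"] unfolding distrib_right by linarith
  qed
qed

lemma moderate_growth_mult:
  assumes "moderate_growth f" "moderate_growth g"
  shows "moderate_growth (\<lambda>\<tau>. f \<tau> * g \<tau>)"
proof -
  obtain C N where f: "C \<ge> 0" "\<And>\<tau>. \<tau> \<in> \<H> \<Longrightarrow> norm (f \<tau>) \<le> C * height \<tau> ^ N"
    using moderate_growthE[OF assms(1)] by blast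
  obtain D M where g: "D \<ge> 0" "\<And>\<tau>. \<tau> \<in> \<H> \<Longrightarrow> norm (g \<tau>) \<le> D * height \<tau> ^ M"
    using moderate_growthE[OF assms(2)] by blast
  show ?thesis
  proof (rule moderate_growthI[of _ "C * D" "N + M"])
    fix \<tau> assume t: "\<tau> \<in> \<H>"
    have "norm (f \<tau> * g \<tau>) \<le> (C * height \<tau> ^ N) * (D * height \<tau> ^ M)"
      unfolding norm_mult using f g height_bounds(1)[OF t] t by (intro mult_mono) auto
    then show "norm (f \<tau> * g \<tau>) \<le> C * D * height \<tau> ^ (N + M)" by (simp add: power_add mult_ac)
  qed
qed

lemma moderate_growth_diff:
  assumes "moderate_growth f" "moderate_growth g"
  shows "moderate_growth (\<lambda>\<tau>. f \<tau> - g \<tau>)"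
  using moderate_growth_add[OF assms(1) moderate_growth_mult[OF moderate_growth_const[of "- 1"] assms(2)]] by simp

lemma moderate_growth_power: "moderate_growth f \<Longrightarrow> moderate_growth (\<lambda>\<tau>. f \<tau> ^ n)"
  by (induction n) (auto intro: moderate_growth_const moderate_growth_mult)

lemma moderate_growth_sum:
  "finite A \<Longrightarrow> (\<And>i. i \<in> A \<Longrightarrow> moderate_growth (f i)) \<Longrightarrow> moderate_growth (\<lambda>\<tau>. \<Sum>i\<in>A. f i \<tau>)"
  by (induction rule: finite_induct) (auto intro: moderate_growth_const moderate_growth_add)

text \<open>Cauchy's estimate on the disc of radius Im \<tau> / 2: there \<open>height\<close> grows
  at most by a factor 8, and division by the radius costs one more power of
  \<open>height\<close>.\<close>

lemma moderate_growth_deriv: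
  assumes hol: "f holomorphic_on \<H>" and "moderate_growth f"
  shows "moderate_growth (deriv f)"
proof -
  obtain C N where f: "C \<ge> 0" "\<And>\<tau>. \<tau> \<in> \<H> \<Longrightarrow> norm (f \<tau>) \<le> C * height \<tau> ^ N"
    using moderate_growthE[OF assms(2)] by blast
  show ?thesis
  proof (rule moderate_growthI[of _ "2 * (C * 8 ^ N)" "N + 1"])
    fix \<tau> assume t: "\<tau> \<in> \<H>"
    define r where "r = Im \<tau> / 2"
    have r: "r > 0" using t by (simp add: r_def upper_half_plane_def)
    have Im: "Im w \<ge> r" and nw: "norm w \<le> 2 * norm \<tau>" if "w \<in> cball \<tau> r" for w
    proof -
      have "\<bar>Im (\<tau> - w)\<bar> \<le> r" using that abs_Im_le_cmod[of "\<tau> - w"] by (simp add: dist_norm)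
      then have "Im (\<tau> - w) \<le> r" by (rule abs_le_D1)
      then show "Im w \<ge> r" by (simp add: r_def)
      have "norm w \<le> norm \<tau> + norm (\<tau> - w)" by (metis norm_minus_commute norm_triangle_sub)
      moreover have "norm (\<tau> - w) \<le> r" using that by (simp add: dist_norm)
      moreover have "r \<le> norm \<tau>" using abs_Im_le_cmod[of \<tau>] r by (simp add: r_def)
      ultimately show "norm w \<le> 2 * norm \<tau>" by linarith
    qed
    have sub: "cball \<tau> r \<subseteq> \<H>"
    proof
      fix w assume "w \<in> cball \<tau> r"
      then show "w \<in> \<H>" using Im[of w] r unfolding upper_half_plane_def by simp
    qed
    have hw: "height w \<le> 8 * height \<tau>" if "w \<in> cball \<tau> r" for w
    proof -
      have "(norm w)\<^sup>2 \<le> (2 * norm \<tau>)\<^sup>2" by (rule power_mono[OF nw[OF that]]) simp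
      then have "1 + (norm w)\<^sup>2 \<le> 4 * (1 + (norm \<tau>)\<^sup>2)" by (simp add: power_mult_distrib)
      then have "height w \<le> 4 * (1 + (norm \<tau>)\<^sup>2) / r"
        unfolding height_def using Im[OF that] r by (intro frac_le) auto
      then show ?thesis by (simp add: height_def r_def)
    qed
    have "norm ((deriv ^^ 1) f \<tau>) \<le> fact 1 * (C * (8 * height \<tau>) ^ N) / r ^ 1"
    proof (rule Cauchy_inequality)
      show "f holomorphic_on ball \<tau> r"
        using holomorphic_on_subset[OF hol] sub ball_subset_cball by blast
      show "continuous_on (cball \<tau> r) f"
        using holomorphic_on_subset[OF hol sub] by (rule holomorphic_on_imp_continuous_on)
      fix w assume "norm (\<tau> - w) = r"
      then have w: "w \<in> cball \<tau> r" by (simp add: dist_norm)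
      then have wH: "w \<in> \<H>" using sub by blast
      have "height w ^ N \<le> (8 * height \<tau>) ^ N"
        by (rule power_mono[OF hw[OF w]]) (use height_bounds(1)[OF wH] in simp)
      then show "norm (f w) \<le> C * (8 * height \<tau>) ^ N"
        using f(2)[OF wH] mult_left_mono[OF _ f(1)] by fastforce
    qed (rule r)
    also have "fact 1 * (C * (8 * height \<tau>) ^ N) / r ^ 1 = 2 * (C * 8 ^ N) * height \<tau> ^ N * (1 / Im \<tau>)"
      by (simp add: r_def power_mult_distrib)
    also have "\<dots> \<le> 2 * (C * 8 ^ N) * height \<tau> ^ N * height \<tau>"
      using height_bounds[OF t] f(1) by (intro mult_left_mono) auto
    finally show "norm (deriv f \<tau>) \<le> 2 * (C * 8 ^ N) * height \<tau> ^ (N + 1)" by (simp add: mult_ac)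
  qed
qed

text \<open>In the Lambert series with squared denominators the n-th term is at most |q|^n / (1 -
  |q|)^2, and the geometric series adds one more factor.\<close>

lemma E2_bound:
  assumes q: "norm q < 1"
  shows "norm (E2 q) \<le> 1 + 24 / (1 - norm q) ^ 3"
proof -
  define r where "r = norm q"
  have r: "0 \<le> r" "r < 1" using q by (auto simp: r_def)
  let ?f = "\<lambda>n. q ^ Suc n / (1 - q ^ Suc n)\<^sup>2"
  have b: "norm (?f n) \<le> r ^ n * (1 / (1 - r)\<^sup>2)" for n
  proof -
    have "norm (q ^ Suc n) \<le> r" using power_decreasing[of 1 "Suc n" r] r by (simp add: norm_power norm_mult r_def)
    then have "1 - r \<le> norm (1 - q ^ Suc n)" using norm_triangle_ineq2[of 1 "q ^ Suc n"] by simp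
    then have "(1 - r)\<^sup>2 \<le> norm (1 - q ^ Suc n) ^ 2" using r by (intro power_mono) auto
    moreover have "norm (q ^ Suc n) \<le> r ^ n"
      using power_decreasing[of n "Suc n" r] r by (simp add: norm_power norm_mult r_def)
    ultimately have "norm (q ^ Suc n) / norm (1 - q ^ Suc n) ^ 2 \<le> r ^ n / (1 - r)\<^sup>2"
      using r by (intro frac_le) auto
    then show ?thesis by (simp add: norm_divide norm_power)
  qed
  have s: "(\<lambda>n. r ^ n * (1 / (1 - r)\<^sup>2)) sums (1 / (1 - r) * (1 / (1 - r)\<^sup>2))"
    using geometric_sums[of r] r by (intro sums_mult2) auto
  have "norm (suminf ?f) \<le> suminf (\<lambda>n. r ^ n * (1 / (1 - r)\<^sup>2))"
    by (rule norm_suminf_le[OF b]) (use s in \<open>simp add: sums_iff\<close>)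
  also have "\<dots> = 1 / (1 - r) ^ 3" using s by (simp add: sums_iff power2_eq_square power3_eq_cube)
  finally have "norm (suminf ?f) \<le> 1 / (1 - r) ^ 3" .
  then have "norm (1 - 24 * suminf ?f) \<le> 1 + 24 * (1 / (1 - r) ^ 3)"
    using norm_triangle_ineq4[of 1 "24 * suminf ?f"] by (simp add: norm_mult)
  then show ?thesis unfolding E2_eq_lambert[OF q] r_def by simp
qed

text \<open>From exp x \<ge> 1 + x one gets 1 / (1 - exp (-x)) \<le> 1 + 1/x, and
  \<open>height\<close> dominates both 1 and 1 / Im \<tau>.\<close>

lemma nome_bound:
  assumes t: "\<tau> \<in> \<H>"
  shows "1 / (1 - norm (nome \<tau>)) \<le> 2 * height \<tau>"
proof -
  define y where "y = Im \<tau>"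
  have y: "y > 0" using t by (simp add: y_def upper_half_plane_def)
  define x where "x = 2 * pi * y"
  have xy: "x \<ge> y" using mult_right_mono[of 1 "2 * pi" y] pi_gt3 y by (simp add: x_def)
  have x: "x > 0" using xy y by linarith
  have "1 + x \<le> exp x" by (rule exp_ge_add_one_self)
  then have "exp (- x) \<le> 1 / (1 + x)" using x by (simp add: exp_minus field_simps)
  then have "x / (1 + x) \<le> 1 - exp (- x)" using x by (simp add: field_simps)
  then have "1 / (1 - exp (- x)) \<le> 1 / (x / (1 + x))" using x by (intro divide_left_mono) auto
  also have "\<dots> = 1 + 1 / x" using x by (simp add: field_simps)
  also have "1 / x \<le> 1 / y" using xy y by (intro divide_left_mono) auto
  finally show ?thesis using height_bounds[OF t] by (simp add: norm_nome x_def y_def)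
qed

lemma moderate_growth_E2: "moderate_growth (\<lambda>\<tau>. E2 (nome \<tau>))" "moderate_growth (\<lambda>\<tau>. E2 (nome \<tau> ^ 3))"
proof -
  have *: "norm (E2 q) \<le> 200 * height \<tau> ^ 3" if t: "\<tau> \<in> \<H>" and q: "norm q \<le> norm (nome \<tau>)" for q \<tau>
  proof -
    have n1: "norm (nome \<tau>) < 1" by (rule norm_nome_less_1[OF t])
    have "1 / (1 - norm q) \<le> 1 / (1 - norm (nome \<tau>))" using q n1 by (intro divide_left_mono) auto
    then have "1 / (1 - norm q) \<le> 2 * height \<tau>" using nome_bound[OF t] by linarith
    then have "(1 / (1 - norm q)) ^ 3 \<le> (2 * height \<tau>) ^ 3" using q n1 by (intro power_mono) auto
    then have "24 / (1 - norm q) ^ 3 \<le> 192 * height \<tau> ^ 3" by (simp add: power_divide power_mult_distrib)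
    moreover have "1 \<le> height \<tau> ^ 3" using height_bounds(1)[OF t] by (rule one_le_power)
    moreover have "norm (E2 q) \<le> 1 + 24 / (1 - norm q) ^ 3" by (rule E2_bound) (use q n1 in linarith)
    ultimately show ?thesis by linarith
  qed
  show "moderate_growth (\<lambda>\<tau>. E2 (nome \<tau>))" by (rule moderate_growthI) (rule *, auto)
  show "moderate_growth (\<lambda>\<tau>. E2 (nome \<tau> ^ 3))"
  proof (rule moderate_growthI, rule *)
    fix \<tau> assume "\<tau> \<in> \<H>"
    then show "norm (nome \<tau> ^ 3) \<le> norm (nome \<tau>)"
      using power_decreasing[of 1 3 "norm (nome \<tau>)"] norm_nome_less_1[of \<tau>] by (simp add: norm_power)
  qed
qed

lemma moderate_growth_pq: "moderate_growth (\<lambda>\<tau>. pexp (nome \<tau>))" "moderate_growth (\<lambda>\<tau>. qexp (nome \<tau>))"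
proof -
  have "moderate_growth (\<lambda>\<tau>. 1 / 4 * (E2 (nome \<tau>) + 3 * E2 (nome \<tau> ^ 3)))"
    "moderate_growth (\<lambda>\<tau>. 1 / 2 * (3 * E2 (nome \<tau> ^ 3) - E2 (nome \<tau>)))"
    by (intro moderate_growth_mult moderate_growth_add moderate_growth_diff moderate_growth_const moderate_growth_E2)+
  then show "moderate_growth (\<lambda>\<tau>. pexp (nome \<tau>))" "moderate_growth (\<lambda>\<tau>. qexp (nome \<tau>))"
    by (simp_all add: pexp_def qexp_def)
qed

text \<open>The operator q d/dq is, up to 2 pi i, differentiation in \<tau>, so
  \<open>moderate_growth_deriv\<close> applies.\<close>

lemma moderate_growth_theta:
  assumes hol: "F holomorphic_on ball 0 1" and F: "moderate_growth (\<lambda>\<tau>. F (nome \<tau>))"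
  shows "moderate_growth (\<lambda>\<tau>. nome \<tau> * deriv F (nome \<tau>))"
proof -
  have "moderate_growth (form_of F)"
    using F by (subst moderate_growth_cong[of _ "\<lambda>\<tau>. F (nome \<tau>)"]) (simp_all add: form_of_apply)
  from moderate_growth_deriv[OF form_of_holomorphic[OF hol] this]
  have "moderate_growth (\<lambda>\<tau>. 1 / (2 * of_real pi * \<i>) * deriv (form_of F) \<tau>)"
    by (intro moderate_growth_mult moderate_growth_const)
  then show ?thesis
    by (subst moderate_growth_cong[of _ "\<lambda>\<tau>. 1 / (2 * of_real pi * \<i>) * deriv (form_of F) \<tau>"])
       (use form_of_qderiv[OF hol] in \<open>simp_all add: qderiv_def\<close>)
qed

section \<open>Derivatives of Q_3, R_3, S_3 and Delta_3\<close>

lemma theta_mult: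
  assumes "F holomorphic_on ball 0 1" "G holomorphic_on ball 0 1" "q \<in> ball 0 1"
  shows "q * deriv (\<lambda>q. F q * G q) q = (q * deriv F q) * G q + F q * (q * deriv G q)"
proof -
  have "deriv (\<lambda>q. F q * G q) q = F q * deriv G q + deriv F q * G q"
    using assms by (intro deriv_mult) (auto intro: holomorphic_on_imp_differentiable_at)
  then show ?thesis by (simp add: algebra_simps)
qed

lemma deriv_cong_ball:
  assumes "\<And>q. q \<in> ball 0 1 \<Longrightarrow> F q = G q" "q \<in> ball 0 (1::real)"
  shows "deriv F q = deriv G (q::complex)"
proof (rule deriv_cong_ev)
  show "eventually (\<lambda>q. F q = G q) (nhds q)"
    using assms eventually_nhds_in_open[of "ball 0 1" q] by (auto elim: eventually_mono)
qed simp

lemma qexp_deriv: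
  assumes q: "q \<in> ball 0 1"
  shows "3 * (q * deriv qexp q) = pexp q * qexp q - (qexp q)\<^sup>2 + 54 * (aexp q * cexp q)"
proof -
  have "deriv qexp q = deriv (\<lambda>q. aexp q * aexp q) q"
    by (rule deriv_cong_ball[OF _ q]) (simp add: qexp_eq_aexp power2_eq_square)
  then have "q * deriv qexp q = 2 * aexp q * (q * deriv aexp q)"
    using theta_mult[OF exps_holomorphic(3) exps_holomorphic(3) q] by simp
  then have "3 * (q * deriv qexp q) = aexp q * (6 * (q * deriv aexp q))" by simp
  then show ?thesis
    unfolding aexp_deriv[OF q] qexp_eq_aexp[OF q] by (simp add: algebra_simps eval_nat_numeral)
qed

lemma rexp_deriv:
  assumes q: "q \<in> ball 0 1"
  shows "q * deriv (\<lambda>q. aexp q * cexp q) q = 2 / 3 * pexp q * (aexp q * cexp q) + 1 / 3 * qexp q * (aexp q * cexp q) + 9 * (cexp q)\<^sup>2"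
proof -
  have "6 * (q * deriv (\<lambda>q. aexp q * cexp q) q) =
      (6 * (q * deriv aexp q)) * cexp q + 3 * aexp q * (2 * (q * deriv cexp q))"
    unfolding theta_mult[OF exps_holomorphic(3,5) q] by (simp add: algebra_simps)
  also have "\<dots> = 6 * (2 / 3 * pexp q * (aexp q * cexp q) + 1 / 3 * qexp q * (aexp q * cexp q) + 9 * (cexp q)\<^sup>2)"
    unfolding aexp_deriv[OF q] cexp_deriv[OF q] qexp_eq_aexp[OF q] by (simp add: algebra_simps eval_nat_numeral)
  finally show ?thesis by (simp only: mult_cancel_left numeral_neq_zero simp_thms)
qed

lemma sexp_deriv:
  assumes q: "q \<in> ball 0 1"
  shows "q * deriv (\<lambda>q. (cexp q)\<^sup>2) q = pexp q * (cexp q)\<^sup>2 + qexp q * (cexp q)\<^sup>2"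
proof -
  have "(\<lambda>q. (cexp q)\<^sup>2) = (\<lambda>q. cexp q * cexp q)" by (simp add: power2_eq_square)
  then have "q * deriv (\<lambda>q. (cexp q)\<^sup>2) q = (q * deriv cexp q) * cexp q + cexp q * (q * deriv cexp q)"
    using theta_mult[OF exps_holomorphic(5,5) q] by (simp only:)
  also have "\<dots> = cexp q * (2 * (q * deriv cexp q))" by (simp add: algebra_simps)
  finally have "q * deriv (\<lambda>q. (cexp q)\<^sup>2) q = cexp q * (2 * (q * deriv cexp q))" .
  then show ?thesis unfolding cexp_deriv[OF q] by (simp add: algebra_simps power2_eq_square)
qed

text \<open>The product b^3 c equals Q_3 R_3 - 27 S_3 by the cubic identity, so its derivative
  follows from those of the generators; all terms without P_3 cancel.\<close>

lemma dexp_deriv: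
  assumes q: "q \<in> ball 0 1"
  shows "q * deriv (\<lambda>q. bexp q * cexp q) q = pexp q * (bexp q * cexp q)"
proof -
  have "deriv (\<lambda>q. bexp q * cexp q) q = deriv (\<lambda>q. qexp q * (aexp q * cexp q) - 27 * (cexp q)\<^sup>2) q"
    by (rule deriv_cong_ball[OF _ q]) (simp add: bexp_eq qexp_eq_aexp algebra_simps eval_nat_numeral)
  also have "\<dots> = deriv (\<lambda>q. qexp q * (aexp q * cexp q)) q - 27 * deriv (\<lambda>q. (cexp q)\<^sup>2) q"
  proof -
    have h: "(\<lambda>q. qexp q * (aexp q * cexp q)) holomorphic_on ball 0 1" "(\<lambda>q. (cexp q)\<^sup>2) holomorphic_on ball 0 1"
      by (intro holomorphic_intros exps_holomorphic)+
    show ?thesis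
      by (rule DERIV_imp_deriv[OF DERIV_diff[OF holomorphic_derivI[OF h(1) open_ball q]
            DERIV_cmult[OF holomorphic_derivI[OF h(2) open_ball q]]]])
  qed
  finally have "q * deriv (\<lambda>q. bexp q * cexp q) q =
      q * deriv (\<lambda>q. qexp q * (aexp q * cexp q)) q - 27 * (q * deriv (\<lambda>q. (cexp q)\<^sup>2) q)"
    by (simp only: right_diff_distrib mult.left_commute[of q 27])
  also have "q * deriv (\<lambda>q. qexp q * (aexp q * cexp q)) q =
      (q * deriv qexp q) * (aexp q * cexp q) + qexp q * (q * deriv (\<lambda>q. aexp q * cexp q) q)"
    by (rule theta_mult[OF _ _ q]) (intro holomorphic_intros exps_holomorphic)+
  also have "q * deriv qexp q = (pexp q * qexp q - (qexp q)\<^sup>2 + 54 * (aexp q * cexp q)) / 3"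
    unfolding qexp_deriv[OF q, symmetric] by simp
  finally have e: "q * deriv (\<lambda>q. bexp q * cexp q) q =
      (pexp q * qexp q - (qexp q)\<^sup>2 + 54 * (aexp q * cexp q)) / 3 * (aexp q * cexp q) +
      qexp q * (q * deriv (\<lambda>q. aexp q * cexp q) q) - 27 * (q * deriv (\<lambda>q. (cexp q)\<^sup>2) q)" .
  show ?thesis
    unfolding e rexp_deriv[OF q] sexp_deriv[OF q] bexp_eq[OF q] qexp_eq_aexp[OF q] by (simp add: field_simps eval_nat_numeral)
qed

text \<open>The equation for the derivative of Q_3 is solved for R_3, then the one for the
  derivative of R_3 for S_3.\<close>

lemma moderate_growth_rs: "moderate_growth (\<lambda>\<tau>. aexp (nome \<tau>) * cexp (nome \<tau>))" "moderate_growth (\<lambda>\<tau>. (cexp (nome \<tau>))\<^sup>2)"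
proof -
  let ?P = "\<lambda>\<tau>. pexp (nome \<tau>)" and ?Q = "\<lambda>\<tau>. qexp (nome \<tau>)" and ?R = "\<lambda>\<tau>. aexp (nome \<tau>) * cexp (nome \<tau>)"
  have "moderate_growth (\<lambda>\<tau>. 1 / 54 * (3 * (nome \<tau> * deriv qexp (nome \<tau>)) - ?P \<tau> * ?Q \<tau> + ?Q \<tau> * ?Q \<tau>))"
    by (intro moderate_growth_mult moderate_growth_add moderate_growth_diff moderate_growth_const moderate_growth_pq
        moderate_growth_theta exps_holomorphic)
  moreover have "?R \<tau> = 1 / 54 * (3 * (nome \<tau> * deriv qexp (nome \<tau>)) - ?P \<tau> * ?Q \<tau> + ?Q \<tau> * ?Q \<tau>)" if "\<tau> \<in> \<H>" for \<tau>
    unfolding qexp_deriv[OF nome_in_ball[OF that]] by (simp add: power2_eq_square)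
  ultimately show R: "moderate_growth ?R" by (rule moderate_growth_cong[THEN iffD2, rotated])
  have h: "(\<lambda>q. aexp q * cexp q) holomorphic_on ball 0 1" by (intro holomorphic_intros exps_holomorphic)
  have "moderate_growth (\<lambda>\<tau>. 1 / 9 * (nome \<tau> * deriv (\<lambda>q. aexp q * cexp q) (nome \<tau>) - 2 / 3 * ?P \<tau> * ?R \<tau> - 1 / 3 * ?Q \<tau> * ?R \<tau>))"
    by (intro moderate_growth_mult[of "\<lambda>_. 1 / 9"] moderate_growth_diff moderate_growth_const moderate_growth_theta[OF h R]
        moderate_growth_mult[OF _ R] moderate_growth_mult[OF moderate_growth_const] moderate_growth_pq)
  moreover have "(cexp (nome \<tau>))\<^sup>2 = 1 / 9 * (nome \<tau> * deriv (\<lambda>q. aexp q * cexp q) (nome \<tau>) - 2 / 3 * ?P \<tau> * ?R \<tau> - 1 / 3 * ?Q \<tau> * ?R \<tau>)" if "\<tau> \<in> \<H>" for \<tau>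
    unfolding rexp_deriv[OF nome_in_ball[OF that]] by simp
  ultimately show "moderate_growth (\<lambda>\<tau>. (cexp (nome \<tau>))\<^sup>2)"
    by (rule moderate_growth_cong[THEN iffD2, rotated])
qed

lemma dexp_pair: "fricke_pair (int 6) (\<lambda>q. bexp q * cexp q) (\<lambda>q. - 27 * (bexp q * cexp q))"
proof -
  have "81 * of_real (sqrt 3) * \<i> * cexp q * (dual_c * bexp q) = - 27 * (bexp q * cexp q)" for q
    using sqrt3_powers(3) by (simp add: field_simps)
  then show ?thesis using fricke_pair_mult[OF bexp_pair cexp_pair] by simp
qed

text \<open>P_3 is the logarithmic derivative of \<open>D\<close>, the expansion of Delta_3, which
  is modular of weight 6 and has no zeros on the upper half-plane. Differentiating the law of
  \<open>D\<close> and dividing by it gives the law of P_3; the constant 3 / (pi i) is 6 / (2 pi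
  i).\<close>

lemma pexp_transform:
  fixes a b c d :: int
  assumes c: "3 dvd c" and det: "a * d - b * c = 1" and t: "\<tau> \<in> \<H>"
  defines "J \<equiv> of_int c * \<tau> + of_int d"
  shows "pexp (nome ((of_int a * \<tau> + of_int b) / J)) = J\<^sup>2 * pexp (nome \<tau>) + 3 / (of_real pi * \<i>) * of_int c * J"
proof -
  define D where "D = (\<lambda>q. bexp q * cexp q)"
  have hD: "D holomorphic_on ball 0 1" unfolding D_def by (intro holomorphic_intros exps_holomorphic)
  define \<sigma> where "\<sigma> = (of_int a * \<tau> + of_int b) / J"
  have s: "\<sigma> \<in> \<H>" unfolding \<sigma>_def J_def by (rule moebius_in_uhp[OF det t])
  have J0: "J \<noteq> 0" unfolding J_def by (rule denominator_nonzero[OF det t])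
  define p where "p = (of_real pi * \<i> :: complex)"
  have p0: "p \<noteq> 0" by (simp add: p_def)
  have th: "nome x * deriv D (nome x) = pexp (nome x) * D (nome x)" if "x \<in> \<H>" for x
    unfolding D_def by (rule dexp_deriv[OF nome_in_ball[OF that]])
  have m: "((\<lambda>\<tau>. (of_int a * \<tau> + of_int b) / (of_int c * \<tau> + of_int d)) has_field_derivative 1 / J\<^sup>2) (at \<tau>)"
  proof -
    have "((\<lambda>\<tau>. (of_int a * \<tau> + of_int b) / (of_int c * \<tau> + of_int d)) has_field_derivative
        (of_int a * J - (of_int a * \<tau> + of_int b) * of_int c) / (J * J)) (at \<tau>)"
      using J0 unfolding J_def by (auto intro!: derivative_eq_intros)
    moreover have "of_int a * J - (of_int a * \<tau> + of_int b) * of_int c = of_int (a * d - b * c)"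
      by (simp add: J_def algebra_simps)
    ultimately show ?thesis by (simp add: det power2_eq_square)
  qed
  have dF: "((\<lambda>\<tau>. D (nome ((of_int a * \<tau> + of_int b) / (of_int c * \<tau> + of_int d)))) has_field_derivative
      (2 * of_real pi * \<i> * (pexp (nome \<sigma>) * D (nome \<sigma>))) * (1 / J\<^sup>2)) (at \<tau>)"
    using DERIV_chain2[where f = "\<lambda>\<tau>. D (nome \<tau>)", OF _ m] fricke_expansion_has_field_derivative[OF hD s]
    unfolding th[OF s] by (simp add: \<sigma>_def J_def)
  have d1: "((\<lambda>\<tau>. (of_int c * \<tau> + of_int d) ^ 6) has_field_derivative 6 * (of_int c * J ^ 5)) (at \<tau>)"
    unfolding J_def by (auto intro!: derivative_eq_intros)
  have dG: "((\<lambda>\<tau>. (of_int c * \<tau> + of_int d) ^ 6 * D (nome \<tau>)) has_field_derivative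
      6 * (of_int c * J ^ 5) * D (nome \<tau>) + 2 * of_real pi * \<i> * (pexp (nome \<tau>) * D (nome \<tau>)) * J ^ 6) (at \<tau>)"
    using DERIV_mult[OF d1 fricke_expansion_has_field_derivative[OF hD t]] unfolding th[OF t] J_def .
  have inv: "D (nome ((of_int a * x + of_int b) / (of_int c * x + of_int d))) = (of_int c * x + of_int d) ^ 6 * D (nome x)"
    if "x \<in> \<H>" for x
    using fricke_pair_transform[OF dexp_pair _ c det that] by (simp add: D_def)
  have e: "(2 * of_real pi * \<i> * (pexp (nome \<sigma>) * D (nome \<sigma>))) * (1 / J\<^sup>2) =
      6 * (of_int c * J ^ 5) * D (nome \<tau>) + 2 * of_real pi * \<i> * (pexp (nome \<tau>) * D (nome \<tau>)) * J ^ 6"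
    by (rule DERIV_unique_uhp[OF dF dG t]) (rule inv)
  have Ds: "D (nome \<sigma>) = J ^ 6 * D (nome \<tau>)" using inv[OF t] by (simp add: \<sigma>_def J_def)
  have D0: "D (nome \<tau>) \<noteq> 0"
    using norm_nome_less_1[OF t] by (simp add: D_def bexp_nonzero cexp_nonzero)
  define P P' where "P = pexp (nome \<tau>)" and "P' = pexp (nome \<sigma>)"
  have "(J ^ 4 * D (nome \<tau>) * 2 * p) * P' = (J ^ 4 * D (nome \<tau>) * 2 * p) * (J\<^sup>2 * P + 3 / p * of_int c * J)"
    using e J0 p0 unfolding Ds P_def[symmetric] P'_def[symmetric]
    by (simp add: p_def field_simps eval_nat_numeral)
  moreover have "J ^ 4 * D (nome \<tau>) * 2 * p \<noteq> 0" using J0 D0 p0 by simp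
  ultimately have "P' = J\<^sup>2 * P + 3 / p * of_int c * J" by (simp only: mult_cancel_left simp_thms)
  then show ?thesis by (simp add: P_def P'_def \<sigma>_def p_def)
qed

section \<open>Monomials in the generators\<close>

text \<open>The last branch is meant for i = 4; \<open>mon_exp\<close> evaluates only the indices 1
  to 4.\<close>

definition gen_exp :: "nat \<Rightarrow> complex \<Rightarrow> complex" where
  "gen_exp i q = (if i = 1 then pexp q else if i = 2 then qexp q else if i = 3 then aexp q * cexp q else (cexp q)\<^sup>2)"

definition mon_exp :: "(nat \<Rightarrow>\<^sub>0 nat) \<Rightarrow> complex \<Rightarrow> complex" where
  "mon_exp m q = (\<Prod>i\<in>{1,2,3,4}. gen_exp i q ^ Poly_Mapping.lookup m i)"

definition mon_weight :: "(nat \<Rightarrow>\<^sub>0 nat) \<Rightarrow> nat" where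
  "mon_weight m = (\<Sum>i\<in>{1,2,3,4}. (if i \<le> 2 then 2 else 2 * (i - 1)) * Poly_Mapping.lookup m i)"

lemma mon_exp_eq: "mon_exp m q = pexp q ^ Poly_Mapping.lookup m 1 * (qexp q ^ Poly_Mapping.lookup m 2 *
    ((aexp q * cexp q) ^ Poly_Mapping.lookup m 3 * ((cexp q)\<^sup>2) ^ Poly_Mapping.lookup m 4))"
  by (simp add: mon_exp_def gen_exp_def)

lemma mon_weight_eq: "mon_weight m = 2 * Poly_Mapping.lookup m 1 + 2 * Poly_Mapping.lookup m 2 +
    4 * Poly_Mapping.lookup m 3 + 6 * Poly_Mapping.lookup m 4"
  by (simp add: mon_weight_def)

lemma mon_exp_0 [simp]: "mon_exp 0 q = 1"
  by (simp add: mon_exp_def)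

lemma mon_weight_0 [simp]: "mon_weight 0 = 0"
  by (simp add: mon_weight_def)

lemma mon_exp_add: "mon_exp (m + n) q = mon_exp m q * mon_exp n q"
  by (simp add: mon_exp_def lookup_add power_add prod.distrib)

lemma mon_weight_add: "mon_weight (m + n) = mon_weight m + mon_weight n"
  by (simp add: mon_weight_def lookup_add distrib_left sum.distrib)

lemma moderate_growth_mon: "moderate_growth (\<lambda>\<tau>. mon_exp m (nome \<tau>))"
  unfolding mon_exp_eq
  by (intro moderate_growth_mult moderate_growth_power moderate_growth_pq moderate_growth_rs)

text \<open>The witness is a polynomial rather than a family of coefficients, because it later
  serves as preimage under the evaluation map.\<close>

definition spanned :: "nat set \<Rightarrow> nat \<Rightarrow> (complex \<Rightarrow> complex) \<Rightarrow> bool" where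
  "spanned I k f \<longleftrightarrow> (\<exists>p :: cpoly. (\<forall>m\<in>Poly_Mapping.keys p. Poly_Mapping.keys m \<subseteq> I \<and> mon_weight m = k) \<and>
     (\<forall>\<tau>\<in>\<H>. f \<tau> = (\<Sum>m\<in>Poly_Mapping.keys p. Poly_Mapping.lookup p m * mon_exp m (nome \<tau>))))"

lemma sum_keys_superset:
  assumes "finite A" "Poly_Mapping.keys p \<subseteq> A"
  shows "(\<Sum>m\<in>Poly_Mapping.keys p. Poly_Mapping.lookup p m * f m) = (\<Sum>m\<in>A. Poly_Mapping.lookup p m * (f m :: complex))"
  by (rule sum.mono_neutral_left) (use assms in \<open>auto simp: in_keys_iff\<close>)

lemma sum_keys_add:
  fixes p r :: "'a \<Rightarrow>\<^sub>0 complex"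
  shows "(\<Sum>m\<in>Poly_Mapping.keys (p + r). Poly_Mapping.lookup (p + r) m * f m) =
    (\<Sum>m\<in>Poly_Mapping.keys p. Poly_Mapping.lookup p m * f m) + (\<Sum>m\<in>Poly_Mapping.keys r. Poly_Mapping.lookup r m * f m)"
proof -
  let ?A = "Poly_Mapping.keys p \<union> Poly_Mapping.keys r"
  have fin: "finite ?A" by simp
  show ?thesis
    unfolding sum_keys_superset[OF fin keys_add] sum_keys_superset[OF fin Un_upper1]
      sum_keys_superset[OF fin Un_upper2]
    by (simp only: lookup_add distrib_right sum.distrib)
qed

lemma spanned_zero: "(\<And>\<tau>. \<tau> \<in> \<H> \<Longrightarrow> f \<tau> = 0) \<Longrightarrow> spanned I k f"
  unfolding spanned_def by (rule exI[of _ 0]) simp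

lemma spanned_monomial:
  assumes "Poly_Mapping.keys m \<subseteq> I" "mon_weight m = k" "\<And>\<tau>. \<tau> \<in> \<H> \<Longrightarrow> f \<tau> = c * mon_exp m (nome \<tau>)"
  shows "spanned I k f"
  unfolding spanned_def by (rule exI[of _ "Poly_Mapping.single m c"]) (use assms in auto)

lemma spanned_add:
  assumes "spanned I k f" "spanned I k g" "\<And>\<tau>. \<tau> \<in> \<H> \<Longrightarrow> h \<tau> = f \<tau> + g \<tau>"
  shows "spanned I k h"
proof -
  obtain p where p: "\<forall>m\<in>Poly_Mapping.keys p. Poly_Mapping.keys m \<subseteq> I \<and> mon_weight m = k"
      "\<forall>\<tau>\<in>\<H>. f \<tau> = (\<Sum>m\<in>Poly_Mapping.keys p. Poly_Mapping.lookup p m * mon_exp m (nome \<tau>))"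
    using assms(1) unfolding spanned_def by blast
  obtain r where r: "\<forall>m\<in>Poly_Mapping.keys r. Poly_Mapping.keys m \<subseteq> I \<and> mon_weight m = k"
      "\<forall>\<tau>\<in>\<H>. g \<tau> = (\<Sum>m\<in>Poly_Mapping.keys r. Poly_Mapping.lookup r m * mon_exp m (nome \<tau>))"
    using assms(2) unfolding spanned_def by blast
  have "\<forall>m\<in>Poly_Mapping.keys (p + r). Poly_Mapping.keys m \<subseteq> I \<and> mon_weight m = k"
    using p(1) r(1) keys_add[of p r] by blast
  moreover have "\<forall>\<tau>\<in>\<H>. h \<tau> = (\<Sum>m\<in>Poly_Mapping.keys (p + r). Poly_Mapping.lookup (p + r) m * mon_exp m (nome \<tau>))"
    using p(2) r(2) assms(3) by (simp add: sum_keys_add)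
  ultimately show ?thesis unfolding spanned_def by blast
qed

lemma spanned_sum:
  assumes "finite A" "\<And>i. i \<in> A \<Longrightarrow> spanned I k (f i)"
  shows "spanned I k (\<lambda>\<tau>. \<Sum>i\<in>A. f i \<tau>)"
  using assms by (induction rule: finite_induct) (auto intro: spanned_zero spanned_add)

lemma spanned_mult_monomial:
  assumes "spanned I k f" "Poly_Mapping.keys n \<subseteq> I" "l = mon_weight n + k"
    "\<And>\<tau>. \<tau> \<in> \<H> \<Longrightarrow> h \<tau> = c * mon_exp n (nome \<tau>) * f \<tau>"
  shows "spanned I l h"
proof -
  obtain p where p: "\<forall>m\<in>Poly_Mapping.keys p. Poly_Mapping.keys m \<subseteq> I \<and> mon_weight m = k"
      "\<forall>\<tau>\<in>\<H>. f \<tau> = (\<Sum>m\<in>Poly_Mapping.keys p. Poly_Mapping.lookup p m * mon_exp m (nome \<tau>))"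
    using assms(1) unfolding spanned_def by blast
  have "spanned I l (\<lambda>\<tau>. \<Sum>m\<in>Poly_Mapping.keys p. (c * Poly_Mapping.lookup p m) * mon_exp (n + m) (nome \<tau>))"
  proof (rule spanned_sum)
    fix m assume m: "m \<in> Poly_Mapping.keys p"
    show "spanned I l (\<lambda>\<tau>. c * Poly_Mapping.lookup p m * mon_exp (n + m) (nome \<tau>))"
    proof (rule spanned_monomial[where m = "n + m" and c = "c * Poly_Mapping.lookup p m"])
      show "Poly_Mapping.keys (n + m) \<subseteq> I" using keys_add[of n m] assms(2) p(1) m by blast
      show "mon_weight (n + m) = l" using p(1) m assms(3) by (simp add: mon_weight_add)
    qed simp
  qed simp
  moreover have "h \<tau> = (\<Sum>m\<in>Poly_Mapping.keys p. (c * Poly_Mapping.lookup p m) * mon_exp (n + m) (nome \<tau>))" if "\<tau> \<in> \<H>" for \<tau>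
    using assms(4)[OF that] p(2) that by (simp add: mon_exp_add sum_distrib_left mult_ac)
  ultimately show ?thesis unfolding spanned_def by simp
qed

lemma spanned_mono: "spanned I k f \<Longrightarrow> I \<subseteq> J \<Longrightarrow> spanned J k f"
  unfolding spanned_def by blast

text \<open>For even k the exponents in a^(k-3j) c^j have the same parity. If they are odd, one
  factor R_3 = a c is split off, and what remains is a product of powers of Q_3 = a^2 and S_3 =
  c^2.\<close>

lemma fricke_pair_spanned:
  assumes FG: "fricke_pair (int k) F G" and k: "even k"
  shows "spanned {2,3,4} k (\<lambda>\<tau>. F (nome \<tau>))"
proof -
  obtain \<alpha> where a: "\<forall>q\<in>ball 0 1. F q = (\<Sum>j\<le>k div 3. \<alpha> j * (aexp q ^ (k - 3 * j) * cexp q ^ j))"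
    using fricke_pair_structure[OF FG] by blast
  have "spanned {2,3,4} k (\<lambda>\<tau>. \<Sum>j\<le>k div 3. \<alpha> j * (aexp (nome \<tau>) ^ (k - 3 * j) * cexp (nome \<tau>) ^ j))"
  proof (rule spanned_sum)
    fix j assume "j \<in> {..k div 3}"
    then have j: "3 * j \<le> k" by simp
    define r s where "r = j mod 2" and "s = j div 2"
    have js: "j = r + 2 * s" by (simp add: r_def s_def)
    define t where "t = (k - 3 * j) div 2"
    have "even (k - 3 * j) \<longleftrightarrow> even j" using k j by (simp add: even_diff_nat)
    then have "r = (k - 3 * j) mod 2" by (simp add: r_def mod2_eq_if)
    then have t: "k - 3 * j = r + 2 * t" by (simp add: t_def)
    define m where "m = Poly_Mapping.single 2 t + Poly_Mapping.single 3 r + Poly_Mapping.single (4::nat) s"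
    have l: "Poly_Mapping.lookup m 1 = 0" "Poly_Mapping.lookup m 2 = t" "Poly_Mapping.lookup m 3 = r" "Poly_Mapping.lookup m 4 = s"
      by (simp_all add: m_def lookup_add lookup_single)
    show "spanned {2,3,4} k (\<lambda>\<tau>. \<alpha> j * (aexp (nome \<tau>) ^ (k - 3 * j) * cexp (nome \<tau>) ^ j))"
    proof (rule spanned_monomial)
      show "Poly_Mapping.keys m \<subseteq> {2,3,4}"
      proof
        fix i assume "i \<in> Poly_Mapping.keys m"
        then show "i \<in> {2,3,4}"
          by (auto simp: m_def in_keys_iff lookup_add lookup_single when_def split: if_splits)
      qed
      have "k = r + 2 * t + 3 * j" using t j by linarith
      then show "mon_weight m = k" unfolding mon_weight_eq l js by simp
      fix \<tau> assume "\<tau> \<in> \<H>"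
      then have q: "nome \<tau> \<in> ball 0 1" by (rule nome_in_ball)
      show "\<alpha> j * (aexp (nome \<tau>) ^ (k - 3 * j) * cexp (nome \<tau>) ^ j) = \<alpha> j * mon_exp m (nome \<tau>)"
        unfolding t mon_exp_eq l qexp_eq_aexp[OF q] unfolding js
        by (simp add: power_add power_mult power_mult_distrib)
    qed
  qed simp
  moreover have "F (nome \<tau>) = (\<Sum>j\<le>k div 3. \<alpha> j * (aexp (nome \<tau>) ^ (k - 3 * j) * cexp (nome \<tau>) ^ j))" if "\<tau> \<in> \<H>" for \<tau>
    using a nome_in_ball[OF that] by blast
  ultimately show ?thesis unfolding spanned_def by simp
qed

lemma mon_exp_pair:
  assumes "Poly_Mapping.lookup m 1 = 0"
  shows "\<exists>G. fricke_pair (int (mon_weight m)) (mon_exp m) G"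
proof -
  have ac: "fricke_pair (1 + 3) (\<lambda>q. aexp q * cexp q) (\<lambda>q. (dual_a * aexp q) * (dual_c * bexp q))"
    by (rule fricke_pair_mult[OF aexp_pair cexp_pair])
  let ?l = "Poly_Mapping.lookup m"
  have e: "int (mon_weight m) = int (?l 2) * 2 + (int (?l 3) * (1 + 3) + int (?l 4) * (int 2 * 3))"
    using assms by (simp add: mon_weight_eq)
  have f: "mon_exp m = (\<lambda>q. qexp q ^ ?l 2 * ((aexp q * cexp q) ^ ?l 3 * ((cexp q)\<^sup>2) ^ ?l 4))"
    using assms by (simp add: mon_exp_eq fun_eq_iff)
  show ?thesis
    unfolding e f
    by (rule exI, rule fricke_pair_mult[OF fricke_pair_power[OF qexp_pair]
          fricke_pair_mult[OF fricke_pair_power[OF ac] fricke_pair_power[OF fricke_pair_power[OF cexp_pair]]]])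
qed

lemma even_mon_weight: "even (mon_weight m)"
  by (simp add: mon_weight_eq)

section \<open>Quasi-modular forms\<close>

text \<open>The coefficient functions are kept explicit because the arguments about the law work on
  its last member; entries beyond p are arbitrary.\<close>

definition quasi_expansion :: "nat \<Rightarrow> nat \<Rightarrow> (nat \<Rightarrow> complex \<Rightarrow> complex) \<Rightarrow> bool" where
  "quasi_expansion k p F \<longleftrightarrow> (\<forall>j\<le>p. F j holomorphic_on \<H> \<and> moderate_growth (F j)) \<and>
     (\<forall>\<gamma>\<in>Gamma0 3. \<forall>\<tau>\<in>\<H>. slash k \<gamma> (F 0) \<tau> =
        (\<Sum>j\<le>p. F j \<tau> * (of_int (\<gamma> $ 2 $ 1) / aut_factor \<gamma> \<tau>) ^ j))"

lemma quasimodular_iff: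
  "f \<in> quasimodular_forms k (Gamma0 3) \<longleftrightarrow> (\<forall>\<tau>. \<tau> \<notin> \<H> \<longrightarrow> f \<tau> = 0) \<and> (\<exists>p F. F 0 = f \<and> quasi_expansion k p F)"
  unfolding quasimodular_forms_def quasi_expansion_def by auto

lemma quasimodularI:
  assumes "quasi_expansion k p F" "F 0 = f" "\<And>\<tau>. \<tau> \<notin> \<H> \<Longrightarrow> f \<tau> = 0"
  shows "f \<in> quasimodular_forms k (Gamma0 3)"
  using assms unfolding quasimodular_iff by blast

text \<open>Filling up with zeros brings two laws to a common length; with r = p it supplies the
  vanishing entries that \<open>quasi_expansion_mult\<close> asks for.\<close>

lemma quasi_expansion_mono:
  assumes "quasi_expansion k p F" "p \<le> r"
  shows "quasi_expansion k r (\<lambda>j. if j \<le> p then F j else (\<lambda>_. 0))"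
  unfolding quasi_expansion_def
proof (intro conjI allI impI ballI)
  fix \<gamma> :: "int^2^2" and \<tau> assume gt: "\<gamma> \<in> Gamma0 3" "\<tau> \<in> \<H>"
  let ?X = "of_int (\<gamma> $ 2 $ 1) / aut_factor \<gamma> \<tau>"
  have "(\<Sum>j\<le>r. (if j \<le> p then F j else (\<lambda>_. 0)) \<tau> * ?X ^ j) = (\<Sum>j\<le>p. F j \<tau> * ?X ^ j)"
    by (rule sum.mono_neutral_cong_right) (use assms(2) in auto)
  then show "slash k \<gamma> ((\<lambda>j. if j \<le> p then F j else (\<lambda>_. 0)) 0) \<tau> =
      (\<Sum>j\<le>r. (if j \<le> p then F j else (\<lambda>_. 0)) \<tau> * ?X ^ j)"
    using assms(1) gt unfolding quasi_expansion_def by simp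
qed (use assms in \<open>auto simp: quasi_expansion_def intro: moderate_growth_const\<close>)

lemma quasi_expansion_add:
  assumes "quasi_expansion k p F" "quasi_expansion k p G"
  shows "quasi_expansion k p (\<lambda>j \<tau>. F j \<tau> + G j \<tau>)"
  using assms unfolding quasi_expansion_def
  by (auto intro!: holomorphic_intros moderate_growth_add simp: distrib_right sum.distrib slash_def add_divide_distrib)

lemma quasi_expansion_mult:
  assumes F: "quasi_expansion k p F" and G: "quasi_expansion l r G"
    and F0: "\<And>j. j > p \<Longrightarrow> F j = (\<lambda>_. 0)" and G0: "\<And>j. j > r \<Longrightarrow> G j = (\<lambda>_. 0)"
  shows "quasi_expansion (k + l) (p + r) (\<lambda>j \<tau>. \<Sum>i\<le>j. F i \<tau> * G (j - i) \<tau>)"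
  unfolding quasi_expansion_def
proof (intro conjI allI impI ballI)
  have hF: "F j holomorphic_on \<H>" "moderate_growth (F j)" for j
    using F F0[of j] by (cases "j \<le> p"; auto simp: quasi_expansion_def intro: moderate_growth_const)+
  have hG: "G j holomorphic_on \<H>" "moderate_growth (G j)" for j
    using G G0[of j] by (cases "j \<le> r"; auto simp: quasi_expansion_def intro: moderate_growth_const)+
  show "(\<lambda>\<tau>. \<Sum>i\<le>j. F i \<tau> * G (j - i) \<tau>) holomorphic_on \<H>" for j
    by (intro holomorphic_intros hF hG)
  show "moderate_growth (\<lambda>\<tau>. \<Sum>i\<le>j. F i \<tau> * G (j - i) \<tau>)" for j
    by (intro moderate_growth_sum moderate_growth_mult hF hG) simp
  fix \<gamma> :: "int^2^2" and \<tau> assume gt: "\<gamma> \<in> Gamma0 3" "\<tau> \<in> \<H>"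
  let ?X = "of_int (\<gamma> $ 2 $ 1) / aut_factor \<gamma> \<tau>"
  have "slash (k + l) \<gamma> ((\<lambda>j \<tau>. \<Sum>i\<le>j. F i \<tau> * G (j - i) \<tau>) 0) \<tau> = slash k \<gamma> (F 0) \<tau> * slash l \<gamma> (G 0) \<tau>"
    by (simp add: slash_def power_add)
  also have "\<dots> = (\<Sum>i\<le>p. F i \<tau> * ?X ^ i) * (\<Sum>j\<le>r. G j \<tau> * ?X ^ j)"
    using F G gt unfolding quasi_expansion_def by simp
  also have "\<dots> = (\<Sum>s\<le>p + r. (\<Sum>i\<le>s. F i \<tau> * G (s - i) \<tau>) * ?X ^ s)"
    by (rule polynomial_product) (use F0 G0 in auto)
  finally show "slash (k + l) \<gamma> ((\<lambda>j \<tau>. \<Sum>i\<le>j. F i \<tau> * G (j - i) \<tau>) 0) \<tau> =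
     (\<Sum>j\<le>p + r. (\<Sum>i\<le>j. F i \<tau> * G (j - i) \<tau>) * ?X ^ j)" .
qed

lemma quasimodular_mult:
  assumes "f \<in> quasimodular_forms k (Gamma0 3)" "g \<in> quasimodular_forms l (Gamma0 3)"
  shows "(\<lambda>\<tau>. f \<tau> * g \<tau>) \<in> quasimodular_forms (k + l) (Gamma0 3)"
proof -
  obtain p F where F: "F 0 = f" "quasi_expansion k p F" using assms(1) by (auto simp: quasimodular_iff)
  obtain r G where G: "G 0 = g" "quasi_expansion l r G" using assms(2) by (auto simp: quasimodular_iff)
  from quasi_expansion_mult[OF quasi_expansion_mono[OF F(2) order_refl] quasi_expansion_mono[OF G(2) order_refl]]
  have "quasi_expansion (k + l) (p + r) (\<lambda>j \<tau>. \<Sum>i\<le>j. (if i \<le> p then F i else (\<lambda>_. 0)) \<tau> * (if j - i \<le> r then G (j - i) else (\<lambda>_. 0)) \<tau>)"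
    by auto
  then show ?thesis
  proof (rule quasimodularI)
    show "f \<tau> * g \<tau> = 0" if "\<tau> \<notin> \<H>" for \<tau> using assms(1) that by (simp add: quasimodular_iff)
  qed (use F G in auto)
qed

lemma quasimodular_add:
  assumes "f \<in> quasimodular_forms k (Gamma0 3)" "g \<in> quasimodular_forms k (Gamma0 3)"
  shows "(\<lambda>\<tau>. f \<tau> + g \<tau>) \<in> quasimodular_forms k (Gamma0 3)"
proof -
  obtain p F where F: "F 0 = f" "quasi_expansion k p F" using assms(1) by (auto simp: quasimodular_iff)
  obtain r G where G: "G 0 = g" "quasi_expansion k r G" using assms(2) by (auto simp: quasimodular_iff)
  from quasi_expansion_add[OF quasi_expansion_mono[OF F(2), of "max p r"] quasi_expansion_mono[OF G(2), of "max p r"]]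
  have "quasi_expansion k (max p r) (\<lambda>j \<tau>. (if j \<le> p then F j else (\<lambda>_. 0)) \<tau> + (if j \<le> r then G j else (\<lambda>_. 0)) \<tau>)"
    by simp
  then show ?thesis
  proof (rule quasimodularI)
    show "f \<tau> + g \<tau> = 0" if "\<tau> \<notin> \<H>" for \<tau> using assms that by (simp add: quasimodular_iff)
  qed (use F G in auto)
qed

lemma modular_imp_quasimodular:
  assumes "fricke_pair (int k) F G" "even k" "moderate_growth (\<lambda>\<tau>. F (nome \<tau>))"
  shows "form_of F \<in> quasimodular_forms k (Gamma0 3)"
proof -
  have "moderate_growth (form_of F)"
    using assms(3) by (subst moderate_growth_cong[of _ "\<lambda>\<tau>. F (nome \<tau>)"]) (simp_all add: form_of_apply)
  then have "quasi_expansion k 0 (\<lambda>_. form_of F)"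
    using form_of_holomorphic[OF fricke_pairD(1)[OF assms(1)]] form_of_slash_Gamma0[OF assms(1,2)]
    by (simp add: quasi_expansion_def)
  then show ?thesis by (auto simp: quasimodular_iff form_of_outside)
qed

definition qm_const :: complex where "qm_const = 3 / (of_real pi * \<i>)"

lemma pexp_slash:
  assumes g: "\<gamma> \<in> Gamma0 3" and t: "\<tau> \<in> \<H>"
  shows "pexp (nome (moebius_act \<gamma> \<tau>)) = (aut_factor \<gamma> \<tau>)\<^sup>2 *
    (pexp (nome \<tau>) + qm_const * (of_int (\<gamma> $ 2 $ 1) / aut_factor \<gamma> \<tau>))"
proof -
  have det: "\<gamma> $ 1 $ 1 * \<gamma> $ 2 $ 2 - \<gamma> $ 1 $ 2 * \<gamma> $ 2 $ 1 = 1" and c: "3 dvd \<gamma> $ 2 $ 1"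
    using g by (auto simp: Gamma0_iff)
  have J0: "aut_factor \<gamma> \<tau> \<noteq> 0" unfolding aut_factor_def by (rule denominator_nonzero[OF det t])
  have e: "J\<^sup>2 * (p + K * (x / J)) = J\<^sup>2 * p + K * x * J" if "J \<noteq> 0" for J p K x :: complex
    using that by (simp add: field_simps power2_eq_square)
  show ?thesis
    unfolding e[OF J0] unfolding moebius_act_def qm_const_def aut_factor_def by (rule pexp_transform[OF c det t])
qed

lemma Gamma0_uhp:
  assumes "\<gamma> \<in> Gamma0 3" "\<tau> \<in> \<H>"
  shows "moebius_act \<gamma> \<tau> \<in> \<H>" "aut_factor \<gamma> \<tau> \<noteq> 0"
  using assms moebius_in_uhp denominator_nonzero by (auto simp: Gamma0_iff moebius_act_def aut_factor_def)

lemma pexp_quasimodular: "form_of pexp \<in> quasimodular_forms 2 (Gamma0 3)"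
proof -
  have mg: "moderate_growth (form_of pexp)"
    using moderate_growth_pq(1) by (subst moderate_growth_cong[of _ "\<lambda>\<tau>. pexp (nome \<tau>)"]) (simp_all add: form_of_apply)
  have "quasi_expansion 2 1 (\<lambda>j. if j = 0 then form_of pexp else (\<lambda>_. qm_const))"
    unfolding quasi_expansion_def
  proof (intro conjI allI impI ballI)
    fix \<gamma> :: "int^2^2" and \<tau> assume gt: "\<gamma> \<in> Gamma0 3" "\<tau> \<in> \<H>"
    show "slash 2 \<gamma> ((\<lambda>j. if j = 0 then form_of pexp else (\<lambda>_. qm_const)) 0) \<tau> =
      (\<Sum>j\<le>1. (if j = 0 then form_of pexp else (\<lambda>_. qm_const)) \<tau> * (of_int (\<gamma> $ 2 $ 1) / aut_factor \<gamma> \<tau>) ^ j)"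
      using Gamma0_uhp[OF gt] gt(2) by (simp add: slash_def form_of_apply pexp_slash[OF gt])
  qed (use mg in \<open>auto intro: moderate_growth_const form_of_holomorphic exps_holomorphic\<close>)
  then show ?thesis by (rule quasimodularI) (simp_all add: form_of_outside)
qed

lemma quasimodular_const: "on_uhp (\<lambda>_. c) \<in> quasimodular_forms 0 (Gamma0 3)"
proof -
  have "form_of (\<lambda>_. c) \<in> quasimodular_forms 0 (Gamma0 3)"
    by (rule modular_imp_quasimodular[where G = "\<lambda>_. c"]) (simp_all add: fricke_pair_const moderate_growth_const)
  then show ?thesis by (simp add: form_of_def)
qed

lemma form_of_mult: "form_of (\<lambda>q. F q * G q) = (\<lambda>\<tau>. form_of F \<tau> * form_of G \<tau>)"
  by (simp add: form_of_def on_uhp_def fun_eq_iff)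

lemma quasimodular_power:
  assumes "form_of F \<in> quasimodular_forms k (Gamma0 3)"
  shows "form_of (\<lambda>q. F q ^ n) \<in> quasimodular_forms (n * k) (Gamma0 3)"
proof (induction n)
  case 0
  show ?case using quasimodular_const[of 1] by (simp add: form_of_def)
next
  case (Suc n)
  from quasimodular_mult[OF assms Suc] show ?case by (simp add: form_of_mult)
qed

text \<open>The power of P_3 is split off; the other factor \<open>n\<close> comes from a pair of
  even weight and is thus a modular form.\<close>

lemma mon_exp_quasimodular: "form_of (mon_exp m) \<in> quasimodular_forms (mon_weight m) (Gamma0 3)"
proof -
  have s: "Poly_Mapping.lookup (m - Poly_Mapping.single 1 (Poly_Mapping.lookup m 1)) 1 = 0"
    by (simp add: lookup_minus)
  define n where "n = m - Poly_Mapping.single 1 (Poly_Mapping.lookup m 1)"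
  have m: "m = Poly_Mapping.single 1 (Poly_Mapping.lookup m 1) + n"
    by (rule poly_mapping_eqI) (simp add: n_def lookup_add lookup_minus lookup_single when_def)
  obtain G where "fricke_pair (int (mon_weight n)) (mon_exp n) G"
    using mon_exp_pair s unfolding n_def by blast
  then have 1: "form_of (mon_exp n) \<in> quasimodular_forms (mon_weight n) (Gamma0 3)"
    by (rule modular_imp_quasimodular[OF _ even_mon_weight moderate_growth_mon])
  have e: "mon_exp (Poly_Mapping.single 1 i) q = pexp q ^ i" "mon_weight (Poly_Mapping.single 1 i) = i * 2" for i q
    by (simp_all add: mon_exp_eq mon_weight_eq lookup_single)
  have "mon_exp m = (\<lambda>q. pexp q ^ Poly_Mapping.lookup m 1 * mon_exp n q)"
    by (subst m) (simp add: mon_exp_add e fun_eq_iff del: One_nat_def)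
  moreover have "mon_weight m = Poly_Mapping.lookup m 1 * 2 + mon_weight n"
    by (subst m) (simp add: mon_weight_add e del: One_nat_def)
  ultimately show ?thesis
    using quasimodular_mult[OF quasimodular_power[OF pexp_quasimodular] 1] by (simp add: form_of_mult)
qed

text \<open>These are the values of c/(c \<tau> + d) for the shears at a fixed point. Being
  infinitely many, they turn a transformation law into an identity of polynomials.\<close>

lemma infinite_shear_values:
  assumes t: "\<tau> \<in> \<H>"
  shows "infinite (range (\<lambda>n::int. of_int (3 * n) / (of_int (3 * n) * \<tau> + 1)))"
proof -
  have "inj (\<lambda>n::int. of_int (3 * n) / (of_int (3 * n) * \<tau> + 1))"
  proof (rule injI)
    fix m n :: int
    assume *: "of_int (3 * m) / (of_int (3 * m) * \<tau> + 1) = of_int (3 * n) / (of_int (3 * n) * \<tau> + 1)"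
    have "of_int (3 * i) * \<tau> + 1 \<noteq> 0" for i using denominator_nonzero[of 1 1 0 "3 * i" \<tau>] t by simp
    with * have "of_int (3 * m) * (of_int (3 * n) * \<tau> + 1) = of_int (3 * n) * (of_int (3 * m) * \<tau> + 1)"
      by (simp add: frac_eq_eq)
    then have "(of_int (3 * m) :: complex) = of_int (3 * n)" by (simp add: algebra_simps)
    then show "m = n" by (simp only: of_int_eq_iff)
  qed
  then show ?thesis using finite_imageD infinite_UNIV_int by blast
qed

lemma poly_eq_on_infinite:
  assumes "infinite A" "\<And>x. x \<in> A \<Longrightarrow> poly p x = poly r (x :: complex)"
  shows "p = r"
proof (rule ccontr)
  assume "p \<noteq> r"
  then have "finite {x. poly (p - r) x = 0}" by (intro poly_roots_finite) simp
  moreover have "A \<subseteq> {x. poly (p - r) x = 0}" using assms(2) by auto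
  ultimately show False using assms(1) finite_subset by blast
qed

text \<open>
  Composing with \<open>\<gamma>\<^sup>-\<^sup>1\<close> and then with the shears \<open>(1, 0; 3 n, 1)\<close>, the defining expansion becomes
  an identity of polynomials in \<open>3 n / (3 n \<tau> + 1)\<close>; its leading coefficients give the
  modularity of the last coefficient function.
\<close>

lemma quasi_expansion_top:
  assumes F: "quasi_expansion k p F" and g: "\<gamma> \<in> Gamma0 3" and t: "\<tau> \<in> \<H>"
  shows "F p (moebius_act \<gamma> \<tau>) = aut_factor \<gamma> \<tau> powi (int k - 2 * int p) * F p \<tau>"
proof -
  define a b c d where "a = \<gamma> $ 1 $ 1" and "b = \<gamma> $ 1 $ 2" and "c = \<gamma> $ 2 $ 1" and "d = \<gamma> $ 2 $ 2"
  have det: "a * d - b * c = 1" and c3: "3 dvd c" using g by (auto simp: Gamma0_iff a_def b_def c_def d_def)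
  define J where "J = aut_factor \<gamma> \<tau>"
  define \<sigma> where "\<sigma> = moebius_act \<gamma> \<tau>"
  have J: "J = of_int c * \<tau> + of_int d" by (simp add: J_def aut_factor_def c_def d_def)
  have s: "\<sigma> = (of_int a * \<tau> + of_int b) / J" by (simp add: \<sigma>_def moebius_act_def J_def a_def b_def)
  have J0: "J \<noteq> 0" and sH: "\<sigma> \<in> \<H>" unfolding J_def \<sigma>_def using Gamma0_uhp[OF g t] by auto
  define x where "x = of_int c / J"
  let ?Y = "\<lambda>n::int. of_int (3 * n) / (of_int (3 * n) * \<tau> + 1)"
  \<comment> \<open>\<open>p1\<close> comes from the law at \<tau> for the shear \<gamma>1,
    \<open>p2\<close> from the law at \<sigma> for \<gamma>2, the product of \<gamma>1 with the
    inverse of \<gamma>; both maps lead to the same point.\<close>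
  define p1 where "p1 = (\<Sum>j\<le>p. Polynomial.monom (J ^ k * F j \<tau>) j)"
  define p2 where "p2 = (\<Sum>j\<le>p. Polynomial.smult (F j \<sigma> * (J\<^sup>2) ^ j) ([:- x, 1:] ^ j))"
  have "p1 = p2"
  proof (rule poly_eq_on_infinite[OF infinite_shear_values[OF t]])
    fix y assume "y \<in> range ?Y"
    then obtain n :: int where y: "y = ?Y n" by blast
    obtain \<gamma>1 :: "int^2^2" where g1: "\<gamma>1 $ 1 $ 1 = 1" "\<gamma>1 $ 1 $ 2 = 0" "\<gamma>1 $ 2 $ 1 = 3 * n" "\<gamma>1 $ 2 $ 2 = 1"
      by (rule exists_int_matrix)
    obtain \<gamma>2 :: "int^2^2" where g2: "\<gamma>2 $ 1 $ 1 = d" "\<gamma>2 $ 1 $ 2 = - b"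
        "\<gamma>2 $ 2 $ 1 = 3 * n * d - c" "\<gamma>2 $ 2 $ 2 = a - 3 * n * b"
      by (rule exists_int_matrix)
    have G1: "\<gamma>1 \<in> Gamma0 3" by (simp add: Gamma0_iff g1)
    have G2: "\<gamma>2 \<in> Gamma0 3" using det c3 by (simp add: Gamma0_iff g2 algebra_simps mult.assoc)
    define E where "E = of_int (3 * n) * \<tau> + 1"
    have E: "E = aut_factor \<gamma>1 \<tau>" by (simp add: E_def aut_factor_def g1)
    have E0: "E \<noteq> 0" unfolding E using Gamma0_uhp[OF G1 t] by simp
    have detc: "of_int a * of_int d - of_int b * of_int c = (1::complex)"
      using arg_cong[OF det, of "of_int :: int \<Rightarrow> complex"] by simp
    have E2: "aut_factor \<gamma>2 \<sigma> = E / J"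
    proof -
      have "aut_factor \<gamma>2 \<sigma> * J = (of_int (3 * n * d - c)) * (of_int a * \<tau> + of_int b) + (of_int a - of_int (3 * n * b)) * J"
        using J0 by (simp add: aut_factor_def g2 s distrib_right)
      also have "\<dots> = (of_int a * of_int d - of_int b * of_int c) * E"
        by (simp add: J E_def algebra_simps)
      finally show ?thesis using J0 detc by (simp add: field_simps)
    qed
    have m2: "moebius_act \<gamma>2 \<sigma> = moebius_act \<gamma>1 \<tau>"
    proof -
      have "(of_int d * \<sigma> - of_int b) * J = of_int d * (of_int a * \<tau> + of_int b) - of_int b * J"
        using J0 by (simp add: s left_diff_distrib)
      also have "\<dots> = (of_int a * of_int d - of_int b * of_int c) * \<tau>" by (simp add: J algebra_simps)
      finally have "of_int d * \<sigma> - of_int b = \<tau> / J" using J0 detc by (simp add: field_simps)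
      then show ?thesis
        unfolding moebius_act_def E2 E[symmetric] using J0 by (simp add: g1 g2)
    qed
    have yX: "y = of_int (\<gamma>1 $ 2 $ 1) / aut_factor \<gamma>1 \<tau>" by (simp only: y E[symmetric] g1 E_def)
    \<comment> \<open>The argument of the second law is affine in y, so both sides are polynomials
      in y of degree at most p.\<close>
    have X2: "of_int (\<gamma>2 $ 2 $ 1) / aut_factor \<gamma>2 \<sigma> = J\<^sup>2 * (y - x)"
    proof -
      have "of_int (3 * n) * J - of_int c * E = of_int (3 * n * d - c)" by (simp add: J E_def algebra_simps)
      moreover have "J\<^sup>2 * (u / E - v / J) = (u * J - v * E) * J / E" for u v
        using J0 E0 by (simp add: field_simps power2_eq_square)
      ultimately have "J\<^sup>2 * (y - x) = of_int (3 * n * d - c) * J / E"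
        unfolding y E_def[symmetric] x_def by (simp only:)
      then show ?thesis unfolding E2 g2 by simp
    qed
    have "F 0 (moebius_act \<gamma>1 \<tau>) / E ^ k = (\<Sum>j\<le>p. F j \<tau> * y ^ j)"
      using F G1 t unfolding quasi_expansion_def slash_def yX E by blast
    then have "F 0 (moebius_act \<gamma>1 \<tau>) = E ^ k * (\<Sum>j\<le>p. F j \<tau> * y ^ j)"
      using E0 by (metis nonzero_mult_div_cancel_left power_not_zero times_divide_eq_right)
    moreover have "F 0 (moebius_act \<gamma>2 \<sigma>) / (E / J) ^ k = (\<Sum>j\<le>p. F j \<sigma> * (J\<^sup>2 * (y - x)) ^ j)"
      using F G2 sH unfolding quasi_expansion_def slash_def X2[symmetric] E2[symmetric] by blast
    then have "F 0 (moebius_act \<gamma>2 \<sigma>) = (E / J) ^ k * (\<Sum>j\<le>p. F j \<sigma> * (J\<^sup>2 * (y - x)) ^ j)"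
      using E0 J0 by (metis divide_eq_0_iff nonzero_mult_div_cancel_left power_not_zero times_divide_eq_right)
    ultimately have "E ^ k * (\<Sum>j\<le>p. F j \<tau> * y ^ j) = (E / J) ^ k * (\<Sum>j\<le>p. F j \<sigma> * (J\<^sup>2 * (y - x)) ^ j)"
      unfolding m2 by simp
    then have "E ^ k * (J ^ k * (\<Sum>j\<le>p. F j \<tau> * y ^ j)) = E ^ k * (\<Sum>j\<le>p. F j \<sigma> * (J\<^sup>2 * (y - x)) ^ j)"
      using J0 by (simp add: power_divide field_simps)
    then have "J ^ k * (\<Sum>j\<le>p. F j \<tau> * y ^ j) = (\<Sum>j\<le>p. F j \<sigma> * (J\<^sup>2 * (y - x)) ^ j)"
      using E0 by simp
    then show "poly p1 y = poly p2 y"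
      by (simp add: p1_def p2_def poly_sum poly_monom sum_distrib_left power_mult_distrib mult_ac)
  qed
  moreover have "coeff p1 p = J ^ k * F p \<tau>" by (simp add: p1_def coeff_sum)
  moreover have "coeff p2 p = F p \<sigma> * (J\<^sup>2) ^ p"
  proof -
    have "coeff ([:- x, 1:] ^ j) p = (if j = p then 1 else 0)" if "j \<le> p" for j
    proof (cases "j = p")
      case True then show ?thesis by (simp add: coeff_linear_power)
    next
      case False
      then show ?thesis using that by (simp add: coeff_eq_0 degree_linear_power)
    qed
    then have "coeff p2 p = (\<Sum>j\<le>p. F j \<sigma> * (J\<^sup>2) ^ j * (if j = p then 1 else 0))"
      unfolding p2_def coeff_sum coeff_smult by (intro sum.cong) auto
    also have "\<dots> = F p \<sigma> * (J\<^sup>2) ^ p" by (simp add: if_distrib cong: if_cong)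
    finally show ?thesis .
  qed
  ultimately have "F p \<sigma> * (J\<^sup>2) ^ p = J ^ k * F p \<tau>" by simp
  then have "F p \<sigma> = J ^ k / (J\<^sup>2) ^ p * F p \<tau>" using J0 by (simp add: field_simps)
  also have "J ^ k / (J\<^sup>2) ^ p = J powi (int k - 2 * int p)"
    using J0 by (simp add: power_int_diff power_int_mult flip: power_mult)
  finally show ?thesis by (simp add: \<sigma>_def J_def)
qed

lemma height_fricke:
  assumes "\<tau> \<in> \<H>"
  shows "height (- 1 / (3 * \<tau>)) \<le> 3 * height \<tau>"
proof -
  have y: "Im \<tau> > 0" and t0: "\<tau> \<noteq> 0" using assms uhp_nonzero by (auto simp: upper_half_plane_def)
  have n: "(norm \<tau>)\<^sup>2 > 0" using t0 by simp
  have "- 1 / (3 * \<tau>) = (1 / 3) *\<^sub>R (- 1 / \<tau>)" by (simp add: scaleR_conv_of_real)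
  then have "Im (- 1 / (3 * \<tau>)) = 1 / 3 * Im (- 1 / \<tau>)" by (simp only: scaleR_complex.simps)
  also have "Im (- 1 / \<tau>) = Im \<tau> / (norm \<tau>)\<^sup>2" by (simp add: Im_divide cmod_power2)
  finally have "Im (- 1 / (3 * \<tau>)) = Im \<tau> / (3 * (norm \<tau>)\<^sup>2)" by simp
  moreover have "(norm (- 1 / (3 * \<tau>)))\<^sup>2 = 1 / (9 * (norm \<tau>)\<^sup>2)"
    by (simp add: norm_divide norm_mult power_divide power_mult_distrib)
  ultimately have "height (- 1 / (3 * \<tau>)) = (1 + 1 / (9 * (norm \<tau>)\<^sup>2)) / (Im \<tau> / (3 * (norm \<tau>)\<^sup>2))"
    by (simp add: height_def)
  also have "\<dots> = (3 * (norm \<tau>)\<^sup>2 + 1 / 3) / Im \<tau>" using n y by (simp add: field_simps)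
  also have "\<dots> \<le> (3 * (1 + (norm \<tau>)\<^sup>2)) / Im \<tau>" using y by (intro divide_right_mono) auto
  finally show ?thesis by (simp add: height_def)
qed

lemma height_near_cusp:
  assumes "Im \<tau> \<ge> 1" "\<bar>Re \<tau>\<bar> \<le> 1"
  shows "height \<tau> \<le> 3 * Im \<tau>" "norm \<tau> \<le> 2 * Im \<tau>" "1 \<le> norm \<tau>"
proof -
  have "(Re \<tau>)\<^sup>2 \<le> 1" using assms(2) by (simp add: abs_square_le_1)
  moreover have "1 \<le> (Im \<tau>)\<^sup>2" using assms(1) by simp
  ultimately have "1 + (norm \<tau>)\<^sup>2 \<le> 3 * (Im \<tau>)\<^sup>2" unfolding cmod_power2 by linarith
  then have "1 + (norm \<tau>)\<^sup>2 \<le> 3 * Im \<tau> * Im \<tau>" by (simp only: power2_eq_square[of "Im \<tau>"] mult.assoc)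
  then show "height \<tau> \<le> 3 * Im \<tau>" using assms(1) by (simp add: height_def divide_le_eq)
  show "norm \<tau> \<le> 2 * Im \<tau>" using cmod_le[of \<tau>] assms by linarith
  show "1 \<le> norm \<tau>" using abs_Im_le_cmod[of \<tau>] assms by linarith
qed

text \<open>On a vertical strip moderate growth is a polynomial bound in Im \<tau>. It holds at the
  other cusp as well, since the involution enlarges \<open>height\<close> at most by a factor
  3.\<close>

lemma invariant_moderate_growth_pair:
  assumes hol: "f holomorphic_on \<H>" and mg: "moderate_growth f"
    and inv: "\<And>\<gamma> \<tau>. \<gamma> \<in> Gamma0 3 \<Longrightarrow> \<tau> \<in> \<H> \<Longrightarrow> f (moebius_act \<gamma> \<tau>) = aut_factor \<gamma> \<tau> powi k * f \<tau>"
  shows "\<exists>F G. fricke_pair k F G \<and> (\<forall>\<tau>\<in>\<H>. f \<tau> = F (nome \<tau>))"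
proof -
  obtain C N where C: "C \<ge> 0" "\<And>\<tau>. \<tau> \<in> \<H> \<Longrightarrow> norm (f \<tau>) \<le> C * height \<tau> ^ N"
    using moderate_growthE[OF mg] by blast
  have H: "\<tau> \<in> \<H>" if "Im \<tau> \<ge> 1" for \<tau> using that by (simp add: upper_half_plane_def)
  have b1: "norm (f \<tau>) \<le> (C * 3 ^ N) * Im \<tau> ^ N" if t: "Im \<tau> \<ge> 1" "\<bar>Re \<tau>\<bar> \<le> 1" for \<tau>
  proof -
    have "height \<tau> ^ N \<le> (3 * Im \<tau>) ^ N"
      using height_near_cusp[OF t] height_bounds[OF H[OF t(1)]] by (intro power_mono) auto
    from mult_left_mono[OF this C(1)] C(2)[OF H[OF t(1)]] show ?thesis by (simp add: power_mult_distrib)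
  qed
  \<comment> \<open>The exponent |k| bounds the automorphy factor for either sign of the
    weight.\<close>
  define n where "n = nat \<bar>k\<bar>"
  have b2: "norm (\<tau> powi (- k) * f (- 1 / (3 * \<tau>))) \<le> (2 ^ n * (C * 9 ^ N)) * Im \<tau> ^ (n + N)"
    if t: "Im \<tau> \<ge> 1" "\<bar>Re \<tau>\<bar> \<le> 1" for \<tau>
  proof -
    note nc = height_near_cusp[OF t]
    have "norm (\<tau> powi (- k)) \<le> norm \<tau> powi (int n)"
      unfolding norm_power_int using nc(3) by (intro power_int_increasing) (auto simp: n_def)
    also have "\<dots> \<le> (2 * Im \<tau>) ^ n" using power_mono[OF nc(2) norm_ge_zero] by (simp only: power_int_of_nat)
    finally have 1: "norm (\<tau> powi (- k)) \<le> (2 * Im \<tau>) ^ n" .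
    have "height (- 1 / (3 * \<tau>)) ^ N \<le> (9 * Im \<tau>) ^ N"
      using height_fricke[OF H[OF t(1)]] nc(1) height_bounds[OF fricke_uhp[OF H[OF t(1)]]] by (intro power_mono) auto
    from mult_left_mono[OF this C(1)] C(2)[OF fricke_uhp[OF H[OF t(1)]]]
    have 2: "norm (f (- 1 / (3 * \<tau>))) \<le> C * (9 * Im \<tau>) ^ N" by linarith
    have "norm (\<tau> powi (- k) * f (- 1 / (3 * \<tau>))) \<le> (2 * Im \<tau>) ^ n * (C * (9 * Im \<tau>) ^ N)"
      unfolding norm_mult by (rule mult_mono[OF 1 2]) (use t in auto)
    then show ?thesis by (simp add: power_mult_distrib power_add mult_ac)
  qed
  show ?thesis
    by (rule fricke_pair_of_invariant[OF hol slash_invariant_generators(1)[of f k, OF inv]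
          slash_invariant_generators(2)[of f k, OF inv] b1 b2])
qed

lemma quasi_expansion_spanned:
  assumes k: "even k" and F: "quasi_expansion k p F"
  shows "spanned {1,2,3,4} k (F 0)"
  using F
proof (induction p arbitrary: F)
  case (0 F)
  have hol: "F 0 holomorphic_on \<H>" "moderate_growth (F 0)" using 0 by (auto simp: quasi_expansion_def)
  obtain f g where fg: "fricke_pair (int k) f g" "\<forall>\<tau>\<in>\<H>. F 0 \<tau> = f (nome \<tau>)"
    using invariant_moderate_growth_pair[OF hol quasi_expansion_top[OF 0, of _ _]] by auto
  have "spanned {1,2,3,4} k (\<lambda>\<tau>. f (nome \<tau>))"
    by (rule spanned_mono[OF fricke_pair_spanned[OF fg(1) k]]) auto
  then show ?case using fg(2) unfolding spanned_def by auto
next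
  case (Suc p F)
  let ?P = "Suc p"
  have hol: "F j holomorphic_on \<H>" "moderate_growth (F j)" if "j \<le> ?P" for j
    using Suc.prems that by (auto simp: quasi_expansion_def)
  have exp: "slash k \<gamma> (F 0) \<tau> = (\<Sum>j\<le>?P. F j \<tau> * (of_int (\<gamma> $ 2 $ 1) / aut_factor \<gamma> \<tau>) ^ j)"
    if "\<gamma> \<in> Gamma0 3" "\<tau> \<in> \<H>" for \<gamma> \<tau> using Suc.prems that unfolding quasi_expansion_def by blast
  note top = quasi_expansion_top[OF Suc.prems]
  obtain f g where fg: "fricke_pair (int k - 2 * int ?P) f g" "\<forall>\<tau>\<in>\<H>. F ?P \<tau> = f (nome \<tau>)"
    using invariant_moderate_growth_pair[OF hol(1)[OF order_refl] hol(2)[OF order_refl] top] by blast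
  show ?case
  proof (cases "2 * ?P \<le> k")
    \<comment> \<open>The last coefficient has negative weight, so it vanishes and the law can be
      shortened at once.\<close>
    case False
    then have neg: "int k - 2 * int ?P < 0" by linarith
    have "F ?P \<tau> = 0" if "\<tau> \<in> \<H>" for \<tau>
      using fricke_pair_negative[OF fg(1) neg nome_in_ball[OF that]] fg(2) that by simp
    then have "quasi_expansion k p F"
      using hol exp unfolding quasi_expansion_def by simp
    then show ?thesis by (rule Suc.IH)
  next
    case True
    define l where "l = k - 2 * ?P"
    have l: "int k - 2 * int ?P = int l" "k = 2 * ?P + l" "even l" using True k by (auto simp: l_def)
    have fgl: "fricke_pair (int l) f g" using fg(1) unfolding l(1) .
    have topl: "F ?P (moebius_act \<gamma> \<tau>) = aut_factor \<gamma> \<tau> ^ l * F ?P \<tau>" if "\<gamma> \<in> Gamma0 3" "\<tau> \<in> \<H>" for \<gamma> \<tau>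
      using top[OF that] unfolding l(1) by simp
    define \<kappa> where "\<kappa> = qm_const"
    have k0: "\<kappa> \<noteq> 0" by (simp add: \<kappa>_def qm_const_def)
    let ?p = "\<lambda>\<tau>. form_of pexp \<tau>"
    have mgp: "moderate_growth ?p"
      using moderate_growth_pq(1) by (subst moderate_growth_cong[of _ "\<lambda>\<tau>. pexp (nome \<tau>)"]) (simp_all add: form_of_apply)
    \<comment> \<open>From the law of \<open>F 0\<close> the law of \<open>F ?P\<close> times (P_3 /
      \<kappa>)^(p+1) is subtracted. The binomial theorem gives these coefficients, and dividing by
      the power of \<kappa> makes the last ones agree.\<close>
    define F' where "F' = (\<lambda>j \<tau>. F j \<tau> - (of_nat (?P choose j) * \<kappa> ^ j / \<kappa> ^ ?P) * (F ?P \<tau> * ?p \<tau> ^ (?P - j)))"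
    have F'P: "F' ?P \<tau> = 0" for \<tau> using k0 by (simp add: F'_def)
    have "quasi_expansion k p F'"
      unfolding quasi_expansion_def
    proof (intro conjI allI impI ballI)
      fix j assume "j \<le> p"
      then have j: "j \<le> ?P" by simp
      show "F' j holomorphic_on \<H>"
        unfolding F'_def by (intro holomorphic_intros hol j order_refl form_of_holomorphic exps_holomorphic)
      show "moderate_growth (F' j)"
        unfolding F'_def
        by (intro moderate_growth_diff moderate_growth_mult moderate_growth_const moderate_growth_power hol j order_refl mgp)
    next
      fix \<gamma> :: "int^2^2" and \<tau> assume gt: "\<gamma> \<in> Gamma0 3" "\<tau> \<in> \<H>"
      define A where "A = aut_factor \<gamma> \<tau>"
      define x where "x = of_int (\<gamma> $ 2 $ 1) / A"
      have A0: "A \<noteq> 0" using Gamma0_uhp[OF gt] by (simp add: A_def)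
      have ak: "A ^ k = A ^ l * (A\<^sup>2) ^ ?P" unfolding l(2) power_add power_mult by (rule mult.commute)
      have pm: "?p (moebius_act \<gamma> \<tau>) = A\<^sup>2 * (?p \<tau> + \<kappa> * x)"
        using pexp_slash[OF gt] Gamma0_uhp[OF gt] gt(2) by (simp add: form_of_apply A_def x_def \<kappa>_def)
      have "slash k \<gamma> (F' 0) \<tau> = slash k \<gamma> (F 0) \<tau> - (1 / \<kappa> ^ ?P) * (F ?P (moebius_act \<gamma> \<tau>) * ?p (moebius_act \<gamma> \<tau>) ^ ?P / A ^ k)"
        by (simp add: slash_def F'_def A_def diff_divide_distrib)
      also have "F ?P (moebius_act \<gamma> \<tau>) * ?p (moebius_act \<gamma> \<tau>) ^ ?P / A ^ k = F ?P \<tau> * (\<kappa> * x + ?p \<tau>) ^ ?P"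
        unfolding topl[OF gt] pm ak A_def[symmetric] power_mult_distrib[of "A\<^sup>2"] using A0 by (simp add: add.commute)
      also have "(\<kappa> * x + ?p \<tau>) ^ ?P = (\<Sum>j\<le>?P. of_nat (?P choose j) * (\<kappa> * x) ^ j * ?p \<tau> ^ (?P - j))"
        by (rule binomial_ring)
      also have "(1 / \<kappa> ^ ?P) * (F ?P \<tau> * (\<Sum>j\<le>?P. of_nat (?P choose j) * (\<kappa> * x) ^ j * ?p \<tau> ^ (?P - j))) =
          (\<Sum>j\<le>?P. (of_nat (?P choose j) * \<kappa> ^ j / \<kappa> ^ ?P) * (F ?P \<tau> * ?p \<tau> ^ (?P - j)) * x ^ j)"
        unfolding sum_distrib_left by (intro sum.cong refl) (simp only: power_mult_distrib, simp add: mult_ac)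
      also have "slash k \<gamma> (F 0) \<tau> - \<dots> = (\<Sum>j\<le>?P. F' j \<tau> * x ^ j)"
        unfolding exp[OF gt] A_def[symmetric] x_def[symmetric] sum_subtractf[symmetric] F'_def
        by (intro sum.cong refl) (simp only: left_diff_distrib)
      also have "\<dots> = (\<Sum>j\<le>p. F' j \<tau> * x ^ j)" using F'P by simp
      finally show "slash k \<gamma> (F' 0) \<tau> = (\<Sum>j\<le>p. F' j \<tau> * (of_int (\<gamma> $ 2 $ 1) / aut_factor \<gamma> \<tau>) ^ j)"
        by (simp add: A_def x_def)
    qed
    then have 1: "spanned {1,2,3,4} k (F' 0)" by (rule Suc.IH)
    have 2: "spanned {1,2,3,4} k (\<lambda>\<tau>. (1 / \<kappa> ^ ?P) * mon_exp (Poly_Mapping.single 1 ?P) (nome \<tau>) * f (nome \<tau>))"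
    proof (rule spanned_mult_monomial[where c = "1 / \<kappa> ^ ?P" and n = "Poly_Mapping.single 1 ?P",
          OF spanned_mono[OF fricke_pair_spanned[OF fgl l(3)]]])
      show "k = mon_weight (Poly_Mapping.single 1 ?P) + l"
        using l(2) by (simp add: mon_weight_eq lookup_single)
    qed auto
    show ?thesis
    proof (rule spanned_add[OF 1 2])
      fix \<tau> assume t: "\<tau> \<in> \<H>"
      have "mon_exp (Poly_Mapping.single 1 ?P) (nome \<tau>) = ?p \<tau> ^ ?P"
        using t by (simp add: mon_exp_eq lookup_single form_of_apply del: power_Suc)
      then show "F 0 \<tau> = F' 0 \<tau> + (1 / \<kappa> ^ ?P) * mon_exp (Poly_Mapping.single 1 ?P) (nome \<tau>) * f (nome \<tau>)"
        using fg(2) t by (simp add: F'_def mult_ac)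
    qed
  qed
qed

text \<open>For the matrix -1 the lower left entry is 0, so only the term j = 0 of the law remains
  and gives f = (-1)^k f.\<close>

lemma quasimodular_odd:
  assumes f: "f \<in> quasimodular_forms k (Gamma0 3)" and k: "odd k"
  shows "f = (\<lambda>_. 0)"
proof
  fix \<tau>
  show "f \<tau> = 0"
  proof (cases "\<tau> \<in> \<H>")
    case True
    obtain p F where F: "F 0 = f" "quasi_expansion k p F" using f by (auto simp: quasimodular_iff)
    obtain \<gamma> :: "int^2^2" where g: "\<gamma> $ 1 $ 1 = - 1" "\<gamma> $ 1 $ 2 = 0" "\<gamma> $ 2 $ 1 = 0" "\<gamma> $ 2 $ 2 = - 1"
      by (rule exists_int_matrix)
    have "\<gamma> \<in> Gamma0 3" by (simp add: Gamma0_iff g)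
    then have "slash k \<gamma> f \<tau> = (\<Sum>j\<le>p. F j \<tau> * (of_int (\<gamma> $ 2 $ 1) / aut_factor \<gamma> \<tau>) ^ j)"
      using F True unfolding quasi_expansion_def by blast
    also have "\<dots> = (\<Sum>j\<le>p. if j = 0 then F j \<tau> else 0)" by (intro sum.cong) (auto simp: g power_0_left)
    also have "\<dots> = f \<tau>" using F by simp
    finally show ?thesis using k by (simp add: slash_entries g)
  qed (use f in \<open>auto simp: quasimodular_iff\<close>)
qed

section \<open>The graded algebras as quotients of polynomial rings\<close>

definition strip_p :: "(nat \<Rightarrow>\<^sub>0 nat) \<Rightarrow> (nat \<Rightarrow>\<^sub>0 nat)" where
  "strip_p m = m - Poly_Mapping.single 1 (Poly_Mapping.lookup m 1)"

lemma strip_p_lookup: "Poly_Mapping.lookup (strip_p m) i = (if i = 1 then 0 else Poly_Mapping.lookup m i)"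
  by (simp add: strip_p_def lookup_minus lookup_single)

lemma mon_exp_strip: "mon_exp m q = pexp q ^ Poly_Mapping.lookup m 1 * mon_exp (strip_p m) q"
  by (simp add: mon_exp_eq strip_p_lookup)

lemma mon_weight_strip: "mon_weight m = 2 * Poly_Mapping.lookup m 1 + mon_weight (strip_p m)"
  by (simp add: mon_weight_eq strip_p_lookup)

text \<open>At a fixed \<tau> the shears change the modular part of a monomial only by powers of the
  automorphy factor, but they move P_3, up to its own such factor, to infinitely many values. A
  relation in one weight is therefore a polynomial identity in the value of P_3.\<close>

lemma monomial_relation_split:
  assumes N: "finite N" "\<And>m. m \<in> N \<Longrightarrow> mon_weight m = k"
    and z: "\<And>\<tau>. \<tau> \<in> \<H> \<Longrightarrow> (\<Sum>m\<in>N. c m * mon_exp m (nome \<tau>)) = 0" and t: "\<tau> \<in> \<H>"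
  shows "(\<Sum>m\<in>{m\<in>N. Poly_Mapping.lookup m 1 = i}. c m * mon_exp (strip_p m) (nome \<tau>)) = 0"
proof -
  let ?M = "\<lambda>m. mon_exp (strip_p m) (nome \<tau>)" and ?i = "\<lambda>m. Poly_Mapping.lookup m 1"
  let ?Y = "\<lambda>n::int. of_int (3 * n) / (of_int (3 * n) * \<tau> + 1)"
  define r where "r = (\<Sum>m\<in>N. Polynomial.monom (c m * ?M m) (?i m))"
  have "r = 0"
  proof (rule poly_eq_on_infinite)
    have "inj (\<lambda>x. pexp (nome \<tau>) + qm_const * x)" by (rule injI) (simp add: qm_const_def)
    then show "infinite ((\<lambda>x. pexp (nome \<tau>) + qm_const * x) ` range ?Y)"
      using infinite_shear_values[OF t] finite_imageD inj_on_subset by blast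
    fix y assume "y \<in> (\<lambda>x. pexp (nome \<tau>) + qm_const * x) ` range ?Y"
    then obtain n :: int where y: "y = pexp (nome \<tau>) + qm_const * ?Y n" by blast
    obtain \<gamma> :: "int^2^2" where g: "\<gamma> $ 1 $ 1 = 1" "\<gamma> $ 1 $ 2 = 0" "\<gamma> $ 2 $ 1 = 3 * n" "\<gamma> $ 2 $ 2 = 1"
      by (rule exists_int_matrix)
    have G: "\<gamma> \<in> Gamma0 3" by (simp add: Gamma0_iff g)
    define E where "E = aut_factor \<gamma> \<tau>"
    have E0: "E \<noteq> 0" and s: "moebius_act \<gamma> \<tau> \<in> \<H>" using Gamma0_uhp[OF G t] by (auto simp: E_def)
    have "of_int (\<gamma> $ 2 $ 1) / aut_factor \<gamma> \<tau> = ?Y n" by (simp add: aut_factor_def g)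
    then have P: "pexp (nome (moebius_act \<gamma> \<tau>)) = E\<^sup>2 * y" using pexp_slash[OF G t] by (simp add: y E_def)
    have M: "mon_exp (strip_p m) (nome (moebius_act \<gamma> \<tau>)) = E ^ mon_weight (strip_p m) * ?M m" for m
    proof -
      obtain F where "fricke_pair (int (mon_weight (strip_p m))) (mon_exp (strip_p m)) F"
        using mon_exp_pair[of "strip_p m"] by (auto simp: strip_p_lookup)
      from form_of_slash_Gamma0[OF this even_mon_weight G t] show ?thesis
        using E0 s t by (simp add: slash_def form_of_apply E_def field_simps)
    qed
    have "(\<Sum>m\<in>N. c m * mon_exp m (nome (moebius_act \<gamma> \<tau>))) = E ^ k * (\<Sum>m\<in>N. c m * ?M m * y ^ ?i m)"
      unfolding sum_distrib_left
    proof (rule sum.cong)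
      fix m assume m: "m \<in> N"
      have "E ^ k = (E\<^sup>2) ^ ?i m * E ^ mon_weight (strip_p m)"
        unfolding N(2)[OF m, symmetric] mon_weight_strip[of m] power_add power_mult ..
      then show "c m * mon_exp m (nome (moebius_act \<gamma> \<tau>)) = E ^ k * (c m * ?M m * y ^ ?i m)"
        unfolding mon_exp_strip[of m] P M by (simp add: power_mult_distrib mult_ac)
    qed simp
    then have "(\<Sum>m\<in>N. c m * ?M m * y ^ ?i m) = 0" using z[OF s] E0 by simp
    then show "poly r y = poly 0 y" by (simp add: r_def poly_sum poly_monom)
  qed
  then have "coeff r i = 0" by simp
  then have "(\<Sum>m\<in>N. if ?i m = i then c m * ?M m else 0) = 0" by (simp add: r_def coeff_sum)
  then show ?thesis using N(1) by (simp add: sum.If_cases Int_def)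
qed

text \<open>With the power of P_3 set aside, a monomial is a^e c^j, and together with the weight its
  order j at q = 0 determines it: the parity of j is the exponent of x_3. Since c vanishes at q = 0
  and a does not, dividing by the lowest power of c isolates one coefficient.\<close>

lemma monomials_independent_same_p:
  assumes N: "finite N" "\<And>m. m \<in> N \<Longrightarrow> mon_weight m = k \<and> Poly_Mapping.lookup m 1 = i \<and>
      Poly_Mapping.lookup m 3 \<le> 1 \<and> Poly_Mapping.keys m \<subseteq> {1,2,3,4}"
    and z: "\<And>\<tau>. \<tau> \<in> \<H> \<Longrightarrow> (\<Sum>m\<in>N. c m * mon_exp (strip_p m) (nome \<tau>)) = 0" and n: "n \<in> N"
  shows "c n = 0"
proof (rule ccontr)
  assume "c n \<noteq> 0"
  let ?l = "Poly_Mapping.lookup :: (nat \<Rightarrow>\<^sub>0 nat) \<Rightarrow> _"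
  define j :: "(nat \<Rightarrow>\<^sub>0 nat) \<Rightarrow> nat" where "j = (\<lambda>m. Poly_Mapping.lookup m 3 + 2 * Poly_Mapping.lookup m 4)"
  define e :: "(nat \<Rightarrow>\<^sub>0 nat) \<Rightarrow> nat" where "e = (\<lambda>m. 2 * Poly_Mapping.lookup m 2 + Poly_Mapping.lookup m 3)"
  define N' where "N' = {m \<in> N. c m \<noteq> 0}"
  have inj: "m = m'" if "m \<in> N'" "m' \<in> N'" "j m = j m'" for m m'
  proof (rule poly_mapping_eqI)
    fix x
    have a: "mon_weight m = k" "?l m 1 = i" "?l m 3 \<le> 1" "Poly_Mapping.keys m \<subseteq> {1,2,3,4}"
      "mon_weight m' = k" "?l m' 1 = i" "?l m' 3 \<le> 1" "Poly_Mapping.keys m' \<subseteq> {1,2,3,4}"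
      using N(2) that by (auto simp: N'_def)
    have "?l m 3 = ?l m' 3 \<and> ?l m 4 = ?l m' 4" using a(3,7) that(3) unfolding j_def by presburger
    moreover from this have "?l m 2 = ?l m' 2" using a(1,2,5,6) by (simp add: mon_weight_eq)
    moreover have "?l m x = 0 \<and> ?l m' x = 0" if "x \<notin> {1,2,3,4}" using a(4,8) that by (meson in_keys_iff subsetD)
    ultimately show "?l m x = ?l m' x" using a(2,6) by (cases "x \<in> {1,2,3,4}") auto
  qed
  have fin: "finite N'" "N' \<noteq> {}" using N(1) n \<open>c n \<noteq> 0\<close> by (auto simp: N'_def)
  obtain m0 where m0: "m0 \<in> N'" "\<And>m. m \<in> N' \<Longrightarrow> j m0 \<le> j m"
    using ex_is_arg_min_if_finite[OF fin, of j] by (auto simp: is_arg_min_linorder)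
  define H where "H = (\<lambda>q. \<Sum>m\<in>N'. c m * (aexp q ^ e m * cexp q ^ (j m - j m0)))"
  have "H holomorphic_on ball 0 1" unfolding H_def by (intro holomorphic_intros exps_holomorphic)
  moreover have "H (nome \<tau>) = 0" if t: "\<tau> \<in> \<H>" for \<tau>
  proof -
    have q: "nome \<tau> \<in> ball 0 1" by (rule nome_in_ball[OF t])
    have "cexp (nome \<tau>) ^ j m0 * H (nome \<tau>) = (\<Sum>m\<in>N'. c m * mon_exp (strip_p m) (nome \<tau>))"
      unfolding H_def sum_distrib_left
    proof (rule sum.cong)
      fix m assume m: "m \<in> N'"
      have "cexp (nome \<tau>) ^ j m = cexp (nome \<tau>) ^ j m0 * cexp (nome \<tau>) ^ (j m - j m0)"
        using m0(2)[OF m] by (simp flip: power_add)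
      moreover have "mon_exp (strip_p m) (nome \<tau>) = aexp (nome \<tau>) ^ e m * cexp (nome \<tau>) ^ j m"
        by (simp add: mon_exp_eq strip_p_lookup qexp_eq_aexp[OF q] e_def j_def power_add power_mult power_mult_distrib)
      ultimately show "cexp (nome \<tau>) ^ j m0 * (c m * (aexp (nome \<tau>) ^ e m * cexp (nome \<tau>) ^ (j m - j m0))) =
          c m * mon_exp (strip_p m) (nome \<tau>)" by (simp add: mult_ac)
    qed simp
    also have "\<dots> = (\<Sum>m\<in>N. c m * mon_exp (strip_p m) (nome \<tau>))"
      by (rule sum.mono_neutral_left) (use N(1) in \<open>auto simp: N'_def\<close>)
    also have "\<dots> = 0" by (rule z[OF t])
    finally show ?thesis using cexp_nonzero[OF norm_nome_less_1[OF t] nome_nonzero] by simp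
  qed
  ultimately have "H 0 = 0" using nome_expansion_unique[of H "\<lambda>_. 0" 0] by simp
  moreover have "H 0 = (\<Sum>m\<in>N'. if m = m0 then c m else 0)"
    unfolding H_def
  proof (rule sum.cong)
    fix m assume m: "m \<in> N'"
    show "c m * (aexp 0 ^ e m * cexp 0 ^ (j m - j m0)) = (if m = m0 then c m else 0)"
      using inj[OF m m0(1)] m0(2)[OF m] by (auto simp: power_0_left)
  qed simp
  ultimately have "c m0 = 0" using m0(1) fin(1) by simp
  then show False using m0(1) by (simp add: N'_def)
qed

text \<open>The weight k component of the polynomial p evaluated at the generators.\<close>

definition eval_exp :: "cpoly \<Rightarrow> nat \<Rightarrow> complex \<Rightarrow> complex" where
  "eval_exp p k q = (\<Sum>m\<in>Poly_Mapping.keys p. Poly_Mapping.lookup p m * (if mon_weight m = k then mon_exp m q else 0))"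

lemma eval_exp_add: "eval_exp (p + r) k q = eval_exp p k q + eval_exp r k q"
  unfolding eval_exp_def by (rule sum_keys_add)

lemma eval_exp_0 [simp]: "eval_exp 0 k q = 0"
  by (simp add: eval_exp_def)

lemma eval_exp_single: "eval_exp (Poly_Mapping.single m c) k q = (if mon_weight m = k then c * mon_exp m q else 0)"
  by (simp add: eval_exp_def)

lemma eval_exp_sum: "finite A \<Longrightarrow> eval_exp (\<Sum>a\<in>A. g a) k q = (\<Sum>a\<in>A. eval_exp (g a) k q)"
  by (induction rule: finite_induct) (auto simp: eval_exp_add)

lemma eval_exp_uminus: "eval_exp (- p) k q = - eval_exp p k q"
  using eval_exp_add[of p "- p" k q] by (simp add: eq_neg_iff_add_eq_0 add.commute)

lemma poly_mapping_sum_single: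
  fixes p :: "'a \<Rightarrow>\<^sub>0 'b::comm_monoid_add"
  shows "p = (\<Sum>m\<in>Poly_Mapping.keys p. Poly_Mapping.single m (Poly_Mapping.lookup p m))"
proof (rule poly_mapping_eqI)
  fix n
  have "Poly_Mapping.lookup (\<Sum>m\<in>Poly_Mapping.keys p. Poly_Mapping.single m (Poly_Mapping.lookup p m)) n =
      (\<Sum>m\<in>Poly_Mapping.keys p. if m = n then Poly_Mapping.lookup p n else 0)"
    unfolding lookup_sum by (intro sum.cong) (auto simp: lookup_single)
  then show "Poly_Mapping.lookup p n = Poly_Mapping.lookup (\<Sum>m\<in>Poly_Mapping.keys p. Poly_Mapping.single m (Poly_Mapping.lookup p m)) n"
    by (simp add: in_keys_iff)
qed

lemma eval_exp_mult: "eval_exp (p * r) k q = (\<Sum>i\<le>k. eval_exp p i q * eval_exp r (k - i) q)"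
proof -
  let ?l = "Poly_Mapping.lookup"
  have "p * r = (\<Sum>m\<in>Poly_Mapping.keys p. \<Sum>n\<in>Poly_Mapping.keys r. Poly_Mapping.single (m + n) (?l p m * ?l r n))"
    by (subst poly_mapping_sum_single[of p], subst poly_mapping_sum_single[of r]) (simp add: sum_product mult_single)
  then have "eval_exp (p * r) k q = (\<Sum>m\<in>Poly_Mapping.keys p. \<Sum>n\<in>Poly_Mapping.keys r.
      if mon_weight m + mon_weight n = k then ?l p m * ?l r n * (mon_exp m q * mon_exp n q) else 0)"
    by (simp only: eval_exp_sum finite_keys) (unfold eval_exp_single mon_exp_add mon_weight_add, rule refl)
  \<comment> \<open>Weights add under multiplication, so the inserted sum over i has at most the
    term i = \<open>mon_weight m\<close>.\<close>
  also have "\<dots> = (\<Sum>m\<in>Poly_Mapping.keys p. \<Sum>n\<in>Poly_Mapping.keys r. \<Sum>i\<le>k.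
      (?l p m * (if mon_weight m = i then mon_exp m q else 0)) * (?l r n * (if mon_weight n = k - i then mon_exp n q else 0)))"
  proof (intro sum.cong refl)
    fix m n
    let ?f = "\<lambda>i. (?l p m * (if mon_weight m = i then mon_exp m q else 0)) * (?l r n * (if mon_weight n = k - i then mon_exp n q else 0))"
    have "(\<Sum>i\<le>k. ?f i) = (\<Sum>i\<le>k. if i = mon_weight m then (if mon_weight m + mon_weight n = k then ?l p m * ?l r n * (mon_exp m q * mon_exp n q) else 0) else 0)"
      by (intro sum.cong) auto
    then show "(if mon_weight m + mon_weight n = k then ?l p m * ?l r n * (mon_exp m q * mon_exp n q) else 0) = (\<Sum>i\<le>k. ?f i)"
      by auto
  qed
  also have "\<dots> = (\<Sum>i\<le>k. eval_exp p i q * eval_exp r (k - i) q)"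
  proof -
    have swap: "(\<Sum>m\<in>A. \<Sum>n\<in>B. \<Sum>i\<in>C. f m n i) = (\<Sum>i\<in>C. \<Sum>m\<in>A. \<Sum>n\<in>B. f m n i)"
      for A B :: "(nat \<Rightarrow>\<^sub>0 nat) set" and C :: "nat set" and f :: "_ \<Rightarrow> _ \<Rightarrow> _ \<Rightarrow> complex"
    proof -
      have "(\<Sum>m\<in>A. \<Sum>n\<in>B. \<Sum>i\<in>C. f m n i) = (\<Sum>m\<in>A. \<Sum>i\<in>C. \<Sum>n\<in>B. f m n i)"
        by (intro sum.cong refl sum.swap)
      also have "\<dots> = (\<Sum>i\<in>C. \<Sum>m\<in>A. \<Sum>n\<in>B. f m n i)" by (rule sum.swap)
      finally show ?thesis .
    qed
    show ?thesis unfolding eval_exp_def sum_product by (rule swap)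
  qed
  finally show ?thesis .
qed

text \<open>Degree at most 1 in x_3 is the normal form modulo x_3^2 - x_2 x_4. A relation is sorted
  by weight and by the power of P_3 before \<open>monomials_independent_same_p\<close>
  applies.\<close>

lemma normal_form_independent:
  assumes p: "\<And>m. m \<in> Poly_Mapping.keys p \<Longrightarrow> Poly_Mapping.lookup m 3 \<le> 1 \<and> Poly_Mapping.keys m \<subseteq> {1,2,3,4}"
    and z: "\<And>k \<tau>. \<tau> \<in> \<H> \<Longrightarrow> eval_exp p k (nome \<tau>) = 0"
  shows "p = 0"
proof (rule poly_mapping_eqI)
  fix n
  show "Poly_Mapping.lookup p n = Poly_Mapping.lookup 0 n"
  proof (cases "n \<in> Poly_Mapping.keys p")
    case True
    define k where "k = mon_weight n"
    define N where "N = {m \<in> Poly_Mapping.keys p. mon_weight m = k}"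
    let ?N = "{m \<in> N. Poly_Mapping.lookup m 1 = Poly_Mapping.lookup n 1}"
    have "(\<Sum>m\<in>N. Poly_Mapping.lookup p m * mon_exp m (nome \<tau>)) = 0" if "\<tau> \<in> \<H>" for \<tau>
    proof -
      have "eval_exp p k (nome \<tau>) = (\<Sum>m\<in>Poly_Mapping.keys p. if mon_weight m = k then Poly_Mapping.lookup p m * mon_exp m (nome \<tau>) else 0)"
        unfolding eval_exp_def by (intro sum.cong) auto
      also have "\<dots> = (\<Sum>m\<in>N. Poly_Mapping.lookup p m * mon_exp m (nome \<tau>))"
        by (simp add: N_def sum.If_cases Int_def)
      finally show ?thesis using z[OF that] by simp
    qed
    then have *: "(\<Sum>m\<in>?N. Poly_Mapping.lookup p m * mon_exp (strip_p m) (nome \<tau>)) = 0" if "\<tau> \<in> \<H>" for \<tau>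
      by (intro monomial_relation_split[where k = k]) (use that in \<open>auto simp: N_def\<close>)
    have "Poly_Mapping.lookup p n = 0"
      by (rule monomials_independent_same_p[where N = ?N and k = k and i = "Poly_Mapping.lookup n 1"])
         (use p True * in \<open>auto simp: N_def k_def\<close>)
    then show ?thesis by simp
  qed (simp add: in_keys_iff)
qed

section \<open>The evaluation homomorphism and its kernel\<close>

lemma poly_ring_simps:
  "carrier (poly_ring I) = {p. \<forall>m\<in>Poly_Mapping.keys p. Poly_Mapping.keys m \<subseteq> I}"
  "mult (poly_ring I) = (*)" "one (poly_ring I) = 1" "zero (poly_ring I) = 0" "add (poly_ring I) = (+)"
  by (simp_all add: poly_ring_def)

lemma poly_ring_mult_closed:
  assumes "p \<in> carrier (poly_ring I)" "r \<in> carrier (poly_ring I)"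
  shows "p * r \<in> carrier (poly_ring I)"
proof -
  have "Poly_Mapping.keys m \<subseteq> I" if "m \<in> Poly_Mapping.keys (p * r)" for m
  proof -
    have "m \<in> {a + b |a b. a \<in> Poly_Mapping.keys p \<and> b \<in> Poly_Mapping.keys r}"
      using that keys_mult[of p r] by (rule rev_subsetD)
    then obtain a b where "m = a + b" "a \<in> Poly_Mapping.keys p" "b \<in> Poly_Mapping.keys r" by auto
    then show ?thesis using keys_add[of a b] assms by (auto simp: poly_ring_simps)
  qed
  then show ?thesis by (simp add: poly_ring_simps)
qed

lemma poly_ring_add_closed:
  "p \<in> carrier (poly_ring I) \<Longrightarrow> r \<in> carrier (poly_ring I) \<Longrightarrow> p + r \<in> carrier (poly_ring I)"
  using keys_add[of p r] by (auto simp: poly_ring_simps)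

lemma poly_ring_is_ring: "ring (poly_ring I)"
proof (rule ringI)
  show "abelian_group (poly_ring I)"
  proof (rule abelian_groupI)
    fix p assume "p \<in> carrier (poly_ring I)"
    then show "\<exists>r\<in>carrier (poly_ring I). r \<oplus>\<^bsub>poly_ring I\<^esub> p = \<zero>\<^bsub>poly_ring I\<^esub>"
      by (intro bexI[of _ "- p"]) (auto simp: poly_ring_simps)
  next
    show "\<zero>\<^bsub>poly_ring I\<^esub> \<in> carrier (poly_ring I)" by (simp add: poly_ring_simps)
  qed (use poly_ring_add_closed in \<open>simp_all add: poly_ring_simps(2-5) add_ac\<close>)
  show "monoid (poly_ring I)"
  proof (rule monoidI)
    show "\<one>\<^bsub>poly_ring I\<^esub> \<in> carrier (poly_ring I)" by (simp add: poly_ring_simps)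
  qed (use poly_ring_mult_closed in \<open>simp_all add: poly_ring_simps(2-5) mult.assoc\<close>)
qed (simp_all add: poly_ring_simps(2-5) ring_distribs)

text \<open>Rewriting x_3^2 to x_2 x_4 stays in the same class modulo J and lowers the exponent of
  x_3 by 2.\<close>

lemma ideal_reduction:
  fixes J :: "cpoly set"
  assumes I: "{2,3,4} \<subseteq> I" and J0: "0 \<in> J" and Jadd: "\<And>a b. a \<in> J \<Longrightarrow> b \<in> J \<Longrightarrow> a + b \<in> J"
    and Jmult: "\<And>u a. u \<in> carrier (poly_ring I) \<Longrightarrow> a \<in> J \<Longrightarrow> u * a \<in> J"
    and gen: "(X 3)\<^sup>2 - X 2 * X 4 \<in> J" and m: "Poly_Mapping.keys m \<subseteq> I"
  shows "\<exists>m'. Poly_Mapping.keys m' \<subseteq> I \<and> Poly_Mapping.lookup m' 3 \<le> 1 \<and>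
     (\<forall>c. Poly_Mapping.single m c - Poly_Mapping.single m' c \<in> J)"
  using m
proof (induction "Poly_Mapping.lookup m 3" arbitrary: m rule: less_induct)
  case less
  show ?case
  proof (cases "Poly_Mapping.lookup m 3 \<le> 1")
    case True
    then show ?thesis using less.prems J0 by (intro exI[of _ m]) simp
  next
    case False
    let ?s = "Poly_Mapping.single :: nat \<Rightarrow> nat \<Rightarrow> _"
    define n where "n = m - ?s 3 2"
    have mn: "m = n + ?s 3 2"
      using False by (intro poly_mapping_eqI) (auto simp: n_def lookup_add lookup_minus lookup_single when_def)
    define m' where "m' = n + ?s 2 1 + ?s 4 1"
    have kn: "Poly_Mapping.keys n \<subseteq> I"
      using less.prems by (auto simp: n_def in_keys_iff lookup_minus)
    have km': "Poly_Mapping.keys m' \<subseteq> I"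
    proof
      fix i assume "i \<in> Poly_Mapping.keys m'"
      then have "i \<in> Poly_Mapping.keys n \<or> i = 2 \<or> i = 4"
        by (auto simp: m'_def in_keys_iff lookup_add lookup_single when_def split: if_splits)
      then show "i \<in> I" using kn I by auto
    qed
    have "Poly_Mapping.lookup m' 3 < Poly_Mapping.lookup m 3"
      using False by (simp add: m'_def n_def lookup_add lookup_minus lookup_single)
    from less.hyps[OF this km'] obtain m'' where m'': "Poly_Mapping.keys m'' \<subseteq> I" "Poly_Mapping.lookup m'' 3 \<le> 1"
      "\<And>c. Poly_Mapping.single m' c - Poly_Mapping.single m'' c \<in> J" by blast
    have "Poly_Mapping.single m c - Poly_Mapping.single m'' c \<in> J" for c
    proof -
      have "?s 3 1 + ?s 3 1 = ?s 3 2" by (simp add: numeral_2_eq_2 flip: single_add)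
      then have "Poly_Mapping.single m c - Poly_Mapping.single m' c = Poly_Mapping.single n c * ((X 3)\<^sup>2 - X 2 * X 4)"
        by (simp add: X_def power2_eq_square mult_single right_diff_distrib mn m'_def add.assoc)
      moreover have "Poly_Mapping.single n c \<in> carrier (poly_ring I)"
        using kn by (simp add: poly_ring_simps)
      ultimately have "Poly_Mapping.single m c - Poly_Mapping.single m' c \<in> J" using Jmult gen by simp
      from Jadd[OF this m''(3)[of c]] show ?thesis by simp
    qed
    then show ?thesis using m'' by blast
  qed
qed

lemma graded_algebra_simps:
  "carrier (graded_algebra M) = {F. (\<forall>k. F k \<in> M k) \<and> finite {k. F k \<noteq> (\<lambda>_. 0)}}"
  "mult (graded_algebra M) = (\<lambda>F G k \<tau>. \<Sum>i\<le>k. F i \<tau> * G (k - i) \<tau>)"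
  "one (graded_algebra M) = scalar_form 1" "zero (graded_algebra M) = (\<lambda>k \<tau>. 0)"
  "add (graded_algebra M) = (\<lambda>F G k \<tau>. F k \<tau> + G k \<tau>)"
  by (simp_all add: graded_algebra_def)

definition graded_eval :: "cpoly \<Rightarrow> nat \<Rightarrow> complex \<Rightarrow> complex" where
  "graded_eval p k = form_of (eval_exp p k)"

lemma graded_eval_apply: "graded_eval p k \<tau> = (if \<tau> \<in> \<H> then eval_exp p k (nome \<tau>) else 0)"
  by (simp add: graded_eval_def form_of_def on_uhp_def)

lemma graded_eval_add: "graded_eval (p + r) = (\<lambda>k \<tau>. graded_eval p k \<tau> + graded_eval r k \<tau>)"
  by (simp add: graded_eval_apply eval_exp_add fun_eq_iff)

lemma graded_eval_mult: "graded_eval (p * r) = (\<lambda>k \<tau>. \<Sum>i\<le>k. graded_eval p i \<tau> * graded_eval r (k - i) \<tau>)"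
  by (simp add: graded_eval_apply eval_exp_mult fun_eq_iff)

lemma graded_eval_single:
  "graded_eval (Poly_Mapping.single m c) = in_degree (mon_weight m) (form_of (\<lambda>q. c * mon_exp m q))"
  by (auto simp: graded_eval_apply in_degree_def form_of_def on_uhp_def eval_exp_single fun_eq_iff)

lemma graded_eval_Const: "graded_eval (Const c) = scalar_form c"
  by (simp add: Const_def graded_eval_single scalar_form_def form_of_def)

lemma mon_single: "mon_exp (Poly_Mapping.single i 1) q = (if i \<in> {1,2,3,4} then gen_exp i q else 1)"
proof -
  have "mon_exp (Poly_Mapping.single i 1) q = (\<Prod>j\<in>{1,2,3,4}. if j = i then gen_exp i q else 1)"
    unfolding mon_exp_def by (intro prod.cong) (auto simp: lookup_single)
  then show ?thesis by (simp only: prod.delta) simp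
qed

lemma graded_eval_X: "i \<in> {1,2,3,4} \<Longrightarrow>
    graded_eval (X i) = in_degree (mon_weight (Poly_Mapping.single i 1)) (form_of (gen_exp i))"
  unfolding X_def graded_eval_single mon_single by simp

text \<open>Hypothesis \<open>M\<close> amounts to surjectivity in each weight, for both algebras at
  once. For the kernel, a polynomial is brought to normal form modulo J, and on normal forms
  evaluation is injective; the rest is the first isomorphism theorem.\<close>

theorem graded_algebra_iso:
  fixes I :: "nat set"
  assumes I: "{2,3,4} \<subseteq> I" "I \<subseteq> {1,2,3,4}"
    and M: "\<And>k f. f \<in> M k \<longleftrightarrow> (\<forall>\<tau>. \<tau> \<notin> \<H> \<longrightarrow> f \<tau> = 0) \<and> spanned I k f"
  defines "J \<equiv> Idl\<^bsub>poly_ring I\<^esub> {(X 3)\<^sup>2 - X 2 * X 4}"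
  shows "\<exists>\<phi>\<in>ring_iso (poly_ring I Quot J) (graded_algebra M).
     \<forall>p\<in>carrier (poly_ring I). \<phi> (J +>\<^bsub>poly_ring I\<^esub> p) = graded_eval p"
proof -
  let ?R = "poly_ring I" and ?S = "graded_algebra M" and ?g = "(X 3)\<^sup>2 - X 2 * X 4"
  interpret R: ring ?R by (rule poly_ring_is_ring)
  have zero_out: "graded_eval p k \<tau> = 0" if "\<tau> \<notin> \<H>" for p k \<tau> using that by (simp add: graded_eval_apply)
  have sp: "spanned I k (graded_eval p k)" if "p \<in> carrier ?R" for p k
  proof -
    have "spanned I k (\<lambda>\<tau>. \<Sum>m\<in>Poly_Mapping.keys p. Poly_Mapping.lookup p m * (if mon_weight m = k then mon_exp m (nome \<tau>) else 0))"
    proof (rule spanned_sum)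
      fix m assume "m \<in> Poly_Mapping.keys p"
      then have "Poly_Mapping.keys m \<subseteq> I" using that by (simp add: poly_ring_simps)
      then show "spanned I k (\<lambda>\<tau>. Poly_Mapping.lookup p m * (if mon_weight m = k then mon_exp m (nome \<tau>) else 0))"
        by (cases "mon_weight m = k") (auto intro: spanned_zero spanned_monomial)
    qed simp
    then show ?thesis unfolding spanned_def by (simp add: graded_eval_apply eval_exp_def)
  qed
  have carr: "graded_eval p \<in> carrier ?S" if "p \<in> carrier ?R" for p
  proof -
    have "graded_eval p k = (\<lambda>_. 0)" if "k \<notin> mon_weight ` Poly_Mapping.keys p" for k
    proof -
      have "eval_exp p k q = 0" for q
        unfolding eval_exp_def by (rule sum.neutral) (use that in auto)
      then show ?thesis by (simp add: graded_eval_apply fun_eq_iff)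
    qed
    then have "{k. graded_eval p k \<noteq> (\<lambda>_. 0)} \<subseteq> mon_weight ` Poly_Mapping.keys p" by blast
    then have "finite {k. graded_eval p k \<noteq> (\<lambda>_. 0)}" by (rule finite_subset) simp
    then show ?thesis using sp[OF that] zero_out by (simp add: graded_algebra_simps M)
  qed
  have hom: "graded_eval \<in> ring_hom ?R ?S"
  proof (rule ring_hom_memI)
    show "graded_eval \<one>\<^bsub>?R\<^esub> = \<one>\<^bsub>?S\<^esub>"
      using graded_eval_Const[of 1] by (simp add: poly_ring_simps graded_algebra_simps Const_def)
  qed (use carr in \<open>simp_all add: poly_ring_simps graded_algebra_simps graded_eval_add graded_eval_mult\<close>)
  have surj: "graded_eval ` carrier ?R = carrier ?S"
  proof
    show "graded_eval ` carrier ?R \<subseteq> carrier ?S" using carr by blast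
    show "carrier ?S \<subseteq> graded_eval ` carrier ?R"
    proof
      fix F assume F: "F \<in> carrier ?S"
      have "\<exists>p. p \<in> carrier ?R \<and> (\<forall>m\<in>Poly_Mapping.keys p. mon_weight m = k) \<and> (\<forall>\<tau>\<in>\<H>. F k \<tau> = (\<Sum>m\<in>Poly_Mapping.keys p. Poly_Mapping.lookup p m * mon_exp m (nome \<tau>)))" for k
      proof -
        have "spanned I k (F k)" using F M by (auto simp: graded_algebra_simps)
        then show ?thesis unfolding spanned_def poly_ring_simps by blast
      qed
      then obtain P where P: "\<And>k. P k \<in> carrier ?R" "\<And>k m. m \<in> Poly_Mapping.keys (P k) \<Longrightarrow> mon_weight m = k"
        "\<And>k \<tau>. \<tau> \<in> \<H> \<Longrightarrow> F k \<tau> = (\<Sum>m\<in>Poly_Mapping.keys (P k). Poly_Mapping.lookup (P k) m * mon_exp m (nome \<tau>))"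
        by metis
      have Pl: "eval_exp (P l) k (nome \<tau>) = (if l = k then F k \<tau> else 0)" if "\<tau> \<in> \<H>" for k l \<tau>
      proof (cases "l = k")
        case True
        have "eval_exp (P k) k (nome \<tau>) = (\<Sum>m\<in>Poly_Mapping.keys (P k). Poly_Mapping.lookup (P k) m * mon_exp m (nome \<tau>))"
          unfolding eval_exp_def by (intro sum.cong) (use P(2) in auto)
        then show ?thesis using True P(3)[OF that] by simp
      next
        case False
        then show ?thesis unfolding eval_exp_def using P(2) by (auto intro!: sum.neutral)
      qed
      \<comment> \<open>Only finitely many components are nonzero, so their preimages can be added
        up.\<close>
      define K where "K = {k. F k \<noteq> (\<lambda>_. 0)}"
      have K: "finite K" using F by (simp add: graded_algebra_simps K_def)
      define p where "p = (\<Sum>k\<in>K. P k)"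
      have "p \<in> carrier ?R" unfolding p_def using K
      proof (induction rule: finite_induct)
        case empty
        show ?case by (simp add: poly_ring_simps(1))
      next
        case (insert x A)
        then show ?case using P(1) poly_ring_add_closed by simp
      qed
      moreover have "graded_eval p = F"
      proof (intro ext)
        fix k \<tau>
        show "graded_eval p k \<tau> = F k \<tau>"
        proof (cases "\<tau> \<in> \<H>")
          case True
          then have "eval_exp p k (nome \<tau>) = (\<Sum>l\<in>K. if l = k then F k \<tau> else 0)"
            unfolding p_def eval_exp_sum[OF K] by (simp add: Pl)
          also have "\<dots> = F k \<tau>" using K by (auto simp: K_def)
          finally show ?thesis using True by (simp add: graded_eval_apply)
        next
          case False
          then show ?thesis using F M by (auto simp: graded_algebra_simps graded_eval_apply)
        qed
      qed
      ultimately show "F \<in> graded_eval ` carrier ?R" by blast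
    qed
  qed
  \<comment> \<open>The graded algebra is a ring as the image of one, so its axioms come from the
    polynomial ring.\<close>
  have "ring (?S \<lparr> carrier := graded_eval ` carrier ?R, zero := graded_eval \<zero>\<^bsub>?R\<^esub> \<rparr>)"
    by (rule R.ring_hom_imp_img_ring[OF hom])
  moreover have "graded_eval \<zero>\<^bsub>?R\<^esub> = \<zero>\<^bsub>?S\<^esub>"
    by (simp add: poly_ring_simps graded_algebra_simps graded_eval_apply fun_eq_iff)
  then have "?S \<lparr> carrier := graded_eval ` carrier ?R, zero := graded_eval \<zero>\<^bsub>?R\<^esub> \<rparr> = ?S"
    unfolding surj by (simp add: graded_algebra_def)
  ultimately have "ring ?S" by simp
  then interpret h: ring_hom_ring ?R ?S graded_eval
    using hom poly_ring_is_ring by (intro ring_hom_ringI2)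
  have kernel_iff: "p \<in> a_kernel ?R ?S graded_eval \<longleftrightarrow> p \<in> carrier ?R \<and> (\<forall>k. \<forall>\<tau>\<in>\<H>. eval_exp p k (nome \<tau>) = 0)" for p
    by (auto simp: a_kernel_def kernel_def graded_algebra_simps graded_eval_apply fun_eq_iff)
  have X_carr: "X i \<in> carrier ?R" if "i \<in> {2,3,4}" for i
    using that I by (auto simp: X_def poly_ring_simps)
  have g_carr: "?g \<in> carrier ?R"
  proof -
    have "?g = X 3 * X 3 + - Const 1 * (X 2 * X 4)" by (simp add: power2_eq_square Const_def)
    moreover have "- Const 1 \<in> carrier ?R" by (simp add: poly_ring_simps Const_def)
    then have "X 3 * X 3 + - Const 1 * (X 2 * X 4) \<in> carrier ?R"
      by (intro poly_ring_add_closed poly_ring_mult_closed X_carr) auto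
    ultimately show ?thesis by (simp only:)
  qed
  have idJ: "ideal J ?R" unfolding J_def using g_carr by (intro R.genideal_ideal) simp
  interpret J: ideal J ?R by (rule idJ)
  have gJ: "?g \<in> J" unfolding J_def using R.genideal_self[of "{?g}"] g_carr by auto
  have Jadd: "a + b \<in> J" if "a \<in> J" "b \<in> J" for a b using J.a_closed[OF that] by (simp add: poly_ring_simps)
  have Jmult: "u * a \<in> J" if "u \<in> carrier ?R" "a \<in> J" for u a using J.I_l_closed[OF that(2,1)] by (simp add: poly_ring_simps)
  have J0: "0 \<in> J" using J.zero_closed by (simp add: poly_ring_simps)
  have gK: "?g \<in> a_kernel ?R ?S graded_eval"
    unfolding kernel_iff
  proof (intro conjI allI ballI g_carr)
    fix k \<tau> assume "\<tau> \<in> \<H>"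
    then have q: "nome \<tau> \<in> ball 0 1" by (rule nome_in_ball)
    have g: "?g = Poly_Mapping.single (Poly_Mapping.single 3 1 + Poly_Mapping.single 3 1) 1 +
        - Poly_Mapping.single (Poly_Mapping.single 2 1 + Poly_Mapping.single 4 1) 1"
      by (simp add: X_def power2_eq_square mult_single)
    show "eval_exp ?g k (nome \<tau>) = 0"
      unfolding g eval_exp_add eval_exp_uminus eval_exp_single mon_weight_add mon_exp_add mon_single
      by (simp add: mon_weight_eq lookup_single gen_exp_def qexp_eq_aexp[OF q] power2_eq_square mult_ac)
  qed
  have JK: "J \<subseteq> a_kernel ?R ?S graded_eval"
    unfolding J_def by (rule R.genideal_minimal[OF h.kernel_is_ideal]) (use gK in simp)
  have KJ: "a_kernel ?R ?S graded_eval \<subseteq> J"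
  proof
    fix p assume p: "p \<in> a_kernel ?R ?S graded_eval"
    \<comment> \<open>The implication stands inside the quantifier so that a choice function \<rho>
      on all monomials exists; \<open>p'\<close> is then the normal form of p.\<close>
    have "\<exists>m'. m \<in> Poly_Mapping.keys p \<longrightarrow> Poly_Mapping.keys m' \<subseteq> I \<and> Poly_Mapping.lookup m' 3 \<le> 1 \<and>
        (\<forall>c. Poly_Mapping.single m c - Poly_Mapping.single m' c \<in> J)" for m
      using ideal_reduction[OF I(1) J0 Jadd Jmult gJ, of m] p by (auto simp: kernel_iff poly_ring_simps)
    then obtain \<rho> where \<rho>: "\<And>m. m \<in> Poly_Mapping.keys p \<Longrightarrow> Poly_Mapping.keys (\<rho> m) \<subseteq> I \<and> Poly_Mapping.lookup (\<rho> m) 3 \<le> 1 \<and>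
        (\<forall>c. Poly_Mapping.single m c - Poly_Mapping.single (\<rho> m) c \<in> J)" by metis
    define p' where "p' = (\<Sum>m\<in>Poly_Mapping.keys p. Poly_Mapping.single (\<rho> m) (Poly_Mapping.lookup p m))"
    have p'keys: "Poly_Mapping.lookup m 3 \<le> 1 \<and> Poly_Mapping.keys m \<subseteq> I" if "m \<in> Poly_Mapping.keys p'" for m
    proof -
      have "Poly_Mapping.lookup p' m \<noteq> 0" using that by (simp add: in_keys_iff)
      then obtain n where "n \<in> Poly_Mapping.keys p" "Poly_Mapping.lookup (Poly_Mapping.single (\<rho> n) (Poly_Mapping.lookup p n)) m \<noteq> 0"
        unfolding p'_def lookup_sum by (meson sum.not_neutral_contains_not_neutral)
      then show ?thesis using \<rho> by (auto simp: lookup_single when_def split: if_splits)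
    qed
    have "(\<Sum>m\<in>A. Poly_Mapping.single m (Poly_Mapping.lookup p m) - Poly_Mapping.single (\<rho> m) (Poly_Mapping.lookup p m)) \<in> J"
      if "finite A" "A \<subseteq> Poly_Mapping.keys p" for A
      using that by (induction rule: finite_induct) (auto intro: J0 Jadd simp: \<rho>)
    from this[of "Poly_Mapping.keys p"]
    have d: "p - p' \<in> J"
      by (simp add: sum_subtractf p'_def flip: poly_mapping_sum_single)
    have "p' = 0"
    proof (rule normal_form_independent)
      fix k \<tau> assume t: "\<tau> \<in> \<H>"
      have "eval_exp (p - p') k (nome \<tau>) = 0" using d JK t kernel_iff by blast
      moreover have "eval_exp p k (nome \<tau>) = 0" using p t kernel_iff by blast
      moreover have "eval_exp p k (nome \<tau>) = eval_exp (p - p') k (nome \<tau>) + eval_exp p' k (nome \<tau>)"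
        by (simp flip: eval_exp_add)
      ultimately show "eval_exp p' k (nome \<tau>) = 0" by simp
    qed (use p'keys I(2) in blast)
    then show "p \<in> J" using d by simp
  qed
  have kerJ: "a_kernel ?R ?S graded_eval = J" using JK KJ by blast
  show ?thesis
  proof (rule bexI)
    show "(\<lambda>X. the_elem (graded_eval ` X)) \<in> ring_iso (?R Quot J) ?S"
      using h.FactRing_iso_set[OF surj] unfolding kerJ .
    show "\<forall>p\<in>carrier ?R. the_elem (graded_eval ` (J +>\<^bsub>?R\<^esub> p)) = graded_eval p"
      using h.the_elem_simp unfolding kerJ by blast
  qed
qed

lemma zero_modular: "(\<lambda>_. 0) \<in> modular_forms k (Gamma0 3)"
proof -
  have "holomorphic_at_ioo (slash k \<gamma> (\<lambda>_. 0))" for \<gamma>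
    unfolding holomorphic_at_ioo_def cusp_expansion_def
    by (intro exI[of _ 1] exI[of _ "\<lambda>_. 0"]) (simp add: slash_def)
  then show ?thesis by (simp add: modular_forms_def slash_def)
qed

lemma modular_forms_iff_spanned:
  "f \<in> modular_forms k (Gamma0 3) \<longleftrightarrow> (\<forall>\<tau>. \<tau> \<notin> \<H> \<longrightarrow> f \<tau> = 0) \<and> spanned {2,3,4} k f"
proof
  assume f: "f \<in> modular_forms k (Gamma0 3)"
  show "(\<forall>\<tau>. \<tau> \<notin> \<H> \<longrightarrow> f \<tau> = 0) \<and> spanned {2,3,4} k f"
  proof (cases "even k")
    case True
    obtain F G where FG: "fricke_pair (int k) F G" "f = form_of F" using modular_imp_fricke_pair[OF f] by blast
    have "spanned {2,3,4} k f"
      using fricke_pair_spanned[OF FG(1) True] unfolding spanned_def FG(2) by (simp add: form_of_apply)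
    then show ?thesis using FG(2) by (simp add: form_of_outside)
  next
    case False
    then have "f = (\<lambda>_. 0)" using modular_form_odd[OF f] by simp
    then show ?thesis by (auto intro: spanned_zero)
  qed
next
  assume f: "(\<forall>\<tau>. \<tau> \<notin> \<H> \<longrightarrow> f \<tau> = 0) \<and> spanned {2,3,4} k f"
  then obtain p where p: "\<forall>m\<in>Poly_Mapping.keys p. Poly_Mapping.keys m \<subseteq> {2,3,4} \<and> mon_weight m = k"
      "\<forall>\<tau>\<in>\<H>. f \<tau> = (\<Sum>m\<in>Poly_Mapping.keys p. Poly_Mapping.lookup p m * mon_exp m (nome \<tau>))"
    unfolding spanned_def by blast
  let ?F = "\<lambda>q. \<Sum>m\<in>Poly_Mapping.keys p. Poly_Mapping.lookup p m * mon_exp m q"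
  have fF: "f = form_of ?F" using f p(2) by (auto simp: form_of_def on_uhp_def)
  show "f \<in> modular_forms k (Gamma0 3)"
  \<comment> \<open>Without monomials the weight may be odd, so the zero form is treated on its
    own.\<close>
  proof (cases "Poly_Mapping.keys p = {}")
    case True
    then have "f = (\<lambda>_. 0)" using f p(2) by auto
    then show ?thesis using zero_modular by simp
  next
    case False
    then have k: "even k" using p(1) even_mon_weight by fastforce
    have "\<exists>G. fricke_pair (int k) (mon_exp m) G" if "m \<in> Poly_Mapping.keys p" for m
    proof -
      have "1 \<notin> Poly_Mapping.keys m" using p(1) that by fastforce
      then have "Poly_Mapping.lookup m 1 = 0" by (simp add: in_keys_iff)
      then show ?thesis using mon_exp_pair p(1) that by metis
    qed
    then obtain G where G: "\<And>m. m \<in> Poly_Mapping.keys p \<Longrightarrow> fricke_pair (int k) (mon_exp m) (G m)" by metis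
    have "fricke_pair (int k) ?F (\<lambda>q. \<Sum>m\<in>Poly_Mapping.keys p. Poly_Mapping.lookup p m * G m q)"
      by (rule fricke_pair_sum) (auto intro: fricke_pair_scale G)
    from fricke_pair_imp_modular[OF this k] show ?thesis unfolding fF .
  qed
qed

lemma zero_quasimodular: "(\<lambda>_. 0) \<in> quasimodular_forms k (Gamma0 3)"
  by (rule quasimodularI[of k 0 "\<lambda>_ _. 0"]) (auto simp: quasi_expansion_def slash_def moderate_growth_const)

lemma quasimodular_sum:
  assumes "finite A" "\<And>i. i \<in> A \<Longrightarrow> f i \<in> quasimodular_forms k (Gamma0 3)"
  shows "(\<lambda>\<tau>. \<Sum>i\<in>A. f i \<tau>) \<in> quasimodular_forms k (Gamma0 3)"
  using assms by (induction rule: finite_induct) (auto intro: zero_quasimodular quasimodular_add)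

lemma quasimodular_forms_iff_spanned:
  "f \<in> quasimodular_forms k (Gamma0 3) \<longleftrightarrow> (\<forall>\<tau>. \<tau> \<notin> \<H> \<longrightarrow> f \<tau> = 0) \<and> spanned {1,2,3,4} k f"
proof
  assume f: "f \<in> quasimodular_forms k (Gamma0 3)"
  show "(\<forall>\<tau>. \<tau> \<notin> \<H> \<longrightarrow> f \<tau> = 0) \<and> spanned {1,2,3,4} k f"
  proof (cases "even k")
    case True
    then show ?thesis using f quasi_expansion_spanned[OF True] unfolding quasimodular_iff by blast
  next
    case False
    then have "f = (\<lambda>_. 0)" using quasimodular_odd[OF f] by simp
    then show ?thesis by (auto intro: spanned_zero)
  qed
next
  assume f: "(\<forall>\<tau>. \<tau> \<notin> \<H> \<longrightarrow> f \<tau> = 0) \<and> spanned {1,2,3,4} k f"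
  then obtain p where p: "\<forall>m\<in>Poly_Mapping.keys p. Poly_Mapping.keys m \<subseteq> {1,2,3,4} \<and> mon_weight m = k"
      "\<forall>\<tau>\<in>\<H>. f \<tau> = (\<Sum>m\<in>Poly_Mapping.keys p. Poly_Mapping.lookup p m * mon_exp m (nome \<tau>))"
    unfolding spanned_def by blast
  \<comment> \<open>A coefficient counts as a form of weight 0, so that scalar multiples are
    products of quasi-modular forms.\<close>
  have "(\<lambda>\<tau>. \<Sum>m\<in>Poly_Mapping.keys p. on_uhp (\<lambda>_. Poly_Mapping.lookup p m) \<tau> * form_of (mon_exp m) \<tau>) \<in> quasimodular_forms k (Gamma0 3)"
  proof (rule quasimodular_sum)
    fix m assume "m \<in> Poly_Mapping.keys p"
    then show "(\<lambda>\<tau>. on_uhp (\<lambda>_. Poly_Mapping.lookup p m) \<tau> * form_of (mon_exp m) \<tau>) \<in> quasimodular_forms k (Gamma0 3)"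
      using quasimodular_mult[OF quasimodular_const mon_exp_quasimodular] p(1) by fastforce
  qed simp
  also have "(\<lambda>\<tau>. \<Sum>m\<in>Poly_Mapping.keys p. on_uhp (\<lambda>_. Poly_Mapping.lookup p m) \<tau> * form_of (mon_exp m) \<tau>) = f"
  proof
    fix \<tau>
    show "(\<Sum>m\<in>Poly_Mapping.keys p. on_uhp (\<lambda>_. Poly_Mapping.lookup p m) \<tau> * form_of (mon_exp m) \<tau>) = f \<tau>"
      using f p(2) by (cases "\<tau> \<in> \<H>") (simp_all add: form_of_def on_uhp_def)
  qed
  finally show "f \<in> quasimodular_forms k (Gamma0 3)" .
qed

section \<open>The functions of the theorem as expansions\<close>

lemma P3_eq: "P3 = form_of pexp"
  by (simp add: P3_def form_of_def pexp_def)

lemma Q3_eq: "Q3 = form_of qexp"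
  by (simp add: Q3_def form_of_def qexp_def)

lemma eta_multiples_nonzero:
  assumes "\<tau> \<in> \<H>"
  shows "eta \<tau> \<noteq> 0" "eta (3 * \<tau>) \<noteq> 0"
  using assms by (auto intro!: eta_nonzero simp: upper_half_plane_def)

lemma R3_eq: "R3 = form_of (\<lambda>q. aexp q * cexp q)"
proof
  fix \<tau>
  show "R3 \<tau> = form_of (\<lambda>q. aexp q * cexp q) \<tau>"
  proof (cases "\<tau> \<in> \<H>")
    case True
    note nz = eta_multiples_nonzero[OF True]
    have "e3 ^ 8 + 9 * (e3 ^ 8 * e9 ^ 3 / e1 ^ 3) = (e1 ^ 3 + 9 * e9 ^ 3) / e3 * (e3 ^ 9 / e1 ^ 3)"
      if "e1 \<noteq> 0" "e3 \<noteq> 0" for e1 e3 e9 :: complex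
      using that by (simp add: field_simps eval_nat_numeral)
    from this[OF nz] show ?thesis
      using True by (simp add: R3_def on_uhp_def form_of_apply eta_quotients[OF True])
  qed (simp add: R3_def on_uhp_def form_of_outside)
qed

lemma S3_eq: "S3 = form_of (\<lambda>q. (cexp q)\<^sup>2)"
  by (auto simp: S3_def on_uhp_def form_of_def eta_quotients fun_eq_iff)

lemma Delta3_eq: "Delta3 = form_of (\<lambda>q. bexp q * cexp q)"
proof
  fix \<tau>
  show "Delta3 \<tau> = form_of (\<lambda>q. bexp q * cexp q) \<tau>"
  proof (cases "\<tau> \<in> \<H>")
    case True
    note nz = eta_multiples_nonzero[OF True]
    have "e1 ^ 6 * e3 ^ 6 = e1 ^ 9 / e3 ^ 3 * (e3 ^ 9 / e1 ^ 3)"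
      if "e1 \<noteq> 0" "e3 \<noteq> 0" for e1 e3 :: complex
      using that by (simp add: field_simps flip: power_add)
    from this[OF nz] show ?thesis
      using True by (simp add: Delta3_def on_uhp_def form_of_apply eta_quotients[OF True])
  qed (simp add: Delta3_def on_uhp_def form_of_outside)
qed

lemma ramanujan_system_P3: "ramanujan_system_solution P3 Q3 R3 S3"
  unfolding ramanujan_system_solution_def P3_eq Q3_eq R3_eq S3_eq
proof (intro conjI ballI)
  have h: "(\<lambda>q. aexp q * cexp q) holomorphic_on ball 0 1" "(\<lambda>q. (cexp q)\<^sup>2) holomorphic_on ball 0 1"
    by (intro holomorphic_intros exps_holomorphic)+
  show "form_of pexp holomorphic_on \<H>" "form_of qexp holomorphic_on \<H>"
    "form_of (\<lambda>q. aexp q * cexp q) holomorphic_on \<H>" "form_of (\<lambda>q. (cexp q)\<^sup>2) holomorphic_on \<H>"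
    by (intro form_of_holomorphic exps_holomorphic h)+
  fix \<tau> assume t: "\<tau> \<in> \<H>"
  note q = nome_in_ball[OF t]
  show "qderiv (form_of pexp) \<tau> = 1 / 6 * ((form_of pexp \<tau>)\<^sup>2 - (form_of qexp \<tau>)\<^sup>2)"
    unfolding form_of_qderiv[OF exps_holomorphic(1) t] form_of_apply[OF t] pexp_deriv[OF q, symmetric] by simp
  show "qderiv (form_of qexp) \<tau> = 1 / 3 * (form_of pexp \<tau> * form_of qexp \<tau> - (form_of qexp \<tau>)\<^sup>2 + 54 * form_of (\<lambda>q. aexp q * cexp q) \<tau>)"
    unfolding form_of_qderiv[OF exps_holomorphic(2) t] form_of_apply[OF t] qexp_deriv[OF q, symmetric] by simp
  show "qderiv (form_of (\<lambda>q. aexp q * cexp q)) \<tau> = 2 / 3 * form_of pexp \<tau> * form_of (\<lambda>q. aexp q * cexp q) \<tau> +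
      1 / 3 * form_of qexp \<tau> * form_of (\<lambda>q. aexp q * cexp q) \<tau> + 9 * form_of (\<lambda>q. (cexp q)\<^sup>2) \<tau>"
    unfolding form_of_qderiv[OF h(1) t] form_of_apply[OF t] by (rule rexp_deriv[OF q])
  show "qderiv (form_of (\<lambda>q. (cexp q)\<^sup>2)) \<tau> = form_of pexp \<tau> * form_of (\<lambda>q. (cexp q)\<^sup>2) \<tau> + form_of qexp \<tau> * form_of (\<lambda>q. (cexp q)\<^sup>2) \<tau>"
    unfolding form_of_qderiv[OF h(2) t] form_of_apply[OF t] by (rule sexp_deriv[OF q])
  show "(form_of (\<lambda>q. aexp q * cexp q) \<tau>)\<^sup>2 - form_of qexp \<tau> * form_of (\<lambda>q. (cexp q)\<^sup>2) \<tau> = 0"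
    unfolding form_of_apply[OF t] qexp_eq_aexp[OF q] by (simp add: power_mult_distrib)
qed

lemma generator_weights: "mon_weight (Poly_Mapping.single 1 1) = 2" "mon_weight (Poly_Mapping.single 2 1) = 2"
  "mon_weight (Poly_Mapping.single 3 1) = 4" "mon_weight (Poly_Mapping.single 4 1) = 6"
  by (simp_all add: mon_weight_eq lookup_single)

lemma generator_forms: "form_of (gen_exp 1) = P3" "form_of (gen_exp 2) = Q3" "form_of (gen_exp 3) = R3" "form_of (gen_exp 4) = S3"
  unfolding P3_eq Q3_eq R3_eq S3_eq gen_exp_def[abs_def] by simp_all

lemma generators_graded_eval:
  "graded_eval (X 1) = in_degree 2 P3" "graded_eval (X 2) = in_degree 2 Q3"
  "graded_eval (X 3) = in_degree 4 R3" "graded_eval (X 4) = in_degree 6 S3"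
  using graded_eval_X[of 1] graded_eval_X[of 2] graded_eval_X[of 3] graded_eval_X[of 4]
  unfolding generator_weights generator_forms by simp_all

lemma modular_generators:
  "Q3 \<in> modular_forms 2 (Gamma0 3)" "R3 \<in> modular_forms 4 (Gamma0 3)" "S3 \<in> modular_forms 6 (Gamma0 3)"
proof -
  have "form_of (mon_exp (Poly_Mapping.single i 1)) \<in> modular_forms (mon_weight (Poly_Mapping.single i 1)) (Gamma0 3)"
    if "i \<in> {2,3,4}" for i
  proof -
    have "Poly_Mapping.lookup (Poly_Mapping.single i (1::nat)) 1 = 0" using that by (auto simp: lookup_single)
    then show ?thesis using mon_exp_pair fricke_pair_imp_modular even_mon_weight by blast
  qed
  moreover have "mon_exp (Poly_Mapping.single i 1) = gen_exp i" if "i \<in> {2,3,4}" for i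
    using that by (intro ext) (auto simp: mon_single simp del: One_nat_def)
  ultimately show "Q3 \<in> modular_forms 2 (Gamma0 3)" "R3 \<in> modular_forms 4 (Gamma0 3)" "S3 \<in> modular_forms 6 (Gamma0 3)"
    using generator_weights generator_forms by (metis insertCI)+
qed

section \<open>The Lie algebra\<close>

lemma vector_4_nth [simp]:
  "(vector [a, b, c, d] :: complex^4) $ 1 = a" "(vector [a, b, c, d] :: complex^4) $ 2 = b"
  "(vector [a, b, c, d] :: complex^4) $ 3 = c" "(vector [a, b, c, d] :: complex^4) $ 4 = d"
  unfolding vector_def by simp_all

text \<open>A general element of the span, so that closure under brackets and the structure
  constants come out of one computation.\<close>

definition vf_comb :: "complex \<Rightarrow> complex \<Rightarrow> complex \<Rightarrow> vfield" where
  "vf_comb a b c = (\<lambda>t. a *s R1 t + b *s H1 t + c *s F1 t)"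

lemma vf_comb_nth:
  "vf_comb a b c t $ 1 = a * (1/6 * ((t$1)\<^sup>2 - (t$2)\<^sup>2)) + b * (2 * t$1) - 6 * c"
  "vf_comb a b c t $ 2 = a * (1/3 * (t$1 * t$2 - (t$2)\<^sup>2 + 54 * t$3)) + b * (2 * t$2)"
  "vf_comb a b c t $ 3 = a * (2/3 * t$1 * t$3 + 1/3 * t$2 * t$3 + 9 * t$4) + b * (4 * t$3)"
  "vf_comb a b c t $ 4 = a * (t$1 * t$4 + (t$3)\<^sup>2) + b * (6 * t$4)"
  by (simp_all add: vf_comb_def R1_def H1_def F1_def)

lemma vf_comb_partial:
  "partial_deriv 1 (\<lambda>s. vf_comb a b c s $ 1) t = a / 3 * t$1 + 2 * b"
  "partial_deriv 2 (\<lambda>s. vf_comb a b c s $ 1) t = - a / 3 * t$2"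
  "partial_deriv 3 (\<lambda>s. vf_comb a b c s $ 1) t = 0"
  "partial_deriv 4 (\<lambda>s. vf_comb a b c s $ 1) t = 0"
  "partial_deriv 1 (\<lambda>s. vf_comb a b c s $ 2) t = a / 3 * t$2"
  "partial_deriv 2 (\<lambda>s. vf_comb a b c s $ 2) t = a / 3 * (t$1 - 2 * t$2) + 2 * b"
  "partial_deriv 3 (\<lambda>s. vf_comb a b c s $ 2) t = 18 * a"
  "partial_deriv 4 (\<lambda>s. vf_comb a b c s $ 2) t = 0"
  "partial_deriv 1 (\<lambda>s. vf_comb a b c s $ 3) t = 2 / 3 * a * t$3"
  "partial_deriv 2 (\<lambda>s. vf_comb a b c s $ 3) t = a / 3 * t$3"
  "partial_deriv 3 (\<lambda>s. vf_comb a b c s $ 3) t = a * (2 / 3 * t$1 + 1 / 3 * t$2) + 4 * b"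
  "partial_deriv 4 (\<lambda>s. vf_comb a b c s $ 3) t = 9 * a"
  "partial_deriv 1 (\<lambda>s. vf_comb a b c s $ 4) t = a * t$4"
  "partial_deriv 2 (\<lambda>s. vf_comb a b c s $ 4) t = 0"
  "partial_deriv 3 (\<lambda>s. vf_comb a b c s $ 4) t = 2 * a * t$3"
  "partial_deriv 4 (\<lambda>s. vf_comb a b c s $ 4) t = a * t$1 + 6 * b"
  unfolding partial_deriv_def vf_comb_nth
  by (rule DERIV_imp_deriv; auto intro!: derivative_eq_intros; simp add: field_simps)+

text \<open>Bilinear form of the relations [H,R] = 2 R, [H,F] = -2 F and [R,F] = H.\<close>

lemma vf_comb_bracket:
  "vf_bracket (vf_comb a b c) (vf_comb a' b' c') =
     vf_comb (2 * (b * a' - a * b')) (a * c' - c * a') (2 * (c * b' - b * c'))"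
proof (rule ext)
  fix t
  show "vf_bracket (vf_comb a b c) (vf_comb a' b' c') t =
     vf_comb (2 * (b * a' - a * b')) (a * c' - c * a') (2 * (c * b' - b * c')) t"
    unfolding vec_eq_iff forall_4 vf_bracket_def sum_4 vec_lambda_beta vf_comb_partial
    unfolding vf_comb_nth by (intro conjI) (simp_all add: field_simps power2_eq_square)
qed

lemma vf_comb_add: "vf_comb a b c t + vf_comb a' b' c' t = vf_comb (a + a') (b + b') (c + c') t"
  unfolding vec_eq_iff forall_4 vector_add_component vf_comb_nth by (simp add: field_simps)

lemma vf_comb_scale: "k *s vf_comb a b c t = vf_comb (k * a) (k * b) (k * c) t"
  unfolding vec_eq_iff forall_4 vector_smult_component vf_comb_nth by (simp add: algebra_simps)

lemma vf_comb_generators: "R1 = vf_comb 1 0 0" "H1 = vf_comb 0 1 0" "F1 = vf_comb 0 0 1" "(\<lambda>t. 0) = vf_comb 0 0 0"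
  by (auto simp: vf_comb_def fun_eq_iff)

lemma lie_generated_eq: "lie_generated {R1, H1, F1} = {V. \<exists>a b c. V = vf_comb a b c}"
proof
  show "lie_generated {R1, H1, F1} \<subseteq> {V. \<exists>a b c. V = vf_comb a b c}"
  proof
    fix V assume "V \<in> lie_generated {R1, H1, F1}"
    then show "V \<in> {V. \<exists>a b c. V = vf_comb a b c}"
    proof induction
      case (gen V)
      then show ?case using vf_comb_generators by blast
    next
      case zero
      then show ?case using vf_comb_generators by blast
    next
      case (add V W)
      then show ?case by (clarsimp simp: vf_comb_add) blast
    next
      case (scale V c)
      then show ?case by (clarsimp simp: vf_comb_scale) blast
    next
      case (bracket V W)
      then show ?case by (clarsimp simp: vf_comb_bracket) blast
    qed
  qed
  have "vf_comb a b c \<in> lie_generated {R1, H1, F1}" for a b c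
    unfolding vf_comb_def
    by (intro lie_generated.add lie_generated.scale lie_generated.gen) auto
  then show "{V. \<exists>a b c. V = vf_comb a b c} \<subseteq> lie_generated {R1, H1, F1}" by blast
qed

text \<open>R, H and F correspond to the upper nilpotent matrix, diag(1, -1) and the lower nilpotent
  matrix, which satisfy the same relations.\<close>

definition sl2_mat :: "complex \<Rightarrow> complex \<Rightarrow> complex \<Rightarrow> complex^2^2" where
  "sl2_mat a b c = vector [vector [b, a], vector [c, - b]]"

lemma sl2_mat_nth: "sl2_mat a b c $ 1 $ 1 = b" "sl2_mat a b c $ 1 $ 2 = a" "sl2_mat a b c $ 2 $ 1 = c" "sl2_mat a b c $ 2 $ 2 = - b"
  by (simp_all add: sl2_mat_def)

text \<open>The coordinates are read off at three points: at the third unit vector the last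
  component of a combination is a, at the fourth it is 6b, and at the origin the first component is
  -6c. This also shows that the three fields are linearly independent.\<close>

definition vf_coords :: "vfield \<Rightarrow> complex^2^2" where
  "vf_coords V = sl2_mat (V (axis 3 1) $ 4) (V (axis 4 1) $ 4 / 6) (- (V 0 $ 1) / 6)"

lemma vf_coords_comb: "vf_coords (vf_comb a b c) = sl2_mat a b c"
  unfolding vf_coords_def vf_comb_nth by (simp add: axis_def)

lemma lie_isomorphic: "lie_isomorphic_sl2 (lie_generated {R1, H1, F1})"
  unfolding lie_isomorphic_sl2_def lie_generated_eq
proof (intro exI[of _ vf_coords] conjI ballI allI)
  show "bij_betw vf_coords {V. \<exists>a b c. V = vf_comb a b c} sl2"
  proof (rule bij_betw_imageI)
    show "inj_on vf_coords {V. \<exists>a b c. V = vf_comb a b c}"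
    proof (rule inj_onI)
      fix V W assume *: "V \<in> {V. \<exists>a b c. V = vf_comb a b c}" "W \<in> {V. \<exists>a b c. V = vf_comb a b c}" "vf_coords V = vf_coords W"
      then obtain a b c a' b' c' where "V = vf_comb a b c" "W = vf_comb a' b' c'" by blast
      moreover from this *(3) have "sl2_mat a b c = sl2_mat a' b' c'" by (simp add: vf_coords_comb)
      then have "a = a' \<and> b = b' \<and> c = c'" by (metis sl2_mat_nth)
      ultimately show "V = W" by simp
    qed
    show "vf_coords ` {V. \<exists>a b c. V = vf_comb a b c} = sl2"
    proof
      show "vf_coords ` {V. \<exists>a b c. V = vf_comb a b c} \<subseteq> sl2"
        by (auto simp: vf_coords_comb sl2_def trace_def sum_2 sl2_mat_nth)
      show "sl2 \<subseteq> vf_coords ` {V. \<exists>a b c. V = vf_comb a b c}"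
      proof
        fix A assume "A \<in> sl2"
        then have "A $ 1 $ 1 + A $ 2 $ 2 = 0" by (simp add: sl2_def trace_def sum_2)
        then have "A = sl2_mat (A $ 1 $ 2) (A $ 1 $ 1) (A $ 2 $ 1)"
          by (simp add: vec_eq_iff forall_2 sl2_mat_nth eq_neg_iff_add_eq_0 add.commute)
        then have "A = vf_coords (vf_comb (A $ 1 $ 2) (A $ 1 $ 1) (A $ 2 $ 1))" by (simp add: vf_coords_comb)
        then show "A \<in> vf_coords ` {V. \<exists>a b c. V = vf_comb a b c}" by blast
      qed
    qed
  qed
next
  fix V W assume "V \<in> {V. \<exists>a b c. V = vf_comb a b c}" "W \<in> {V. \<exists>a b c. V = vf_comb a b c}"
  then obtain a b c a' b' c' where VW: "V = vf_comb a b c" "W = vf_comb a' b' c'" by blast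
  show "vf_coords (\<lambda>t. V t + W t) = vf_coords V + vf_coords W"
    unfolding VW vf_comb_add vf_coords_comb by (simp add: vec_eq_iff forall_2 sl2_mat_nth)
  show "vf_coords (vf_bracket V W) = vf_coords V ** vf_coords W - vf_coords W ** vf_coords V"
    unfolding VW vf_comb_bracket vf_coords_comb
    by (simp add: vec_eq_iff forall_2 matrix_matrix_mult_def sum_2 sl2_mat_nth algebra_simps)
next
  fix k V assume "V \<in> {V. \<exists>a b c. V = vf_comb a b c}"
  then obtain a b c where V: "V = vf_comb a b c" by blast
  show "vf_coords (\<lambda>t. k *s V t) = (\<chi> i. k *s (vf_coords V $ i))"
    unfolding V vf_comb_scale vf_coords_comb by (simp add: vec_eq_iff forall_2 sl2_mat_nth)
qed

theorem theorem1p2: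
  shows
    "(ramanujan_system_solution P3 Q3 R3 S3 \<and>
      Q3 \<in> modular_forms 2 (Gamma0 3) \<and>
      R3 \<in> modular_forms 4 (Gamma0 3) \<and>
      S3 \<in> modular_forms 6 (Gamma0 3) \<and>
      P3 \<in> quasimodular_forms 2 (Gamma0 3) \<and>
      Delta3 \<in> cusp_forms 6 (Gamma0 3) \<and>
      (\<forall>\<tau>\<in>\<H>. Delta3 \<tau> = Q3 \<tau> * R3 \<tau> - 27 * S3 \<tau>) \<and>
      (\<forall>\<tau>\<in>\<H>. qderiv Delta3 \<tau> = P3 \<tau> * Delta3 \<tau>)) \<and>
     ((\<exists>\<phi> \<in> ring_iso (poly_ring {2,3,4} Quot ideal_I) (modular_algebra (Gamma0 3)).
         (\<forall>c. \<phi> (ideal_I +>\<^bsub>poly_ring {2,3,4}\<^esub> Const c) = scalar_form c) \<and>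
         \<phi> (ideal_I +>\<^bsub>poly_ring {2,3,4}\<^esub> X 2) = in_degree 2 Q3 \<and>
         \<phi> (ideal_I +>\<^bsub>poly_ring {2,3,4}\<^esub> X 3) = in_degree 4 R3 \<and>
         \<phi> (ideal_I +>\<^bsub>poly_ring {2,3,4}\<^esub> X 4) = in_degree 6 S3) \<and>
      (\<exists>\<phi> \<in> ring_iso (poly_ring {1,2,3,4} Quot ideal_I_tilde) (quasimodular_algebra (Gamma0 3)).
         (\<forall>c. \<phi> (ideal_I_tilde +>\<^bsub>poly_ring {1,2,3,4}\<^esub> Const c) = scalar_form c) \<and>
         \<phi> (ideal_I_tilde +>\<^bsub>poly_ring {1,2,3,4}\<^esub> X 1) = in_degree 2 P3 \<and>
         \<phi> (ideal_I_tilde +>\<^bsub>poly_ring {1,2,3,4}\<^esub> X 2) = in_degree 2 Q3 \<and>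
         \<phi> (ideal_I_tilde +>\<^bsub>poly_ring {1,2,3,4}\<^esub> X 3) = in_degree 4 R3 \<and>
         \<phi> (ideal_I_tilde +>\<^bsub>poly_ring {1,2,3,4}\<^esub> X 4) = in_degree 6 S3)) \<and>
     lie_isomorphic_sl2 (lie_generated {R1, H1, F1})"
proof -
  have cusp: "Delta3 \<in> cusp_forms 6 (Gamma0 3)"
    unfolding Delta3_eq by (rule fricke_pair_imp_cusp_form[OF dexp_pair]) simp_all
  have rel: "Delta3 \<tau> = Q3 \<tau> * R3 \<tau> - 27 * S3 \<tau>" if t: "\<tau> \<in> \<H>" for \<tau>
    unfolding Delta3_eq Q3_eq R3_eq S3_eq form_of_apply[OF t] bexp_eq[OF nome_in_ball[OF t]] qexp_eq_aexp[OF nome_in_ball[OF t]]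
    by (simp add: algebra_simps eval_nat_numeral)
  have der: "qderiv Delta3 \<tau> = P3 \<tau> * Delta3 \<tau>" if t: "\<tau> \<in> \<H>" for \<tau>
  proof -
    have "(\<lambda>q. bexp q * cexp q) holomorphic_on ball 0 1" by (intro holomorphic_intros exps_holomorphic)
    then show ?thesis
      unfolding Delta3_eq P3_eq form_of_apply[OF t] by (simp add: form_of_qderiv[OF _ t] dexp_deriv[OF nome_in_ball[OF t]])
  qed
  have C: "Const c \<in> carrier (poly_ring I)" for c I by (simp add: poly_ring_simps Const_def)
  have XI: "X i \<in> carrier (poly_ring I)" if "i \<in> I" for i I using that by (simp add: poly_ring_simps X_def)
  \<comment> \<open>Both isomorphisms are induced by \<open>graded_eval\<close>, so the images of
    the generators are the values in \<open>generators_graded_eval\<close>.\<close>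
  obtain \<phi> where \<phi>: "\<phi> \<in> ring_iso (poly_ring {2,3,4} Quot ideal_I) (modular_algebra (Gamma0 3))"
      "\<And>p. p \<in> carrier (poly_ring {2,3,4}) \<Longrightarrow> \<phi> (ideal_I +>\<^bsub>poly_ring {2,3,4}\<^esub> p) = graded_eval p"
    using graded_algebra_iso[of "{2,3,4}", OF order_refl _ modular_forms_iff_spanned]
    unfolding modular_algebra_def ideal_I_def by auto
  obtain \<psi> where \<psi>: "\<psi> \<in> ring_iso (poly_ring {1,2,3,4} Quot ideal_I_tilde) (quasimodular_algebra (Gamma0 3))"
      "\<And>p. p \<in> carrier (poly_ring {1,2,3,4}) \<Longrightarrow> \<psi> (ideal_I_tilde +>\<^bsub>poly_ring {1,2,3,4}\<^esub> p) = graded_eval p"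
    using graded_algebra_iso[of "{1,2,3,4}", OF _ order_refl quasimodular_forms_iff_spanned]
    unfolding quasimodular_algebra_def ideal_I_tilde_def by auto
  show ?thesis
  proof (intro conjI ballI ramanujan_system_P3 modular_generators cusp rel der lie_isomorphic)
    show "P3 \<in> quasimodular_forms 2 (Gamma0 3)" unfolding P3_eq by (rule pexp_quasimodular)
  next
    show "\<exists>\<phi> \<in> ring_iso (poly_ring {2,3,4} Quot ideal_I) (modular_algebra (Gamma0 3)).
         (\<forall>c. \<phi> (ideal_I +>\<^bsub>poly_ring {2,3,4}\<^esub> Const c) = scalar_form c) \<and>
         \<phi> (ideal_I +>\<^bsub>poly_ring {2,3,4}\<^esub> X 2) = in_degree 2 Q3 \<and>
         \<phi> (ideal_I +>\<^bsub>poly_ring {2,3,4}\<^esub> X 3) = in_degree 4 R3 \<and>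
         \<phi> (ideal_I +>\<^bsub>poly_ring {2,3,4}\<^esub> X 4) = in_degree 6 S3"
      by (rule bexI[OF _ \<phi>(1)]) (simp add: \<phi>(2) C XI graded_eval_Const generators_graded_eval)
  next
    show "\<exists>\<phi> \<in> ring_iso (poly_ring {1,2,3,4} Quot ideal_I_tilde) (quasimodular_algebra (Gamma0 3)).
         (\<forall>c. \<phi> (ideal_I_tilde +>\<^bsub>poly_ring {1,2,3,4}\<^esub> Const c) = scalar_form c) \<and>
         \<phi> (ideal_I_tilde +>\<^bsub>poly_ring {1,2,3,4}\<^esub> X 1) = in_degree 2 P3 \<and>
         \<phi> (ideal_I_tilde +>\<^bsub>poly_ring {1,2,3,4}\<^esub> X 2) = in_degree 2 Q3 \<and>
         \<phi> (ideal_I_tilde +>\<^bsub>poly_ring {1,2,3,4}\<^esub> X 3) = in_degree 4 R3 \<and>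
         \<phi> (ideal_I_tilde +>\<^bsub>poly_ring {1,2,3,4}\<^esub> X 4) = in_degree 6 S3"
      by (rule bexI[OF _ \<psi>(1)]) (simp add: \<psi>(2) C XI graded_eval_Const generators_graded_eval del: One_nat_def)
  qed
qed

end
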